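(* Let $-\infty\le x_l<0<x_r\le\infty$, let $\Pi$ be an atomless infinite measure on $(x_l,x_r)$ with $Q(x):=\Pi(x,x_r)\in(0,\infty)$ for $x_l<x<x_r$, let $N$ be a Poisson random measure on $[0,\infty)\times(x_l,x_r)$ with mean measure $\mathrm{Leb}\times\Pi$, and let $Y^{(r)}$ be the $r$-th order extremal process of $N$. Let $\mathcal R_r$ be the set of distinct points of $\{Y^{(r)}(t),t>0\}$, and let $\mathcal R_r^+=\mathcal R_r\cap(0,\infty)$ and $\mathcal R_r^-=\mathcal R_r\cap(-\infty,0)$, so that $\mathcal R_r=\mathcal R_r^+\cup\mathcal R_r^-$ almost surely. Then the two point processes $\mathcal R_r^{+}$ and $\mathcal R_r^-$ are independent Poisson processes, $\mathcal R_r^+$ has mean measure $rS^+$ on $\mathbb R_+$, and $-\mathcal R_r^-$ has mean measure $rS^-$ on $\mathbb R_+$ (so that the points of $\mathcal R_r^-$ lie in $(-\infty,0)$). Suppose moreover that there exist $a^\pm(t)>0$, $b^\pm(t)\in\mathbb R$ and infinite Radon measures $S_\infty^\pm$ on $\mathbb R_+$ such that, as $t\to\infty$, for $x>0$, $$tS^+(a^+(t)x-b^+(t))\to S_\infty^+(x),\qquad tS^-(a^-(t)x-b^-(t))\to S_\infty^-(x).$$ Then, as $r\to\infty$, $$\Bigl(\frac{\mathcal R_r^++b^+(r)}{a^+(r)},\ \frac{-\mathcal R_r^-+b^-(r)}{a^-(r)}\Bigr)\Rightarrow\bigl(\mathcal R_\infty^+,-\mathcal R_\infty^-\bigr),$$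 where the limits $\mathcal R_\infty^+$ and $-\mathcal R_\infty^-$ are independent Poisson processes on $\mathbb R_+$ with mean measures $S_\infty^+$ and $S_\infty^-$ respectively.
   Context: The $r$-th order extremal process is $Y^{(r)}(t)=\inf\{x>x_l:N([0,t]\times(x,x_r))<r\}$, $t>0$. Note $Q$ is non-increasing with $Q(x_l)=\infty$ and $Q(x_r)=0$ (as limits); the endpoints are not atoms of $\Pi$. Define $S(x)=-\log\Pi(x,x_r)=-\log Q(x)$ for $x_l<x<x_r$, with $S(x_l)=-\infty$, $S(x_r)=\infty$; $S$ is nondecreasing and also denotes the corresponding measure on $(x_l,x_r)$. Define nondecreasing functions on $\mathbb R_+$, also regarded as measures, $$S^+(x)=S(0,x]=S(x)-S(0),\ 0<x\le x_r;\qquad S^-(x)=S[-x,0)=S(0)-S(-x),\ 0<x\le -x_l,$$ with $S^\pm(y)=0$ for $y\le0$, and $S^+(y)=\infty$ for $y\ge x_r$, $S^-(y)=\infty$ for $y\ge -x_l$. Here $\mathbb R_+=(0,\infty)$ and $S_\infty^\pm(x)$ denotes $S_\infty^\pm(0,x]$. A set of points is identified with the corresponding point measure; $c\mathcal A+d=\{cx+d:x\in\mathcal A\}$. "$\Rightarrow$" denotes (joint) weak convergence of point processes on $\mathbb R_+$, with Radon measures topologized by vague convergence.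
   Formalization: The limit part assumes S_∞^±(0,x] finite for every x>0; and since the rescaled processes are not Radon when x_l or x_r is finite, convergence is stated for the processes cut at arbitrary levels tending to infinity below which they are almost surely Radon. *)

theory Defs
  imports "HOL-Probability.Probability"
begin

section \<open>Poisson processes\<close>

text \<open>The measurable space of all measures on the measurable space \<open>K\<close>, with the
  \<open>\<sigma>\<close>-algebra generated by the evaluations \<open>\<mu> \<mapsto> \<mu>(A)\<close>; this is \<^const>\<open>subprob_algebra\<close>
  without the restriction on the total mass.\<close>

definition measures_algebra :: "'a measure \<Rightarrow> 'a measure measure" where
  "measures_algebra K =
     (SUP A \<in> sets K. vimage_algebra {\<mu>. sets \<mu> = sets K} (\<lambda>\<mu>. emeasure \<mu> A) borel)"

text \<open>The mean measure may be infinite on some sets; such sets contain infinitely many points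
  almost surely. The Poisson weights are written out because \<^const>\<open>poisson_pmf\<close> is only
  specified for positive rates.\<close>

definition poisson_process :: "'w measure \<Rightarrow> 'a measure \<Rightarrow> ('w \<Rightarrow> 'a measure) \<Rightarrow> bool" where
  "poisson_process P \<mu> \<xi> \<longleftrightarrow>
     prob_space P \<and>
     \<xi> \<in> measurable P (measures_algebra \<mu>) \<and>
     (\<forall>A\<in>sets \<mu>. emeasure \<mu> A < \<infinity> \<longrightarrow>
        (\<forall>k::nat. measure P {\<omega>\<in>space P. emeasure (\<xi> \<omega>) A = of_nat k} =
                  measure \<mu> A ^ k / fact k * exp (- measure \<mu> A))) \<and>
     (\<forall>A\<in>sets \<mu>. emeasure \<mu> A = \<infinity> \<longrightarrow> (AE \<omega> in P. emeasure (\<xi> \<omega>) A = \<infinity>)) \<and>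
     (\<forall>\<A>\<subseteq>sets \<mu>. finite \<A> \<longrightarrow> disjoint \<A> \<longrightarrow>
        prob_space.indep_vars P (\<lambda>_. borel) (\<lambda>A \<omega>. emeasure (\<xi> \<omega>) A) \<A>)"

section \<open>Point processes on the positive half-line and weak convergence\<close>

abbreviation pos_reals :: "real measure" where
  "pos_reals \<equiv> restrict_space borel {0<..}"

text \<open>The point measure on \<open>(0,\<infinity>)\<close> identified with a set; points outside \<open>(0,\<infinity>)\<close> are ignored.\<close>

definition point_measure_of :: "real set \<Rightarrow> real measure" where
  "point_measure_of A = distr (count_space (A \<inter> {0<..})) pos_reals (\<lambda>x. x)"

definition radon_measures :: "real measure set" where
  "radon_measures = {\<mu>. sets \<mu> = sets pos_reals \<and>
     (\<forall>K. compact K \<longrightarrow> K \<subseteq> {0<..} \<longrightarrow> emeasure \<mu> K < \<infinity>)}"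

text \<open>Continuous functions with compact support in \<open>(0,\<infinity>)\<close>, extended by zero to the real line.\<close>

definition Cc_pos :: "(real \<Rightarrow> real) set" where
  "Cc_pos = {f. continuous_on UNIV f \<and> (\<exists>K. compact K \<and> K \<subseteq> {0<..} \<and> (\<forall>x. x \<notin> K \<longrightarrow> f x = 0))}"

definition vague_topology :: "real measure topology" where
  "vague_topology =
     pullback_topology radon_measures (\<lambda>\<mu>. \<lambda>f\<in>Cc_pos. \<integral>x. f x \<partial>\<mu>)
       (product_topology (\<lambda>_. euclideanreal) Cc_pos)"

text \<open>Convergence in distribution of random elements of a topological space. The completions
  allow the random elements to be undefined (outside the space) on null sets.\<close>

definition weakly_converges ::
  "'b topology \<Rightarrow> 'w measure \<Rightarrow> (nat \<Rightarrow> 'w \<Rightarrow> 'b) \<Rightarrow> 'v measure \<Rightarrow> ('v \<Rightarrow> 'b) \<Rightarrow> bool" where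
  "weakly_converges T P X P' X' \<longleftrightarrow>
     (\<forall>n. AE \<omega> in P. X n \<omega> \<in> topspace T) \<and>
     (AE \<omega> in P'. X' \<omega> \<in> topspace T) \<and>
     (\<forall>F. continuous_map T euclideanreal F \<longrightarrow> bounded (F ` topspace T) \<longrightarrow>
        (\<forall>n. integrable (completion P) (\<lambda>\<omega>. F (X n \<omega>))) \<and>
        integrable (completion P') (\<lambda>\<omega>. F (X' \<omega>)) \<and>
        (\<lambda>n. \<integral>\<omega>. F (X n \<omega>) \<partial>completion P) \<longlonglongrightarrow> (\<integral>\<omega>. F (X' \<omega>) \<partial>completion P'))"

definition cut :: "ereal \<Rightarrow> real measure \<Rightarrow> real measure" where
  "cut k \<mu> = density \<mu> (indicator {x. ereal x < k})"

text \<open>If the endpoint \<open>x\<^sub>r\<close> is finite, the points of the range of an extremal process accumulate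
  at \<open>x\<^sub>r\<close>, so that the rescaled range is not a Radon measure on all of \<open>(0,\<infinity>)\<close>, but only on
  \<open>(0,k]\<close> with \<open>k\<close> below the accumulation point, which tends to infinity. Vague convergence does not
  see what happens beyond levels \<open>k\<^sub>n \<longrightarrow> \<infinity>\<close>. Joint weak convergence is therefore required for
  the processes cut at any levels \<open>k\<^sub>n \<longrightarrow> \<infinity>\<close> below which they are almost surely Radon, and such
  levels must exist. For processes that are Radon from the outset \<open>k\<^sub>n = \<infinity>\<close> is admissible, and
  this is weak convergence with respect to the vague topology in the usual sense.\<close>

definition admissible_cut :: "'w measure \<Rightarrow> (nat \<Rightarrow> 'w \<Rightarrow> real measure) \<Rightarrow> (nat \<Rightarrow> ereal) \<Rightarrow> bool" where
  "admissible_cut P \<xi> k \<longleftrightarrow>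
     k \<longlonglongrightarrow> \<infinity> \<and> (\<forall>n. AE \<omega> in P. cut (k n) (\<xi> n \<omega>) \<in> radon_measures)"

definition pp_converges_jointly ::
  "'w measure \<Rightarrow> (nat \<Rightarrow> 'w \<Rightarrow> real measure) \<Rightarrow> (nat \<Rightarrow> 'w \<Rightarrow> real measure) \<Rightarrow>
   'v measure \<Rightarrow> ('v \<Rightarrow> real measure) \<Rightarrow> ('v \<Rightarrow> real measure) \<Rightarrow> bool" where
  "pp_converges_jointly P \<xi> \<eta> P' \<xi>' \<eta>' \<longleftrightarrow>
     (\<exists>k. admissible_cut P \<xi> k) \<and> (\<exists>l. admissible_cut P \<eta> l) \<and>
     (\<forall>k l. admissible_cut P \<xi> k \<longrightarrow> admissible_cut P \<eta> l \<longrightarrow>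
        weakly_converges (prod_topology vague_topology vague_topology)
          P (\<lambda>n \<omega>. (cut (k n) (\<xi> n \<omega>), cut (l n) (\<eta> n \<omega>))) P' (\<lambda>\<omega>. (\<xi>' \<omega>, \<eta>' \<omega>)))"

section \<open>Extremal processes\<close>

text \<open>The infimum is taken in the extended reals, so that it is defined for every measure \<open>M\<close>.\<close>

definition extremal_process :: "ereal \<Rightarrow> ereal \<Rightarrow> (real \<times> real) measure \<Rightarrow> nat \<Rightarrow> real \<Rightarrow> ereal" where
  "extremal_process xl xr M r t =
     Inf {ereal x | x::real. xl < ereal x \<and> emeasure M ({0..t} \<times> einterval (ereal x) xr) < of_nat r}"

definition extremal_range :: "ereal \<Rightarrow> ereal \<Rightarrow> (real \<times> real) measure \<Rightarrow> nat \<Rightarrow> real set" where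
  "extremal_range xl xr M r = {y. \<exists>t>0. extremal_process xl xr M r t = ereal y}"

definition extremal_range_pos :: "ereal \<Rightarrow> ereal \<Rightarrow> (real \<times> real) measure \<Rightarrow> nat \<Rightarrow> real set" where
  "extremal_range_pos xl xr M r = extremal_range xl xr M r \<inter> {0<..}"

definition extremal_range_neg :: "ereal \<Rightarrow> ereal \<Rightarrow> (real \<times> real) measure \<Rightarrow> nat \<Rightarrow> real set" where
  "extremal_range_neg xl xr M r = extremal_range xl xr M r \<inter> {..<0}"

section \<open>The function S and the associated measures\<close>

text \<open>\<open>\<nu>\<close> is the measure \<open>\<Pi>\<close> on \<open>(x\<^sub>l, x\<^sub>r)\<close>, and \<^term>\<open>measure \<nu> (einterval (ereal x) xr)\<close> is
  \<open>Q(x)\<close>. The formula is only meaningful at points of the interval \<open>(x\<^sub>l, x\<^sub>r)\<close>.\<close>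

definition S_fun :: "real measure \<Rightarrow> ereal \<Rightarrow> real \<Rightarrow> real" where
  "S_fun \<nu> xr x = - ln (measure \<nu> (einterval (ereal x) xr))"

definition S_plus :: "real measure \<Rightarrow> ereal \<Rightarrow> real \<Rightarrow> ennreal" where
  "S_plus \<nu> xr x =
     (if x \<le> 0 then 0
      else if ereal x < xr then ennreal (S_fun \<nu> xr x - S_fun \<nu> xr 0)
      else \<infinity>)"

definition S_minus :: "real measure \<Rightarrow> ereal \<Rightarrow> ereal \<Rightarrow> real \<Rightarrow> ennreal" where
  "S_minus \<nu> xl xr x =
     (if x \<le> 0 then 0
      else if ereal x < - xl then ennreal (S_fun \<nu> xr 0 - S_fun \<nu> xr (- x))
      else \<infinity>)"

text \<open>The Lebesgue--Stieltjes measure of \<open>S\<close> on \<open>(x\<^sub>l, x\<^sub>r)\<close>; compare \<^const>\<open>interval_measure\<close>,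
  which needs a distribution function on the whole real line.\<close>

definition S_measure :: "real measure \<Rightarrow> ereal \<Rightarrow> ereal \<Rightarrow> real measure" where
  "S_measure \<nu> xl xr =
     extend_measure (einterval xl xr)
       {(a, b). a \<in> einterval xl xr \<and> b \<in> einterval xl xr \<and> a \<le> b}
       (\<lambda>(a, b). {a<..b}) (\<lambda>(a, b). ennreal (S_fun \<nu> xr b - S_fun \<nu> xr a))"

text \<open>As measures on \<open>(0,\<infinity>)\<close>, \<open>S\<^sup>+\<close> and \<open>S\<^sup>-\<close> put no mass beyond \<open>x\<^sub>r\<close> and \<open>-x\<^sub>l\<close>; the value
  \<open>\<infinity>\<close> of the functions there comes from the infinite mass accumulating at these points.\<close>

definition S_plus_measure :: "real measure \<Rightarrow> ereal \<Rightarrow> ereal \<Rightarrow> real measure" where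
  "S_plus_measure \<nu> xl xr =
     distr (restrict_space (S_measure \<nu> xl xr) {0<..}) pos_reals (\<lambda>x. x)"

definition S_minus_measure :: "real measure \<Rightarrow> ereal \<Rightarrow> ereal \<Rightarrow> real measure" where
  "S_minus_measure \<nu> xl xr =
     distr (restrict_space (S_measure \<nu> xl xr) {..<0}) pos_reals (\<lambda>x. - x)"

end

theory Submission
  imports Defs
begin

text \<open>
  The range of the \<open>r\<close>-th order extremal process. Fix levels \<open>a < b\<close> and look at the points of
  \<open>N\<close> above \<open>a\<close> in the order of their arrival. The process jumps into \<open>(a, b]\<close> exactly if at some
  time there are at least \<open>r\<close> points above \<open>a\<close> but fewer than \<open>r\<close> above \<open>b\<close>; hence the range misses
  \<open>(a, b]\<close> if and only if the first \<open>r\<close> points above \<open>a\<close> all lie above \<open>b\<close>. Each point above \<open>a\<close> lies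
  above \<open>b\<close> with probability \<open>Q(b) / Q(a)\<close>, independently of the others and of the arrival times, so
  the range misses \<open>(a, b]\<close> with probability \<open>(Q(b) / Q(a))\<^sup>r = exp (- r (S(b) - S(a)))\<close>, and this event
  is independent of the counting process of the points above \<open>a\<close> (\<open>thinning\<close>). Descending through
  levels \<open>y\<^sub>0 > y\<^sub>1 > \<dots>\<close> this gives the probability that the range misses any union of the intervals
  between them (\<open>prob_void_chain\<close>). Monotone class arguments extend the formula
  \<open>P(R \<inter> A = {}) = exp (- r S(A))\<close> to all Borel sets \<open>A\<close> (\<open>void_formula_borel\<close>), and by Renyi's theorem
  (\<open>renyi\<close>) these probabilities characterize a Poisson process if the mean is atomless. Its
  restrictions to the two half-lines are independent Poisson processes (\<open>range_sides\<close>).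

  The limit theorem. After affine scaling and cutting, the two sides of \<open>R\<^sub>n\<close> are independent Poisson
  processes whose means \<open>\<mu>\<^sub>n\<close> satisfy \<open>\<mu>\<^sub>n(0, x] \<longlonglongrightarrow> \<mu>(0, x]\<close> (\<open>scaled_mean_tendsto\<close>). Only the joint
  law for each \<open>n\<close> matters for convergence in distribution, so the processes may be realized together:
  the image of \<open>R\<^sub>1\<close> under \<open>S\<close> is a Poisson process \<open>U\<close> with Lebesgue mean, and mapping the points of \<open>U\<close> in
  \<open>(0, \<infinity>)\<close> by the generalized inverse of \<open>x \<mapsto> \<mu>\<^sub>n(0, x]\<close> produces a Poisson process with mean \<open>\<mu>\<^sub>n\<close>; the
  negative points of \<open>U\<close> serve the other side. The inverse functions converge outside a countable set, so the
  coupled processes converge vaguely almost surely (\<open>coupled_tendsto\<close>), and dominated convergence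
  finishes the proof (\<open>coupling_convergence\<close>). That the expectation of a vaguely continuous function
  exists and depends on the law only is obtained by moving all points to the right end points of
  dyadic cells: the function becomes one of finitely many counts, and tends to the
  original one as the cells shrink (\<open>vague_expectation\<close>, \<open>same_expectation\<close>).
\<close>

section \<open>Poisson processes: images, and independence over disjoint regions\<close>

lemma space_measures_algebra: "space (measures_algebra K) = {\<mu>. sets \<mu> = sets K}"
  by (auto simp: measures_algebra_def space_Sup_eq_UN)

lemma measures_algebra_cong: "sets K = sets L \<Longrightarrow> measures_algebra K = measures_algebra L"
  by (simp add: measures_algebra_def)

lemma measurable_emeasure_measures_algebra:
  assumes "A \<in> sets K"
  shows "(\<lambda>\<mu>. emeasure \<mu> A) \<in> borel_measurable (measures_algebra K)"
  using assms unfolding measures_algebra_def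
  by (auto intro!: measurable_Sup1 measurable_vimage_algebra1)

lemma measurable_into_measures_algebra:
  assumes "\<And>w. w \<in> space M \<Longrightarrow> sets (f w) = sets K"
  assumes "\<And>A. A \<in> sets K \<Longrightarrow> (\<lambda>w. emeasure (f w) A) \<in> borel_measurable M"
  shows "f \<in> measurable M (measures_algebra K)"
  using assms unfolding measures_algebra_def
  by (intro measurable_Sup2) (auto intro!: measurable_vimage_algebra2)

lemma poisson_process_prob_space: "poisson_process P \<mu> \<xi> \<Longrightarrow> prob_space P"
  unfolding poisson_process_def by (rule conjunct1)

lemma poisson_process_sets:
  "poisson_process P \<mu> \<xi> \<Longrightarrow> w \<in> space P \<Longrightarrow> sets (\<xi> w) = sets \<mu>"
  unfolding poisson_process_def using measurable_space[of \<xi> P "measures_algebra \<mu>" w]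
  by (simp only: space_measures_algebra mem_Collect_eq)

lemma poisson_process_measurable:
  "poisson_process P \<mu> \<xi> \<Longrightarrow> A \<in> sets \<mu> \<Longrightarrow> (\<lambda>w. emeasure (\<xi> w) A) \<in> borel_measurable P"
  unfolding poisson_process_def
  by (rule measurable_compose[OF _ measurable_emeasure_measures_algebra, of \<xi> P \<mu>]) auto

lemma poisson_process_weight:
  "poisson_process P \<mu> \<xi> \<Longrightarrow> A \<in> sets \<mu> \<Longrightarrow> emeasure \<mu> A < \<infinity> \<Longrightarrow>
    measure P {w\<in>space P. emeasure (\<xi> w) A = of_nat k} =
      measure \<mu> A ^ k / fact k * exp (- measure \<mu> A)"
  unfolding poisson_process_def by blast

lemma poisson_process_infinite:
  "poisson_process P \<mu> \<xi> \<Longrightarrow> A \<in> sets \<mu> \<Longrightarrow> emeasure \<mu> A = \<infinity> \<Longrightarrow>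
    AE w in P. emeasure (\<xi> w) A = \<infinity>"
  unfolding poisson_process_def by blast

lemma (in prob_space) indep_vars_extend_const:
  assumes ind: "indep_vars N X J" and "J \<subseteq> I"
    and const: "\<And>i w. i \<in> I - J \<Longrightarrow> w \<in> space M \<Longrightarrow> X i w = c i" "\<And>i. i \<in> I - J \<Longrightarrow> c i \<in> space (N i)"
  shows "indep_vars N X I"
proof -
  have rv: "random_variable (N i) (X i)" if "i \<in> I" for i
  proof (cases "i \<in> J")
    case True then show ?thesis using ind by (auto simp: indep_vars_def)
  next
    case False
    then have "random_variable (N i) (\<lambda>_. c i)" using const that by auto
    then show ?thesis
      by (subst measurable_cong[where g="\<lambda>_. c i"]) (use const that False in auto)
  qed
  show ?thesis unfolding indep_vars_def2
  proof (intro conjI ballI rv, assumption, rule indep_setsI)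
    fix i assume "i \<in> I" then show "{X i -` A \<inter> space M |A. A \<in> sets (N i)} \<subseteq> events"
      by (auto intro: measurable_sets[OF rv])
  next
    fix A K assume K: "K \<noteq> {}" "K \<subseteq> I" "finite K" and A: "\<forall>j\<in>K. A j \<in> {X j -` B \<inter> space M |B. B \<in> sets (N j)}"
    have ev: "A j \<in> events" if jK: "j \<in> K" for j
    proof -
      obtain B where "A j = X j -` B \<inter> space M" "B \<in> sets (N j)" using A jK by auto
      then show ?thesis using measurable_sets[OF rv, of j B] jK K by auto
    qed
    have triv: "A j = {} \<or> A j = space M" if jK: "j \<in> K - J" for j
    proof -
      obtain B where "A j = X j -` B \<inter> space M" using A jK by auto
      then show ?thesis using const[of j] jK K by (cases "c j \<in> B") auto
    qed
    show "prob (\<Inter>j\<in>K. A j) = (\<Prod>j\<in>K. prob (A j))"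
    proof (cases "\<exists>j\<in>K - J. A j = {}")
      case True
      then obtain j where j: "j \<in> K" "A j = {}" by blast
      then have "(\<Prod>j\<in>K. prob (A j)) = 0" using K by (intro prod_zero) (auto intro!: bexI[of _ j])
      moreover have "(\<Inter>j\<in>K. A j) = {}" using j by blast
      ultimately show ?thesis by simp
    next
      case False
      then have sp: "A j = space M" if "j \<in> K - J" for j using triv that by blast
      have prodeq: "(\<Prod>j\<in>K. prob (A j)) = (\<Prod>j\<in>K\<inter>J. prob (A j))"
        by (rule prod.mono_neutral_right) (use K sp prob_space in auto)
      show ?thesis
      proof (cases "K \<inter> J = {}")
        case True
        then have "(\<Inter>j\<in>K. A j) = (\<Inter>j\<in>K. space M)" using sp by (intro INF_cong) auto
        then have "(\<Inter>j\<in>K. A j) = space M" using K(1) by simp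
        then show ?thesis using prodeq True prob_space by simp
      next
        case ne: False
        have "indep_sets (\<lambda>i. {X i -` B \<inter> space M |B. B \<in> sets (N i)}) J"
          using ind unfolding indep_vars_def2 by simp
        then have "prob (\<Inter>j\<in>K\<inter>J. A j) = (\<Prod>j\<in>K\<inter>J. prob (A j))"
          using A K ne by (intro indep_setsD) auto
        moreover have "(\<Inter>j\<in>K. A j) = (\<Inter>j\<in>K\<inter>J. A j)"
        proof -
          obtain i where "i \<in> K \<inter> J" using ne by blast
          then have "(\<Inter>j\<in>K\<inter>J. A j) \<subseteq> space M" using ev sets.sets_into_space by blast
          then show ?thesis using sp by blast
        qed
        ultimately show ?thesis using prodeq by simp
      qed
    qed
  qed
qed

lemma (in prob_space) indep_vars_reindex:
  assumes ind: "indep_vars N X I" and "inj_on f J" "f ` J \<subseteq> I"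
  shows "indep_vars (\<lambda>j. N (f j)) (\<lambda>j. X (f j)) J"
  unfolding indep_vars_def2
proof (intro conjI ballI)
  fix j assume "j \<in> J" then show "random_variable (N (f j)) (X (f j))"
    using ind assms(3) by (auto simp: indep_vars_def)
next
  show "indep_sets (\<lambda>j. {X (f j) -` A \<inter> space M |A. A \<in> sets (N (f j))}) J"
  proof (rule indep_setsI)
    fix j assume "j \<in> J"
    then have "random_variable (N (f j)) (X (f j))"
      using ind assms(3) by (auto simp: indep_vars_def)
    then show "{X (f j) -` A \<inter> space M |A. A \<in> sets (N (f j))} \<subseteq> events"
      by (auto intro: measurable_sets)
  next
    fix A K assume K: "K \<noteq> {}" "K \<subseteq> J" "finite K"
      and A: "\<forall>j\<in>K. A j \<in> {X (f j) -` A \<inter> space M |A. A \<in> sets (N (f j))}"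
    define h where "h = the_inv_into J f"
    have h: "h (f j) = j" if "j \<in> K" for j
      unfolding h_def using assms(2) K that by (intro the_inv_into_f_f) auto
    have inj: "inj_on f K" using assms(2) K by (auto simp: inj_on_def)
    have "indep_sets (\<lambda>i. {X i -` A \<inter> space M |A. A \<in> sets (N i)}) I"
      using ind unfolding indep_vars_def2 by simp
    then have "prob (\<Inter>i\<in>f ` K. A (h i)) = (\<Prod>i\<in>f ` K. prob (A (h i)))"
    proof (rule indep_setsD)
      show "f ` K \<subseteq> I" using K assms(3) by blast
      show "\<forall>i\<in>f ` K. A (h i) \<in> {X i -` A \<inter> space M |A. A \<in> sets (N i)}" using A h by simp
    qed (use K in auto)
    moreover have "(\<Inter>i\<in>f ` K. A (h i)) = (\<Inter>j\<in>K. A j)" using h by auto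
    moreover have "(\<Prod>i\<in>f ` K. prob (A (h i))) = (\<Prod>j\<in>K. prob (A j))"
      using inj h by (simp add: prod.reindex)
    ultimately show "prob (\<Inter>j\<in>K. A j) = (\<Prod>j\<in>K. prob (A j))" by simp
  qed
qed

lemma (in prob_space) indep_vars_modification:
  assumes ind: "indep_vars N X I" and rv: "\<And>i. i \<in> I \<Longrightarrow> random_variable (N i) (Y i)"
    and eq: "\<And>i. i \<in> I \<Longrightarrow> AE w in M. Y i w = X i w"
  shows "indep_vars N Y I"
  unfolding indep_vars_def2
proof (intro conjI ballI rv, assumption, rule indep_setsI)
  fix i assume "i \<in> I" then show "{Y i -` A \<inter> space M |A. A \<in> sets (N i)} \<subseteq> events"
    by (auto intro: measurable_sets[OF rv])
next
  fix A K assume K: "K \<noteq> {}" "K \<subseteq> I" "finite K" and A: "\<forall>j\<in>K. A j \<in> {Y j -` B \<inter> space M |B. B \<in> sets (N j)}"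
  from A have "\<exists>B. \<forall>j\<in>K. B j \<in> sets (N j) \<and> A j = Y j -` B j \<inter> space M"
    by (intro bchoice) auto
  then obtain B where B: "\<And>j. j \<in> K \<Longrightarrow> B j \<in> sets (N j)" "\<And>j. j \<in> K \<Longrightarrow> A j = Y j -` B j \<inter> space M"
    by blast
  have X: "random_variable (N j) (X j)" if "j \<in> K" for j
    using ind that K by (auto simp: indep_vars_def)
  have ev: "A j \<in> events" "X j -` B j \<inter> space M \<in> events" if "j \<in> K" for j
    using that B rv[of j] X[of j] K measurable_sets by auto
  have ae: "AE w in M. \<forall>j\<in>K. Y j w = X j w"
    using eq K by (intro AE_finite_allI) auto
  have "prob (\<Inter>j\<in>K. A j) = prob (\<Inter>j\<in>K. X j -` B j \<inter> space M)"
  proof (rule finite_measure_eq_AE)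
    show "AE w in M. (w \<in> (\<Inter>j\<in>K. A j)) = (w \<in> (\<Inter>j\<in>K. X j -` B j \<inter> space M))"
      using ae by eventually_elim (use B(2) in auto)
  qed (use ev K in \<open>auto intro: sets.finite_INT simp del: INT_simps\<close>)
  also have "\<dots> = (\<Prod>j\<in>K. prob (X j -` B j \<inter> space M))"
    using ind K B(1) unfolding indep_vars_def2 by (intro indep_setsD) auto
  also have "\<dots> = (\<Prod>j\<in>K. prob (A j))"
  proof (rule prod.cong[OF refl])
    fix j assume j: "j \<in> K"
    show "prob (X j -` B j \<inter> space M) = prob (A j)"
      by (rule finite_measure_eq_AE) (use ae B(2)[OF j] ev[OF j] j in auto)
  qed
  finally show "prob (\<Inter>j\<in>K. A j) = (\<Prod>j\<in>K. prob (A j))" .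
qed

text \<open>The definition of a Poisson process speaks of sets of sets. In an indexed disjoint family only the
  empty set can occur repeatedly, and its count is the constant \<open>0\<close>.\<close>

lemma poisson_process_indep_family:
  assumes pp: "poisson_process P \<mu> \<xi>" and "finite I" "disjoint_family_on A I" "\<And>i. i \<in> I \<Longrightarrow> A i \<in> sets \<mu>"
  shows "prob_space.indep_vars P (\<lambda>_. borel) (\<lambda>i w. emeasure (\<xi> w) (A i)) I"
proof -
  interpret prob_space P using pp by (rule poisson_process_prob_space)
  define J where "J = {i\<in>I. A i \<noteq> {}}"
  have inj: "inj_on A J" using assms(3) by (auto simp: inj_on_def J_def disjoint_family_on_def)
  have "disjoint (A ` J)"
    using disjoint_family_on_disjoint_image[of A J] assms(3)
    by (auto simp: J_def disjoint_family_on_def)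
  then have "indep_vars (\<lambda>_. borel) (\<lambda>A w. emeasure (\<xi> w) A) (A ` J)"
  proof -
    have "A ` J \<subseteq> sets \<mu>" "finite (A ` J)" using assms(2,4) by (auto simp: J_def)
    then show ?thesis using pp \<open>disjoint (A ` J)\<close> unfolding poisson_process_def by blast
  qed
  then have "indep_vars (\<lambda>_. borel) (\<lambda>i w. emeasure (\<xi> w) (A i)) J"
    using indep_vars_reindex[of "\<lambda>_. borel" "\<lambda>A w. emeasure (\<xi> w) A", OF _ inj] by (simp add: comp_def)
  then show ?thesis
    by (rule indep_vars_extend_const[where c="\<lambda>_. 0"]) (auto simp: J_def)
qed

lemma emeasure_distr_restrict:
  assumes "sets \<nu> = sets \<mu>" "D \<in> sets \<mu>" "q \<in> measurable (restrict_space \<mu> D) K" "A \<in> sets K"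
  shows "q -` A \<inter> D \<in> sets \<mu>"
    and "emeasure (distr (restrict_space \<nu> D) K q) A = emeasure \<nu> (q -` A \<inter> D)"
proof -
  have D: "D \<inter> space \<mu> = D" "D \<subseteq> space \<mu>" using sets.sets_into_space[OF assms(2)] by auto
  have "q -` A \<inter> space (restrict_space \<mu> D) \<in> sets (restrict_space \<mu> D)"
    using assms(3,4) by (rule measurable_sets)
  then show *: "q -` A \<inter> D \<in> sets \<mu>"
    using D assms(2) by (simp add: space_restrict_space sets_restrict_space_iff)
  have q: "q \<in> measurable (restrict_space \<nu> D) K"
    using assms(1,3) by (simp cong: measurable_cong_sets sets_restrict_space_cong)
  have sp: "space \<nu> = space \<mu>" using assms(1) by (rule sets_eq_imp_space_eq)
  show "emeasure (distr (restrict_space \<nu> D) K q) A = emeasure \<nu> (q -` A \<inter> D)"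
    using D sp assms(1,2)
    by (subst emeasure_distr[OF q assms(4)]) (auto simp: space_restrict_space emeasure_restrict_space)
qed

text \<open>Restriction and mapping in one step: the count of \<open>A\<close> in the image is the count of a preimage in the
  original process, and preimages of disjoint sets are disjoint.\<close>

lemma poisson_process_pushforward:
  assumes pp: "poisson_process P \<mu> \<xi>" and D: "D \<in> sets \<mu>" and q: "q \<in> measurable (restrict_space \<mu> D) K"
  shows "poisson_process P (distr (restrict_space \<mu> D) K q) (\<lambda>w. distr (restrict_space (\<xi> w) D) K q)"
proof -
  interpret prob_space P using pp by (rule poisson_process_prob_space)
  have e: "emeasure (distr (restrict_space (\<xi> w) D) K q) A = emeasure (\<xi> w) (q -` A \<inter> D)"
    if "w \<in> space P" "A \<in> sets K" for w A
    using poisson_process_sets[OF pp that(1)] D q that(2) by (rule emeasure_distr_restrict)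
  have em: "emeasure (distr (restrict_space \<mu> D) K q) A = emeasure \<mu> (q -` A \<inter> D)"
    and s: "q -` A \<inter> D \<in> sets \<mu>" if "A \<in> sets K" for A
    using emeasure_distr_restrict[OF refl D q that] by auto
  have me: "measure (distr (restrict_space \<mu> D) K q) A = measure \<mu> (q -` A \<inter> D)" if "A \<in> sets K" for A
    using em[OF that] by (simp add: measure_def)
  show ?thesis unfolding poisson_process_def
  proof (intro conjI ballI impI allI)
    show "prob_space P" by (rule prob_space_axioms)
    show "(\<lambda>w. distr (restrict_space (\<xi> w) D) K q) \<in> measurable P (measures_algebra (distr (restrict_space \<mu> D) K q))"
    proof (rule measurable_into_measures_algebra)
      fix A assume "A \<in> sets (distr (restrict_space \<mu> D) K q)"
      then have A: "A \<in> sets K" by simp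
      show "(\<lambda>w. emeasure (distr (restrict_space (\<xi> w) D) K q) A) \<in> borel_measurable P"
        using poisson_process_measurable[OF pp s[OF A]]
        by (subst measurable_cong[OF e[OF _ A]])
    qed auto
  next
    fix A k assume "A \<in> sets (distr (restrict_space \<mu> D) K q)" and fin: "emeasure (distr (restrict_space \<mu> D) K q) A < \<infinity>"
    then have A: "A \<in> sets K" by simp
    have "{w \<in> space P. emeasure (distr (restrict_space (\<xi> w) D) K q) A = of_nat k}
       = {w \<in> space P. emeasure (\<xi> w) (q -` A \<inter> D) = of_nat k}"
      using e[OF _ A] by (intro Collect_cong) (simp cong: conj_cong)
    then show "prob {w \<in> space P. emeasure (distr (restrict_space (\<xi> w) D) K q) A = of_nat k} =
         measure (distr (restrict_space \<mu> D) K q) A ^ k / fact k * exp (- measure (distr (restrict_space \<mu> D) K q) A)"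
      using poisson_process_weight[OF pp s[OF A] fin[unfolded em[OF A]], of k] me[OF A] by (simp only:)
  next
    fix A assume "A \<in> sets (distr (restrict_space \<mu> D) K q)" and inf: "emeasure (distr (restrict_space \<mu> D) K q) A = \<infinity>"
    then have A: "A \<in> sets K" by simp
    have "AE w in P. emeasure (\<xi> w) (q -` A \<inter> D) = \<infinity>"
      using poisson_process_infinite[OF pp s[OF A]] inf[unfolded em[OF A]] .
    then show "AE w in P. emeasure (distr (restrict_space (\<xi> w) D) K q) A = \<infinity>"
      by (rule AE_mp) (rule AE_I2, simp only: e[OF _ A] simp_thms)
  next
    fix \<A> assume \<A>: "\<A> \<subseteq> sets (distr (restrict_space \<mu> D) K q)" "finite \<A>" "disjoint \<A>"
    have "disjoint_family_on (\<lambda>A. q -` A \<inter> D) \<A>"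
      using \<A>(3) unfolding disjoint_def disjoint_family_on_def by blast
    then have "indep_vars (\<lambda>_. borel) (\<lambda>A w. emeasure (\<xi> w) (q -` A \<inter> D)) \<A>"
      by (rule poisson_process_indep_family[OF pp \<A>(2)]) (use \<A>(1) in \<open>auto intro: s\<close>)
    then show "indep_vars (\<lambda>_. borel) (\<lambda>A w. emeasure (distr (restrict_space (\<xi> w) D) K q) A) \<A>"
    proof (rule indep_vars_modification)
      fix A assume "A \<in> \<A>"
      then have A: "A \<in> sets K" using \<A>(1) by auto
      show "random_variable borel (\<lambda>w. emeasure (distr (restrict_space (\<xi> w) D) K q) A)"
        using poisson_process_measurable[OF pp s[OF A]]
        by (subst measurable_cong[OF e[OF _ A]])
      show "AE w in P. emeasure (distr (restrict_space (\<xi> w) D) K q) A = emeasure (\<xi> w) (q -` A \<inter> D)"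
        by (rule AE_I2) (rule e[OF _ A])
    qed
  qed
qed

lemma sets_Collect_Ball_finite:
  assumes "finite F" "\<And>i. i \<in> F \<Longrightarrow> {x\<in>space M. Q i x} \<in> sets M"
  shows "{x\<in>space M. \<forall>i\<in>F. Q i x} \<in> sets M"
  using assms by (cases "F = {}") (auto intro: sets.sets_Collect_finite_All')

text \<open>The events that are determined by the points in \<open>D\<close>.\<close>

definition region_algebra :: "'w measure \<Rightarrow> ('w \<Rightarrow> 'a measure) \<Rightarrow> 'a measure \<Rightarrow> 'a set \<Rightarrow> 'w measure" where
  "region_algebra P \<xi> \<mu> D =
     sigma (space P) {{w\<in>space P. emeasure (\<xi> w) A \<in> B} | A B. A \<in> sets \<mu> \<and> A \<subseteq> D \<and> B \<in> sets borel}"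

lemma space_region_algebra [simp]: "space (region_algebra P \<xi> \<mu> D) = space P"
  by (simp add: region_algebra_def space_measure_of_conv)

lemma sets_region_algebra:
  "sets (region_algebra P \<xi> \<mu> D) =
     sigma_sets (space P) {{w\<in>space P. emeasure (\<xi> w) A \<in> B} | A B. A \<in> sets \<mu> \<and> A \<subseteq> D \<and> B \<in> sets borel}"
  unfolding region_algebra_def by (rule sets_measure_of) auto

lemma measurable_region_algebra:
  assumes "A \<in> sets \<mu>" "A \<subseteq> D"
  shows "(\<lambda>w. emeasure (\<xi> w) A) \<in> borel_measurable (region_algebra P \<xi> \<mu> D)"
proof (rule measurableI)
  fix B :: "ennreal set" assume "B \<in> sets borel"
  then have "{w\<in>space P. emeasure (\<xi> w) A \<in> B} \<in> sets (region_algebra P \<xi> \<mu> D)"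
    unfolding sets_region_algebra using assms by (intro sigma_sets.Basic) auto
  then show "(\<lambda>w. emeasure (\<xi> w) A) -` B \<inter> space (region_algebra P \<xi> \<mu> D) \<in> sets (region_algebra P \<xi> \<mu> D)"
    by (simp add: vimage_def Int_def conj_commute)
qed auto

lemma region_algebra_mono: "D \<subseteq> D' \<Longrightarrow> sets (region_algebra P \<xi> \<mu> D) \<subseteq> sets (region_algebra P \<xi> \<mu> D')"
  unfolding sets_region_algebra by (rule sigma_sets_mono') auto

lemma region_algebra_events:
  assumes "poisson_process P \<mu> \<xi>"
  shows "sets (region_algebra P \<xi> \<mu> D) \<subseteq> sets P"
  unfolding sets_region_algebra
proof (rule sets.sigma_sets_subset, safe)
  fix A and B :: "ennreal set" assume "A \<in> sets \<mu>" "B \<in> sets borel"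
  then have "(\<lambda>w. emeasure (\<xi> w) A) -` B \<inter> space P \<in> sets P"
    using poisson_process_measurable[OF assms] by (intro measurable_sets)
  then show "{w \<in> space P. emeasure (\<xi> w) A \<in> B} \<in> sets P"
    by (simp add: vimage_def Int_def conj_commute)
qed

text \<open>The \<open>\<pi>\<close>-system generating \<open>region_algebra\<close>.\<close>

definition region_cylinders :: "'w measure \<Rightarrow> ('w \<Rightarrow> 'a measure) \<Rightarrow> 'a measure \<Rightarrow> 'a set \<Rightarrow> 'w set set" where
  "region_cylinders P \<xi> \<mu> D =
     {{w\<in>space P. \<forall>A\<in>F. emeasure (\<xi> w) A \<in> B A} | F B. finite F \<and> F \<subseteq> sets \<mu> \<and> (\<forall>A\<in>F. A \<subseteq> D \<and> B A \<in> sets borel)}"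

lemma Int_stable_region_cylinders: "Int_stable (region_cylinders P \<xi> \<mu> D)"
proof (rule Int_stableI)
  fix a b assume "a \<in> region_cylinders P \<xi> \<mu> D" "b \<in> region_cylinders P \<xi> \<mu> D"
  then obtain F1 B1 F2 B2 where
    F1: "a = {w\<in>space P. \<forall>A\<in>F1. emeasure (\<xi> w) A \<in> B1 A}" "finite F1" "F1 \<subseteq> sets \<mu>" "\<forall>A\<in>F1. A \<subseteq> D \<and> B1 A \<in> sets borel" and
    F2: "b = {w\<in>space P. \<forall>A\<in>F2. emeasure (\<xi> w) A \<in> B2 A}" "finite F2" "F2 \<subseteq> sets \<mu>" "\<forall>A\<in>F2. A \<subseteq> D \<and> B2 A \<in> sets borel"
    unfolding region_cylinders_def by auto
  define B where "B A = (if A \<in> F1 then B1 A else UNIV) \<inter> (if A \<in> F2 then B2 A else UNIV)" for A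
  have "a \<inter> b = {w\<in>space P. \<forall>A\<in>F1 \<union> F2. emeasure (\<xi> w) A \<in> B A}"
    unfolding F1 F2 B_def by auto
  moreover have "finite (F1 \<union> F2)" "F1 \<union> F2 \<subseteq> sets \<mu>" "\<forall>A\<in>F1 \<union> F2. A \<subseteq> D \<and> B A \<in> sets borel"
    using F1 F2 by (auto simp: B_def)
  ultimately show "a \<inter> b \<in> region_cylinders P \<xi> \<mu> D"
    unfolding region_cylinders_def by blast
qed

lemma sets_region_algebra_cylinders:
  "sets (region_algebra P \<xi> \<mu> D) = sigma_sets (space P) (region_cylinders P \<xi> \<mu> D)"
proof (rule antisym)
  show "sets (region_algebra P \<xi> \<mu> D) \<subseteq> sigma_sets (space P) (region_cylinders P \<xi> \<mu> D)"
    unfolding sets_region_algebra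
  proof (rule sigma_sets_mono', safe)
    fix A and B :: "ennreal set" assume "A \<in> sets \<mu>" "A \<subseteq> D" "B \<in> sets borel"
    then show "{w \<in> space P. emeasure (\<xi> w) A \<in> B} \<in> region_cylinders P \<xi> \<mu> D"
      unfolding region_cylinders_def by (auto intro!: exI[of _ "{A}"] exI[of _ "\<lambda>_. B"])
  qed
  have "region_cylinders P \<xi> \<mu> D \<subseteq> sets (region_algebra P \<xi> \<mu> D)"
    unfolding region_cylinders_def
  proof safe
    fix F and B :: "'b set \<Rightarrow> ennreal set"
    assume F: "finite F" "F \<subseteq> sets \<mu>" "\<forall>A\<in>F. A \<subseteq> D \<and> B A \<in> sets borel"
    have "{w \<in> space (region_algebra P \<xi> \<mu> D). \<forall>A\<in>F. emeasure (\<xi> w) A \<in> B A} \<in> sets (region_algebra P \<xi> \<mu> D)"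
    proof (rule sets_Collect_Ball_finite[OF F(1)], goal_cases)
      case (1 A)
      then have "(\<lambda>w. emeasure (\<xi> w) A) -` B A \<inter> space (region_algebra P \<xi> \<mu> D) \<in> sets (region_algebra P \<xi> \<mu> D)"
        using F by (intro measurable_sets[OF measurable_region_algebra]) auto
      then show ?case by (simp add: vimage_def Int_def conj_commute)
    qed
    then show "{w \<in> space P. \<forall>A\<in>F. emeasure (\<xi> w) A \<in> B A} \<in> sets (region_algebra P \<xi> \<mu> D)" by simp
  qed
  then show "sigma_sets (space P) (region_cylinders P \<xi> \<mu> D) \<subseteq> sets (region_algebra P \<xi> \<mu> D)"
    using sets.sigma_sets_subset[of "region_cylinders P \<xi> \<mu> D" "region_algebra P \<xi> \<mu> D"] by simp
qed

text \<open>The cells of the Venn diagram of \<open>F\<close>. Independence is known for disjoint sets only, so that the counts of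
  overlapping sets have to be expressed by the counts of these cells.\<close>

definition atom_of :: "'a set set \<Rightarrow> 'a set set \<Rightarrow> 'a set" where
  "atom_of F T = {x\<in>\<Union>F. \<forall>A\<in>F. x \<in> A \<longleftrightarrow> A \<in> T}"

lemma disjoint_atoms: "disjoint_family_on (atom_of F) (Pow F)"
  by (auto simp: disjoint_family_on_def atom_of_def)

lemma atom_of_sets:
  assumes "finite F" "F \<subseteq> sets \<mu>" shows "atom_of F T \<in> sets \<mu>"
proof -
  have "atom_of F T = {x\<in>space \<mu>. (\<exists>A\<in>F. x \<in> A) \<and> (\<forall>A\<in>F. x \<in> A \<longleftrightarrow> A \<in> T)}"
    using sets.sets_into_space assms(2) by (auto simp: atom_of_def)
  also have "\<dots> \<in> sets \<mu>"
    using assms by (intro sets.sets_Collect_conj sets.sets_Collect_finite_Ex sets.sets_Collect_finite_All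
        sets.sets_Collect sets.sets_Collect_imp) (auto simp: subset_eq intro!: pred_sets1 sets.sets_Collect)
  finally show ?thesis .
qed

lemma emeasure_atoms:
  assumes "finite F" "F \<subseteq> sets \<mu>" "A \<in> F"
  shows "emeasure \<mu> A = (\<Sum>T\<in>{T\<in>Pow F. A \<in> T}. emeasure \<mu> (atom_of F T))"
proof -
  have "A = (\<Union>T\<in>{T\<in>Pow F. A \<in> T}. atom_of F T)"
  proof (intro equalityI subsetI)
    fix x assume "x \<in> A"
    then show "x \<in> (\<Union>T\<in>{T\<in>Pow F. A \<in> T}. atom_of F T)"
      using assms(3) by (intro UN_I[of "{B\<in>F. x \<in> B}"]) (auto simp: atom_of_def)
  qed (auto simp: atom_of_def)
  also have "emeasure \<mu> \<dots> = (\<Sum>T\<in>{T\<in>Pow F. A \<in> T}. emeasure \<mu> (atom_of F T))"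
    using assms disjoint_atoms[of F] atom_of_sets[OF assms(1,2)]
    by (intro sum_emeasure[symmetric]) (auto simp: disjoint_family_on_def)
  finally show ?thesis .
qed

text \<open>For cylinder events, refine the finitely many sets on both sides to their atoms: these are jointly
  disjoint, so their counts are independent, and the events are functions of the counts of separate
  groups of atoms. The general case follows since the cylinders are stable under intersection.\<close>

theorem poisson_process_indep_regions:
  fixes \<xi> :: "'w \<Rightarrow> 'a measure"
  assumes pp: "poisson_process P \<mu> \<xi>" and D: "D1 \<inter> D2 = {}"
    and a: "a \<in> sets (region_algebra P \<xi> \<mu> D1)" and b: "b \<in> sets (region_algebra P \<xi> \<mu> D2)"
  shows "measure P (a \<inter> b) = measure P a * measure P b"
proof -
  interpret prob_space P using pp by (rule poisson_process_prob_space)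
  have cyl: "region_cylinders P \<xi> \<mu> D \<subseteq> events" for D
    using region_algebra_events[OF pp, of D] unfolding sets_region_algebra_cylinders by auto
  have "indep_set (region_cylinders P \<xi> \<mu> D1) (region_cylinders P \<xi> \<mu> D2)"
  proof (rule indep_setI[OF cyl cyl])
    fix a b assume "a \<in> region_cylinders P \<xi> \<mu> D1" "b \<in> region_cylinders P \<xi> \<mu> D2"
    then obtain F1 B1 F2 B2 where
      F1: "a = {w\<in>space P. \<forall>A\<in>F1. emeasure (\<xi> w) A \<in> B1 A}" "finite F1" "F1 \<subseteq> sets \<mu>" "\<forall>A\<in>F1. A \<subseteq> D1 \<and> B1 A \<in> sets borel" and
      F2: "b = {w\<in>space P. \<forall>A\<in>F2. emeasure (\<xi> w) A \<in> B2 A}" "finite F2" "F2 \<subseteq> sets \<mu>" "\<forall>A\<in>F2. A \<subseteq> D2 \<and> B2 A \<in> sets borel"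
      unfolding region_cylinders_def by (elim CollectE exE conjE) blast
    define I where "I = Inl ` Pow F1 \<union> Inr ` Pow F2"
    define A where "A = case_sum (atom_of F1) (atom_of F2)"
    have "atom_of F1 T \<inter> atom_of F2 U = {}" for T U
    proof -
      have "atom_of F1 T \<subseteq> D1" "atom_of F2 U \<subseteq> D2" using F1(4) F2(4) by (auto simp: atom_of_def)
      then show ?thesis using D by blast
    qed
    then have "disjoint_family_on A I"
      using disjoint_atoms[of F1] disjoint_atoms[of F2]
      unfolding disjoint_family_on_def I_def A_def
      by (simp add: ball_Un Int_commute)
    then have ind: "indep_vars (\<lambda>_. borel) (\<lambda>i w. emeasure (\<xi> w) (A i)) I"
      by (rule poisson_process_indep_family[OF pp, rotated])
         (use F1 F2 atom_of_sets in \<open>auto simp: I_def A_def\<close>)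
    have iv: "indep_var (PiM (Inl ` Pow F1) (\<lambda>_. borel)) (\<lambda>w. restrict (\<lambda>i. emeasure (\<xi> w) (A i)) (Inl ` Pow F1))
       (PiM (Inr ` Pow F2) (\<lambda>_. borel)) (\<lambda>w. restrict (\<lambda>i. emeasure (\<xi> w) (A i)) (Inr ` Pow F2))"
      by (rule indep_var_restrict[OF ind]) (auto simp: I_def)
    define X1 where "X1 w = restrict (\<lambda>i. emeasure (\<xi> w) (A i)) (Inl ` Pow F1)" for w
    define X2 where "X2 w = restrict (\<lambda>i. emeasure (\<xi> w) (A i)) (Inr ` Pow F2)" for w
    define S1 where "S1 = {f\<in>space (PiM (Inl ` Pow F1 :: ('a set set + 'a set set) set) (\<lambda>_. borel :: ennreal measure)). \<forall>A\<in>F1. (\<Sum>T\<in>{T\<in>Pow F1. A \<in> T}. f (Inl T)) \<in> B1 A}"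
    define S2 where "S2 = {f\<in>space (PiM (Inr ` Pow F2 :: ('a set set + 'a set set) set) (\<lambda>_. borel :: ennreal measure)). \<forall>A\<in>F2. (\<Sum>T\<in>{T\<in>Pow F2. A \<in> T}. f (Inr T)) \<in> B2 A}"
    have S1: "S1 \<in> sets (PiM (Inl ` Pow F1) (\<lambda>_. borel))" unfolding S1_def
    proof (rule sets_Collect_Ball_finite[OF F1(2)])
      fix A assume A: "A \<in> F1"
      have m: "(\<lambda>f. \<Sum>T\<in>{T\<in>Pow F1. A \<in> T}. f (Inl T)) \<in> borel_measurable (PiM (Inl ` Pow F1 :: ('a set set + 'a set set) set) (\<lambda>_. borel :: ennreal measure))"
        by (intro borel_measurable_sum measurable_component_singleton) auto
      show "{f \<in> space (PiM (Inl ` Pow F1) (\<lambda>_. borel)). (\<Sum>T\<in>{T\<in>Pow F1. A \<in> T}. f (Inl T)) \<in> B1 A} \<in> sets (PiM (Inl ` Pow F1 :: ('a set set + 'a set set) set) (\<lambda>_. borel :: ennreal measure))"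
        using measurable_sets[OF m, of "B1 A"] F1(4) A by (simp add: vimage_def Int_def conj_commute)
    qed
    have S2: "S2 \<in> sets (PiM (Inr ` Pow F2) (\<lambda>_. borel))" unfolding S2_def
    proof (rule sets_Collect_Ball_finite[OF F2(2)])
      fix A assume A: "A \<in> F2"
      have m: "(\<lambda>f. \<Sum>T\<in>{T\<in>Pow F2. A \<in> T}. f (Inr T)) \<in> borel_measurable (PiM (Inr ` Pow F2 :: ('a set set + 'a set set) set) (\<lambda>_. borel :: ennreal measure))"
        by (intro borel_measurable_sum measurable_component_singleton) auto
      show "{f \<in> space (PiM (Inr ` Pow F2) (\<lambda>_. borel)). (\<Sum>T\<in>{T\<in>Pow F2. A \<in> T}. f (Inr T)) \<in> B2 A} \<in> sets (PiM (Inr ` Pow F2 :: ('a set set + 'a set set) set) (\<lambda>_. borel :: ennreal measure))"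
        using measurable_sets[OF m, of "B2 A"] F2(4) A by (simp add: vimage_def Int_def conj_commute)
    qed
    have sub: "F1 \<subseteq> sets (\<xi> w)" "F2 \<subseteq> sets (\<xi> w)" if "w \<in> space P" for w
      using poisson_process_sets[OF pp that] F1 F2 by auto
    have X1: "(\<Sum>T\<in>{T\<in>Pow F1. A \<in> T}. X1 w (Inl T)) = emeasure (\<xi> w) A" if "w \<in> space P" "A \<in> F1" for w A
      unfolding emeasure_atoms[OF F1(2) sub(1)[OF that(1)] that(2)] X1_def A_def
      by (intro sum.cong) auto
    have X2: "(\<Sum>T\<in>{T\<in>Pow F2. A \<in> T}. X2 w (Inr T)) = emeasure (\<xi> w) A" if "w \<in> space P" "A \<in> F2" for w A
      unfolding emeasure_atoms[OF F2(2) sub(2)[OF that(1)] that(2)] X2_def A_def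
      by (intro sum.cong) auto
    have rv: "random_variable (PiM (Inl ` Pow F1) (\<lambda>_. borel)) X1" "random_variable (PiM (Inr ` Pow F2) (\<lambda>_. borel)) X2"
      using indep_var_rv1[OF iv] indep_var_rv2[OF iv] unfolding X1_def X2_def by auto
    have a: "X1 -` S1 \<inter> space P = a"
      unfolding S1_def F1(1) using measurable_space[OF rv(1)] X1 by auto
    have b: "X2 -` S2 \<inter> space P = b"
      unfolding S2_def F2(1) using measurable_space[OF rv(2)] X2 by auto
    have "prob ((\<lambda>x. (X1 x, X2 x)) -` (S1 \<times> S2) \<inter> space P) = prob (X1 -` S1 \<inter> space P) * prob (X2 -` S2 \<inter> space P)"
      using indep_varD[OF iv S1 S2] unfolding X1_def X2_def .
    moreover have "(\<lambda>x. (X1 x, X2 x)) -` (S1 \<times> S2) \<inter> space P = a \<inter> b"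
      using a b by auto
    ultimately show "prob (a \<inter> b) = prob a * prob b" unfolding a b by simp
  qed
  then have "indep_set (sets (region_algebra P \<xi> \<mu> D1)) (sets (region_algebra P \<xi> \<mu> D2))"
    unfolding sets_region_algebra_cylinders
    by (rule indep_set_sigma_sets) (rule Int_stable_region_cylinders)+
  then show ?thesis using a b by (rule indep_setD)
qed

section \<open>Modification on null sets\<close>

lemma completion_completion: "completion (completion M) = completion M"
proof (rule measure_eqI)
  show *: "sets (completion (completion M)) = sets (completion M)"
  proof (intro equalityI subsetI)
    fix A assume "A \<in> sets (completion (completion M))"
    then obtain S N N' where "A = S \<union> N" "N \<subseteq> N'" "N' \<in> null_sets (completion M)" "S \<in> sets (completion M)"
      by (rule sets_completionE)
    then show "A \<in> sets (completion M)" using completion.complete[of N N' M] by auto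
  qed auto
  fix A assume "A \<in> sets (completion (completion M))"
  then show "emeasure (completion (completion M)) A = emeasure (completion M) A" unfolding * by simp
qed

lemma measurable_completion_AE:
  assumes f: "f \<in> measurable M N" and eq: "AE x in M. g x = f x"
    and g: "\<And>x. x \<in> space M \<Longrightarrow> g x \<in> space N"
  shows "g \<in> measurable (completion M) N"
proof (rule measurableI)
  fix B assume B: "B \<in> sets N"
  from eq obtain Z where Z: "Z \<in> null_sets M" "{x\<in>space M. g x \<noteq> f x} \<subseteq> Z"
    by (auto elim!: AE_E simp: null_sets_def)
  show "g -` B \<inter> space (completion M) \<in> sets (completion M)"
  proof (rule sets_completionI)
    show "g -` B \<inter> space (completion M) = (f -` B \<inter> space M - Z) \<union> (g -` B \<inter> space M \<inter> Z)"
      using Z by auto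
    show "f -` B \<inter> space M - Z \<in> sets M"
      using measurable_sets[OF f B] Z by auto
  qed (use Z in auto)
qed (use g in auto)

lemma (in prob_space) prob_space_completion_M: "prob_space (completion M)"
  by (intro prob_spaceI) (simp add: emeasure_space_1)

lemma (in prob_space) indep_vars_completion:
  assumes ind: "indep_vars N X I"
  shows "prob_space.indep_vars (completion M) N X I"
proof -
  interpret c: prob_space "completion M" by (rule prob_space_completion_M)
  have rv: "random_variable (N i) (X i)" if "i \<in> I" for i
    using ind that by (auto simp: indep_vars_def)
  have "indep_sets (\<lambda>i. {X i -` A \<inter> space M |A. A \<in> sets (N i)}) I"
    using ind unfolding indep_vars_def2 by simp
  then have ind': "prob (\<Inter>j\<in>J. A j) = (\<Prod>j\<in>J. prob (A j))"
    if "J \<subseteq> I" "J \<noteq> {}" "finite J" "\<forall>j\<in>J. A j \<in> {X j -` B \<inter> space M |B. B \<in> sets (N j)}" for A J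
    using that by (intro indep_setsD)
  have "c.indep_sets (\<lambda>i. {X i -` A \<inter> space M |A. A \<in> sets (N i)}) I"
  proof (rule c.indep_setsI)
    fix i assume "i \<in> I"
    then show "{X i -` A \<inter> space M |A. A \<in> sets (N i)} \<subseteq> sets (completion M)"
      by (auto intro!: sets_completionI_sets measurable_sets[OF rv])
  next
    fix A J assume J: "J \<noteq> {}" "J \<subseteq> I" "finite J" and A: "\<forall>j\<in>J. A j \<in> {X j -` B \<inter> space M |B. B \<in> sets (N j)}"
    have ev: "A j \<in> events" if "j \<in> J" for j
      using bspec[OF A that] J(2) that by (auto intro!: measurable_sets[OF rv])
    have "(\<Inter>j\<in>J. A j) \<in> events" using J ev by (intro sets.finite_INT) auto
    then show "measure (completion M) (\<Inter>j\<in>J. A j) = (\<Prod>j\<in>J. measure (completion M) (A j))"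
      using ind'[OF J(2,1,3) A] ev by simp
  qed
  then show ?thesis unfolding c.indep_vars_def2
    using rv by (auto intro: measurable_completion)
qed

lemma (in prob_space) indep_vars_completion_modification:
  assumes ind: "indep_vars N X I"
    and eq: "\<And>i. i \<in> I \<Longrightarrow> AE w in M. Y i w = X i w"
    and Y: "\<And>i w. i \<in> I \<Longrightarrow> w \<in> space M \<Longrightarrow> Y i w \<in> space (N i)"
  shows "prob_space.indep_vars (completion M) N Y I"
proof -
  interpret c: prob_space "completion M" by (rule prob_space_completion_M)
  show ?thesis
  proof (rule c.indep_vars_modification[OF indep_vars_completion[OF ind]])
    fix i assume i: "i \<in> I"
    then have "random_variable (N i) (X i)" using ind by (auto simp: indep_vars_def)
    then show "Y i \<in> measurable (completion M) (N i)"
      by (rule measurable_completion_AE[OF _ eq[OF i]]) (rule Y[OF i])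
    show "AE w in completion M. Y i w = X i w" using eq[OF i] by (rule AE_completion)
  qed
qed

lemma (in prob_space) indep_var_completion_modification:
  assumes ind: "indep_var S X T Y"
    and eq: "AE w in M. X' w = X w" "AE w in M. Y' w = Y w"
    and sp: "\<And>w. w \<in> space M \<Longrightarrow> X' w \<in> space S" "\<And>w. w \<in> space M \<Longrightarrow> Y' w \<in> space T"
  shows "prob_space.indep_var (completion M) S X' T Y'"
proof -
  interpret c: prob_space "completion M" by (rule prob_space_completion_M)
  show ?thesis unfolding c.indep_var_def
    by (rule indep_vars_completion_modification[OF ind[unfolded indep_var_def]])
       (use eq sp in \<open>auto split: bool.splits\<close>)
qed

text \<open>The range of an extremal process is only almost surely well behaved, so that processes have to be changed
  on null sets; the changed process may be measurable for the completion only.\<close>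

theorem poisson_process_modification:
  assumes pp: "poisson_process P \<mu> \<xi>" and eq: "AE w in P. \<xi>' w = \<xi> w"
    and sets: "\<And>w. w \<in> space P \<Longrightarrow> sets (\<xi>' w) = sets \<mu>"
  shows "poisson_process (completion P) \<mu> \<xi>'"
proof -
  interpret prob_space P using pp by (rule poisson_process_prob_space)
  interpret c: prob_space "completion P" by (rule prob_space_completion_M)
  have ae: "AE w in P. emeasure (\<xi>' w) A = emeasure (\<xi> w) A" for A
    using eq by eventually_elim simp
  have m: "(\<lambda>w. emeasure (\<xi>' w) A) \<in> borel_measurable (completion P)" if "A \<in> sets \<mu>" for A
    by (rule measurable_completion_AE[OF poisson_process_measurable[OF pp that] ae]) simp
  show ?thesis unfolding poisson_process_def
  proof (intro conjI ballI impI allI)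
    show "prob_space (completion P)" by (rule prob_space_completion_M)
    show "\<xi>' \<in> measurable (completion P) (measures_algebra \<mu>)"
      by (rule measurable_into_measures_algebra) (use sets m in auto)
  next
    fix A and k :: nat assume A: "A \<in> sets \<mu>" and fin: "emeasure \<mu> A < \<infinity>"
    have ev: "{w \<in> space P. emeasure (\<xi> w) A = of_nat k} \<in> sets P"
      using measurable_sets[OF poisson_process_measurable[OF pp A], of "{of_nat k}"]
      by (simp add: vimage_def Int_def conj_commute)
    have ev': "{w \<in> space P. emeasure (\<xi>' w) A = of_nat k} \<in> sets (completion P)"
      using measurable_sets[OF m[OF A], of "{of_nat k}"]
      by (simp add: vimage_def Int_def conj_commute)
    have "measure (completion P) {w \<in> space (completion P). emeasure (\<xi>' w) A = of_nat k}
      = measure (completion P) {w \<in> space P. emeasure (\<xi> w) A = of_nat k}"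
      using AE_completion[OF ae[of A]] ev ev' by (intro c.finite_measure_eq_AE) auto
    also have "\<dots> = prob {w \<in> space P. emeasure (\<xi> w) A = of_nat k}"
      using ev by (rule measure_completion)
    finally show "measure (completion P) {w \<in> space (completion P). emeasure (\<xi>' w) A = of_nat k} =
           measure \<mu> A ^ k / fact k * exp (- measure \<mu> A)"
      using poisson_process_weight[OF pp A fin] by simp
  next
    fix A assume A: "A \<in> sets \<mu>" and inf: "emeasure \<mu> A = \<infinity>"
    have "AE w in P. emeasure (\<xi>' w) A = \<infinity>"
      using poisson_process_infinite[OF pp A inf] ae[of A] by eventually_elim simp
    then show "AE w in completion P. emeasure (\<xi>' w) A = \<infinity>" by (rule AE_completion)
  next
    fix \<A> assume \<A>: "\<A> \<subseteq> sets \<mu>" "finite \<A>" "disjoint \<A>"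
    then have "indep_vars (\<lambda>_. borel) (\<lambda>A w. emeasure (\<xi> w) A) \<A>"
      using pp unfolding poisson_process_def by blast
    then show "c.indep_vars (\<lambda>_. borel) (\<lambda>A w. emeasure (\<xi>' w) A) \<A>"
      by (rule indep_vars_completion_modification) (use ae in auto)
  qed
qed

lemma Int_stable_preimages: "Int_stable {f -` A \<inter> \<Omega> |A. A \<in> sets L}"
proof (rule Int_stableI)
  fix a b assume "a \<in> {f -` A \<inter> \<Omega> |A. A \<in> sets L}" "b \<in> {f -` A \<inter> \<Omega> |A. A \<in> sets L}"
  then obtain A B where "A \<in> sets L" "B \<in> sets L" "a = f -` A \<inter> \<Omega>" "b = f -` B \<inter> \<Omega>" by auto
  then show "a \<inter> b \<in> {f -` A \<inter> \<Omega> |A. A \<in> sets L}" by (auto intro!: exI[of _ "A \<inter> B"])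
qed

lemma measurable_pushforward_region:
  assumes pp: "poisson_process P \<mu> \<xi>" and D: "D \<in> sets \<mu>" and q: "q \<in> measurable (restrict_space \<mu> D) K"
  shows "(\<lambda>w. distr (restrict_space (\<xi> w) D) K q) \<in> measurable (region_algebra P \<xi> \<mu> D) (measures_algebra K)"
proof (rule measurable_into_measures_algebra)
  fix A assume A: "A \<in> sets K"
  have e: "emeasure (distr (restrict_space (\<xi> w) D) K q) A = emeasure (\<xi> w) (q -` A \<inter> D)"
    if "w \<in> space (region_algebra P \<xi> \<mu> D)" for w
    using poisson_process_sets[OF pp] D q A that by (intro emeasure_distr_restrict) auto
  have "q -` A \<inter> D \<in> sets \<mu>" using emeasure_distr_restrict(1)[OF refl D q A] .
  then show "(\<lambda>w. emeasure (distr (restrict_space (\<xi> w) D) K q) A) \<in> borel_measurable (region_algebra P \<xi> \<mu> D)"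
    by (subst measurable_cong[OF e]) (auto intro: measurable_region_algebra)
qed auto

theorem poisson_process_indep_pushforward:
  assumes pp: "poisson_process P \<mu> \<xi>" and "D1 \<inter> D2 = {}"
    and D1: "D1 \<in> sets \<mu>" and q1: "q1 \<in> measurable (restrict_space \<mu> D1) K1"
    and D2: "D2 \<in> sets \<mu>" and q2: "q2 \<in> measurable (restrict_space \<mu> D2) K2"
  shows "prob_space.indep_var P (measures_algebra K1) (\<lambda>w. distr (restrict_space (\<xi> w) D1) K1 q1)
     (measures_algebra K2) (\<lambda>w. distr (restrict_space (\<xi> w) D2) K2 q2)"
proof -
  interpret prob_space P using pp by (rule poisson_process_prob_space)
  let ?X = "\<lambda>w. distr (restrict_space (\<xi> w) D1) K1 q1"
  let ?Y = "\<lambda>w. distr (restrict_space (\<xi> w) D2) K2 q2"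
  have X: "?X \<in> measurable (region_algebra P \<xi> \<mu> D1) (measures_algebra K1)"
    by (rule measurable_pushforward_region[OF pp D1 q1])
  have Y: "?Y \<in> measurable (region_algebra P \<xi> \<mu> D2) (measures_algebra K2)"
    by (rule measurable_pushforward_region[OF pp D2 q2])
  have sub: "{f -` A \<inter> space P |A. A \<in> sets L} \<subseteq> sets (region_algebra P \<xi> \<mu> D)"
    if "f \<in> measurable (region_algebra P \<xi> \<mu> D) L" for f D and L :: "'z measure"
    using measurable_sets[OF that] by auto
  have rv: "random_variable L f" if "f \<in> measurable (region_algebra P \<xi> \<mu> D) L" for f D and L :: "'z measure"
    using that region_algebra_events[OF pp, of D]
    by (auto simp: measurable_def)
  show ?thesis unfolding indep_var_eq
  proof (intro conjI)
    show "random_variable (measures_algebra K1) ?X" "random_variable (measures_algebra K2) ?Y"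
      using rv[OF X] rv[OF Y] by auto
    have "indep_set {?X -` A \<inter> space P |A. A \<in> sets (measures_algebra K1)} {?Y -` A \<inter> space P |A. A \<in> sets (measures_algebra K2)}"
    proof (rule indep_setI)
      show "{?X -` A \<inter> space P |A. A \<in> sets (measures_algebra K1)} \<subseteq> events"
        "{?Y -` A \<inter> space P |A. A \<in> sets (measures_algebra K2)} \<subseteq> events"
        using sub[OF X] sub[OF Y] region_algebra_events[OF pp] by auto
      fix a b assume "a \<in> {?X -` A \<inter> space P |A. A \<in> sets (measures_algebra K1)}"
        and "b \<in> {?Y -` A \<inter> space P |A. A \<in> sets (measures_algebra K2)}"
      then show "prob (a \<inter> b) = prob a * prob b"
        using sub[OF X] sub[OF Y] by (intro poisson_process_indep_regions[OF pp assms(2)]) auto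
    qed
    then show "indep_set (sigma_sets (space P) {?X -` A \<inter> space P |A. A \<in> sets (measures_algebra K1)})
      (sigma_sets (space P) {?Y -` A \<inter> space P |A. A \<in> sets (measures_algebra K2)})"
      by (rule indep_set_sigma_sets) (rule Int_stable_preimages)+
  qed
qed

section \<open>Thinning\<close>

definition poisson_weight :: "real \<Rightarrow> nat \<Rightarrow> real" where
  "poisson_weight m k = m ^ k / fact k * exp (- m)"

lemma poisson_weight_nonneg: "0 \<le> m \<Longrightarrow> 0 \<le> poisson_weight m k"
  by (simp add: poisson_weight_def)

text \<open>The convolution of two Poisson laws, which is the binomial theorem.\<close>

lemma poisson_weight_add:
  "(\<Sum>c\<le>n. poisson_weight a c * poisson_weight b (n - c)) = poisson_weight (a + b) n"
proof -
  have "(\<Sum>c\<le>n. poisson_weight a c * poisson_weight b (n - c))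
      = (\<Sum>c\<le>n. of_nat (n choose c) * a ^ c * b ^ (n - c)) / fact n * (exp (- a) * exp (- b))"
    unfolding sum_divide_distrib sum_distrib_right
    by (intro sum.cong) (auto simp: poisson_weight_def binomial_fact field_simps)
  also have "\<dots> = poisson_weight (a + b) n"
    unfolding poisson_weight_def binomial_ring mult_exp_exp by simp
  finally show ?thesis .
qed

text \<open>Given \<open>n\<close> points altogether, all of them are of the first kind with probability \<open>(a / (a + b)) ^ n\<close>.\<close>

lemma poisson_weight_thin:
  assumes "0 < a" "0 \<le> b"
  shows "poisson_weight a n * poisson_weight b 0 = (a / (a + b)) ^ n * poisson_weight (a + b) n"
proof -
  have "poisson_weight a n * poisson_weight b 0 = a ^ n / fact n * (exp (- a) * exp (- b))"
    by (simp add: poisson_weight_def)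
  also have "\<dots> = a ^ n / fact n * exp (- (a + b))"
    unfolding mult_exp_exp by simp
  also have "\<dots> = (a / (a + b)) ^ n * poisson_weight (a + b) n"
    using assms by (simp add: poisson_weight_def power_divide)
  finally show ?thesis .
qed

text \<open>Conditioning on a variable with countably many values: a proportionality that holds for every
  value may be summed over all values.\<close>

lemma (in finite_measure) measure_countable_scale:
  fixes X :: "'a \<Rightarrow> 'c::countable"
  assumes X: "X \<in> measurable M (count_space UNIV)" and V: "V \<in> sets M" and W: "W \<in> sets M" and "0 \<le> \<kappa>"
    and eq: "\<And>x. x \<in> E \<Longrightarrow> measure M {w\<in>V. X w = x} = \<kappa> * measure M {w\<in>W. X w = x}"
  shows "measure M {w\<in>V. X w \<in> E} = \<kappa> * measure M {w\<in>W. X w \<in> E}"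
proof -
  have ev: "{w\<in>U. X w \<in> F} \<in> sets M" if "U \<in> sets M" for U F
  proof -
    have "{w\<in>U. X w \<in> F} = U \<inter> (X -` F \<inter> space M)" using sets.sets_into_space[OF that] by auto
    then show ?thesis using that measurable_sets[OF X, of F] by auto
  qed
  have ev1: "{w\<in>U. X w = x} \<in> sets M" if "U \<in> sets M" for U x
    using ev[OF that, of "{x}"] by simp
  have dec: "emeasure M {w\<in>U. X w \<in> E} = (\<integral>\<^sup>+x. emeasure M {w\<in>U. X w = x} \<partial>count_space E)" if "U \<in> sets M" for U
  proof -
    have "{w\<in>U. X w \<in> E} = (\<Union>x\<in>E. {w\<in>U. X w = x})" by auto
    also have "emeasure M \<dots> = (\<integral>\<^sup>+x. emeasure M {w\<in>U. X w = x} \<partial>count_space E)"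
      using ev1[OF that] by (intro emeasure_UN_countable) (auto simp: disjoint_family_on_def)
    finally show ?thesis .
  qed
  have "emeasure M {w\<in>V. X w \<in> E} = (\<integral>\<^sup>+x. ennreal \<kappa> * emeasure M {w\<in>W. X w = x} \<partial>count_space E)"
    unfolding dec[OF V] using eq \<open>0 \<le> \<kappa>\<close>
    by (intro nn_integral_cong) (simp add: emeasure_eq_measure ennreal_mult)
  also have "\<dots> = ennreal \<kappa> * emeasure M {w\<in>W. X w \<in> E}"
    unfolding dec[OF W] by (rule nn_integral_cmult) auto
  finally show ?thesis using \<open>0 \<le> \<kappa>\<close>
    by (simp add: emeasure_eq_measure flip: ennreal_mult)
qed

text \<open>\<open>C\<close> and \<open>D\<close> count the arrivals of two independent Poisson streams with rates \<open>qc\<close> and \<open>qd\<close>, which are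
  moreover independent of the event \<open>G\<close>. Only the increments over dyadic time cells are described, which keeps
  all conditions on countably many counts; \<open>simple\<close> expresses that two arrivals are rarely in the same
  cell.\<close>

locale thinning = prob_space M for M :: "'a measure" +
  fixes C D :: "real \<Rightarrow> 'a \<Rightarrow> nat" and G :: "'a set" and qc qd :: real and r :: nat
  assumes C [measurable]: "C t \<in> measurable M (count_space UNIV)"
    and D [measurable]: "D t \<in> measurable M (count_space UNIV)"
    and C_mono: "w \<in> space M \<Longrightarrow> 0 \<le> s \<Longrightarrow> s \<le> t \<Longrightarrow> C s w \<le> C t w"
    and D_mono: "w \<in> space M \<Longrightarrow> 0 \<le> s \<Longrightarrow> s \<le> t \<Longrightarrow> D s w \<le> D t w"
    and C_0: "w \<in> space M \<Longrightarrow> C 0 w = 0" and D_0: "w \<in> space M \<Longrightarrow> D 0 w = 0"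
    and C_unbounded: "w \<in> space M \<Longrightarrow> \<exists>n::nat. r \<le> C (real n) w"
    and G [measurable]: "G \<in> sets M"
    and qc: "0 < qc" and qd: "0 \<le> qd"
    and joint: "prob {w\<in>G. \<forall>i<K. C (real (Suc i) / 2^p) w - C (real i / 2^p) w = c i
        \<and> D (real (Suc i) / 2^p) w - D (real i / 2^p) w = d i}
      = prob G * (\<Prod>i<K. poisson_weight (qc / 2^p) (c i) * poisson_weight (qd / 2^p) (d i))"
    and simple: "prob {w\<in>space M. 2 \<le> (C (real (Suc i) / 2^p) w - C (real i / 2^p) w)
        + (D (real (Suc i) / 2^p) w - D (real i / 2^p) w)} \<le> ((qc + qd) / 2^p)\<^sup>2"
begin

definition incC where "incC p i w = C (real (Suc i) / 2^p) w - C (real i / 2^p) w"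
definition incD where "incD p i w = D (real (Suc i) / 2^p) w - D (real i / 2^p) w"
definition T where "T t w = C t w + D t w"
definition incT where "incT p i w = incC p i w + incD p i w"
definition \<kappa> where "\<kappa> = qc / (qc + qd)"

lemma incC_measurable [measurable]: "incC p i \<in> measurable M (count_space UNIV)"
  unfolding incC_def[abs_def] by measurable
lemma incD_measurable [measurable]: "incD p i \<in> measurable M (count_space UNIV)"
  unfolding incD_def[abs_def] by measurable
lemma incT_measurable [measurable]: "incT p i \<in> measurable M (count_space UNIV)"
  unfolding incT_def[abs_def] by measurable
lemma T_measurable [measurable]: "T t \<in> measurable M (count_space UNIV)"
  unfolding T_def[abs_def] by measurable

lemma C_sum: "w \<in> space M \<Longrightarrow> C (real k / 2^p) w = (\<Sum>i<k. incC p i w)"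
proof (induction k)
  case (Suc k)
  have "C (real k / 2^p) w \<le> C (real (Suc k) / 2^p) w"
    using Suc.prems by (intro C_mono) (auto simp: divide_right_mono)
  then show ?case using Suc by (simp add: incC_def)
qed (simp add: C_0)

lemma D_sum: "w \<in> space M \<Longrightarrow> D (real k / 2^p) w = (\<Sum>i<k. incD p i w)"
proof (induction k)
  case (Suc k)
  have "D (real k / 2^p) w \<le> D (real (Suc k) / 2^p) w"
    using Suc.prems by (intro D_mono) (auto simp: divide_right_mono)
  then show ?case using Suc by (simp add: incD_def)
qed (simp add: D_0)

lemma T_sum: "w \<in> space M \<Longrightarrow> T (real k / 2^p) w = (\<Sum>i<k. incT p i w)"
  by (simp add: T_def incT_def C_sum D_sum sum.distrib)

lemma inc_eq_sets: "{w\<in>space M. incC p i w = c \<and> incD p i w = d} \<in> events" "{w\<in>space M. incT p i w = c} \<in> events"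
  by measurable

lemma joint_sets:
  assumes fin: "\<And>j. j < K \<Longrightarrow> finite (E j)"
  shows "prob {w\<in>G. \<forall>j<K. (incC p j w, incD p j w) \<in> E j} =
     prob G * (\<Prod>j<K. \<Sum>e\<in>E j. poisson_weight (qc / 2^p) (fst e) * poisson_weight (qd / 2^p) (snd e))"
proof -
  let ?A = "\<lambda>f. {w\<in>G. \<forall>i<K. incC p i w = fst (f i) \<and> incD p i w = snd (f i)}"
  have eq: "{w\<in>G. \<forall>j<K. (incC p j w, incD p j w) \<in> E j} = (\<Union>f\<in>PiE {..<K} E. ?A f)"
  proof (intro equalityI subsetI)
    fix w assume "w \<in> {w\<in>G. \<forall>j<K. (incC p j w, incD p j w) \<in> E j}"
    then show "w \<in> (\<Union>f\<in>PiE {..<K} E. ?A f)"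
      by (intro UN_I[of "restrict (\<lambda>j. (incC p j w, incD p j w)) {..<K}"]) auto
  next
    fix w assume "w \<in> (\<Union>f\<in>PiE {..<K} E. ?A f)"
    then obtain f where f: "f \<in> PiE {..<K} E" "w \<in> ?A f" by blast
    then have "(incC p j w, incD p j w) = f j" if "j < K" for j using that by auto
    then show "w \<in> {w\<in>G. \<forall>j<K. (incC p j w, incD p j w) \<in> E j}"
      using f PiE_mem[OF f(1)] by simp
  qed
  have finP: "finite (PiE {..<K} E)" using fin by (intro finite_PiE) auto
  have disj: "disjoint_family_on ?A (PiE {..<K} E)"
    unfolding disjoint_family_on_def
  proof safe
    fix f g w assume fg: "f \<in> PiE {..<K} E" "g \<in> PiE {..<K} E" "f \<noteq> g"
      and w: "\<forall>i<K. incC p i w = fst (f i) \<and> incD p i w = snd (f i)" "\<forall>i<K. incC p i w = fst (g i) \<and> incD p i w = snd (g i)"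
    have "f = g" using fg(1,2) by (rule PiE_ext) (use w in \<open>auto simp: prod_eq_iff\<close>)
    with fg show "w \<in> {}" by simp
  qed
  have ev: "?A f \<in> events" for f
  proof -
    have "?A f = G \<inter> {w\<in>space M. \<forall>i\<in>{..<K}. incC p i w = fst (f i) \<and> incD p i w = snd (f i)}"
      using sets.sets_into_space[OF G] by auto
    also have "\<dots> \<in> events"
      by (intro sets.Int G sets_Collect_Ball_finite finite_lessThan inc_eq_sets)
    finally show ?thesis .
  qed
  have "prob (\<Union>f\<in>PiE {..<K} E. ?A f) = (\<Sum>f\<in>PiE {..<K} E. prob (?A f))"
    using ev by (intro finite_measure_finite_Union[OF finP _ disj] image_subsetI)
  also have "\<dots> = (\<Sum>f\<in>PiE {..<K} E. prob G * (\<Prod>i<K. poisson_weight (qc / 2^p) (fst (f i)) * poisson_weight (qd / 2^p) (snd (f i))))"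
    unfolding incC_def incD_def joint ..
  also have "\<dots> = prob G * (\<Prod>j<K. \<Sum>e\<in>E j. poisson_weight (qc / 2^p) (fst e) * poisson_weight (qd / 2^p) (snd e))"
    unfolding sum_distrib_left[symmetric] using fin by (subst prod_sum_PiE) auto
  finally show ?thesis unfolding eq .
qed

lemma weight_sum:
  "(\<Sum>e\<in>(\<lambda>c. (c, n - c)) ` {..n}. poisson_weight (qc / 2^p) (fst e) * poisson_weight (qd / 2^p) (snd e))
    = poisson_weight ((qc + qd) / 2^p) n"
proof -
  have "inj_on (\<lambda>c. (c, n - c)) {..n}" by (auto simp: inj_on_def)
  then show ?thesis
    using poisson_weight_add[where a="qc / 2^p" and b="qd / 2^p" and n=n]
    by (simp add: sum.reindex add_divide_distrib)
qed

lemma joint_total: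
  "prob {w\<in>G. \<forall>j<K. incT p j w = n j} = prob G * (\<Prod>j<K. poisson_weight ((qc + qd) / 2^p) (n j))"
proof -
  have "{w\<in>G. \<forall>j<K. incT p j w = n j} = {w\<in>G. \<forall>j<K. (incC p j w, incD p j w) \<in> (\<lambda>c. (c, n j - c)) ` {..n j}}"
    by (intro Collect_cong conj_cong all_cong refl) (auto simp: incT_def image_iff)
  then show ?thesis by (simp only: joint_sets finite_imageI finite_atMost weight_sum)
qed

text \<open>The core of the thinning argument on a fixed time grid. If the total count is exactly \<open>r\<close> after the first \<open>i\<close>
  cells, then the first \<open>r\<close> arrivals are those in these cells, and the event says that \<open>D\<close> has no arrival
  there. In each of these cells this costs the factor \<open>\<kappa>\<close> per arrival, whatever the total counts are.\<close>

lemma joint_exact: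
  assumes "i \<le> K" and r: "(\<Sum>j<i. n j) = r"
  shows "prob {w\<in>G. (\<forall>k\<le>K. r \<le> T (real k / 2^p) w \<longrightarrow> r \<le> C (real k / 2^p) w) \<and> (\<forall>j<K. incT p j w = n j)}
    = \<kappa> ^ r * prob {w\<in>G. \<forall>j<K. incT p j w = n j}"
proof -
  \<comment> \<open>Total count \<open>n j\<close> in every cell, and no arrival of \<open>D\<close> in the first \<open>i\<close> cells.\<close>
  define E where "E j = (if j < i then {(n j, 0)} else (\<lambda>c. (c, n j - c)) ` {..n j})" for j
  have "{w\<in>G. (\<forall>k\<le>K. r \<le> T (real k / 2^p) w \<longrightarrow> r \<le> C (real k / 2^p) w) \<and> (\<forall>j<K. incT p j w = n j)}
    = {w\<in>G. \<forall>j<K. (incC p j w, incD p j w) \<in> E j}" (is "?L = ?R")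
  proof (intro Collect_cong conj_cong refl)
    fix w assume "w \<in> G"
    then have w: "w \<in> space M" using sets.sets_into_space[OF G] by auto
    have E: "(\<forall>j<K. (incC p j w, incD p j w) \<in> E j) \<longleftrightarrow> (\<forall>j<K. incT p j w = n j) \<and> (\<forall>j<i. incD p j w = 0)"
    proof -
      have "(incC p j w, incD p j w) \<in> E j \<longleftrightarrow> incT p j w = n j \<and> (j < i \<longrightarrow> incD p j w = 0)" for j
        unfolding E_def incT_def by (auto simp: image_iff)
      then show ?thesis using \<open>i \<le> K\<close> less_le_trans by blast
    qed
    show "((\<forall>k\<le>K. r \<le> T (real k / 2^p) w \<longrightarrow> r \<le> C (real k / 2^p) w) \<and> (\<forall>j<K. incT p j w = n j))
       = (\<forall>j<K. (incC p j w, incD p j w) \<in> E j)"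
      unfolding E
    proof (safe)
      fix j assume v: "\<forall>k\<le>K. r \<le> T (real k / 2^p) w \<longrightarrow> r \<le> C (real k / 2^p) w" and n: "\<forall>j<K. incT p j w = n j" and j: "j < i"
      have Ti: "T (real i / 2^p) w = r" unfolding T_sum[OF w] using n r \<open>i \<le> K\<close> by auto
      then have "r \<le> C (real i / 2^p) w" using v \<open>i \<le> K\<close> by auto
      then have "D (real i / 2^p) w = 0" using Ti unfolding T_def by simp
      then show "incD p j w = 0" using j unfolding D_sum[OF w] by simp
    next
      fix k assume n: "\<forall>j<K. incT p j w = n j" and d: "\<forall>j<i. incD p j w = 0" and k: "k \<le> K" and rT: "r \<le> T (real k / 2^p) w"
      have Di: "D (real i / 2^p) w = 0" unfolding D_sum[OF w] using d by simp
      have Ti: "T (real i / 2^p) w = r" unfolding T_sum[OF w] using n r \<open>i \<le> K\<close> by auto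
      show "r \<le> C (real k / 2^p) w"
      proof (cases "i \<le> k")
        case True
        then have "C (real i / 2^p) w \<le> C (real k / 2^p) w"
          by (intro C_mono[OF w]) (auto simp: divide_right_mono)
        then show ?thesis using Ti Di unfolding T_def by simp
      next
        case False
        then have "D (real k / 2^p) w \<le> D (real i / 2^p) w"
          by (intro D_mono[OF w]) (auto simp: divide_right_mono)
        then show ?thesis using Di rT unfolding T_def by simp
      qed
    qed
  qed
  then have "prob ?L = prob G * (\<Prod>j<K. \<Sum>e\<in>E j. poisson_weight (qc / 2^p) (fst e) * poisson_weight (qd / 2^p) (snd e))"
    by (simp only:) (rule joint_sets, auto simp: E_def)
  also have "(\<Prod>j<K. \<Sum>e\<in>E j. poisson_weight (qc / 2^p) (fst e) * poisson_weight (qd / 2^p) (snd e))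
    = (\<Prod>j<K. (if j < i then \<kappa> ^ n j else 1) * poisson_weight ((qc + qd) / 2^p) (n j))"
  proof (rule prod.cong[OF refl])
    fix j
    have k: "(qc / 2^p) / (qc / 2^p + qd / 2^p) = \<kappa>"
      using qc qd by (simp add: \<kappa>_def flip: add_divide_distrib)
    show "(\<Sum>e\<in>E j. poisson_weight (qc / 2^p) (fst e) * poisson_weight (qd / 2^p) (snd e))
       = (if j < i then \<kappa> ^ n j else 1) * poisson_weight ((qc + qd) / 2^p) (n j)"
    proof (cases "j < i")
      case True
      then show ?thesis
        using poisson_weight_thin[of "qc / 2^p" "qd / 2^p" "n j"] qc qd k
        by (simp add: E_def add_divide_distrib)
    next
      case False
      then show ?thesis by (simp add: E_def weight_sum)
    qed
  qed
  also have "\<dots> = (\<Prod>j<K. if j < i then \<kappa> ^ n j else 1) * (\<Prod>j<K. poisson_weight ((qc + qd) / 2^p) (n j))"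
    by (rule prod.distrib)
  also have "(\<Prod>j<K. if j < i then \<kappa> ^ n j else 1) = (\<Prod>j<i. \<kappa> ^ n j)"
    using \<open>i \<le> K\<close> by (intro prod.mono_neutral_cong_right) auto
  also have "\<dots> = \<kappa> ^ r" using r by (simp flip: power_sum)
  finally show ?thesis unfolding joint_total by simp
qed

text \<open>The first \<open>r\<close> arrivals all belong to \<open>C\<close>. For counting functions that are monotone and right
  continuous the condition at all times reduces to dyadic times.\<close>

definition void where
  "void = {w\<in>space M. \<forall>p k. r \<le> T (real k / 2^p) w \<longrightarrow> r \<le> C (real k / 2^p) w}"

definition void_grid where
  "void_grid p = {w\<in>space M. \<forall>k\<le>p * 2^p. r \<le> T (real k / 2^p) w \<longrightarrow> r \<le> C (real k / 2^p) w}"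

definition exact where
  "exact p = {w\<in>space M. \<exists>k\<le>p * 2^p. T (real k / 2^p) w = r}"

lemma void_sets [measurable]: "void \<in> events" "void_grid p \<in> events" "exact p \<in> events"
  unfolding void_def void_grid_def exact_def by measurable

text \<open>The total count can jump over the value \<open>r\<close> on the grid only if two arrivals share a cell, and there are
  \<open>p * 2^p\<close> cells with a probability of order \<open>4^-p\<close> each; the other possibility is that there are fewer than
  \<open>r\<close> arrivals up to time \<open>p\<close>.\<close>

lemma not_exact_tendsto_0: "(\<lambda>p. prob (space M - exact p)) \<longlonglongrightarrow> 0"
proof (rule tendsto_sandwich[where f="\<lambda>_. 0", OF _ _ tendsto_const])
  let ?F = "\<lambda>p. {w\<in>space M. C (real p) w < r}"
  show "\<forall>\<^sub>F p in sequentially. prob (space M - exact p) \<le> prob (?F p) + real p * (qc + qd)\<^sup>2 / 2^p"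
  proof (intro always_eventually allI)
    fix p
    have "space M - exact p \<subseteq> ?F p \<union> (\<Union>i<p * 2^p. {w\<in>space M. 2 \<le> incT p i w})"
    proof (rule subsetI, rule ccontr)
      fix w assume 1: "w \<in> space M - exact p" and "w \<notin> ?F p \<union> (\<Union>i<p * 2^p. {w\<in>space M. 2 \<le> incT p i w})"
      then have w: "w \<in> space M" and Cp: "r \<le> C (real p) w" and inc: "\<And>i. i < p * 2^p \<Longrightarrow> incT p i w < 2"
        by (auto simp: not_le)
      define k where "k = (LEAST k. r \<le> T (real k / 2^p) w)"
      have ex: "r \<le> T (real (p * 2^p) / 2^p) w" using Cp by (simp add: T_def)
      then have k: "r \<le> T (real k / 2^p) w" "k \<le> p * 2^p"
        unfolding k_def using LeastI[where P="\<lambda>k. r \<le> T (real k / 2^p) w", OF ex]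
          Least_le[where P="\<lambda>k. r \<le> T (real k / 2^p) w", OF ex] by blast+
      have "T (real k / 2^p) w = r"
      proof (cases k)
        case 0 then show ?thesis using k w by (simp add: T_def C_0 D_0)
      next
        case (Suc j)
        then have "T (real j / 2^p) w < r" using not_less_Least[of j "\<lambda>k. r \<le> T (real k / 2^p) w"]
          unfolding k_def by auto
        moreover have "T (real k / 2^p) w = T (real j / 2^p) w + incT p j w"
          unfolding Suc T_sum[OF w] by simp
        moreover have "incT p j w < 2" using inc k Suc by auto
        ultimately show ?thesis using k by linarith
      qed
      then show False using 1 k by (auto simp: exact_def)
    qed
    then have "prob (space M - exact p) \<le> prob (?F p \<union> (\<Union>i<p * 2^p. {w\<in>space M. 2 \<le> incT p i w}))"
      by (intro finite_measure_mono) auto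
    also have "\<dots> \<le> prob (?F p) + prob (\<Union>i<p * 2^p. {w\<in>space M. 2 \<le> incT p i w})"
      by (intro measure_Un_le) auto
    also have "prob (\<Union>i<p * 2^p. {w\<in>space M. 2 \<le> incT p i w}) \<le> (\<Sum>i<p * 2^p. prob {w\<in>space M. 2 \<le> incT p i w})"
      by (intro measure_UNION_le) auto
    also have "\<dots> \<le> (\<Sum>i<p * 2^p. ((qc + qd) / 2^p)\<^sup>2)"
      using simple unfolding incT_def incC_def incD_def by (intro sum_mono) auto
    also have "\<dots> = real p * (qc + qd)\<^sup>2 / 2^p"
      by (simp add: power2_eq_square)
    finally show "prob (space M - exact p) \<le> prob (?F p) + real p * (qc + qd)\<^sup>2 / 2^p" by simp
  qed
  have "(\<lambda>p. prob (?F p)) \<longlonglongrightarrow> prob (\<Inter>p. ?F p)"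
  proof (rule finite_Lim_measure_decseq)
    show "decseq ?F"
    proof (rule decseq_SucI, safe)
      fix n w assume "w \<in> space M" "C (real (Suc n)) w < r"
      then show "C (real n) w < r" using C_mono[of w "real n" "real (Suc n)"] by auto
    qed
    have "?F n \<in> events" for n by measurable
    then show "range ?F \<subseteq> events" by blast
  qed
  also have "(\<Inter>p. ?F p) = {}"
  proof (rule ccontr)
    assume "(\<Inter>p. ?F p) \<noteq> {}"
    then obtain w where w: "w \<in> space M" "\<And>p. C (real p) w < r" by blast
    with C_unbounded[OF w(1)] show False by (meson not_less)
  qed
  finally have "(\<lambda>p. prob (?F p)) \<longlonglongrightarrow> 0" by simp
  moreover have "(\<lambda>p. real p * (qc + qd)\<^sup>2 / 2^p) \<longlonglongrightarrow> 0"
  proof -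
    have "(\<lambda>p. real p * (1/2)^p) \<longlonglongrightarrow> 0"
      using powser_times_n_limit_0[of "1/2::real"] by simp
    from tendsto_mult_right[OF this, of "(qc + qd)\<^sup>2"] show ?thesis
      by (simp add: power_one_over field_simps)
  qed
  ultimately show "(\<lambda>p. prob (?F p) + real p * (qc + qd)\<^sup>2 / 2^p) \<longlonglongrightarrow> 0"
    using tendsto_add[of "\<lambda>p. prob (?F p)" 0 sequentially "\<lambda>p. real p * (qc + qd)\<^sup>2 / 2^p" 0] by simp
qed simp

text \<open>On a fine grid the event is approximated by \<open>void_grid\<close>, where
  \<open>joint_exact\<close> applies up to the small probability that \<open>exact\<close> fails; the coarser increments of the total
  count are functions of the finer ones. The product form of the result means that the event is independent of \<open>G\<close> and of
  the process of all arrivals.\<close>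

theorem thinning:
  "prob {w\<in>G \<inter> void. \<forall>j<K. incT p j w = n j} = \<kappa> ^ r * (prob G * (\<Prod>j<K. poisson_weight ((qc + qd) / 2^p) (n j)))"
proof -
  define B where "B = {w\<in>G. \<forall>j<K. incT p j w = n j}"
  have Gsp: "w \<in> space M" if "w \<in> G" for w using that sets.sets_into_space[OF G] by auto
  have B_ev [measurable]: "B \<in> events"
  proof -
    have "B = G \<inter> {w\<in>space M. \<forall>j\<in>{..<K}. incT p j w = n j}" using Gsp by (auto simp: B_def)
    also have "\<dots> \<in> events"
      by (intro sets.Int G sets_Collect_Ball_finite finite_lessThan inc_eq_sets)
    finally show ?thesis .
  qed
  have kap: "0 \<le> \<kappa>" "\<kappa> \<le> 1" using qc qd by (auto simp: \<kappa>_def)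
  have key: "\<bar>prob (B \<inter> void_grid m) - \<kappa> ^ r * prob B\<bar> \<le> 2 * prob (space M - exact m)" if m: "p \<le> m" "K \<le> m" for m
  proof -
    define X where "X w = map (\<lambda>j. incT m j w) [0..<m * 2^m]" for w
    have X [measurable]: "X \<in> measurable M (count_space UNIV)"
    proof -
      have "(\<lambda>w. map (\<lambda>j. incT m j w) js) \<in> measurable M (count_space UNIV)" for js
        by (induction js) (auto intro!: measurable_compose_countable[OF _ incT_measurable[of m]])
      then show ?thesis unfolding X_def .
    qed
    have take_X: "sum_list (take k (X w)) = T (real k / 2^m) w" if "w \<in> space M" "k \<le> m * 2^m" for k w
    proof -
      have "take k (X w) = map (\<lambda>j. incT m j w) [0..<k]"
        using that by (simp add: X_def take_map)
      then show ?thesis using T_sum[OF that(1)] by (simp add: sum_list_sum_nth interv_sum_list_conv_sum_set_nat atLeast0LessThan)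
    qed
    \<comment> \<open>\<open>X\<close> lists the fine increments of the total count; \<open>E\<close> prescribes the coarse ones, \<open>E'\<close> also that the partial sums meet \<open>r\<close>.\<close>
    define E where "E = {ns. \<forall>j<K. sum_list (take (Suc j * 2^(m - p)) ns) - sum_list (take (j * 2^(m - p)) ns) = n j}"
    define E' where "E' = E \<inter> {ns. length ns = m * 2^m \<and> (\<exists>i\<le>m * 2^m. sum_list (take i ns) = r)}"
    have idx: "j * 2^(m - p) \<le> m * 2^m" "real (j * 2^(m - p)) / 2^m = real j / 2^p" if "j \<le> K" for j
    proof -
      have "j * 2^(m - p) \<le> m * 2^m" using that m by (intro mult_mono power_increasing) auto
      then show "j * 2^(m - p) \<le> m * 2^m" .
      have "(2::real)^m = 2^(m - p) * 2^p" using m by (simp flip: power_add)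
      then show "real (j * 2^(m - p)) / 2^m = real j / 2^p" by simp
    qed
    have XE: "X w \<in> E \<longleftrightarrow> (\<forall>j<K. incT p j w = n j)" if w: "w \<in> space M" for w
    proof -
      have "sum_list (take (Suc j * 2^(m - p)) (X w)) - sum_list (take (j * 2^(m - p)) (X w)) = incT p j w" if "j < K" for j
      proof -
        have "sum_list (take (Suc j * 2^(m - p)) (X w)) = T (real (Suc j) / 2^p) w"
          using take_X[OF w idx(1)[of "Suc j"]] idx(2)[of "Suc j"] that by simp
        moreover have "sum_list (take (j * 2^(m - p)) (X w)) = T (real j / 2^p) w"
          using take_X[OF w idx(1)[of "j"]] idx(2)[of "j"] that by simp
        ultimately show ?thesis unfolding T_sum[OF w] by simp
      qed
      then show ?thesis by (simp add: E_def)
    qed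
    have XE': "X w \<in> E' \<longleftrightarrow> (\<forall>j<K. incT p j w = n j) \<and> w \<in> exact m" if w: "w \<in> space M" for w
      using XE[OF w] take_X[OF w] w by (auto simp: E'_def exact_def X_def)
    have "prob {w\<in>G \<inter> void_grid m. X w \<in> E'} = \<kappa> ^ r * prob {w\<in>G. X w \<in> E'}"
    proof (rule measure_countable_scale[OF X])
      fix ns assume "ns \<in> E'"
      then obtain i where len: "length ns = m * 2^m" and i: "i \<le> m * 2^m" "sum_list (take i ns) = r"
        by (auto simp: E'_def)
      have Xns: "X w = ns \<longleftrightarrow> (\<forall>j<m * 2^m. incT m j w = ns ! j)" for w
        by (simp add: X_def list_eq_iff_nth_eq len)
      have "(\<Sum>j<i. ns ! j) = r"
        using i len by (simp add: sum_list_sum_nth atLeast0LessThan)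
      from joint_exact[OF i(1) this, of m]
      have "prob {w\<in>G. (\<forall>k\<le>m * 2^m. r \<le> T (real k / 2^m) w \<longrightarrow> r \<le> C (real k / 2^m) w) \<and> X w = ns}
         = \<kappa> ^ r * prob {w\<in>G. X w = ns}" unfolding Xns .
      moreover have "{w\<in>G \<inter> void_grid m. X w = ns} = {w\<in>G. (\<forall>k\<le>m * 2^m. r \<le> T (real k / 2^m) w \<longrightarrow> r \<le> C (real k / 2^m) w) \<and> X w = ns}"
        using Gsp by (auto simp: void_grid_def)
      ultimately show "prob {w\<in>G \<inter> void_grid m. X w = ns} = \<kappa> ^ r * prob {w\<in>G. X w = ns}" by simp
    qed (use kap in auto)
    moreover have "{w\<in>G \<inter> void_grid m. X w \<in> E'} = B \<inter> void_grid m \<inter> exact m"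
      "{w\<in>G. X w \<in> E'} = B \<inter> exact m"
      using XE' Gsp by (auto simp: B_def)
    ultimately have eq: "prob (B \<inter> void_grid m \<inter> exact m) = \<kappa> ^ r * prob (B \<inter> exact m)" by simp
    have split: "prob A - prob (space M - exact m) \<le> prob (A \<inter> exact m)" "prob (A \<inter> exact m) \<le> prob A"
      if [measurable]: "A \<in> events" for A
    proof -
      have "prob A \<le> prob ((A \<inter> exact m) \<union> (space M - exact m))"
        using sets.sets_into_space[OF that] by (intro finite_measure_mono) auto
      also have "\<dots> \<le> prob (A \<inter> exact m) + prob (space M - exact m)"
        by (intro measure_Un_le) auto
      finally show "prob A - prob (space M - exact m) \<le> prob (A \<inter> exact m)" by simp
      show "prob (A \<inter> exact m) \<le> prob A" by (intro finite_measure_mono) auto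
    qed
    have k1: "0 \<le> \<kappa> ^ r" "\<kappa> ^ r \<le> 1" using kap by (auto simp: power_le_one)
    have "\<kappa> ^ r * prob B - prob (space M - exact m) \<le> \<kappa> ^ r * (prob B - prob (space M - exact m))"
      using k1 mult_left_le_one_le[of "prob (space M - exact m)" "\<kappa> ^ r"] by (simp add: algebra_simps)
    also have "\<dots> \<le> \<kappa> ^ r * prob (B \<inter> exact m)" by (intro mult_left_mono split k1) auto
    finally have 1: "\<kappa> ^ r * prob B - prob (space M - exact m) \<le> \<kappa> ^ r * prob (B \<inter> exact m)" .
    have 2: "\<kappa> ^ r * prob (B \<inter> exact m) \<le> \<kappa> ^ r * prob B" by (intro mult_left_mono split k1) auto
    have "B \<inter> void_grid m \<in> events" by simp
    note 3 = split[OF this]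
    show ?thesis using 1 2 3 eq measure_nonneg[of M "space M - exact m"] by linarith
  qed
  have "(\<lambda>m. prob (B \<inter> void_grid m)) \<longlonglongrightarrow> prob (\<Inter>m. B \<inter> void_grid m)"
  proof (rule finite_Lim_measure_decseq)
    show "decseq (\<lambda>m. B \<inter> void_grid m)"
    proof (rule decseq_SucI, safe)
      fix m w assume w: "w \<in> void_grid (Suc m)"
      show "w \<in> void_grid m" unfolding void_grid_def
      proof (intro CollectI conjI allI impI)
        show "w \<in> space M" using w by (simp add: void_grid_def)
        fix k assume k: "k \<le> m * 2^m" "r \<le> T (real k / 2^m) w"
        have "2 * k \<le> Suc m * 2^Suc m" using k by simp
        moreover have "real (2 * k) / 2^Suc m = real k / 2^m" by simp
        ultimately show "r \<le> C (real k / 2^m) w"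
          using w k(2) unfolding void_grid_def by (metis (mono_tags, lifting) mem_Collect_eq)
      qed
    qed
    show "range (\<lambda>m. B \<inter> void_grid m) \<subseteq> events"
      using B_ev void_sets(2) by blast
  qed
  also have "(\<Inter>m. B \<inter> void_grid m) = B \<inter> void"
  proof (intro equalityI subsetI)
    fix w assume w: "w \<in> (\<Inter>m. B \<inter> void_grid m)"
    then have wB: "w \<in> B" and wv: "\<And>m. w \<in> void_grid m" by auto
    have "r \<le> C (real k / 2^q) w" if "r \<le> T (real k / 2^q) w" for k q
    proof -
      define m where "m = max q k"
      have m: "q \<le> m" "k \<le> m" by (auto simp: m_def)
      have "k * 2^(m - q) \<le> m * 2^m" using m by (intro mult_mono power_increasing) auto
      moreover have "(2::real)^m = 2^(m - q) * 2^q" using m by (simp flip: power_add)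
      then have "real (k * 2^(m - q)) / 2^m = real k / 2^q" by simp
      ultimately show ?thesis
        using wv[of m] that unfolding void_grid_def by (metis (mono_tags, lifting) mem_Collect_eq)
    qed
    then show "w \<in> B \<inter> void" using wB wv by (auto simp: void_def void_grid_def)
  qed (auto simp: void_def void_grid_def)
  finally have lim: "(\<lambda>m. prob (B \<inter> void_grid m)) \<longlonglongrightarrow> prob (B \<inter> void)" .
  have "(\<lambda>m. prob (B \<inter> void_grid m) - \<kappa> ^ r * prob B) \<longlonglongrightarrow> 0"
  proof (rule Lim_null_comparison)
    show "\<forall>\<^sub>F m in sequentially. norm (prob (B \<inter> void_grid m) - \<kappa> ^ r * prob B) \<le> 2 * prob (space M - exact m)"
      using eventually_ge_at_top[of p] eventually_ge_at_top[of K] by eventually_elim (use key in auto)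
    show "(\<lambda>m. 2 * prob (space M - exact m)) \<longlonglongrightarrow> 0"
      using tendsto_mult_right_zero[OF not_exact_tendsto_0] by simp
  qed
  then have "(\<lambda>m. prob (B \<inter> void_grid m)) \<longlonglongrightarrow> \<kappa> ^ r * prob B"
    by (simp add: LIM_zero_iff)
  with lim have "prob (B \<inter> void) = \<kappa> ^ r * prob B" by (rule LIMSEQ_unique)
  moreover have "B \<inter> void = {w\<in>G \<inter> void. \<forall>j<K. incT p j w = n j}" by (auto simp: B_def)
  ultimately show ?thesis using joint_total[of K p n] by (simp add: B_def)
qed

end

section \<open>Poisson approximation of sums of rare events\<close>

lemma sum_poisson_weight_le_1:
  assumes "0 \<le> m" shows "(\<Sum>c\<le>k. poisson_weight m c) \<le> 1"
proof -
  have s: "(\<lambda>c. m ^ c / fact c) sums exp m"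
    using exp_converges[of m] by (simp add: divide_inverse mult.commute)
  have "(\<Sum>c\<le>k. m ^ c / fact c) \<le> exp m"
    using sum_le_suminf[of "\<lambda>c. m ^ c / fact c" "{..k}"] s assms
    by (simp add: sums_iff)
  then have "(\<Sum>c\<le>k. m ^ c / fact c) * exp (- m) \<le> exp m * exp (- m)" by (intro mult_right_mono) auto
  then show ?thesis by (simp add: poisson_weight_def sum_distrib_right mult_exp_exp)
qed

lemma poisson_weight_le_1: "0 \<le> m \<Longrightarrow> poisson_weight m k \<le> 1"
  using sum_poisson_weight_le_1[of m k] member_le_sum[of k "{..k}" "poisson_weight m"]
  by (auto simp: poisson_weight_nonneg)

lemma poisson_defect:
  fixes m :: real assumes "0 \<le> m"
  shows "0 \<le> 1 - exp (- m) - m * exp (- m)" "1 - exp (- m) - m * exp (- m) \<le> m\<^sup>2"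
proof -
  have "(1 + m) * exp (- m) \<le> exp m * exp (- m)"
    by (intro mult_right_mono) auto
  then show "0 \<le> 1 - exp (- m) - m * exp (- m)" by (simp add: mult_exp_exp algebra_simps)
  have "(1 + m) * (1 - m) \<le> (1 + m) * exp (- m)"
    using assms exp_ge_add_one_self[of "- m"] by (intro mult_left_mono) auto
  then show "1 - exp (- m) - m * exp (- m) \<le> m\<^sup>2" by (simp add: power2_eq_square algebra_simps)
qed

text \<open>Adding a Bernoulli variable with parameter \<open>1 - exp (- m)\<close> instead of a Poisson variable with mean \<open>m\<close>
  changes a Poisson law by an amount of the order \<open>m\<^sup>2\<close> of the probability of two points or more.\<close>

lemma poisson_weight_increment:
  assumes "0 \<le> M" "0 \<le> m"
  shows "\<bar>poisson_weight (M + m) k - (exp (- m) * poisson_weight M k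
      + (if k = 0 then 0 else (1 - exp (- m)) * poisson_weight M (k - 1)))\<bar> \<le> 2 * m\<^sup>2"
proof (cases k)
  case 0
  have "poisson_weight (M + m) 0 = exp (- m) * poisson_weight M 0"
    by (simp add: poisson_weight_def mult_exp_exp)
  then show ?thesis using 0 by simp
next
  case (Suc j)
  define rest where "rest = (\<Sum>c\<in>{2..k}. poisson_weight m c * poisson_weight M (k - c))"
  have "poisson_weight (M + m) k = (\<Sum>c\<le>k. poisson_weight m c * poisson_weight M (k - c))"
    by (simp add: poisson_weight_add add.commute)
  also have "{..k} = insert 0 (insert 1 {2..k})" using Suc by auto
  finally have e: "poisson_weight (M + m) k = exp (- m) * poisson_weight M k + m * exp (- m) * poisson_weight M j + rest"
    using Suc by (simp add: rest_def poisson_weight_def)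
  have "rest \<le> (\<Sum>c\<in>{2..k}. poisson_weight m c)"
    unfolding rest_def using assms
    by (intro sum_mono mult_right_le_one_le poisson_weight_nonneg poisson_weight_le_1)
  also have "\<dots> = (\<Sum>c\<le>k. poisson_weight m c) - exp (- m) - m * exp (- m)"
  proof -
    have "{..k} = insert 0 (insert 1 {2..k})" using Suc by auto
    then show ?thesis by (simp add: poisson_weight_def)
  qed
  also have "\<dots> \<le> m\<^sup>2"
    using sum_poisson_weight_le_1[OF assms(2), of k] poisson_defect(2)[OF assms(2)] by linarith
  finally have rest: "rest \<le> m\<^sup>2" .
  have rest0: "0 \<le> rest" unfolding rest_def
    using assms by (intro sum_nonneg mult_nonneg_nonneg poisson_weight_nonneg)
  define D where "D = (1 - exp (- m) - m * exp (- m)) * poisson_weight M j"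
  have "0 \<le> D" "D \<le> m\<^sup>2"
  proof -
    show "0 \<le> D" unfolding D_def using poisson_defect(1)[OF assms(2)] assms
      by (intro mult_nonneg_nonneg poisson_weight_nonneg)
    have "D \<le> 1 - exp (- m) - m * exp (- m)"
      unfolding D_def using poisson_defect(1)[OF assms(2)] assms
      by (intro mult_right_le_one_le poisson_weight_nonneg poisson_weight_le_1)
    then show "D \<le> m\<^sup>2" using poisson_defect(2)[OF assms(2)] by linarith
  qed
  moreover have "poisson_weight (M + m) k - (exp (- m) * poisson_weight M k
      + (if k = 0 then 0 else (1 - exp (- m)) * poisson_weight M (k - 1))) = rest - D"
    unfolding e D_def using Suc by (simp add: algebra_simps)
  ultimately show ?thesis using rest rest0 by linarith
qed

lemma measurable_sum_nat:
  assumes "\<And>j. j \<in> J \<Longrightarrow> f j \<in> measurable M (count_space UNIV)"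
  shows "(\<lambda>x. \<Sum>j\<in>J. f j x :: nat) \<in> measurable M (count_space UNIV)"
  using assms
proof (induction J rule: infinite_finite_induct)
  case (insert j J)
  have [measurable]: "f j \<in> measurable M (count_space UNIV)" "(\<lambda>x. \<Sum>j\<in>J. f j x) \<in> measurable M (count_space UNIV)"
    using insert by auto
  show ?case using insert.hyps by simp
qed auto

text \<open>Le Cam's inequality. The success probabilities \<open>1 - exp (- m j)\<close> are those of a Poisson variable with
  mean \<open>m j\<close> being nonzero.\<close>

lemma (in prob_space) bernoulli_sum_poisson:
  fixes V :: "'j \<Rightarrow> 'a \<Rightarrow> bool"
  assumes "finite J" and "indep_vars (\<lambda>_. count_space UNIV) V J"
    and "\<And>j. j \<in> J \<Longrightarrow> 0 \<le> m j" "\<And>j. j \<in> J \<Longrightarrow> prob {w\<in>space M. V j w} = 1 - exp (- m j)"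
  shows "\<bar>prob {w\<in>space M. (\<Sum>j\<in>J. of_bool (V j w)) = k} - poisson_weight (\<Sum>j\<in>J. m j) k\<bar> \<le> 2 * (\<Sum>j\<in>J. (m j)\<^sup>2)"
  using assms
proof (induction J arbitrary: k rule: finite_induct)
  case empty
  then show ?case by (cases k) (auto simp: poisson_weight_def prob_space)
next
  case (insert j J)
  let ?X = "\<lambda>w. \<Sum>j\<in>J. of_bool (V j w) :: nat"
  have indJ: "indep_vars (\<lambda>_. count_space UNIV) V J"
    using insert.prems(1) by (rule indep_vars_subset) auto
  have V [measurable]: "V i \<in> measurable M (count_space UNIV)" if "i \<in> insert j J" for i
    using insert.prems(1) that by (auto simp: indep_vars_def)
  have X [measurable]: "?X \<in> measurable M (count_space UNIV)"
    by (intro measurable_sum_nat measurable_compose[OF V, of _ of_bool]) auto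
  have "indep_var (PiM {j} (\<lambda>_. count_space UNIV)) (\<lambda>w. restrict (\<lambda>i. V i w) {j})
      (PiM J (\<lambda>_. count_space UNIV)) (\<lambda>w. restrict (\<lambda>i. V i w) J)"
    by (rule indep_var_restrict[OF insert.prems(1)]) (use insert.hyps in auto)
  then have "indep_var (count_space UNIV) ((\<lambda>f. of_bool (f j) :: nat) \<circ> (\<lambda>w. restrict (\<lambda>i. V i w) {j}))
      (count_space UNIV) ((\<lambda>f. \<Sum>i\<in>J. of_bool (f i) :: nat) \<circ> (\<lambda>w. restrict (\<lambda>i. V i w) J))"
    by (rule indep_var_compose)
       (auto intro!: measurable_sum_nat measurable_component_singleton
          measurable_compose[OF measurable_component_singleton, where g=of_bool])
  moreover have "(\<lambda>f. \<Sum>i\<in>J. of_bool (f i) :: nat) \<circ> (\<lambda>w. restrict (\<lambda>i. V i w) J) = ?X"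
    by (auto simp: fun_eq_iff)
  ultimately have iv: "indep_var (count_space UNIV) (\<lambda>w. of_bool (V j w)) (count_space UNIV) ?X"
    by (simp add: comp_def)
  have split: "prob {w\<in>space M. V j w = b \<and> ?X w = k} = prob {w\<in>space M. V j w = b} * prob {w\<in>space M. ?X w = k}" for b k
  proof -
    have *: "(\<lambda>x. (of_bool (V j x), ?X x)) -` ({of_bool b} \<times> {k}) \<inter> space M = {w\<in>space M. V j w = b \<and> ?X w = k}"
      "(\<lambda>x. of_bool (V j x) :: nat) -` {of_bool b} \<inter> space M = {w\<in>space M. V j w = b}"
      "?X -` {k} \<inter> space M = {w\<in>space M. ?X w = k}"
      by (auto simp: of_bool_def split: if_splits)
    show ?thesis using indep_varD[OF iv, of "{of_bool b}" "{k}"] unfolding * by simp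
  qed
  have pF: "prob {w\<in>space M. V j w = False} = exp (- m j)"
  proof -
    have "{w\<in>space M. V j w = False} = space M - {w\<in>space M. V j w}" by auto
    then show ?thesis using insert.prems(3)[of j] by (simp add: prob_compl)
  qed
  have pT: "prob {w\<in>space M. V j w = True} = 1 - exp (- m j)"
    using insert.prems(3)[of j] by simp
  let ?p = "\<lambda>k. prob {w\<in>space M. ?X w = k}" and ?q = "exp (- m j)" and ?S = "\<Sum>j\<in>J. m j"
  have S0: "0 \<le> ?S" using insert.prems(2) by (intro sum_nonneg) auto
  have step: "prob {w\<in>space M. (\<Sum>j\<in>insert j J. of_bool (V j w)) = k}
     = ?q * ?p k + (if k = 0 then 0 else (1 - ?q) * ?p (k - 1))"
  proof (cases k)
    case 0
    have "{w\<in>space M. (\<Sum>j\<in>insert j J. of_bool (V j w)) = k} = {w\<in>space M. V j w = False \<and> ?X w = k}"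
      using insert.hyps 0 by auto
    then show ?thesis using split[of False k] pF 0 by simp
  next
    case (Suc i)
    have "{w\<in>space M. (\<Sum>j\<in>insert j J. of_bool (V j w)) = k} =
       {w\<in>space M. V j w = False \<and> ?X w = k} \<union> {w\<in>space M. V j w = True \<and> ?X w = i}"
      using insert.hyps Suc by (auto split: if_splits simp: of_bool_def)
    also have "prob \<dots> = prob {w\<in>space M. V j w = False \<and> ?X w = k} + prob {w\<in>space M. V j w = True \<and> ?X w = i}"
      by (intro finite_measure_Union) auto
    finally show ?thesis using split[of False k] split[of True i] pF pT Suc by simp
  qed
  have IH: "\<bar>?p k - poisson_weight ?S k\<bar> \<le> 2 * (\<Sum>j\<in>J. (m j)\<^sup>2)" for k
    using insert.prems by (intro insert.IH[OF indJ]) auto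
  define e where "e = 2 * (\<Sum>j\<in>J. (m j)\<^sup>2)"
  have q: "0 \<le> ?q" "?q \<le> 1" using insert.prems(2)[of j] by auto
  have e0: "0 \<le> e" unfolding e_def by (intro mult_nonneg_nonneg sum_nonneg) auto
  have d1: "\<bar>(?q * ?p k + (if k = 0 then 0 else (1 - ?q) * ?p (k - 1)))
     - (?q * poisson_weight ?S k + (if k = 0 then 0 else (1 - ?q) * poisson_weight ?S (k - 1)))\<bar> \<le> e"
  proof -
    have 1: "\<bar>?q * ?p k - ?q * poisson_weight ?S k\<bar> \<le> ?q * e"
      unfolding right_diff_distrib[symmetric] abs_mult using IH[of k] q
      by (intro mult_mono) (auto simp: e_def)
    have 2: "\<bar>(1 - ?q) * ?p (k - 1) - (1 - ?q) * poisson_weight ?S (k - 1)\<bar> \<le> (1 - ?q) * e"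
      unfolding right_diff_distrib[symmetric] abs_mult using IH[of "k - 1"] q
      by (intro mult_mono) (auto simp: e_def)
    have 3: "0 \<le> (1 - ?q) * e" using q e0 by simp
    have 4: "?q * e + (1 - ?q) * e = e" by (simp add: algebra_simps)
    show ?thesis
    proof (cases "k = 0")
      case True then show ?thesis using 1 3 4 by simp
    next
      case False
      have "\<bar>(a + b) - (c + d)\<bar> \<le> e" if "\<bar>a - c\<bar> \<le> ?q * e" "\<bar>b - d\<bar> \<le> (1 - ?q) * e" for a b c d
        using that 4 by linarith
      then show ?thesis using 1 2 False by simp
    qed
  qed
  have d2: "\<bar>poisson_weight (?S + m j) k - (?q * poisson_weight ?S k
      + (if k = 0 then 0 else (1 - ?q) * poisson_weight ?S (k - 1)))\<bar> \<le> 2 * (m j)\<^sup>2"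
    using S0 insert.prems(2)[of j] by (intro poisson_weight_increment) auto
  have d3: "(\<Sum>j\<in>insert j J. m j) = ?S + m j" "2 * (\<Sum>j\<in>insert j J. (m j)\<^sup>2) = e + 2 * (m j)\<^sup>2"
    using insert.hyps by (auto simp: e_def)
  have d4: "\<bar>a - p\<bar> \<le> e + f" if "\<bar>a - b\<bar> \<le> e" "\<bar>p - b\<bar> \<le> f" for a b p f :: real
    using that by linarith
  show ?case unfolding step d3 by (rule d4[OF d1 d2])
qed

text \<open>Independence passes to increasing limits: \<open>{N i \<le> k}\<close> is the decreasing intersection of the events
  \<open>{X n i \<le> k}\<close>, and these sets generate.\<close>

lemma (in prob_space) indep_vars_SUP_nat:
  fixes X :: "nat \<Rightarrow> 'i \<Rightarrow> 'a \<Rightarrow> nat" and N :: "'i \<Rightarrow> 'a \<Rightarrow> ennreal"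
  assumes "finite I" and ind: "\<And>n. indep_vars (\<lambda>_. count_space UNIV) (X n) I"
    and mono: "\<And>n i w. i \<in> I \<Longrightarrow> w \<in> space M \<Longrightarrow> X n i w \<le> X (Suc n) i w"
    and N: "\<And>i w. i \<in> I \<Longrightarrow> w \<in> space M \<Longrightarrow> N i w = (SUP n. of_nat (X n i w))"
  shows "indep_vars (\<lambda>_. borel) N I"
proof -
  have X: "X n i \<in> measurable M (count_space UNIV)" if "i \<in> I" for n i
    using ind that by (auto simp: indep_vars_def)
  have evX: "{w\<in>space M. X n i w \<le> k} \<in> events" if "i \<in> I" for n i k
    using measurable_sets[OF X[OF that], of "{..k}" n] by (simp add: vimage_def Int_def conj_commute)
  define L where "L i k = {w\<in>space M. N i w \<le> of_nat k}" for i k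
  have L: "L i k = (\<Inter>n. {w\<in>space M. X n i w \<le> k})" if "i \<in> I" for i k
    unfolding L_def using N[OF that] by (auto simp: SUP_le_iff)
  have evL: "L i k \<in> events" if "i \<in> I" for i k
    unfolding L[OF that] using evX[OF that] by auto
  define F where "F i = {space M} \<union> range (L i)" for i
  have "indep_sets F I"
  proof (rule indep_setsI)
    fix i assume "i \<in> I" then show "F i \<subseteq> events" using evL by (auto simp: F_def)
  next
    fix A K assume K: "K \<noteq> {}" "K \<subseteq> I" "finite K" and A: "\<forall>j\<in>K. A j \<in> F j"
    define k where "k j = (if A j = space M then None else Some (SOME k. A j = L j k))" for j
    have Ak: "A j = (case k j of None \<Rightarrow> space M | Some n \<Rightarrow> L j n)" if "j \<in> K" for j
    proof (cases "A j = space M")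
      case False
      then have "\<exists>k. A j = L j k" using A that by (auto simp: F_def)
      then have "A j = L j (SOME k. A j = L j k)" by (rule someI_ex)
      then show ?thesis using False by (simp add: k_def)
    qed (simp add: k_def)
    define B where "B n j = {w\<in>space M. case k j of None \<Rightarrow> True | Some m \<Rightarrow> X n j w \<le> m}" for n j
    have evB: "B n j \<in> events" if "j \<in> K" for n j
      using evX[of j n] that K by (cases "k j") (auto simp: B_def)
    have AB: "A j = (\<Inter>n. B n j)" if "j \<in> K" for j
      using Ak[OF that] L[of j] that K by (cases "k j") (auto simp: B_def)
    have decB: "B (Suc n) j \<subseteq> B n j" if "j \<in> K" for n j
    proof
      fix w assume w: "w \<in> B (Suc n) j"
      then have "X n j w \<le> X (Suc n) j w" using mono that K by (auto simp: B_def)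
      then show "w \<in> B n j" using w by (auto simp: B_def split: option.splits)
    qed
    have "prob (\<Inter>j\<in>K. B n j) = (\<Prod>j\<in>K. prob (B n j))" for n
    proof -
      have "indep_sets (\<lambda>i. {X n i -` A \<inter> space M |A. A \<in> sets (count_space UNIV)}) I"
        using ind unfolding indep_vars_def2 by blast
      then show ?thesis
      proof (rule indep_setsD[OF _ K(2,1,3)], intro ballI)
        fix j assume "j \<in> K"
        show "B n j \<in> {X n j -` A \<inter> space M |A. A \<in> sets (count_space UNIV)}"
          by (auto simp: B_def intro!: exI[of _ "{m. case k j of None \<Rightarrow> True | Some m' \<Rightarrow> m \<le> m'}"])
      qed
    qed
    moreover have "(\<lambda>n. prob (\<Inter>j\<in>K. B n j)) \<longlonglongrightarrow> prob (\<Inter>n. \<Inter>j\<in>K. B n j)"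
    proof (rule finite_Lim_measure_decseq)
      show "range (\<lambda>n. \<Inter>j\<in>K. B n j) \<subseteq> events" using evB K by (auto intro!: sets.finite_INT simp del: INT_simps)
      show "decseq (\<lambda>n. \<Inter>j\<in>K. B n j)" using decB by (intro decseq_SucI) blast
    qed
    moreover have "(\<lambda>n. \<Prod>j\<in>K. prob (B n j)) \<longlonglongrightarrow> (\<Prod>j\<in>K. prob (\<Inter>n. B n j))"
    proof (rule tendsto_prod)
      fix j assume "j \<in> K"
      then have "range (\<lambda>n. B n j) \<subseteq> events" "decseq (\<lambda>n. B n j)"
        using evB by (auto intro!: decseq_SucI dest: subsetD[OF decB])
      then show "(\<lambda>n. prob (B n j)) \<longlonglongrightarrow> prob (\<Inter>n. B n j)"
        by (rule finite_Lim_measure_decseq)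
    qed
    ultimately have "prob (\<Inter>n. \<Inter>j\<in>K. B n j) = (\<Prod>j\<in>K. prob (\<Inter>n. B n j))"
      using LIMSEQ_unique by simp
    moreover have "(\<Inter>n. \<Inter>j\<in>K. B n j) = (\<Inter>j\<in>K. A j)" using AB by auto
    moreover have "(\<Prod>j\<in>K. prob (\<Inter>n. B n j)) = (\<Prod>j\<in>K. prob (A j))" using AB by (intro prod.cong) auto
    ultimately show "prob (\<Inter>j\<in>K. A j) = (\<Prod>j\<in>K. prob (A j))" by simp
  qed
  moreover have "Int_stable (F i)" if "i \<in> I" for i
  proof -
    have "L i k \<inter> L i k' = L i (min k k')" for k k'
      unfolding L[OF that] by auto
    moreover have "L i k \<subseteq> space M" for k by (auto simp: L_def)
    ultimately show ?thesis unfolding Int_stable_def F_def by (auto simp: Int_absorb1 Int_absorb2)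
  qed
  ultimately have sig: "indep_sets (\<lambda>i. sigma_sets (space M) (F i)) I" by (rule indep_sets_sigma)
  have N_F: "N i \<in> borel_measurable (sigma (space M) (F i))" if "i \<in> I" for i
  proof -
    have sub: "F i \<subseteq> Pow (space M)" by (auto simp: F_def L_def)
    have Lm: "L i k \<in> sets (sigma (space M) (F i))" for k
      using sub by (auto simp: F_def)
    have "(\<lambda>w. SUP k. of_nat (Suc k) * indicator (space M - L i k) w :: ennreal) \<in> borel_measurable (sigma (space M) (F i))"
    proof (intro borel_measurable_SUP borel_measurable_times_ennreal borel_measurable_indicator)
      fix k show "space M - L i k \<in> sets (sigma (space M) (F i))"
        using sets.compl_sets[OF Lm[of k]] by (simp add: space_measure_of_conv)
    qed auto
    moreover have "N i w = (SUP k. of_nat (Suc k) * indicator (space M - L i k) w)" if w: "w \<in> space M" for w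
    proof (rule antisym)
      show "(SUP k. of_nat (Suc k) * indicator (space M - L i k) w) \<le> N i w"
      proof (rule SUP_least)
        fix k
        show "of_nat (Suc k) * indicator (space M - L i k) w \<le> N i w"
        proof (cases "w \<in> L i k")
          case False
          then obtain n where "k < X n i w" using w unfolding L[OF \<open>i \<in> I\<close>] by (auto simp: not_le)
          then have "of_nat (Suc k) \<le> (of_nat (X n i w) :: ennreal)" by (simp only: of_nat_le_iff)
          also have "\<dots> \<le> N i w" unfolding N[OF \<open>i \<in> I\<close> w] by (rule SUP_upper) simp
          finally show ?thesis using False w by simp
        qed simp
      qed
      show "N i w \<le> (SUP k. of_nat (Suc k) * indicator (space M - L i k) w)"
        unfolding N[OF \<open>i \<in> I\<close> w]
      proof (rule SUP_least)
        fix n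
        show "of_nat (X n i w) \<le> (SUP k. of_nat (Suc k) * indicator (space M - L i k) w :: ennreal)"
        proof (cases "X n i w")
          case (Suc k)
          then have "w \<notin> L i k" unfolding L[OF \<open>i \<in> I\<close>] by (auto intro!: exI[of _ n])
          then have "of_nat (X n i w) = of_nat (Suc k) * (indicator (space M - L i k) w :: ennreal)"
            using w Suc by simp
          then show ?thesis by (simp only:) (rule SUP_upper, simp)
        qed simp
      qed
    qed
    ultimately show ?thesis
      by (subst measurable_cong[where g="\<lambda>w. SUP k. of_nat (Suc k) * indicator (space M - L i k) w"])
         (auto simp: space_measure_of_conv)
  qed
  have sets_sig: "sets (sigma (space M) (F i)) = sigma_sets (space M) (F i)" for i
    by (rule sets_measure_of) (auto simp: F_def L_def)
  have Fsub: "sigma_sets (space M) (F i) \<subseteq> events" if "i \<in> I" for i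
    using evL[OF that] by (intro sets.sigma_sets_subset) (auto simp: F_def)
  show ?thesis unfolding indep_vars_def2
  proof (intro conjI ballI)
    fix i assume i: "i \<in> I"
    show "random_variable borel (N i)"
    proof (rule measurableI)
      fix A :: "ennreal set" assume "A \<in> sets borel"
      then show "N i -` A \<inter> space M \<in> events"
        using measurable_sets[OF N_F[OF i], of A] Fsub[OF i] by (auto simp: sets_sig space_measure_of_conv)
    qed simp
  next
    show "indep_sets (\<lambda>i. {N i -` A \<inter> space M |A. A \<in> sets borel}) I"
    proof (rule indep_sets_mono_sets[OF sig])
      fix i assume i: "i \<in> I"
      show "{N i -` A \<inter> space M |A. A \<in> sets borel} \<subseteq> sigma_sets (space M) (F i)"
        using measurable_sets[OF N_F[OF i]] by (auto simp: sets_sig space_measure_of_conv)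
    qed
  qed
qed

section \<open>Counting the points of a set by dyadic cells\<close>

definition points_on :: "'a measure \<Rightarrow> 'a set \<Rightarrow> 'a measure" where
  "points_on K R = distr (count_space (R \<inter> space K)) K (\<lambda>x. x)"

lemma sets_points_on [simp]: "sets (points_on K R) = sets K"
  by (simp add: points_on_def)

lemma emeasure_points_on:
  assumes "A \<in> sets K"
  shows "emeasure (points_on K R) A = (if finite (R \<inter> A) then of_nat (card (R \<inter> A)) else \<infinity>)"
proof -
  have *: "(\<lambda>x. x) -` A \<inter> space (count_space (R \<inter> space K)) = R \<inter> A"
    using sets.sets_into_space[OF assms] by auto
  have "emeasure (points_on K R) A = emeasure (count_space (R \<inter> space K)) (R \<inter> A)"
    unfolding points_on_def * [symmetric] by (rule emeasure_distr) (auto simp: assms measurable_count_space_eq1)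
  also have "\<dots> = (if finite (R \<inter> A) then of_nat (card (R \<inter> A)) else \<infinity>)"
    using sets.sets_into_space[OF assms] by (subst emeasure_count_space) auto
  finally show ?thesis .
qed

lemma point_measure_of_eq: "point_measure_of A = points_on pos_reals A"
  by (simp add: point_measure_of_def points_on_def space_restrict_space)

definition dyadic_index :: "nat \<Rightarrow> real \<Rightarrow> int" where "dyadic_index n x = \<lceil>x * 2 ^ n\<rceil> - 1"

definition dyadic_cell :: "nat \<Rightarrow> int \<Rightarrow> real set" where "dyadic_cell n j = {x. dyadic_index n x = j}"

lemma dyadic_index_Suc: "dyadic_index (Suc n) x div 2 = dyadic_index n x"
proof -
  define y where "y = x * 2 ^ n"
  have "\<lceil>2 * y\<rceil> = 2 * \<lceil>y\<rceil> \<or> \<lceil>2 * y\<rceil> = 2 * \<lceil>y\<rceil> - 1" by linarith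
  then have "(\<lceil>2 * y\<rceil> - 1) div 2 = \<lceil>y\<rceil> - 1" by auto
  then show ?thesis by (simp add: dyadic_index_def y_def mult_ac)
qed

lemma dyadic_index_measurable [measurable]: "dyadic_index n \<in> measurable borel (count_space UNIV)"
  unfolding dyadic_index_def[abs_def] by measurable

lemma dyadic_cell_borel [measurable]: "dyadic_cell n j \<in> sets borel"
proof -
  have "dyadic_cell n j = dyadic_index n -` {j} \<inter> space borel" by (auto simp: dyadic_cell_def)
  then show ?thesis using measurable_sets[OF dyadic_index_measurable, of "{j}" n] by simp
qed

lemma eventually_dyadic_index_bounded:
  "\<forall>\<^sub>F n in sequentially. dyadic_index n x \<in> {- (4 ^ n)..<4 ^ n}"
proof -
  obtain k :: nat where k: "\<bar>x\<bar> + 1 \<le> real k" using real_arch_simple by blast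
  show ?thesis using eventually_ge_at_top[of k]
  proof eventually_elim
    case (elim n)
    have "real n \<le> 2 ^ n" using of_nat_less_two_power[of n, where 'a=real] by simp
    then have "\<bar>x\<bar> \<le> 2 ^ n - 1" using k elim by linarith
    then have "\<bar>x\<bar> * 2 ^ n \<le> (2 ^ n - 1) * 2 ^ n" by (intro mult_right_mono) auto
    also have "(2 ^ n - 1) * 2 ^ n = (4::real) ^ n - 2 ^ n"
      by (simp add: algebra_simps flip: power_mult_distrib)
    finally have "\<bar>x * 2 ^ n\<bar> \<le> 4 ^ n - 1" by (simp add: abs_mult) (smt (verit) one_le_power)
    then have "x * 2 ^ n \<le> of_int (4 ^ n)" "of_int (- (4 ^ n) + 1) \<le> x * 2 ^ n" by auto
    then have "\<lceil>x * 2 ^ n\<rceil> \<le> 4 ^ n" "- (4 ^ n) + 1 \<le> \<lceil>x * 2 ^ n\<rceil>"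
      using le_of_int_ceiling[of "x * 2 ^ n"] by (simp add: ceiling_le_iff, metis of_int_le_iff order_trans)
    then show ?case by (auto simp: dyadic_index_def)
  qed
qed

lemma eventually_dyadic_index_separates:
  assumes "x \<noteq> y" shows "\<forall>\<^sub>F n in sequentially. dyadic_index n x \<noteq> dyadic_index n y"
proof -
  obtain k where k: "1 / \<bar>x - y\<bar> < real k" using reals_Archimedean2 by blast
  show ?thesis using eventually_ge_at_top[of k]
  proof eventually_elim
    case (elim n)
    have "real n \<le> 2 ^ n" using of_nat_less_two_power[of n, where 'a=real] by simp
    then have "1 / \<bar>x - y\<bar> < 2 ^ n" using k elim by linarith
    then have "1 < \<bar>x - y\<bar> * 2 ^ n" using assms by (simp add: field_simps)
    also have "\<dots> = \<bar>x * 2 ^ n - y * 2 ^ n\<bar>" by (simp add: abs_mult flip: left_diff_distrib)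
    finally show ?case unfolding dyadic_index_def by linarith
  qed
qed

text \<open>Restricting the indices to a finite range which grows faster than
  \<open>2 ^ n\<close> keeps this set finite while all points are eventually covered.\<close>

definition dyadic_hits :: "nat \<Rightarrow> real set \<Rightarrow> int set" where
  "dyadic_hits n B = {j\<in>{- (4 ^ n)..<4 ^ n}. B \<inter> dyadic_cell n j \<noteq> {}}"

lemma finite_dyadic_hits [simp]: "finite (dyadic_hits n B)"
  by (rule finite_subset[of _ "{- (4 ^ n)..<4 ^ n}"]) (auto simp: dyadic_hits_def)

lemma dyadic_hits_Suc: "card (dyadic_hits n B) \<le> card (dyadic_hits (Suc n) B)"
proof -
  have "dyadic_hits n B \<subseteq> (\<lambda>j. j div 2) ` dyadic_hits (Suc n) B"
  proof
    fix j assume "j \<in> dyadic_hits n B"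
    then obtain x where x: "x \<in> B" "dyadic_index n x = j" "j \<in> {- (4 ^ n)..<4 ^ n}"
      by (auto simp: dyadic_hits_def dyadic_cell_def)
    have "dyadic_index (Suc n) x div 2 = j" using x dyadic_index_Suc by simp
    \<comment> \<open>Generalized over \<open>4 ^ n\<close> to make the arithmetic linear.\<close>
    moreover have gen: "- (4 * N) \<le> d \<and> d < 4 * N" if "d div 2 = j" "- N \<le> j" "j < N" for d j N :: int
      using that by linarith
    ultimately have "dyadic_index (Suc n) x \<in> {- (4 ^ Suc n)..<4 ^ Suc n}"
      using x(3) gen[of "dyadic_index (Suc n) x" j "4 ^ n"] by simp
    then have "dyadic_index (Suc n) x \<in> dyadic_hits (Suc n) B"
      using x by (auto simp: dyadic_hits_def dyadic_cell_def)
    then show "j \<in> (\<lambda>j. j div 2) ` dyadic_hits (Suc n) B"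
      using \<open>dyadic_index (Suc n) x div 2 = j\<close> by blast
  qed
  then show ?thesis by (rule surj_card_le[rotated]) simp
qed

lemma card_dyadic_hits_le:
  assumes "finite B" shows "card (dyadic_hits n B) \<le> card B"
proof -
  have "dyadic_hits n B \<subseteq> dyadic_index n ` B"
    by (auto simp: dyadic_hits_def dyadic_cell_def)
  with assms show ?thesis by (rule surj_card_le)
qed

lemma card_dyadic_hits_ge:
  assumes "finite F" "F \<subseteq> B" shows "\<exists>n. card F \<le> card (dyadic_hits n B)"
proof -
  have "\<forall>\<^sub>F n in sequentially. \<forall>x\<in>F. dyadic_index n x \<in> {- (4 ^ n)..<4 ^ n}"
    using assms eventually_dyadic_index_bounded by (intro eventually_ball_finite) auto
  moreover have "\<forall>\<^sub>F n in sequentially. \<forall>x\<in>F. \<forall>y\<in>F. x \<noteq> y \<longrightarrow> dyadic_index n x \<noteq> dyadic_index n y"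
    using assms eventually_dyadic_index_separates
    by (intro eventually_ball_finite ballI) (auto simp: eventually_mono)
  ultimately have "\<forall>\<^sub>F n in sequentially. card F \<le> card (dyadic_hits n B)"
  proof eventually_elim
    case (elim n)
    have "inj_on (dyadic_index n) F" using elim by (auto simp: inj_on_def)
    moreover have "dyadic_index n ` F \<subseteq> dyadic_hits n B"
      using elim assms(2) by (auto simp: dyadic_hits_def dyadic_cell_def)
    ultimately show ?case by (metis card_inj_on_le finite_dyadic_hits)
  qed
  then show ?thesis by (auto simp: eventually_sequentially)
qed

text \<open>Finer cells eventually separate any finitely many points, so that the number of cells that are hit
  increases to the number of points.\<close>

lemma SUP_card_dyadic_hits:
  "(SUP n. of_nat (card (dyadic_hits n B))) = (if finite B then of_nat (card B) else \<infinity> :: ennreal)"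
proof (cases "finite B")
  case True
  obtain n where n: "card B \<le> card (dyadic_hits n B)" using card_dyadic_hits_ge[OF True order_refl] by blast
  have "(SUP n. of_nat (card (dyadic_hits n B)) :: ennreal) = of_nat (card B)"
  proof (rule antisym)
    show "(SUP n. of_nat (card (dyadic_hits n B)) :: ennreal) \<le> of_nat (card B)"
      by (rule SUP_least) (simp add: card_dyadic_hits_le True)
    have "of_nat (card B) \<le> (of_nat (card (dyadic_hits n B)) :: ennreal)" using n by simp
    also have "\<dots> \<le> (SUP n. of_nat (card (dyadic_hits n B)))" by (rule SUP_upper) simp
    finally show "of_nat (card B) \<le> (SUP n. of_nat (card (dyadic_hits n B)) :: ennreal)" .
  qed
  then show ?thesis using True by simp
next
  case False
  have "(SUP n. of_nat (card (dyadic_hits n B)) :: ennreal) = \<infinity>"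
  proof (rule ennreal_SUP_eq_top[unfolded infinity_ennreal_def[symmetric]])
    fix k :: nat
    obtain F where F: "F \<subseteq> B" "finite F" "card F = k" using infinite_arbitrarily_large[OF False] by blast
    obtain n where "k \<le> card (dyadic_hits n B)" using card_dyadic_hits_ge[OF F(2,1)] F(3) by blast
    then show "\<exists>n\<in>UNIV. of_nat k \<le> (of_nat (card (dyadic_hits n B)) :: ennreal)" by auto
  qed
  then show ?thesis using False by simp
qed

text \<open>The sum is at most the mass that \<open>\<nu> \<Otimes>\<^sub>M \<nu>\<close> gives to the pairs of points in a common cell. These sets of pairs
  decrease to the diagonal, which is a null set for an atomless measure.\<close>

lemma sum_squares_dyadic_tendsto_0:
  fixes \<nu> :: "real measure"
  assumes "finite_measure \<nu>" and s: "sets \<nu> = sets (restrict_space borel A)"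
    and "A \<in> sets borel" and atomless: "\<And>x. x \<in> A \<Longrightarrow> emeasure \<nu> {x} = 0"
  shows "(\<lambda>n. \<Sum>j\<in>{- (4 ^ n)..<4 ^ n}. (measure \<nu> (A \<inter> dyadic_cell n j))\<^sup>2) \<longlonglongrightarrow> 0"
proof -
  interpret finite_measure \<nu> by fact
  have sp: "space \<nu> = A" using sets_eq_imp_space_eq[OF s] by (simp add: space_restrict_space)
  have sub: "B \<in> sets \<nu> \<longleftrightarrow> B \<subseteq> A \<and> B \<in> sets borel" for B
    unfolding s using assms(3) by (simp add: sets_restrict_space_iff)
  have cell: "A \<inter> dyadic_cell n j \<in> sets \<nu>" for n j using assms(3) by (auto simp: sub)
  have idx: "dyadic_index n \<in> measurable \<nu> (count_space UNIV)" for n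
    using measurable_restrict_space1[OF dyadic_index_measurable[of n], of A] s
    by (simp cong: measurable_cong_sets)
  define D where "D n = {z\<in>space (\<nu> \<Otimes>\<^sub>M \<nu>). dyadic_index n (fst z) = dyadic_index n (snd z)}" for n
  have D: "D n \<in> sets (\<nu> \<Otimes>\<^sub>M \<nu>)" for n
  proof -
    have [measurable]: "(\<lambda>z. dyadic_index n (fst z)) \<in> measurable (\<nu> \<Otimes>\<^sub>M \<nu>) (count_space UNIV)"
      "(\<lambda>z. dyadic_index n (snd z)) \<in> measurable (\<nu> \<Otimes>\<^sub>M \<nu>) (count_space UNIV)"
      using measurable_compose[OF measurable_fst idx] measurable_compose[OF measurable_snd idx] by auto
    show ?thesis unfolding D_def by measurable
  qed
  have fin: "emeasure (\<nu> \<Otimes>\<^sub>M \<nu>) (D n) \<noteq> \<infinity>" for n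
  proof -
    have "emeasure (\<nu> \<Otimes>\<^sub>M \<nu>) (D n) \<le> emeasure (\<nu> \<Otimes>\<^sub>M \<nu>) (space \<nu> \<times> space \<nu>)"
      by (rule emeasure_mono) (auto simp: D_def space_pair_measure)
    also have "\<dots> < \<infinity>"
      using emeasure_pair_measure_Times[OF sets.top[of \<nu>] sets.top]
      by (simp add: emeasure_eq_measure ennreal_mult_less_top)
    finally show ?thesis by simp
  qed
  have "(\<lambda>n. emeasure (\<nu> \<Otimes>\<^sub>M \<nu>) (D n)) \<longlonglongrightarrow> emeasure (\<nu> \<Otimes>\<^sub>M \<nu>) (\<Inter>n. D n)"
  proof (rule Lim_emeasure_decseq)
    show "decseq D"
    proof (rule decseq_SucI)
      fix n show "D (Suc n) \<subseteq> D n"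
        unfolding D_def using dyadic_index_Suc by (metis (mono_tags, lifting) Collect_mono)
    qed
  qed (use D fin in auto)
  also have "emeasure (\<nu> \<Otimes>\<^sub>M \<nu>) (\<Inter>n. D n) = 0"
  proof -
    have "(\<Inter>n. D n) \<in> sets (\<nu> \<Otimes>\<^sub>M \<nu>)" using D by auto
    then have "emeasure (\<nu> \<Otimes>\<^sub>M \<nu>) (\<Inter>n. D n) = (\<integral>\<^sup>+ x. emeasure \<nu> (Pair x -` (\<Inter>n. D n)) \<partial>\<nu>)"
      by (rule emeasure_pair_measure_alt)
    also have "\<dots> = (\<integral>\<^sup>+ x. 0 \<partial>\<nu>)"
    proof (rule nn_integral_cong)
      fix x assume x: "x \<in> space \<nu>"
      have "Pair x -` (\<Inter>n. D n) \<subseteq> {x}"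
      proof
        fix y assume "y \<in> Pair x -` (\<Inter>n. D n)"
        then have "dyadic_index n x = dyadic_index n y" for n by (auto simp: D_def)
        then show "y \<in> {x}" using eventually_dyadic_index_separates[of x y] by (auto simp: eventually_sequentially)
      qed
      moreover have "{x} \<in> sets \<nu>" using x sp by (auto simp: sub)
      ultimately have "emeasure \<nu> (Pair x -` (\<Inter>n. D n)) \<le> emeasure \<nu> {x}" by (rule emeasure_mono)
      then show "emeasure \<nu> (Pair x -` (\<Inter>n. D n)) = 0" using atomless x sp by simp
    qed
    finally show ?thesis by simp
  qed
  finally have lim: "(\<lambda>n. emeasure (\<nu> \<Otimes>\<^sub>M \<nu>) (D n)) \<longlonglongrightarrow> 0" .
  have le: "ennreal (\<Sum>j\<in>{- (4 ^ n)..<4 ^ n}. (measure \<nu> (A \<inter> dyadic_cell n j))\<^sup>2) \<le> emeasure (\<nu> \<Otimes>\<^sub>M \<nu>) (D n)" for n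
  proof -
    let ?S = "\<lambda>j. (A \<inter> dyadic_cell n j) \<times> (A \<inter> dyadic_cell n j)"
    have "ennreal (\<Sum>j\<in>{- (4 ^ n)..<4 ^ n}. (measure \<nu> (A \<inter> dyadic_cell n j))\<^sup>2)
      = (\<Sum>j\<in>{- (4 ^ n)..<4 ^ n}. emeasure (\<nu> \<Otimes>\<^sub>M \<nu>) (?S j))"
      using cell
      by (simp add: emeasure_pair_measure_Times emeasure_eq_measure power2_eq_square ennreal_mult flip: sum_ennreal)
    also have "\<dots> = emeasure (\<nu> \<Otimes>\<^sub>M \<nu>) (\<Union>j\<in>{- (4 ^ n)..<4 ^ n}. ?S j)"
      using cell by (intro sum_emeasure) (auto simp: disjoint_family_on_def dyadic_cell_def)
    also have "\<dots> \<le> emeasure (\<nu> \<Otimes>\<^sub>M \<nu>) (D n)"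
      using D by (intro emeasure_mono) (auto simp: D_def space_pair_measure sp dyadic_cell_def)
    finally show ?thesis .
  qed
  have "(\<lambda>n. ennreal (\<Sum>j\<in>{- (4 ^ n)..<4 ^ n}. (measure \<nu> (A \<inter> dyadic_cell n j))\<^sup>2)) \<longlonglongrightarrow> 0"
    by (rule tendsto_sandwich[OF _ _ tendsto_const lim]) (use le in auto)
  then show ?thesis by (rule tendsto_ennrealD[where x=0, simplified]) (auto intro!: always_eventually sum_nonneg)
qed

section \<open>Poisson processes are characterized by their void probabilities\<close>

text \<open>The probability that a Poisson process with mean \<open>\<mu>\<close> has no point in \<open>A\<close>, that is \<open>exp (- \<infinity>) = 0\<close> if the mean is
  infinite.\<close>

definition void_weight :: "'a measure \<Rightarrow> 'a set \<Rightarrow> real" where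
  "void_weight \<mu> A = (if emeasure \<mu> A = \<infinity> then 0 else exp (- measure \<mu> A))"

lemma void_weight_empty [simp]: "void_weight \<mu> {} = 1" by (simp add: void_weight_def)

lemma void_weight_Un:
  assumes "A \<in> sets \<mu>" "B \<in> sets \<mu>" "A \<inter> B = {}"
  shows "void_weight \<mu> (A \<union> B) = void_weight \<mu> A * void_weight \<mu> B"
proof -
  have e: "emeasure \<mu> (A \<union> B) = emeasure \<mu> A + emeasure \<mu> B" using assms by (simp add: plus_emeasure)
  show ?thesis
  proof (cases "emeasure \<mu> A = \<infinity> \<or> emeasure \<mu> B = \<infinity>")
    case True then show ?thesis using e by (auto simp: void_weight_def)
  next
    case False
    then have "measure \<mu> (A \<union> B) = measure \<mu> A + measure \<mu> B"
      using e by (simp add: measure_def enn2real_plus less_top)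
    then show ?thesis using False e by (simp add: void_weight_def mult_exp_exp)
  qed
qed

lemma void_weight_UN:
  assumes "finite I" "disjoint_family_on B I" "\<And>i. i \<in> I \<Longrightarrow> B i \<in> sets \<mu>"
  shows "void_weight \<mu> (\<Union>i\<in>I. B i) = (\<Prod>i\<in>I. void_weight \<mu> (B i))"
  using assms
proof (induction I rule: finite_induct)
  case (insert i I)
  have "(\<Union>i\<in>I. B i) \<in> sets \<mu>" using insert by auto
  moreover have "B i \<inter> (\<Union>i\<in>I. B i) = {}" using insert.hyps insert.prems(1) by (auto simp: disjoint_family_on_def)
  ultimately show ?case
    using insert by (simp add: void_weight_Un disjoint_family_on_def)
qed simp

text \<open>The void probabilities factorize over disjoint sets, so whether the cells of a partition are hit are
  independent events. The number of cells that are hit is therefore a sum of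
  independent rare events; by \<open>bernoulli_sum_poisson\<close> it is nearly Poisson distributed, with an error that vanishes under
  refinement since \<open>\<mu>\<close> has no atoms, and it increases to the number of points. Infinite means are
  exhausted by finite ones, for which \<open>\<sigma>\<close>-finiteness is needed.\<close>

theorem renyi:
  fixes R :: "'a \<Rightarrow> real set" and \<mu> :: "real measure"
  assumes "prob_space M" "sigma_finite_measure \<mu>"
    and sets_\<mu>: "sets \<mu> = sets (restrict_space borel I)" and I: "I \<in> sets borel"
    and atomless: "\<And>x. x \<in> I \<Longrightarrow> emeasure \<mu> {x} = 0"
    and void: "\<And>A. A \<in> sets \<mu> \<Longrightarrow> {w\<in>space M. R w \<inter> A = {}} \<in> sets M"
      "\<And>A. A \<in> sets \<mu> \<Longrightarrow> measure M {w\<in>space M. R w \<inter> A = {}} = void_weight \<mu> A"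
  shows "poisson_process M \<mu> (\<lambda>w. points_on \<mu> (R w))"
proof -
  interpret prob_space M by fact
  interpret \<mu>: sigma_finite_measure \<mu> by fact
  have sub: "B \<in> sets \<mu> \<longleftrightarrow> B \<subseteq> I \<and> B \<in> sets borel" for B
    unfolding sets_\<mu> using I by (simp add: sets_restrict_space_iff)
  have cell: "A \<inter> dyadic_cell n j \<in> sets \<mu>" if "A \<in> sets \<mu>" for A n j
    using that by (auto simp: sub)
  have indV: "indep_vars (\<lambda>_. count_space UNIV) (\<lambda>i w. R w \<inter> B i \<noteq> {}) J"
    if J: "finite J" "disjoint_family_on B J" "\<And>i. i \<in> J \<Longrightarrow> B i \<in> sets \<mu>" for J :: "'i set" and B
  proof -
    let ?v = "\<lambda>i. {w\<in>space M. R w \<inter> B i = {}}"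
    have "indep_sets (\<lambda>i. {?v i}) J"
    proof (rule indep_setsI)
      fix A K assume K: "K \<noteq> {}" "K \<subseteq> J" "finite K" and A: "\<forall>j\<in>K. A j \<in> {?v j}"
      have "(\<Inter>j\<in>K. A j) = {w\<in>space M. R w \<inter> (\<Union>j\<in>K. B j) = {}}"
        using A K(1) by auto
      also have "prob \<dots> = void_weight \<mu> (\<Union>j\<in>K. B j)"
        using K J by (intro void) (auto intro!: sets.finite_UN)
      also have "\<dots> = (\<Prod>j\<in>K. void_weight \<mu> (B j))"
        using K J disjoint_family_on_mono[OF K(2) J(2)] by (intro void_weight_UN) auto
      also have "\<dots> = (\<Prod>j\<in>K. prob (A j))"
        using A void(2)[OF J(3)] K by (intro prod.cong) auto
      finally show "prob (\<Inter>j\<in>K. A j) = (\<Prod>j\<in>K. prob (A j))" .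
    qed (use void(1)[OF J(3)] in auto)
    then have sig: "indep_sets (\<lambda>i. sigma_sets (space M) {?v i}) J"
      by (rule indep_sets_sigma) (auto simp: Int_stable_def)
    have pre: "(\<lambda>w. R w \<inter> B i \<noteq> {}) -` A \<inter> space M \<in> sigma_sets (space M) {?v i}" for i A
    proof -
      have A: "A = {} \<or> A = {True} \<or> A = {False} \<or> A = UNIV"
      proof -
        have "b \<in> A \<longleftrightarrow> b \<in> (if True \<in> A then {True} else {}) \<union> (if False \<in> A then {False} else {})" for b
          by (cases b) simp_all
        then have "A = (if True \<in> A then {True} else {}) \<union> (if False \<in> A then {False} else {})"
          by (rule set_eqI)
        then show ?thesis by (cases "True \<in> A"; cases "False \<in> A") (simp_all add: UNIV_bool insert_commute)
      qed
      have v: "?v i \<in> sigma_sets (space M) {?v i}" by (rule sigma_sets.Basic) simp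
      have c: "space M - ?v i \<in> sigma_sets (space M) {?v i}" by (rule sigma_sets.Compl[OF v])
      have e: "{} \<in> sigma_sets (space M) {?v i}" by (rule sigma_sets.Empty)
      have t: "space M \<in> sigma_sets (space M) {?v i}" by (rule sigma_sets_top)
      have "(\<lambda>w. R w \<inter> B i \<noteq> {}) -` {} \<inter> space M = {}"
        "(\<lambda>w. R w \<inter> B i \<noteq> {}) -` {True} \<inter> space M = space M - ?v i"
        "(\<lambda>w. R w \<inter> B i \<noteq> {}) -` {False} \<inter> space M = ?v i"
        "(\<lambda>w. R w \<inter> B i \<noteq> {}) -` UNIV \<inter> space M = space M"
        by auto
      then show ?thesis using A v c e t by (elim disjE) simp_all
    qed
    show ?thesis unfolding indep_vars_def2
    proof (intro conjI ballI)
      fix i assume i: "i \<in> J"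
      have "sigma_sets (space M) {?v i} \<subseteq> events"
        using void(1)[OF J(3)[OF i]] by (intro sets.sigma_sets_subset) auto
      then show "random_variable (count_space UNIV) (\<lambda>w. R w \<inter> B i \<noteq> {})"
        using pre by (intro measurableI) auto
    next
      show "indep_sets (\<lambda>i. {(\<lambda>w. R w \<inter> B i \<noteq> {}) -` A \<inter> space M |A. A \<in> sets (count_space UNIV)}) J"
        by (rule indep_sets_mono_sets[OF sig]) (use pre in auto)
    qed
  qed
  define JJ where "JJ n = {- (4 ^ n)..<4 ^ n :: int}" for n
  have finJJ: "finite (JJ n)" for n by (simp add: JJ_def)
  define X where "X n A w = card (dyadic_hits n (R w \<inter> A))" for n A w
  have X_sum: "X n A w = (\<Sum>j\<in>JJ n. of_bool (R w \<inter> (A \<inter> dyadic_cell n j) \<noteq> {}))" for n A w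
  proof -
    have "dyadic_hits n (R w \<inter> A) = {j\<in>JJ n. R w \<inter> (A \<inter> dyadic_cell n j) \<noteq> {}}"
      by (auto simp: dyadic_hits_def JJ_def)
    then show ?thesis using finJJ by (simp add: X_def of_bool_def sum.If_cases Int_def)
  qed
  have emX: "emeasure (points_on \<mu> (R w)) A = (SUP n. of_nat (X n A w))" if "A \<in> sets \<mu>" for A w
    unfolding emeasure_points_on[OF that] X_def SUP_card_dyadic_hits by simp
  have X_mono: "X n A w \<le> X (Suc n) A w" for n A w
    unfolding X_def by (rule dyadic_hits_Suc)
  have cells_disj: "disjoint_family_on (\<lambda>j. A \<inter> dyadic_cell n j) (JJ n)" for A n
    by (auto simp: disjoint_family_on_def dyadic_cell_def)
  have indX: "indep_vars (\<lambda>_. count_space UNIV) (X n) \<A>"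
    if \<A>: "finite \<A>" "\<A> \<subseteq> sets \<mu>" "disjoint \<A>" for n \<A>
  proof -
    let ?B = "\<lambda>(A, j). A \<inter> dyadic_cell n j"
    have "disjoint_family_on ?B (\<A> \<times> JJ n)"
      using \<A>(3) by (auto simp: disjoint_family_on_def dyadic_cell_def disjoint_def)
    then have ind: "indep_vars (\<lambda>_. count_space UNIV) (\<lambda>i w. R w \<inter> ?B i \<noteq> {}) (\<A> \<times> JJ n)"
      using \<A> finJJ cell by (intro indV) auto
    have "indep_vars (\<lambda>A. PiM ({A} \<times> JJ n) (\<lambda>_. count_space UNIV)) (\<lambda>A w. restrict (\<lambda>i. R w \<inter> ?B i \<noteq> {}) ({A} \<times> JJ n)) \<A>"
      by (rule indep_vars_restrict[OF ind]) (auto simp: disjoint_family_on_def)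
    then have "indep_vars (\<lambda>_. count_space UNIV) (\<lambda>A w. \<Sum>j\<in>JJ n. of_bool (restrict (\<lambda>i. R w \<inter> ?B i \<noteq> {}) ({A} \<times> JJ n) (A, j)) :: nat) \<A>"
      by (rule indep_vars_compose2[where Y="\<lambda>A f. \<Sum>j\<in>JJ n. of_bool (f (A, j))"])
         (auto intro!: measurable_sum_nat measurable_compose[OF measurable_component_singleton, where g=of_bool])
    moreover have "(\<lambda>A w. \<Sum>j\<in>JJ n. of_bool (restrict (\<lambda>i. R w \<inter> ?B i \<noteq> {}) ({A} \<times> JJ n) (A, j)) :: nat) = X n"
      unfolding X_sum by (intro ext sum.cong) auto
    ultimately show ?thesis by simp
  qed
  have X_meas: "X n A \<in> measurable M (count_space UNIV)" if "A \<in> sets \<mu>" for n A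
    using indX[of "{A}" n] that by (auto simp: indep_vars_def)
  have evX: "{w\<in>space M. X n A w \<in> K} \<in> events" if "A \<in> sets \<mu>" for n A K
    using measurable_sets[OF X_meas[OF that], of K] by (simp add: vimage_def Int_def conj_commute)
  have X_lim: "(\<lambda>n. prob {w\<in>space M. X n A w = k}) \<longlonglongrightarrow> poisson_weight (measure \<mu> A) k"
    if A: "A \<in> sets \<mu>" and fin: "emeasure \<mu> A \<noteq> \<infinity>" for A k
  proof -
    let ?m = "\<lambda>n j. measure \<mu> (A \<inter> dyadic_cell n j)"
    have fin': "emeasure \<mu> B \<noteq> \<infinity>" if "B \<subseteq> A" for B
      using emeasure_mono[OF that A] fin by (auto simp: top_unique)
    have bound: "\<bar>prob {w\<in>space M. X n A w = k} - poisson_weight (\<Sum>j\<in>JJ n. ?m n j) k\<bar> \<le> 2 * (\<Sum>j\<in>JJ n. (?m n j)\<^sup>2)" for n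
      unfolding X_sum
    proof (rule bernoulli_sum_poisson[OF finJJ])
      show "indep_vars (\<lambda>_. count_space UNIV) (\<lambda>j w. R w \<inter> (A \<inter> dyadic_cell n j) \<noteq> {}) (JJ n)"
        using cell[OF A] finJJ cells_disj by (intro indV) auto
      fix j
      have "{w\<in>space M. R w \<inter> (A \<inter> dyadic_cell n j) \<noteq> {}} = space M - {w\<in>space M. R w \<inter> (A \<inter> dyadic_cell n j) = {}}" by auto
      then show "prob {w\<in>space M. R w \<inter> (A \<inter> dyadic_cell n j) \<noteq> {}} = 1 - exp (- ?m n j)"
        using void[OF cell[OF A]] fin'[of "A \<inter> dyadic_cell n j"] by (simp add: prob_compl void_weight_def)
    qed simp
    define \<nu> where "\<nu> = restrict_space \<mu> A"
    have A_bor: "A \<in> sets borel" "A \<subseteq> I" using A by (auto simp: sub)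
    have em\<nu>: "emeasure \<nu> B = emeasure \<mu> B" if "B \<subseteq> A" for B
      unfolding \<nu>_def using A that sets.sets_into_space[OF A] by (intro emeasure_restrict_space) (auto simp: Int_absorb2)
    have "finite_measure \<nu>"
      using em\<nu>[of A] fin sets.sets_into_space[OF A]
      by (intro finite_measureI) (simp add: \<nu>_def space_restrict_space Int_absorb2)
    moreover have "sets \<nu> = sets (restrict_space borel A)"
    proof -
      have "B \<in> sets \<nu> \<longleftrightarrow> B \<in> sets (restrict_space borel A)" for B
        using A sets.sets_into_space[OF A] A_bor
        by (auto simp: \<nu>_def sets_restrict_space_iff sub)
      then show ?thesis by blast
    qed
    ultimately have sq: "(\<lambda>n. \<Sum>j\<in>{- (4 ^ n)..<4 ^ n}. (measure \<nu> (A \<inter> dyadic_cell n j))\<^sup>2) \<longlonglongrightarrow> 0"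
      using A_bor em\<nu> atomless by (intro sum_squares_dyadic_tendsto_0) auto
    have "measure \<nu> (A \<inter> dyadic_cell n j) = ?m n j" for n j
      using em\<nu>[of "A \<inter> dyadic_cell n j"] by (simp add: measure_def)
    then have sq: "(\<lambda>n. 2 * (\<Sum>j\<in>JJ n. (?m n j)\<^sup>2)) \<longlonglongrightarrow> 0"
      using tendsto_mult_right_zero[OF sq, of 2] by (simp add: JJ_def)
    have sumlim: "(\<lambda>n. \<Sum>j\<in>JJ n. ?m n j) \<longlonglongrightarrow> measure \<mu> A"
    proof -
      define W where "W n = {x\<in>A. dyadic_index n x \<in> JJ n}" for n
      have W_eq: "W n = (\<Union>j\<in>JJ n. A \<inter> dyadic_cell n j)" for n by (auto simp: W_def dyadic_cell_def)
      have W_sets: "W n \<in> sets \<mu>" for n unfolding W_eq by (intro sets.finite_UN finJJ cell[OF A])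
      have W_sum: "measure \<mu> (W n) = (\<Sum>j\<in>JJ n. ?m n j)" for n
        unfolding W_eq using cell[OF A] finJJ cells_disj fin' by (intro measure_finite_Union) auto
      have inc: "incseq W"
      proof (rule incseq_SucI, rule subsetI)
        fix n x assume x: "x \<in> W n"
        have "dyadic_index (Suc n) x div 2 = dyadic_index n x" by (rule dyadic_index_Suc)
        moreover have gen: "- (4 * N) \<le> d \<and> d < 4 * N" if "d div 2 = j" "- N \<le> j" "j < N" for d j N :: int
          using that by linarith
        ultimately show "x \<in> W (Suc n)"
          using x gen[of "dyadic_index (Suc n) x" "dyadic_index n x" "4 ^ n"] by (simp add: W_def JJ_def)
      qed
      have "(\<Union>n. W n) = A"
        using eventually_dyadic_index_bounded by (fastforce simp: W_def JJ_def eventually_sequentially)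
      moreover have "(\<lambda>n. measure \<mu> (W n)) \<longlonglongrightarrow> measure \<mu> (\<Union>n. W n)"
      proof (rule Lim_measure_incseq[OF _ inc])
        show "range W \<subseteq> sets \<mu>" using W_sets by blast
        show "emeasure \<mu> (\<Union>n. W n) \<noteq> \<infinity>" by (rule fin') (auto simp: W_def)
      qed
      ultimately show ?thesis by (simp add: W_sum)
    qed
    have "(\<lambda>n. poisson_weight (\<Sum>j\<in>JJ n. ?m n j) k) \<longlonglongrightarrow> poisson_weight (measure \<mu> A) k"
      unfolding poisson_weight_def by (intro tendsto_intros sumlim) auto
    moreover have "(\<lambda>n. prob {w\<in>space M. X n A w = k} - poisson_weight (\<Sum>j\<in>JJ n. ?m n j) k) \<longlonglongrightarrow> 0"
      by (rule Lim_null_comparison[OF always_eventually sq]) (use bound in auto)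
    ultimately show ?thesis using tendsto_add by fastforce
  qed
  define L where "L A k = {w\<in>space M. emeasure (points_on \<mu> (R w)) A \<le> of_nat k}" for A k
  have L_eq: "L A k = (\<Inter>n. {w\<in>space M. X n A w \<le> k})" if "A \<in> sets \<mu>" for A k
    unfolding L_def emX[OF that] by (auto simp: SUP_le_iff)
  have evL: "L A k \<in> events" if "A \<in> sets \<mu>" for A k
    unfolding L_eq[OF that] using evX[OF that, of _ "{..k}"] by auto
  have L_prob: "prob (L A k) = (\<Sum>c\<le>k. poisson_weight (measure \<mu> A) c)"
    if A: "A \<in> sets \<mu>" and fin: "emeasure \<mu> A \<noteq> \<infinity>" for A k
  proof (rule LIMSEQ_unique)
    show "(\<lambda>n. prob {w\<in>space M. X n A w \<le> k}) \<longlonglongrightarrow> prob (L A k)"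
      unfolding L_eq[OF A]
    proof (rule finite_Lim_measure_decseq)
      show "range (\<lambda>n. {w\<in>space M. X n A w \<le> k}) \<subseteq> events" using evX[OF A, of _ "{..k}"] by auto
      show "decseq (\<lambda>n. {w\<in>space M. X n A w \<le> k})"
        by (rule decseq_SucI) (auto intro: order_trans[OF X_mono])
    qed
    have "prob {w\<in>space M. X n A w \<le> k} = (\<Sum>c\<le>k. prob {w\<in>space M. X n A w = c})" for n
    proof -
      have "{w\<in>space M. X n A w \<le> k} = (\<Union>c\<in>{..k}. {w\<in>space M. X n A w = c})" by auto
      also have "prob \<dots> = (\<Sum>c\<le>k. prob {w\<in>space M. X n A w = c})"
        using evX[OF A, of n "{_}"] by (intro finite_measure_finite_Union) (auto simp: disjoint_family_on_def)
      finally show ?thesis .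
    qed
    then show "(\<lambda>n. prob {w\<in>space M. X n A w \<le> k}) \<longlonglongrightarrow> (\<Sum>c\<le>k. poisson_weight (measure \<mu> A) c)"
      by (simp add: tendsto_sum X_lim[OF A fin])
  qed
  have indN: "indep_vars (\<lambda>_. borel) (\<lambda>A w. emeasure (points_on \<mu> (R w)) A) \<A>"
    if \<A>: "finite \<A>" "\<A> \<subseteq> sets \<mu>" "disjoint \<A>" for \<A>
    by (rule indep_vars_SUP_nat[where X=X]) (use \<A> indX X_mono emX in auto)
  show ?thesis unfolding poisson_process_def
  proof (intro conjI ballI impI allI)
    show "prob_space M" by fact
    show "(\<lambda>w. points_on \<mu> (R w)) \<in> measurable M (measures_algebra \<mu>)"
    proof (rule measurable_into_measures_algebra)
      fix A assume "A \<in> sets \<mu>"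
      then show "(\<lambda>w. emeasure (points_on \<mu> (R w)) A) \<in> borel_measurable M"
        using indN[of "{A}"] by (auto simp: indep_vars_def)
    qed simp
  next
    fix A and k :: nat assume A: "A \<in> sets \<mu>" and "emeasure \<mu> A < \<infinity>"
    then have fin: "emeasure \<mu> A \<noteq> \<infinity>" by simp
    have "prob {w \<in> space M. emeasure (points_on \<mu> (R w)) A = of_nat k} = poisson_weight (measure \<mu> A) k"
    proof (cases k)
      case 0
      have "{w \<in> space M. emeasure (points_on \<mu> (R w)) A = of_nat k} = L A 0" using 0 by (auto simp: L_def)
      then show ?thesis using L_prob[OF A fin, of 0] 0 by simp
    next
      case (Suc i)
      have "{w \<in> space M. emeasure (points_on \<mu> (R w)) A = of_nat k} = L A k - L A i"
      proof -
        have "emeasure (points_on \<mu> (R w)) A = of_nat k \<longleftrightarrow>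
           emeasure (points_on \<mu> (R w)) A \<le> of_nat k \<and> \<not> emeasure (points_on \<mu> (R w)) A \<le> of_nat i" for w
          unfolding emeasure_points_on[OF A] using Suc by (auto simp: top_unique simp del: of_nat_Suc)
        then show ?thesis by (auto simp: L_def)
      qed
      moreover have "L A i \<subseteq> L A k" using Suc unfolding L_eq[OF A] by (auto intro: le_SucI)
      ultimately show ?thesis
        using evL[OF A] L_prob[OF A fin] Suc by (simp add: finite_measure_Diff)
    qed
    then show "prob {w \<in> space M. emeasure (points_on \<mu> (R w)) A = of_nat k} =
        measure \<mu> A ^ k / fact k * exp (- measure \<mu> A)" by (simp add: poisson_weight_def)
  next
    fix A assume A: "A \<in> sets \<mu>" and inf: "emeasure \<mu> A = \<infinity>"
    have L0: "prob (L A k) = 0" for k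
    proof -
      have "((\<lambda>m. \<Sum>c\<le>k. poisson_weight m c) \<longlongrightarrow> (\<Sum>c\<le>k. 0 / fact c)) at_top"
      proof (rule tendsto_sum)
        fix c assume "c \<in> {..k}"
        have "((\<lambda>m::real. (m ^ c / exp m) / fact c) \<longlongrightarrow> 0 / fact c) at_top"
          by (rule tendsto_divide[OF tendsto_power_div_exp_0 tendsto_const]) simp
        then show "((\<lambda>m. poisson_weight m c) \<longlongrightarrow> 0 / fact c) at_top"
          by (simp add: poisson_weight_def exp_minus field_simps)
      qed
      then have lim: "((\<lambda>m. \<Sum>c\<le>k. poisson_weight m c) \<longlongrightarrow> 0) at_top" by simp
      have small: "prob (L A k) \<le> e" if "0 < e" for e
      proof -
        have "\<forall>\<^sub>F m in at_top. (\<Sum>c\<le>k. poisson_weight m c) < e" using order_tendstoD(2)[OF lim that] .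
        then obtain m0 where m0: "\<And>m. m0 \<le> m \<Longrightarrow> (\<Sum>c\<le>k. poisson_weight m c) < e"
          by (auto simp: eventually_at_top_linorder)
        obtain Z where Z: "Z \<in> sets \<mu>" "Z \<subseteq> A" "emeasure \<mu> Z < \<infinity>" "emeasure \<mu> Z > ennreal m0"
          using \<mu>.approx_PInf_emeasure_with_finite[OF A inf, of m0] by blast
        have "emeasure \<mu> Z = ennreal (measure \<mu> Z)"
          using Z(3) by (intro emeasure_eq_ennreal_measure) auto
        with Z(4) have "\<not> ennreal (measure \<mu> Z) \<le> ennreal m0" by (simp only: not_le)
        then have "m0 \<le> measure \<mu> Z" using ennreal_leI[of "measure \<mu> Z" m0] by linarith
        have "L A k \<subseteq> L Z k"
        proof
          fix w assume "w \<in> L A k"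
          moreover have "emeasure (points_on \<mu> (R w)) Z \<le> emeasure (points_on \<mu> (R w)) A"
            using Z(2) A by (intro emeasure_mono) auto
          ultimately show "w \<in> L Z k" unfolding L_def by (auto intro: order_trans)
        qed
        then have "prob (L A k) \<le> prob (L Z k)" using evL[OF Z(1)] by (rule finite_measure_mono)
        also have "\<dots> \<le> e" using L_prob[OF Z(1)] Z(3) m0[OF \<open>m0 \<le> measure \<mu> Z\<close>] by simp
        finally show ?thesis .
      qed
      show ?thesis
        using small[of "prob (L A k) / 2"] measure_nonneg[of M "L A k"] by (cases "prob (L A k) = 0") auto
    qed
    have "L A k \<in> null_sets M" for k
      using evL[OF A, of k] L0[of k] by (simp add: null_sets_def emeasure_eq_measure)
    then have "AE w in M. w \<notin> L A k" for k by (rule AE_not_in)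
    then have "AE w in M. \<forall>k. w \<notin> L A k" by (simp only: AE_all_countable) blast
    then show "AE w in M. emeasure (points_on \<mu> (R w)) A = \<infinity>"
    proof (rule AE_mp, intro AE_I2 impI)
      fix w assume "w \<in> space M" "\<forall>k. w \<notin> L A k"
      then show "emeasure (points_on \<mu> (R w)) A = \<infinity>"
        unfolding L_def emeasure_points_on[OF A] by (auto split: if_splits)
    qed
  next
    fix \<A> assume "\<A> \<subseteq> sets \<mu>" "finite \<A>" "disjoint \<A>"
    then show "indep_vars (\<lambda>_. borel) (\<lambda>A w. emeasure (points_on \<mu> (R w)) A) \<A>" by (intro indN)
  qed
qed

section \<open>The function \<open>S\<close> and its Lebesgue--Stieltjes measure\<close>

locale tail_measure =
  fixes xl xr :: ereal and \<nu> :: "real measure"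
  assumes endpoints: "xl < 0" "0 < xr"
    and sets_\<nu>: "sets \<nu> = sets (restrict_space borel (einterval xl xr))"
    and atomless: "\<forall>x\<in>einterval xl xr. emeasure \<nu> {x} = 0"
    and infinite_\<nu>: "emeasure \<nu> (einterval xl xr) = \<infinity>"
    and tail: "\<forall>x\<in>einterval xl xr.
          0 < emeasure \<nu> (einterval (ereal x) xr) \<and> emeasure \<nu> (einterval (ereal x) xr) < \<infinity>"
begin

abbreviation "I \<equiv> einterval xl xr"

definition Q :: "real \<Rightarrow> real" where "Q x = measure \<nu> (einterval (ereal x) xr)"

abbreviation "S \<equiv> S_fun \<nu> xr"

lemma S_Q: "S x = - ln (Q x)" by (simp add: S_fun_def Q_def)

lemma I_borel [measurable]: "I \<in> sets borel" by simp

lemma zero_in_I: "0 \<in> I" using endpoints by (simp add: einterval_def zero_ereal_def)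

lemma I_interval: "a \<in> I \<Longrightarrow> b \<in> I \<Longrightarrow> {a..b} \<subseteq> I"
  by (auto simp: einterval_def) (metis ereal_less_eq(3) less_le_trans, metis ereal_less_eq(3) le_less_trans)

lemma sets_\<nu>_iff: "A \<in> sets \<nu> \<longleftrightarrow> A \<subseteq> I \<and> A \<in> sets borel"
  unfolding sets_\<nu> by (simp add: sets_restrict_space_iff)

lemma space_\<nu>: "space \<nu> = I"
  using sets_eq_imp_space_eq[OF sets_\<nu>] by (simp add: space_restrict_space)

lemma tail_subset: "a \<in> I \<Longrightarrow> einterval (ereal a) xr \<subseteq> I"
  by (auto simp: einterval_def intro: less_trans[of xl "ereal a"])

lemma tail_sets [simp]: "a \<in> I \<Longrightarrow> einterval (ereal a) xr \<in> sets \<nu>"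
  using tail_subset by (simp add: sets_\<nu>_iff)

lemma emeasure_tail: "a \<in> I \<Longrightarrow> emeasure \<nu> (einterval (ereal a) xr) = ennreal (Q a)"
  using tail unfolding Q_def by (intro emeasure_eq_ennreal_measure) auto

lemma Q_pos: "a \<in> I \<Longrightarrow> 0 < Q a"
  using tail emeasure_tail[of a] by (metis ennreal_eq_0_iff less_irrefl not_le)

lemma Ioc_sets: "a \<in> I \<Longrightarrow> b \<in> I \<Longrightarrow> {a<..b} \<in> sets \<nu>"
  using I_interval[of a b] by (auto simp: sets_\<nu>_iff)

lemma emeasure_Ioc:
  assumes "a \<in> I" "b \<in> I" "a \<le> b" shows "emeasure \<nu> {a<..b} = ennreal (Q a - Q b)" "Q b \<le> Q a"
proof -
  have "einterval (ereal a) xr = {a<..b} \<union> einterval (ereal b) xr"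
    using assms by (auto simp: einterval_def) (metis ereal_less_eq(3) le_less_trans)
  moreover have "{a<..b} \<inter> einterval (ereal b) xr = {}" by (auto simp: einterval_def)
  ultimately have e: "ennreal (Q a) = emeasure \<nu> {a<..b} + ennreal (Q b)"
    using plus_emeasure[OF Ioc_sets[OF assms(1,2)] tail_sets[OF assms(2)]]
    unfolding emeasure_tail[OF assms(1), symmetric] emeasure_tail[OF assms(2), symmetric] by simp
  then have "ennreal (Q b) \<le> ennreal (Q a)" by simp
  then show "Q b \<le> Q a" using Q_pos[OF assms(1)] by (simp add: ennreal_le_iff)
  have "emeasure \<nu> {a<..b} = ennreal (Q a) - ennreal (Q b)" unfolding e by simp
  then show "emeasure \<nu> {a<..b} = ennreal (Q a - Q b)"
    using Q_pos[OF assms(2)] by (simp add: ennreal_minus)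
qed

lemma S_mono: "a \<in> I \<Longrightarrow> b \<in> I \<Longrightarrow> a \<le> b \<Longrightarrow> S a \<le> S b"
  using emeasure_Ioc(2)[of a b] Q_pos[of a] Q_pos[of b] by (simp add: S_Q)

lemma I_approx:
  obtains l u :: "nat \<Rightarrow> real" where "incseq u" "decseq l" "\<And>i. l i < u i" "\<And>i. l i \<in> I" "\<And>i. u i \<in> I"
    "I = (\<Union>i. {l i..u i})" "(\<lambda>i. ereal (l i)) \<longlonglongrightarrow> xl" "(\<lambda>i. ereal (u i)) \<longlonglongrightarrow> xr"
proof -
  have "xl < xr" using endpoints by simp
  obtain u l :: "nat \<Rightarrow> real" where *: "I = (\<Union>i. {l i..u i})" "incseq u" "decseq l" "\<And>i. l i < u i"
    "\<And>i. xl < ereal (l i)" "\<And>i. ereal (u i) < xr"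
    "(\<lambda>i. ereal (l i)) \<longlonglongrightarrow> xl" "(\<lambda>i. ereal (u i)) \<longlonglongrightarrow> xr"
    by (rule einterval_Icc_approximation[OF \<open>xl < xr\<close>]) (rule that; assumption)
  have m: "l i \<in> I" "u i \<in> I" for i
    unfolding *(1) using *(4)[of i] by (auto intro!: exI[of _ i] less_imp_le)
  show ?thesis by (rule that[of u l, OF *(2,3,4) m *(1,7,8)])
qed

text \<open>Continuity of \<open>Q\<close> is absence of atoms.\<close>

lemma Q_tendsto:
  assumes "x \<in> I" "\<And>n. X n \<in> I" "X \<longlonglongrightarrow> x" shows "(\<lambda>n. Q (X n)) \<longlonglongrightarrow> Q x"
proof -
  obtain l u where lu: "\<And>i. l i \<in> I" "(\<lambda>i. ereal (l i)) \<longlonglongrightarrow> xl" by (rule I_approx) (rule that; assumption)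
  have "xl < ereal x" using assms(1) by (simp add: einterval_def)
  then have "\<forall>\<^sub>F i in sequentially. ereal (l i) < ereal x" using order_tendstoD(2)[OF lu(2)] by blast
  then obtain i where i: "l i < x" by (auto simp: eventually_sequentially)
  define c where "c = l i"
  have c: "c \<in> I" "c < x" using lu i by (auto simp: c_def)
  have int: "integrable \<nu> (indicator (einterval (ereal a) xr) :: real \<Rightarrow> real)" if "a \<in> I" for a
    using that emeasure_tail[OF that] tail_sets[OF that] by (intro integrable_real_indicator) auto
  have Qi: "Q a = integral\<^sup>L \<nu> (indicator (einterval (ereal a) xr))" if "a \<in> I" for a
    using tail_sets[OF that] sets.sets_into_space[OF tail_sets[OF that]] by (simp add: Q_def Int_absorb2 Int_commute)
  obtain n0 where n0: "\<And>n. n0 \<le> n \<Longrightarrow> c < X n"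
    using order_tendstoD(1)[OF assms(3) c(2)] by (auto simp: eventually_sequentially)
  have "(\<lambda>n. integral\<^sup>L \<nu> (indicator (einterval (ereal (X (n + n0))) xr) :: real \<Rightarrow> real)) \<longlonglongrightarrow> integral\<^sup>L \<nu> (indicator (einterval (ereal x) xr))"
  proof (rule integral_dominated_convergence[where w="indicator (einterval (ereal c) xr)"])
    show "integrable \<nu> (indicator (einterval (ereal c) xr) :: real \<Rightarrow> real)" by (rule int[OF c(1)])
    have "AE y in \<nu>. y \<noteq> x"
      using atomless assms(1) by (intro AE_I[of _ _ "{x}"]) (auto simp: sets_\<nu>_iff)
    then show "AE y in \<nu>. (\<lambda>n. indicator (einterval (ereal (X (n + n0))) xr) y :: real) \<longlonglongrightarrow> indicator (einterval (ereal x) xr) y"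
    proof (rule AE_mp, intro AE_I2 impI)
      fix y assume "y \<noteq> x"
      have X': "(\<lambda>n. X (n + n0)) \<longlonglongrightarrow> x" using assms(3) by (rule LIMSEQ_ignore_initial_segment)
      have "\<forall>\<^sub>F n in sequentially. indicator (einterval (ereal (X (n + n0))) xr) y = (indicator (einterval (ereal x) xr) y :: real)"
      proof (cases "y < x")
        case True
        show ?thesis using order_tendstoD(1)[OF X' True]
          by eventually_elim (use True in \<open>auto simp: einterval_def indicator_def\<close>)
      next
        case False
        with \<open>y \<noteq> x\<close> have "x < y" by simp
        show ?thesis using order_tendstoD(2)[OF X' \<open>x < y\<close>]
          by eventually_elim (use \<open>x < y\<close> in \<open>auto simp: einterval_def indicator_def\<close>)
      qed
      then show "(\<lambda>n. indicator (einterval (ereal (X (n + n0))) xr) y :: real) \<longlonglongrightarrow> indicator (einterval (ereal x) xr) y"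
        by (rule tendsto_eventually)
    qed
    fix n
    show "AE y in \<nu>. norm (indicator (einterval (ereal (X (n + n0))) xr) y :: real) \<le> indicator (einterval (ereal c) xr) y"
      using n0[of "n + n0"] by (intro AE_I2) (auto simp: indicator_def einterval_def)
  qed (use assms in \<open>auto intro!: borel_measurable_indicator tail_sets\<close>)
  then have "(\<lambda>n. Q (X (n + n0))) \<longlonglongrightarrow> Q x" using Qi assms by simp
  then show ?thesis by (rule LIMSEQ_offset)
qed

lemma continuous_S: "continuous_on I S"
  unfolding continuous_on_sequentially
proof (intro allI impI ballI, elim conjE)
  fix X x assume x: "x \<in> I" "\<forall>n. X n \<in> I" "X \<longlonglongrightarrow> x"
  have "(\<lambda>n. - ln (Q (X n))) \<longlonglongrightarrow> - ln (Q x)"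
    using Q_tendsto[of x X] x Q_pos[of x] by (intro tendsto_intros) auto
  then show "(S \<circ> X) \<longlonglongrightarrow> S x" by (simp add: comp_def S_Q)
qed

text \<open>\<open>Q\<close> is unbounded near the left end point because \<open>\<nu>\<close> is infinite.\<close>

lemma S_unbounded_below: "\<exists>a\<in>I. S a < m"
proof -
  obtain l u :: "nat \<Rightarrow> real" where lu: "decseq l" "\<And>i. l i \<in> I" "I = (\<Union>i. {l i..u i})" "(\<lambda>i. ereal (l i)) \<longlonglongrightarrow> xl"
    by (rule I_approx) (rule that; assumption)
  have "(\<Union>i. einterval (ereal (l i)) xr) = I"
  proof (intro equalityI subsetI)
    fix x assume x: "x \<in> I"
    then have "xl < ereal x" by (simp add: einterval_def)
    then have "\<forall>\<^sub>F i in sequentially. ereal (l i) < ereal x" using order_tendstoD(2)[OF lu(4)] by blast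
    then obtain i where "l i < x" by (auto simp: eventually_sequentially)
    then show "x \<in> (\<Union>i. einterval (ereal (l i)) xr)" using x by (auto simp: einterval_def)
  qed (use tail_subset lu(2) in blast)
  moreover have "(\<lambda>i. emeasure \<nu> (einterval (ereal (l i)) xr)) \<longlonglongrightarrow> emeasure \<nu> (\<Union>i. einterval (ereal (l i)) xr)"
  proof (rule Lim_emeasure_incseq)
    show "incseq (\<lambda>i. einterval (ereal (l i)) xr)"
      using lu(1) by (intro incseq_SucI) (auto simp: einterval_def decseq_Suc_iff intro: le_less_trans)
  qed (use lu(2) in auto)
  ultimately have "(\<lambda>i. ennreal (Q (l i))) \<longlonglongrightarrow> \<infinity>" using infinite_\<nu> lu(2) by (simp add: emeasure_tail)
  then have "\<forall>\<^sub>F i in sequentially. ennreal (exp (- m)) < ennreal (Q (l i))"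
    by (rule order_tendstoD) simp
  then obtain i where "ennreal (exp (- m)) < ennreal (Q (l i))" by (auto simp: eventually_sequentially)
  then have "exp (- m) < Q (l i)" using Q_pos[OF lu(2), of i] by (simp add: ennreal_less_iff)
  then have "- m < ln (Q (l i))" using Q_pos[OF lu(2), of i] ln_less_cancel_iff[of "exp (- m)" "Q (l i)"] by simp
  then show ?thesis using lu(2) by (intro bexI[of _ "l i"]) (auto simp: S_Q)
qed

lemma S_unbounded_above: "\<exists>b\<in>I. m < S b"
proof -
  obtain l u :: "nat \<Rightarrow> real" where lu: "incseq u" "\<And>i. u i \<in> I" "(\<lambda>i. ereal (u i)) \<longlonglongrightarrow> xr"
    by (rule I_approx) (rule that; assumption)
  have "(\<Inter>i. einterval (ereal (u i)) xr) = {}"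
  proof -
    have False if "\<And>i. x \<in> einterval (ereal (u i)) xr" for x
    proof -
      have "ereal x < xr" using that[of 0] by (simp add: einterval_def)
      then have "\<forall>\<^sub>F i in sequentially. ereal x < ereal (u i)" using order_tendstoD(1)[OF lu(3)] by blast
      then obtain i where "x < u i" by (auto simp: eventually_sequentially)
      then show False using that[of i] by (auto simp: einterval_def)
    qed
    then show ?thesis by blast
  qed
  moreover have "(\<lambda>i. emeasure \<nu> (einterval (ereal (u i)) xr)) \<longlonglongrightarrow> emeasure \<nu> (\<Inter>i. einterval (ereal (u i)) xr)"
  proof (rule Lim_emeasure_decseq)
    show "decseq (\<lambda>i. einterval (ereal (u i)) xr)"
      using lu(1) by (intro decseq_SucI) (auto simp: einterval_def incseq_Suc_iff intro: le_less_trans)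
  qed (use lu(2) emeasure_tail in auto)
  ultimately have "(\<lambda>i. ennreal (Q (u i))) \<longlonglongrightarrow> 0" using lu(2) by (simp add: emeasure_tail)
  then have "\<forall>\<^sub>F i in sequentially. ennreal (Q (u i)) < ennreal (exp (- m))"
    by (rule order_tendstoD) simp
  then obtain i where "ennreal (Q (u i)) < ennreal (exp (- m))" by (auto simp: eventually_sequentially)
  then have "Q (u i) < exp (- m)" using Q_pos[OF lu(2), of i] by (simp add: ennreal_less_iff)
  then have "ln (Q (u i)) < - m" using Q_pos[OF lu(2), of i] ln_less_cancel_iff[of "Q (u i)" "exp (- m)"] by simp
  then show ?thesis using lu(2) by (intro bexI[of _ "u i"]) (auto simp: S_Q)
qed

lemma ex_quantile: "\<exists>x. x \<in> I \<and> S x = u \<and> (\<forall>y\<in>I. u \<le> S y \<longrightarrow> x \<le> y)"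
proof -
  obtain a b where a: "a \<in> I" "S a < u" and b: "b \<in> I" "u < S b"
    using S_unbounded_below S_unbounded_above by blast
  have ab: "a \<le> b" using S_mono[OF b(1) a(1)] a b by linarith
  have sub: "{a..b} \<subseteq> I" by (rule I_interval[OF a(1) b(1)])
  have cont: "continuous_on {a..b} S" using continuous_S sub by (rule continuous_on_subset)
  define K where "K = {a..b} \<inter> S -` {u}"
  have "closed K"
    unfolding K_def by (rule continuous_closed_preimage[OF cont]) auto
  moreover have "bounded K" by (rule bounded_subset[of "{a..b}"]) (auto simp: K_def)
  ultimately have "compact K" by (simp add: compact_eq_bounded_closed)
  moreover have "K \<noteq> {}"
    using IVT'[of S a u b] a b ab cont by (auto simp: K_def)
  ultimately obtain x where x: "x \<in> K" "\<forall>y\<in>K. x \<le> y" using compact_attains_inf by blast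
  have "x \<le> y" if y: "y \<in> I" "u \<le> S y" for y
  proof (rule ccontr)
    assume "\<not> x \<le> y"
    then have "y < x" by simp
    have "S y \<le> S x" using y x sub \<open>y < x\<close> by (intro S_mono) (auto simp: K_def)
    then have "S y = u" using y x by (auto simp: K_def)
    moreover have "a \<le> y" using S_mono[OF y(1) a(1)] a y by linarith
    ultimately have "y \<in> K" using \<open>y < x\<close> x by (auto simp: K_def)
    then show False using x \<open>y < x\<close> by auto
  qed
  then show ?thesis using x sub by (intro exI[of _ x]) (auto simp: K_def)
qed

text \<open>The generalized inverse of \<open>S\<close>, which is a continuous surjection of \<open>(x\<^sub>l, x\<^sub>r)\<close> onto the
  real line.\<close>

definition quantile :: "real \<Rightarrow> real" where
  "quantile u = (SOME x. x \<in> I \<and> S x = u \<and> (\<forall>y\<in>I. u \<le> S y \<longrightarrow> x \<le> y))"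

lemma quantile: "quantile u \<in> I" "S (quantile u) = u" "y \<in> I \<Longrightarrow> quantile u \<le> y \<longleftrightarrow> u \<le> S y"
proof -
  have *: "quantile u \<in> I \<and> S (quantile u) = u \<and> (\<forall>y\<in>I. u \<le> S y \<longrightarrow> quantile u \<le> y)"
    unfolding quantile_def by (rule someI_ex[OF ex_quantile])
  then show "quantile u \<in> I" "S (quantile u) = u" by auto
  show "quantile u \<le> y \<longleftrightarrow> u \<le> S y" if "y \<in> I" using * S_mono[of "quantile u" y] that by auto
qed

lemma quantile_measurable: "quantile \<in> measurable borel (restrict_space borel I)"
proof (rule measurable_restrict_space2)
  have "mono quantile" by (rule monoI) (simp add: quantile)
  then show "quantile \<in> borel_measurable borel" by (rule borel_measurable_mono)
qed (use quantile(1) in auto)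

text \<open>A construction of the Lebesgue--Stieltjes measure of \<open>S\<close> whose existence is evident; it agrees with
  \<^const>\<open>S_measure\<close>, whose definition by \<^const>\<open>extend_measure\<close> has content only if an extension exists.\<close>

definition quantile_image :: "real measure" where
  "quantile_image = distr lborel (restrict_space borel I) quantile"

lemma sets_quantile_image [simp]: "sets quantile_image = sets (restrict_space borel I)"
  by (simp add: quantile_image_def)

lemma emeasure_quantile_image:
  assumes "A \<subseteq> I" "A \<in> sets borel" shows "emeasure quantile_image A = emeasure lborel (quantile -` A)"
  unfolding quantile_image_def using quantile_measurable assms
  by (subst emeasure_distr) (auto simp: sets_restrict_space_iff)

lemma emeasure_quantile_image_Ioc:
  assumes "a \<in> I" "b \<in> I" "a \<le> b"
  shows "emeasure quantile_image {a<..b} = ennreal (S b - S a)"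
proof -
  have "quantile -` {a<..b} = {S a<..S b}"
    using assms quantile(3) by (auto simp: not_le[symmetric])
  moreover have "{a<..b} \<subseteq> I" using I_interval[OF assms(1,2)] by auto
  ultimately show ?thesis using S_mono[OF assms] by (simp add: emeasure_quantile_image)
qed

lemma sets_S_measure: "sets (S_measure \<nu> xl xr) = sets (restrict_space borel I)"
proof -
  let ?G = "(\<lambda>(a, b). {a<..b}) ` {(a, b). a \<in> I \<and> b \<in> I \<and> a \<le> b} :: real set set"
  have GP: "?G \<subseteq> Pow I" using I_interval by fastforce
  have s: "sets (S_measure \<nu> xl xr) = sigma_sets I ?G"
    unfolding S_measure_def by (rule sets_extend_measure[OF GP])
  have sp: "space (S_measure \<nu> xl xr) = I"
    unfolding S_measure_def by (rule space_extend_measure[OF GP])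
  have G_in: "{a<..b} \<in> sets (S_measure \<nu> xl xr)" if "a \<in> I" "b \<in> I" "a \<le> b" for a b
    unfolding s using that by (intro sigma_sets.Basic) auto
  show ?thesis
  proof (rule antisym)
    have "?G \<subseteq> sets (restrict_space borel I)" using GP by (auto simp: sets_restrict_space_iff)
    then show "sets (S_measure \<nu> xl xr) \<subseteq> sets (restrict_space borel I)"
      unfolding s using sets.sigma_sets_subset[of ?G "restrict_space borel I"] by (simp add: space_restrict_space)
    obtain l u :: "nat \<Rightarrow> real" where lu: "decseq l" "incseq u" "\<And>i. l i \<in> I" "\<And>i. u i \<in> I" "\<And>i. l i < u i" "(\<lambda>i. ereal (l i)) \<longlonglongrightarrow> xl" "(\<lambda>i. ereal (u i)) \<longlonglongrightarrow> xr"
      by (rule I_approx) (rule that; assumption)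
    have id: "(\<lambda>x. x) \<in> borel_measurable (S_measure \<nu> xl xr)"
    proof (rule borel_measurableI_greater)
      fix a :: real
      define A where "A i = (if max a (l i) \<le> u i then {max a (l i)<..u i} else {})" for i
      have "A i \<in> sets (S_measure \<nu> xl xr)" for i
      proof (cases "max a (l i) \<le> u i")
        case True
        then have "max a (l i) \<in> I" using I_interval[OF lu(3)[of i] lu(4)[of i]] by auto
        then show ?thesis using True G_in lu(4) by (simp add: A_def)
      next
        case False
        then have "A i = {}" unfolding A_def by (rule if_not_P)
        then show ?thesis by simp
      qed
      moreover have "{x\<in>space (S_measure \<nu> xl xr). a < x} = (\<Union>i. A i)"
        unfolding sp
      proof (intro equalityI subsetI)
        fix x assume x: "x \<in> {x\<in>I. a < x}"
        then have "xl < ereal x" "ereal x < xr" by (auto simp: einterval_def)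
        then have "\<forall>\<^sub>F i in sequentially. ereal (l i) < ereal x" "\<forall>\<^sub>F i in sequentially. ereal x < ereal (u i)"
          using order_tendstoD(2)[OF lu(6)] order_tendstoD(1)[OF lu(7)] by blast+
        then have "\<forall>\<^sub>F i in sequentially. x \<in> A i"
          by eventually_elim (use x in \<open>auto simp: A_def\<close>)
        then show "x \<in> (\<Union>i. A i)" by (auto simp: eventually_sequentially)
      next
        fix x assume "x \<in> (\<Union>i. A i)"
        then obtain i where "a < x" "l i < x" "x \<le> u i" by (auto simp: A_def split: if_splits)
        then show "x \<in> {x\<in>I. a < x}" using I_interval[OF lu(3)[of i] lu(4)[of i]] by auto
      qed
      ultimately show "{x\<in>space (S_measure \<nu> xl xr). a < x} \<in> sets (S_measure \<nu> xl xr)" by auto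
    qed
    show "sets (restrict_space borel I) \<subseteq> sets (S_measure \<nu> xl xr)"
    proof
      fix A assume "A \<in> sets (restrict_space borel I)"
      then have "A \<in> sets borel" "A \<subseteq> I" by (auto simp: sets_restrict_space_iff)
      then show "A \<in> sets (S_measure \<nu> xl xr)"
        using measurable_sets[OF id, of A] sp by (auto simp: Int_absorb2)
    qed
  qed
qed

lemma S_measure_eq: "S_measure \<nu> xl xr = quantile_image"
proof -
  let ?I = "{(a, b). a \<in> I \<and> b \<in> I \<and> a \<le> b}"
  let ?G = "(\<lambda>(a, b). {a<..b}) :: real \<times> real \<Rightarrow> real set"
  have GP: "?G ` ?I \<subseteq> Pow I" using I_interval by fastforce
  have val: "emeasure (S_measure \<nu> xl xr) (?G i) = emeasure quantile_image (?G i)" if "i \<in> ?I" for i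
  proof -
    have "emeasure (S_measure \<nu> xl xr) (?G i) = (\<lambda>(a, b). ennreal (S b - S a)) i"
    proof (rule emeasure_extend_measure[where \<mu>'="emeasure quantile_image" and \<Omega>=I and I="?I" and G="?G"])
      show "S_measure \<nu> xl xr = extend_measure I ?I ?G (\<lambda>(a, b). ennreal (S b - S a))"
        by (simp add: S_measure_def)
      show "positive (sets (S_measure \<nu> xl xr)) (emeasure quantile_image)"
        "countably_additive (sets (S_measure \<nu> xl xr)) (emeasure quantile_image)"
        using emeasure_positive[of quantile_image] emeasure_countably_additive[of quantile_image]
        by (simp_all add: sets_S_measure)
    qed (use GP that emeasure_quantile_image_Ioc in auto)
    then show ?thesis using that emeasure_quantile_image_Ioc by auto
  qed
  obtain l u :: "nat \<Rightarrow> real" where lu: "\<And>i. l i \<in> I" "\<And>i. u i \<in> I" "\<And>i. l i < u i" "I = (\<Union>i. {l i..u i})" "(\<lambda>i. ereal (l i)) \<longlonglongrightarrow> xl" "(\<lambda>i. ereal (u i)) \<longlonglongrightarrow> xr"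
    by (rule I_approx) (rule that; assumption)
  show ?thesis
  proof (rule measure_eqI_generator_eq[where E="?G ` ?I" and \<Omega>=I and A="\<lambda>i. {l i<..u i}"])
    show "Int_stable (?G ` ?I)"
    proof (rule Int_stableI, safe)
      fix a b c d assume *: "a \<in> I" "b \<in> I" "c \<in> I" "d \<in> I" "a \<le> b" "c \<le> d"
      show "{a<..b} \<inter> {c<..d} \<in> ?G ` ?I"
      proof (cases "max a c \<le> min b d")
        case True
        then show ?thesis using * by (intro image_eqI[of _ _ "(max a c, min b d)"]) (auto simp: max_def min_def)
      next
        case False
        then show ?thesis using * by (intro image_eqI[of _ _ "(a, a)"]) auto
      qed
    qed
    have s: "sets (S_measure \<nu> xl xr) = sigma_sets I (?G ` ?I)"
      unfolding S_measure_def by (rule sets_extend_measure[OF GP])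
    show "sets (S_measure \<nu> xl xr) = sigma_sets I (?G ` ?I)" by (rule s)
    show "sets quantile_image = sigma_sets I (?G ` ?I)" using s sets_S_measure by simp
    show "range (\<lambda>i. {l i<..u i}) \<subseteq> ?G ` ?I" using lu(1-3) by (force intro: less_imp_le)
    show "(\<Union>i. {l i<..u i}) = I"
    proof (intro equalityI subsetI)
      fix x assume x: "x \<in> I"
      then have "xl < ereal x" "ereal x < xr" by (auto simp: einterval_def)
      then have "\<forall>\<^sub>F i in sequentially. ereal (l i) < ereal x" "\<forall>\<^sub>F i in sequentially. ereal x < ereal (u i)"
        using order_tendstoD(2)[OF lu(5)] order_tendstoD(1)[OF lu(6)] by blast+
      then have "\<forall>\<^sub>F i in sequentially. x \<in> {l i<..u i}" by eventually_elim auto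
      then show "x \<in> (\<Union>i. {l i<..u i})" by (auto simp: eventually_sequentially)
    next
      fix x assume "x \<in> (\<Union>i. {l i<..u i})"
      then obtain i where "x \<in> {l i..u i}" by (auto intro: less_imp_le)
      then show "x \<in> I" unfolding lu(4) by blast
    qed
    fix i show "emeasure (S_measure \<nu> xl xr) {l i<..u i} \<noteq> \<infinity>"
      using val[of "(l i, u i)"] emeasure_quantile_image_Ioc[OF lu(1,2)] lu(1-3) by (simp add: less_imp_le)
  qed (use GP val in auto)
qed

lemma emeasure_S_Ioc:
  "a \<in> I \<Longrightarrow> b \<in> I \<Longrightarrow> a \<le> b \<Longrightarrow> emeasure (S_measure \<nu> xl xr) {a<..b} = ennreal (S b - S a)"
  unfolding S_measure_eq by (rule emeasure_quantile_image_Ioc)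

lemma emeasure_S_singleton:
  assumes "x \<in> I" shows "emeasure (S_measure \<nu> xl xr) {x} = 0"
proof -
  have "quantile -` {x} \<subseteq> {S x}" using quantile(2) by auto
  then have "emeasure lborel (quantile -` {x}) \<le> emeasure lborel {S x}" by (intro emeasure_mono) auto
  then show ?thesis unfolding S_measure_eq using assms by (simp add: emeasure_quantile_image)
qed

lemma S_measurable: "S \<in> borel_measurable (restrict_space borel I)"
  using continuous_S by (rule borel_measurable_continuous_on_restrict)

text \<open>\<open>S\<close> transforms its own Lebesgue--Stieltjes measure into Lebesgue measure, as a continuous distribution
  function does.\<close>

lemma distr_S: "distr (S_measure \<nu> xl xr) borel S = lborel"
proof -
  have "distr quantile_image borel S = distr lborel borel (S \<circ> quantile)"
    unfolding quantile_image_def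
    by (rule distr_distr) (use S_measurable quantile_measurable in auto)
  also have "S \<circ> quantile = (\<lambda>x. x)" by (auto simp: quantile(2))
  also have "distr lborel borel (\<lambda>x. x) = lborel" by (simp add: distr_id2)
  finally show ?thesis by (simp add: S_measure_eq)
qed

lemma sigma_finite_S: "sigma_finite_measure (S_measure \<nu> xl xr)"
proof
  obtain l u :: "nat \<Rightarrow> real" where lu: "\<And>i. l i \<in> I" "\<And>i. u i \<in> I" "\<And>i. l i < u i" "I = (\<Union>i. {l i..u i})"
    by (rule I_approx) (rule that; assumption)
  have sub: "{l i..u i} \<subseteq> I" for i using lu(4) by auto
  have sp: "space (S_measure \<nu> xl xr) = I"
    using sets_eq_imp_space_eq[OF sets_S_measure] by (simp add: space_restrict_space)
  have "emeasure (S_measure \<nu> xl xr) {l i..u i} \<noteq> \<infinity>" for i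
  proof -
    have "{l i..u i} = {l i} \<union> {l i<..u i}" using lu(3)[of i] by auto
    then have "emeasure (S_measure \<nu> xl xr) {l i..u i} \<le> emeasure (S_measure \<nu> xl xr) {l i} + emeasure (S_measure \<nu> xl xr) {l i<..u i}"
      using sub[of i] by (simp only:) (rule emeasure_subadditive, auto simp: sets_S_measure sets_restrict_space_iff)
    also have "\<dots> < \<infinity>"
      using emeasure_S_singleton[OF lu(1)[of i]] emeasure_S_Ioc[OF lu(1,2)[of i]] lu(3)[of i] by simp
    finally show ?thesis by simp
  qed
  then show "\<exists>A. countable A \<and> A \<subseteq> sets (S_measure \<nu> xl xr) \<and> \<Union>A = space (S_measure \<nu> xl xr) \<and> (\<forall>a\<in>A. emeasure (S_measure \<nu> xl xr) a \<noteq> \<infinity>)"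
    using sub lu(4) by (intro exI[of _ "range (\<lambda>i. {l i..u i})"]) (auto simp: sp sets_S_measure sets_restrict_space_iff)
qed

end

section \<open>The range of the extremal process of a fixed point configuration\<close>

lemma tendsto_of_nat_ennreal:
  assumes "(\<lambda>n. of_nat (k n) :: ennreal) \<longlonglongrightarrow> L" "L < \<infinity>"
  shows "\<exists>l. L = of_nat l"
proof -
  have "(\<lambda>n. enn2real (of_nat (k n))) \<longlonglongrightarrow> enn2real L"
    using assms by (intro tendsto_enn2real) (auto simp: ennreal_enn2real_if)
  then have "(\<lambda>n. real (k n)) \<longlonglongrightarrow> enn2real L" by (simp add: enn2real_of_nat)
  moreover have "closed (real ` UNIV)" by (rule closed_of_nat_image)
  ultimately have "enn2real L \<in> real ` UNIV" by (rule Lim_in_closed_set[rotated 3]) auto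
  then obtain l where "enn2real L = real l" by auto
  then have "L = ennreal (real l)" using assms(2) by (metis ennreal_enn2real infinity_ennreal_def)
  then show ?thesis by (auto simp: ennreal_of_nat_eq_real_of_nat)
qed

text \<open>Rational approximations from the right: counts are right continuous in the level and in time, and so they are
  controlled by their values at rational arguments.\<close>

definition dyadic_above :: "real \<Rightarrow> nat \<Rightarrow> real" where
  "dyadic_above x n = real_of_int (\<lfloor>x * 2 ^ n\<rfloor> + 1) / 2 ^ n"

lemma dyadic_above:
  "x < dyadic_above x n" "decseq (dyadic_above x)" "(\<lambda>n. dyadic_above x n) \<longlonglongrightarrow> x" "dyadic_above x n \<in> \<rat>"
proof -
  have gt: "x < dyadic_above x n" for n
  proof -
    have "x * 2 ^ n < real_of_int (\<lfloor>x * 2 ^ n\<rfloor> + 1)" by linarith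
    then show ?thesis by (simp add: dyadic_above_def field_simps)
  qed
  then show "x < dyadic_above x n" .
  show "decseq (dyadic_above x)"
  proof (rule decseq_SucI)
    fix n
    define y where "y = x * 2 ^ n"
    have "\<lfloor>2 * y\<rfloor> < 2 * (\<lfloor>y\<rfloor> + 1)" unfolding floor_less_iff by (simp, linarith)
    then have "real_of_int (\<lfloor>2 * y\<rfloor> + 1) \<le> 2 * real_of_int (\<lfloor>y\<rfloor> + 1)" by linarith
    then have "real_of_int (\<lfloor>2 * y\<rfloor> + 1) / (2 * 2 ^ n) \<le> 2 * real_of_int (\<lfloor>y\<rfloor> + 1) / (2 * 2 ^ n)"
      by (rule divide_right_mono) simp
    also have "2 * real_of_int (\<lfloor>y\<rfloor> + 1) / (2 * 2 ^ n) = real_of_int (\<lfloor>y\<rfloor> + 1) / 2 ^ n"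
      by (rule mult_divide_mult_cancel_left) simp
    finally show "dyadic_above x (Suc n) \<le> dyadic_above x n"
      unfolding dyadic_above_def y_def by (simp add: mult_ac)
  qed
  have "dyadic_above x n \<le> x + 1 / 2 ^ n" for n
  proof -
    have "real_of_int (\<lfloor>x * 2 ^ n\<rfloor> + 1) \<le> x * 2 ^ n + 1" by linarith
    then show ?thesis by (simp add: dyadic_above_def field_simps)
  qed
  then have up: "norm (dyadic_above x n - x) \<le> (1/2) ^ n" for n
    using gt[of n] by (simp add: power_one_over algebra_simps)
  have "(\<lambda>n. (1/2::real) ^ n) \<longlonglongrightarrow> 0" by (rule LIMSEQ_realpow_zero) auto
  then have "(\<lambda>n. dyadic_above x n - x) \<longlonglongrightarrow> 0"
    by (rule Lim_null_comparison[OF always_eventually, rotated]) (use up in blast)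
  then show "(\<lambda>n. dyadic_above x n) \<longlonglongrightarrow> x" by (rule LIM_zero_cancel)
  show "dyadic_above x n \<in> \<rat>" by (simp add: dyadic_above_def)
qed

context tail_measure
begin

definition \<mu>N :: "(real \<times> real) measure" where
  "\<mu>N = restrict_space lborel {0..} \<Otimes>\<^sub>M \<nu>"

definition count :: "(real \<times> real) measure \<Rightarrow> real \<Rightarrow> real \<Rightarrow> ennreal" where
  "count m x t = emeasure m ({0..t} \<times> einterval (ereal x) xr)"

text \<open>The almost sure properties of the Poisson random measure on which all pathwise arguments rest. They refer to
  rational levels and times only, so that they involve countably many null sets.\<close>

definition good :: "(real \<times> real) measure \<Rightarrow> bool" where
  "good m \<longleftrightarrow> sets m = sets \<mu>N \<and>
     (\<forall>x\<in>\<rat>\<inter>I. \<forall>t\<in>\<rat>. 0 \<le> t \<longrightarrow> count m x t \<in> range of_nat) \<and>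
     (\<forall>t\<in>\<rat>. 0 < t \<longrightarrow> emeasure m ({0..t} \<times> I) = \<infinity>) \<and>
     emeasure m ({0} \<times> I) = 0 \<and>
     (\<forall>x\<in>\<rat>\<inter>I. emeasure m ({0..} \<times> einterval (ereal x) xr) = \<infinity>)"

lemma times_sets: "T \<in> sets borel \<Longrightarrow> T \<subseteq> {0..} \<Longrightarrow> A \<in> sets \<nu> \<Longrightarrow> T \<times> A \<in> sets \<mu>N"
  unfolding \<mu>N_def sets_restrict_space
  by (intro pair_measureI) (auto simp: sets_restrict_space intro!: image_eqI[of _ _ T])

lemma I_sets: "I \<in> sets \<nu>" by (simp add: sets_\<nu>_iff)

lemma ex_in_I_less: "x \<in> I \<Longrightarrow> \<exists>y\<in>\<rat>\<inter>I. y < x"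
proof -
  assume x: "x \<in> I"
  obtain l u :: "nat \<Rightarrow> real" where lu: "\<And>i. l i \<in> I" "(\<lambda>i. ereal (l i)) \<longlonglongrightarrow> xl"
    by (rule I_approx) (rule that; assumption)
  have "xl < ereal x" using x by (simp add: einterval_def)
  then have "\<forall>\<^sub>F i in sequentially. ereal (l i) < ereal x" using order_tendstoD(2)[OF lu(2)] by blast
  then obtain i where i: "l i < x" by (auto simp: eventually_sequentially)
  then obtain y where y: "y \<in> \<rat>" "l i < y" "y < x" using Rats_dense_in_real by blast
  then have "y \<in> I" using I_interval[OF lu(1)[of i] x] by auto
  then show ?thesis using y by blast
qed

lemma ex_in_I_greater: "x \<in> I \<Longrightarrow> \<exists>y\<in>\<rat>\<inter>I. x < y"
proof -
  assume x: "x \<in> I"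
  obtain l u :: "nat \<Rightarrow> real" where lu: "\<And>i. u i \<in> I" "(\<lambda>i. ereal (u i)) \<longlonglongrightarrow> xr"
    by (rule I_approx) (rule that; assumption)
  have "ereal x < xr" using x by (simp add: einterval_def)
  then have "\<forall>\<^sub>F i in sequentially. ereal x < ereal (u i)" using order_tendstoD(1)[OF lu(2)] by blast
  then obtain i where i: "x < u i" by (auto simp: eventually_sequentially)
  then obtain y where y: "y \<in> \<rat>" "x < y" "y < u i" using Rats_dense_in_real by blast
  then have "y \<in> I" using I_interval[OF x lu(1)[of i]] by auto
  then show ?thesis using y by blast
qed

lemma eventually_dyadic_above_in_I: "x \<in> I \<Longrightarrow> \<forall>\<^sub>F n in sequentially. dyadic_above x n \<in> I"
proof -
  assume x: "x \<in> I"
  obtain y where y: "y \<in> I" "x < y" using ex_in_I_greater[OF x] by blast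
  show ?thesis using order_tendstoD(2)[OF dyadic_above(3)[of x] y(2)]
  proof eventually_elim
    case (elim n)
    then have "dyadic_above x n \<in> {x..y}" using dyadic_above(1)[of x n] by auto
    then show ?case using I_interval[OF x y(1)] by blast
  qed
qed

lemma tail_mono: "a \<le> b \<Longrightarrow> einterval (ereal b) xr \<subseteq> einterval (ereal a) xr"
  by (auto simp: einterval_def intro: le_less_trans)

text \<open>The count as a natural number, which it is for \<open>good\<close> measures.\<close>

definition cn :: "(real \<times> real) measure \<Rightarrow> real \<Rightarrow> real \<Rightarrow> nat" where
  "cn m x t = nat \<lfloor>enn2real (count m x t)\<rfloor>"

context
  fixes m assumes good: "good m"
begin

lemma sets_m: "sets m = sets \<mu>N" using good by (simp add: good_def)

lemma times_sets_m: "T \<in> sets borel \<Longrightarrow> T \<subseteq> {0..} \<Longrightarrow> A \<in> sets \<nu> \<Longrightarrow> T \<times> A \<in> sets m"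
  using times_sets sets_m by simp

lemma count_mono: "a \<in> I \<Longrightarrow> a \<le> b \<Longrightarrow> s \<le> t \<Longrightarrow> count m b s \<le> count m a t"
  unfolding count_def using tail_mono[of a b]
  by (intro emeasure_mono times_sets_m) auto

lemma count_finite: "x \<in> I \<Longrightarrow> count m x t < \<infinity>"
proof -
  assume x: "x \<in> I"
  obtain y where y: "y \<in> \<rat>\<inter>I" "y < x" using ex_in_I_less[OF x] by blast
  obtain n :: nat where n: "t \<le> real n" using real_arch_simple by blast
  have "count m x t \<le> count m y (real n)" using y n by (intro count_mono) auto
  moreover have "count m y (real n) \<in> range of_nat"
    using good y unfolding good_def by (auto dest!: bspec[of _ _ y] bspec[of _ _ "real n"])
  ultimately show ?thesis by (auto elim!: le_less_trans simp: of_nat_less_top)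
qed

lemma count_tendsto_level:
  assumes x: "x \<in> I" shows "(\<lambda>n. count m (dyadic_above x n) t) \<longlonglongrightarrow> count m x t"
proof -
  have eq: "{0..t} \<times> einterval (ereal x) xr = (\<Union>n. {0..t} \<times> einterval (ereal (dyadic_above x n)) xr)"
  proof -
    have "\<exists>n. dyadic_above x n < z" if "x < z" for z
      using order_tendstoD(2)[OF dyadic_above(3)[of x] that] by (auto simp: eventually_sequentially)
    then show ?thesis using dyadic_above(1)[of x] by (auto simp: einterval_def intro: less_trans)
  qed
  have sub: "einterval (ereal (dyadic_above x n)) xr \<in> sets \<nu>" for n
    using tail_subset[OF x] tail_mono[of x "dyadic_above x n"] dyadic_above(1)[of x n]
    by (auto simp: sets_\<nu>_iff less_imp_le)
  show ?thesis unfolding count_def eq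
  proof (rule Lim_emeasure_incseq)
    show "incseq (\<lambda>n. {0..t} \<times> einterval (ereal (dyadic_above x n)) xr)"
      using dyadic_above(2)[of x] by (intro incseq_SucI Sigma_mono tail_mono) (auto simp: decseq_Suc_iff)
    show "range (\<lambda>n. {0..t} \<times> einterval (ereal (dyadic_above x n)) xr) \<subseteq> sets m"
      using sub by (auto intro!: times_sets_m)
  qed
qed

lemma count_tendsto_time:
  assumes x: "x \<in> I" shows "(\<lambda>n. count m x (dyadic_above t n)) \<longlonglongrightarrow> count m x t"
proof -
  have eq: "{0..t} \<times> einterval (ereal x) xr = (\<Inter>n. {0..dyadic_above t n} \<times> einterval (ereal x) xr)"
  proof -
    have "z \<le> t" if "\<And>n. z \<le> dyadic_above t n" for z
      using LIMSEQ_le_const[OF dyadic_above(3)[of t]] that by auto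
    moreover have "z \<le> dyadic_above t n" if "z \<le> t" for z n
      using dyadic_above(1)[of t n] that by linarith
    ultimately show ?thesis by auto
  qed
  show ?thesis unfolding count_def eq
  proof (rule Lim_emeasure_decseq)
    show "decseq (\<lambda>n. {0..dyadic_above t n} \<times> einterval (ereal x) xr)"
    proof (intro decseq_SucI Sigma_mono)
      fix n show "{0..dyadic_above t (Suc n)} \<subseteq> {0..dyadic_above t n}"
        using dyadic_above(2)[of t] by (auto simp: decseq_Suc_iff intro: order_trans)
    qed simp
    show "range (\<lambda>n. {0..dyadic_above t n} \<times> einterval (ereal x) xr) \<subseteq> sets m"
      using x by (auto intro!: times_sets_m)
    show "emeasure m ({0..dyadic_above t n} \<times> einterval (ereal x) xr) \<noteq> \<infinity>" for n
      using count_finite[OF x, of "dyadic_above t n"] by (auto simp: count_def)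
  qed
qed

lemma count_nat: "x \<in> I \<Longrightarrow> count m x t \<in> range of_nat"
proof -
  assume x: "x \<in> I"
  show ?thesis
  proof (cases "0 \<le> t")
    case False
    then have "count m x t = of_nat 0" by (simp add: count_def)
    then show ?thesis by blast
  next
    case True
    have rat: "count m x t \<in> range of_nat" if t: "t \<in> \<rat>" "0 \<le> t" for t
    proof -
      obtain n0 where n0: "\<And>n. n0 \<le> n \<Longrightarrow> dyadic_above x n \<in> I"
        using eventually_dyadic_above_in_I[OF x] by (auto simp: eventually_sequentially)
      have "\<exists>k. \<forall>n. count m (dyadic_above x (n + n0)) t = of_nat (k n)"
      proof (rule choice, rule allI)
        fix n
        have "dyadic_above x (n + n0) \<in> \<rat>\<inter>I" using n0[of "n + n0"] dyadic_above(4) by auto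
        then show "\<exists>k. count m (dyadic_above x (n + n0)) t = of_nat k"
          using good t unfolding good_def by blast
      qed
      then obtain k where k: "\<And>n. count m (dyadic_above x (n + n0)) t = of_nat (k n)" by blast
      have "(\<lambda>n. of_nat (k n)) \<longlonglongrightarrow> count m x t"
        using LIMSEQ_ignore_initial_segment[OF count_tendsto_level[OF x, of t], of n0] by (simp add: k)
      from tendsto_of_nat_ennreal[OF this count_finite[OF x]] show ?thesis by blast
    qed
    have "\<exists>k. \<forall>n. count m x (dyadic_above t n) = of_nat (k n)"
    proof (rule choice, rule allI)
      fix n show "\<exists>k. count m x (dyadic_above t n) = of_nat k"
        using rat[OF dyadic_above(4)[of t n]] dyadic_above(1)[of t n] True by auto
    qed
    then obtain k where k: "\<And>n. count m x (dyadic_above t n) = of_nat (k n)" by blast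
    have "(\<lambda>n. of_nat (k n)) \<longlonglongrightarrow> count m x t" using count_tendsto_time[OF x, of t] by (simp add: k)
    from tendsto_of_nat_ennreal[OF this count_finite[OF x]] show ?thesis by blast
  qed
qed

lemma of_nat_cn: "x \<in> I \<Longrightarrow> of_nat (cn m x t) = count m x t"
  using count_nat[of x t] by (auto simp: cn_def enn2real_of_nat)

lemma cn_mono: "a \<in> I \<Longrightarrow> b \<in> I \<Longrightarrow> a \<le> b \<Longrightarrow> s \<le> t \<Longrightarrow> cn m b s \<le> cn m a t"
  using count_mono[of a b s t] by (simp flip: of_nat_cn)

lemma cn_0: "x \<in> I \<Longrightarrow> cn m x 0 = 0"
proof -
  assume x: "x \<in> I"
  have "count m x 0 \<le> emeasure m ({0} \<times> I)"
    unfolding count_def using tail_subset[OF x] by (intro emeasure_mono times_sets_m I_sets) auto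
  also have "\<dots> = 0" using good by (simp add: good_def)
  finally show ?thesis by (simp add: cn_def)
qed

lemma cn_unbounded: "x \<in> I \<Longrightarrow> \<exists>n::nat. r \<le> cn m x (real n)"
proof -
  assume x: "x \<in> I"
  obtain y where y: "y \<in> \<rat>\<inter>I" "x < y" using ex_in_I_greater[OF x] by blast
  have "(\<lambda>n. emeasure m ({0..real n} \<times> einterval (ereal y) xr)) \<longlonglongrightarrow> emeasure m (\<Union>n. {0..real n} \<times> einterval (ereal y) xr)"
  proof (rule Lim_emeasure_incseq)
    show "incseq (\<lambda>n. {0..real n} \<times> einterval (ereal y) xr)" by (intro incseq_SucI Sigma_mono) auto
  qed (use y in \<open>auto intro!: times_sets_m\<close>)
  moreover have "(\<Union>n. {0..real n} \<times> einterval (ereal y) xr) = {0..} \<times> einterval (ereal y) xr"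
    using real_arch_simple by auto
  moreover have "emeasure m ({0..} \<times> einterval (ereal y) xr) = \<infinity>" using good y unfolding good_def by blast
  ultimately have "(\<lambda>n. count m y (real n)) \<longlonglongrightarrow> \<infinity>" by (simp add: count_def)
  then have "\<forall>\<^sub>F n in sequentially. of_nat r < count m y (real n)" by (rule order_tendstoD) (simp add: of_nat_less_top)
  then obtain n where "of_nat r < count m y (real n)" by (auto simp: eventually_sequentially)
  also have "\<dots> \<le> count m x (real n)" using x y by (intro count_mono) auto
  finally have "r < cn m x (real n)" using x by (simp flip: of_nat_cn)
  then show ?thesis by (auto intro: less_imp_le)
qed

text \<open>The infimum defining the process is attained, as counts are right continuous in the level.\<close>

lemma extremal_process_le_iff:
  assumes b: "b \<in> I" shows "extremal_process xl xr m r t \<le> ereal b \<longleftrightarrow> cn m b t < r"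
proof
  assume "cn m b t < r"
  then have "count m b t < of_nat r" using b by (simp flip: of_nat_cn)
  moreover have "xl < ereal b" using b by (simp add: einterval_def)
  ultimately show "extremal_process xl xr m r t \<le> ereal b"
    unfolding extremal_process_def count_def by (intro Inf_lower) auto
next
  assume le: "extremal_process xl xr m r t \<le> ereal b"
  have lt: "count m x t < of_nat r" if x: "b < x" for x
  proof -
    have "extremal_process xl xr m r t < ereal x" using le x by (meson ereal_less_le less_ereal.simps(1) order_le_less_trans)
    then obtain z where z: "xl < ereal z" "count m z t < of_nat r" "ereal z < ereal x"
      unfolding extremal_process_def Inf_less_iff count_def by blast
    have "emeasure m ({0..t} \<times> einterval (ereal x) xr) \<le> emeasure m ({0..t} \<times> einterval (ereal z) xr)"
    proof (rule emeasure_mono)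
      show "{0..t} \<times> einterval (ereal z) xr \<in> sets m"
        using z(1) by (intro times_sets_m) (auto simp: sets_\<nu>_iff einterval_def intro: less_trans)
    qed (use z tail_mono[of z x] in auto)
    then show ?thesis using z(2) unfolding count_def by (rule le_less_trans)
  qed
  have r: "0 < r" using lt[of "b + 1"] by (cases r) auto
  obtain n0 where n0: "\<And>n. n0 \<le> n \<Longrightarrow> dyadic_above b n \<in> I"
    using eventually_dyadic_above_in_I[OF b] by (auto simp: eventually_sequentially)
  have "count m b t \<le> of_nat (r - 1)"
  proof (rule LIMSEQ_le_const2[OF count_tendsto_level[OF b]], intro exI allI impI)
    fix n assume n: "n0 \<le> n"
    have "of_nat (cn m (dyadic_above b n) t) < (of_nat r :: ennreal)"
      using lt[OF dyadic_above(1)] of_nat_cn[OF n0[OF n]] by simp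
    then have "cn m (dyadic_above b n) t \<le> r - 1" by simp
    then have "of_nat (cn m (dyadic_above b n) t) \<le> (of_nat (r - 1) :: ennreal)" by (simp only: of_nat_le_iff)
    then show "count m (dyadic_above b n) t \<le> of_nat (r - 1)" using of_nat_cn[OF n0[OF n]] by simp
  qed
  then have "cn m b t \<le> r - 1" unfolding of_nat_cn[OF b, symmetric] of_nat_le_iff .
  then show "cn m b t < r" using r by simp
qed

text \<open>Up to a time \<open>t > 0\<close> there are infinitely many points in all, hence at least \<open>r\<close> above some level, and only finitely
  many above each level, hence fewer than \<open>r\<close> above some level if \<open>r \<ge> 1\<close>; for \<open>r = 0\<close> the process is
  constantly \<open>\<infinity>\<close>.\<close>

lemma extremal_range_subset: "extremal_range xl xr m r \<subseteq> I"
proof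
  fix y assume "y \<in> extremal_range xl xr m r"
  then obtain t where t: "0 < t" "extremal_process xl xr m r t = ereal y" by (auto simp: extremal_range_def)
  obtain l u :: "nat \<Rightarrow> real" where lu: "decseq l" "incseq u" "\<And>i. l i \<in> I" "\<And>i. u i \<in> I"
      "(\<lambda>i. ereal (l i)) \<longlonglongrightarrow> xl" "(\<lambda>i. ereal (u i)) \<longlonglongrightarrow> xr"
    by (rule I_approx) (rule that; assumption)
  have r: "0 < r"
  proof (rule ccontr)
    assume "\<not> 0 < r"
    then have "extremal_process xl xr m r t = \<infinity>" by (simp add: extremal_process_def top_ereal_def)
    then show False using t by simp
  qed
  have "(\<lambda>i. count m (u i) t) \<longlonglongrightarrow> emeasure m (\<Inter>i. {0..t} \<times> einterval (ereal (u i)) xr)"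
    unfolding count_def
  proof (rule Lim_emeasure_decseq)
    show "decseq (\<lambda>i. {0..t} \<times> einterval (ereal (u i)) xr)"
      using lu(2) by (intro decseq_SucI Sigma_mono tail_mono) (auto simp: incseq_Suc_iff)
    show "range (\<lambda>i. {0..t} \<times> einterval (ereal (u i)) xr) \<subseteq> sets m" using lu by (auto intro!: times_sets_m)
    show "emeasure m ({0..t} \<times> einterval (ereal (u i)) xr) \<noteq> \<infinity>" for i
      using count_finite[OF lu(4)[of i], of t] by (auto simp: count_def)
  qed
  also have "(\<Inter>i. {0..t} \<times> einterval (ereal (u i)) xr) = {}"
  proof -
    have False if "\<And>i. z \<in> einterval (ereal (u i)) xr" for z
    proof -
      have "ereal z < xr" using that[of 0] by (simp add: einterval_def)
      then have "\<forall>\<^sub>F i in sequentially. ereal z < ereal (u i)" using order_tendstoD(1)[OF lu(6)] by blast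
      then obtain i where "z < u i" by (auto simp: eventually_sequentially)
      then show False using that[of i] by (auto simp: einterval_def)
    qed
    then show ?thesis by blast
  qed
  finally have "(\<lambda>i. count m (u i) t) \<longlonglongrightarrow> 0" by simp
  then have "\<forall>\<^sub>F i in sequentially. count m (u i) t < 1" by (rule order_tendstoD) simp
  then obtain i where i: "count m (u i) t < 1" by (auto simp: eventually_sequentially)
  have "of_nat (cn m (u i) t) < (of_nat 1 :: ennreal)" using i of_nat_cn[OF lu(4)[of i], of t] by simp
  then have "cn m (u i) t < r" using r by (simp only: of_nat_less_iff)
  then have "ereal y \<le> ereal (u i)" using extremal_process_le_iff[OF lu(4)[of i], of r t] t by simp
  moreover have "ereal (u i) < xr" using lu(4) by (simp add: einterval_def)
  ultimately have 1: "ereal y < xr" by (rule le_less_trans)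
  have "(\<lambda>i. count m (l i) t) \<longlonglongrightarrow> emeasure m (\<Union>i. {0..t} \<times> einterval (ereal (l i)) xr)"
    unfolding count_def
  proof (rule Lim_emeasure_incseq)
    show "incseq (\<lambda>i. {0..t} \<times> einterval (ereal (l i)) xr)"
      using lu(1) by (intro incseq_SucI Sigma_mono tail_mono) (auto simp: decseq_Suc_iff)
    show "range (\<lambda>i. {0..t} \<times> einterval (ereal (l i)) xr) \<subseteq> sets m" using lu by (auto intro!: times_sets_m)
  qed
  also have "(\<Union>i. {0..t} \<times> einterval (ereal (l i)) xr) = {0..t} \<times> I"
  proof -
    have "\<exists>i. z \<in> einterval (ereal (l i)) xr" if z: "z \<in> I" for z
    proof -
      have "xl < ereal z" using z by (simp add: einterval_def)
      then have "\<forall>\<^sub>F i in sequentially. ereal (l i) < ereal z" using order_tendstoD(2)[OF lu(5)] by blast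
      then obtain i where "l i < z" by (auto simp: eventually_sequentially)
      then show ?thesis using z by (auto simp: einterval_def)
    qed
    then show ?thesis using tail_subset[OF lu(3)] by blast
  qed
  also have "emeasure m ({0..t} \<times> I) = \<infinity>"
  proof -
    obtain q where q: "q \<in> \<rat>" "0 < q" "q < t" using Rats_dense_in_real[OF t(1)] by blast
    have "emeasure m ({0..q} \<times> I) \<le> emeasure m ({0..t} \<times> I)"
      using q by (intro emeasure_mono times_sets_m I_sets) auto
    moreover have "emeasure m ({0..q} \<times> I) = \<infinity>" using good q unfolding good_def by blast
    ultimately show ?thesis by (simp add: top_unique)
  qed
  finally have "\<forall>\<^sub>F i in sequentially. of_nat r < count m (l i) t" by (rule order_tendstoD) (simp add: of_nat_less_top)
  then obtain i where i: "of_nat r < count m (l i) t" by (auto simp: eventually_sequentially)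
  then have "\<not> cn m (l i) t < r" unfolding of_nat_cn[OF lu(3), symmetric] by simp
  then have "\<not> ereal y \<le> ereal (l i)" using extremal_process_le_iff[OF lu(3)[of i], of r t] t by simp
  moreover have "xl < ereal (l i)" using lu(3) by (simp add: einterval_def)
  ultimately have "xl < ereal y" by (meson less_trans not_le)
  with 1 show "y \<in> I" by (simp add: einterval_def)
qed

lemma hit_iff:
  assumes ab: "a \<in> I" "b \<in> I"
  shows "extremal_range xl xr m r \<inter> {a<..b} \<noteq> {} \<longleftrightarrow> (\<exists>t>0. r \<le> cn m a t \<and> cn m b t < r)"
proof
  assume "extremal_range xl xr m r \<inter> {a<..b} \<noteq> {}"
  then obtain y t where t: "0 < t" "extremal_process xl xr m r t = ereal y" "a < y" "y \<le> b"
    by (auto simp: extremal_range_def)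
  then show "\<exists>t>0. r \<le> cn m a t \<and> cn m b t < r"
    using extremal_process_le_iff[OF ab(1), of r t] extremal_process_le_iff[OF ab(2), of r t]
    by (intro exI[of _ t]) auto
next
  assume "\<exists>t>0. r \<le> cn m a t \<and> cn m b t < r"
  then obtain t where t: "0 < t" "r \<le> cn m a t" "cn m b t < r" by blast
  then have le: "extremal_process xl xr m r t \<le> ereal b" "\<not> extremal_process xl xr m r t \<le> ereal a"
    using extremal_process_le_iff ab by auto
  then obtain y where y: "extremal_process xl xr m r t = ereal y"
    by (cases "extremal_process xl xr m r t") auto
  then have "y \<in> extremal_range xl xr m r \<inter> {a<..b}" using le t(1) by (auto simp: extremal_range_def)
  then show "extremal_range xl xr m r \<inter> {a<..b} \<noteq> {}" by blast
qed

text \<open>Missing an interval becomes a countable condition on counts, and this is the event of the thinning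
  theorem.\<close>

lemma void_iff:
  assumes ab: "a \<in> I" "b \<in> I"
  shows "extremal_range xl xr m r \<inter> {a<..b} = {} \<longleftrightarrow>
     (\<forall>p k. r \<le> cn m a (real k / 2 ^ p) \<longrightarrow> r \<le> cn m b (real k / 2 ^ p))"
proof -
  have "(\<exists>t>0. r \<le> cn m a t \<and> cn m b t < r) \<longleftrightarrow> (\<exists>p k. r \<le> cn m a (real k / 2 ^ p) \<and> cn m b (real k / 2 ^ p) < r)"
  proof
    assume "\<exists>t>0. r \<le> cn m a t \<and> cn m b t < r"
    then obtain t where t: "0 < t" "r \<le> cn m a t" "cn m b t < r" by blast
    have "count m b t < of_nat r" using t(3) ab by (simp flip: of_nat_cn)
    then have "\<forall>\<^sub>F n in sequentially. count m b (dyadic_above t n) < of_nat r"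
      using order_tendstoD(2)[OF count_tendsto_time[OF ab(2), of t]] by blast
    then obtain n where "count m b (dyadic_above t n) < of_nat r" by (auto simp: eventually_sequentially)
    then have 1: "cn m b (dyadic_above t n) < r" using ab by (simp flip: of_nat_cn)
    have 2: "r \<le> cn m a (dyadic_above t n)"
      using t(2) cn_mono[OF ab(1) ab(1) order_refl less_imp_le[OF dyadic_above(1)[of t n]]] by simp
    have "dyadic_above t n = real (nat (\<lfloor>t * 2 ^ n\<rfloor> + 1)) / 2 ^ n"
      using t(1) by (simp add: dyadic_above_def)
    then show "\<exists>p k. r \<le> cn m a (real k / 2 ^ p) \<and> cn m b (real k / 2 ^ p) < r" using 1 2 by metis
  next
    assume "\<exists>p k. r \<le> cn m a (real k / 2 ^ p) \<and> cn m b (real k / 2 ^ p) < r"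
    then obtain p k where pk: "r \<le> cn m a (real k / 2 ^ p)" "cn m b (real k / 2 ^ p) < r" by blast
    then have "k \<noteq> 0" using cn_0[OF ab(1)] by (intro notI) simp
    then show "\<exists>t>0. r \<le> cn m a t \<and> cn m b t < r" using pk by (intro exI[of _ "real k / 2 ^ p"]) auto
  qed
  then have "extremal_range xl xr m r \<inter> {a<..b} \<noteq> {} \<longleftrightarrow> (\<exists>p k. r \<le> cn m a (real k / 2 ^ p) \<and> cn m b (real k / 2 ^ p) < r)"
    using hit_iff[OF ab, of r] by simp
  then show ?thesis by (meson not_less)
qed

lemma count_split:
  assumes ab: "a \<in> I" "b \<in> I" "a \<le> b" and T: "T \<in> sets borel" "T \<subseteq> {0..}"
  shows "emeasure m (T \<times> einterval (ereal a) xr) = emeasure m (T \<times> einterval (ereal b) xr) + emeasure m (T \<times> {a<..b})"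
proof -
  have "T \<times> einterval (ereal a) xr = (T \<times> einterval (ereal b) xr) \<union> (T \<times> {a<..b})"
    using ab by (auto simp: einterval_def intro: le_less_trans[of _ "ereal b"])
  moreover have "(T \<times> einterval (ereal b) xr) \<inter> (T \<times> {a<..b}) = {}" by (auto simp: einterval_def)
  ultimately show ?thesis
    using plus_emeasure[of "T \<times> einterval (ereal b) xr" m "T \<times> {a<..b}"] ab T
    by (simp add: times_sets_m Ioc_sets)
qed

lemma cn_increment_mono:
  assumes ab: "a \<in> I" "b \<in> I" "a \<le> b" and st: "s \<le> t"
  shows "cn m b t - cn m b s \<le> cn m a t - cn m a s" "cn m a s + cn m b t \<le> cn m a t + cn m b s"
proof -
  define d where "d t = emeasure m ({0..t} \<times> {a<..b})" for t
  have e: "of_nat (cn m a t) = of_nat (cn m b t) + d t" for t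
    unfolding of_nat_cn[OF ab(1)] of_nat_cn[OF ab(2)] count_def d_def by (rule count_split[OF ab]) auto
  have "d s \<le> d t" unfolding d_def using st by (intro emeasure_mono times_sets_m Ioc_sets ab) auto
  then have "of_nat (cn m a s + cn m b t) \<le> (of_nat (cn m a t + cn m b s) :: ennreal)"
    unfolding of_nat_add e by (simp add: add_ac add_left_mono)
  then show *: "cn m a s + cn m b t \<le> cn m a t + cn m b s" by (simp only: of_nat_le_iff)
  show "cn m b t - cn m b s \<le> cn m a t - cn m a s" using * by linarith
qed

text \<open>Take for each value in \<open>(a, b]\<close> a time when the process has this value. The number of points above \<open>a\<close> at this
  time increases strictly with the value, and it is bounded, since the process stays above \<open>b\<close> from the time on when there are
  \<open>r\<close> points above \<open>b\<close>.\<close>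

lemma finite_extremal_range:
  assumes ab: "a \<in> I" "b \<in> I" shows "finite (extremal_range xl xr m r \<inter> {a<..b})"
proof -
  let ?R = "extremal_range xl xr m r \<inter> {a<..b}"
  have "\<exists>\<tau>. \<forall>y\<in>?R. 0 < \<tau> y \<and> extremal_process xl xr m r (\<tau> y) = ereal y"
    by (rule bchoice) (auto simp: extremal_range_def)
  then obtain \<tau> where \<tau>: "\<And>y. y \<in> ?R \<Longrightarrow> 0 < \<tau> y" "\<And>y. y \<in> ?R \<Longrightarrow> extremal_process xl xr m r (\<tau> y) = ereal y" by blast
  have inI: "y \<in> I" if "y \<in> ?R" for y using extremal_range_subset that by blast
  have strict: "cn m a (\<tau> y) < cn m a (\<tau> z)" if yz: "y \<in> ?R" "z \<in> ?R" "y < z" for y z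
  proof -
    have 1: "cn m y (\<tau> y) < r" using extremal_process_le_iff[OF inI[OF yz(1)], of r "\<tau> y"] \<tau>(2)[OF yz(1)] by simp
    have 2: "r \<le> cn m y (\<tau> z)" using extremal_process_le_iff[OF inI[OF yz(1)], of r "\<tau> z"] \<tau>(2)[OF yz(2)] yz(3) by simp
    have "\<tau> y \<le> \<tau> z"
    proof (rule ccontr)
      assume "\<not> \<tau> y \<le> \<tau> z"
      then have "cn m y (\<tau> z) \<le> cn m y (\<tau> y)" using inI[OF yz(1)] by (intro cn_mono) auto
      then show False using 1 2 by simp
    qed
    then show ?thesis using cn_increment_mono(2)[OF ab(1) inI[OF yz(1)], of "\<tau> y" "\<tau> z"] yz 1 2 by auto
  qed
  have inj: "inj_on (\<lambda>y. cn m a (\<tau> y)) ?R"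
  proof (rule inj_onI, rule ccontr)
    fix y z assume yz: "y \<in> ?R" "z \<in> ?R" "cn m a (\<tau> y) = cn m a (\<tau> z)" "y \<noteq> z"
    then show False using strict[of y z] strict[of z y] by (cases "y < z") auto
  qed
  obtain n where n: "r \<le> cn m b (real n)" using cn_unbounded[OF ab(2)] by blast
  have "(\<lambda>y. cn m a (\<tau> y)) ` ?R \<subseteq> {..cn m a (real n)}"
  proof safe
    fix y assume y: "y \<in> extremal_range xl xr m r" "y \<in> {a<..b}"
    then have R: "y \<in> ?R" by simp
    have 1: "cn m b (\<tau> y) < r" using extremal_process_le_iff[OF ab(2), of r "\<tau> y"] \<tau>(2)[OF R] y(2) by simp
    have "\<tau> y \<le> real n"
    proof (rule ccontr)
      assume "\<not> \<tau> y \<le> real n"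
      then have "cn m b (real n) \<le> cn m b (\<tau> y)" using ab by (intro cn_mono) auto
      then show False using 1 n by simp
    qed
    then show "cn m a (\<tau> y) \<le> cn m a (real n)" using ab by (intro cn_mono) auto
  qed
  then have "finite ((\<lambda>y. cn m a (\<tau> y)) ` ?R)" by (rule finite_subset) simp
  then show ?thesis using inj by (rule finite_imageD)
qed

end

end

section \<open>Counts of the Poisson random measure above a level\<close>

lemma poisson_weight_sums: "0 \<le> m \<Longrightarrow> poisson_weight m sums 1"
proof -
  assume "0 \<le> m"
  have "(\<lambda>c. m ^ c / fact c) sums exp m"
    using exp_converges[of m] by (simp add: divide_inverse mult.commute)
  from sums_mult2[OF this, of "exp (- m)"] show ?thesis
    by (simp add: poisson_weight_def[abs_def] mult_exp_exp)
qed

lemma emeasure_lborel_Ici: "emeasure lborel {a::real..} = \<infinity>"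
proof (rule ccontr)
  assume "emeasure lborel {a..} \<noteq> \<infinity>"
  then obtain b where b: "0 \<le> b" "emeasure lborel {a..} = ennreal b"
    by (cases "emeasure lborel {a..}") auto
  have "emeasure lborel {a..a + b + 1} \<le> emeasure lborel {a..}" by (intro emeasure_mono) auto
  then show False using b by (simp add: ennreal_le_iff)
qed

lemma poisson_process_event:
  assumes pp: "poisson_process P \<mu> \<xi>" and A: "A \<in> sets \<mu>" and B: "B \<in> sets borel"
  shows "{w\<in>space P. emeasure (\<xi> w) A \<in> B} \<in> sets P"
  using measurable_sets[OF poisson_process_measurable[OF pp A] B] by (simp add: vimage_def Int_def conj_commute)

lemma poisson_process_AE_nat:
  assumes pp: "poisson_process P \<mu> \<xi>" and A: "A \<in> sets \<mu>" "emeasure \<mu> A < \<infinity>"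
  shows "AE w in P. emeasure (\<xi> w) A \<in> range of_nat"
proof -
  interpret prob_space P using pp by (rule poisson_process_prob_space)
  let ?E = "\<lambda>k. {w\<in>space P. emeasure (\<xi> w) A = of_nat k}"
  have ev: "?E k \<in> events" for k
    using poisson_process_event[OF pp A(1), of "{of_nat k}"] by simp
  have "(\<lambda>k. prob (?E k)) sums prob (\<Union>k. ?E k)"
    using ev by (intro finite_measure_UNION) (auto simp: disjoint_family_on_def)
  moreover have "(\<lambda>k. prob (?E k)) sums 1"
    using poisson_weight_sums[of "measure \<mu> A"] poisson_process_weight[OF pp A]
    by (simp add: poisson_weight_def[abs_def])
  ultimately have "prob (\<Union>k. ?E k) = 1" by (rule sums_unique2)
  then have "AE w in P. w \<in> (\<Union>k. ?E k)" by (rule AE_prob_1)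
  then show ?thesis by eventually_elim auto
qed

lemma poisson_process_AE_0:
  assumes pp: "poisson_process P \<mu> \<xi>" and A: "A \<in> sets \<mu>" "emeasure \<mu> A = 0"
  shows "AE w in P. emeasure (\<xi> w) A = 0"
proof -
  interpret prob_space P using pp by (rule poisson_process_prob_space)
  have "prob {w\<in>space P. emeasure (\<xi> w) A = of_nat 0} = 1"
    using poisson_process_weight[OF pp A(1), of 0] A(2) by (simp add: measure_def)
  then have "AE w in P. w \<in> {w\<in>space P. emeasure (\<xi> w) A = of_nat 0}" by (rule AE_prob_1)
  then show ?thesis by eventually_elim auto
qed

context tail_measure
begin

lemma sigma_finite_\<nu>: "sigma_finite_measure \<nu>"
proof
  obtain l u :: "nat \<Rightarrow> real" where lu: "\<And>i. l i \<in> I" "(\<lambda>i. ereal (l i)) \<longlonglongrightarrow> xl"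
    by (rule I_approx) (rule that; assumption)
  have "\<exists>i. z \<in> einterval (ereal (l i)) xr" if z: "z \<in> I" for z
  proof -
    have "xl < ereal z" using z by (simp add: einterval_def)
    then have "\<forall>\<^sub>F i in sequentially. ereal (l i) < ereal z" using order_tendstoD(2)[OF lu(2)] by blast
    then obtain i where "l i < z" by (auto simp: eventually_sequentially)
    then show ?thesis using z by (auto simp: einterval_def)
  qed
  then have "\<Union>(range (\<lambda>i. einterval (ereal (l i)) xr)) = I" using tail_subset[OF lu(1)] by blast
  then show "\<exists>A. countable A \<and> A \<subseteq> sets \<nu> \<and> \<Union>A = space \<nu> \<and> (\<forall>a\<in>A. emeasure \<nu> a \<noteq> \<infinity>)"
    using lu(1) by (intro exI[of _ "range (\<lambda>i. einterval (ereal (l i)) xr)"]) (auto simp: space_\<nu> emeasure_tail)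
qed

lemma emeasure_\<mu>N:
  assumes "T \<in> sets borel" "T \<subseteq> {0..}" "A \<in> sets \<nu>"
  shows "emeasure \<mu>N (T \<times> A) = emeasure lborel T * emeasure \<nu> A"
proof -
  interpret \<nu>: sigma_finite_measure \<nu> by (rule sigma_finite_\<nu>)
  have "T \<in> sets (restrict_space lborel {0..})"
    using assms by (auto simp: sets_restrict_space intro!: image_eqI[of _ _ T])
  moreover have "emeasure (restrict_space lborel {0..}) T = emeasure lborel T"
    by (rule emeasure_restrict_space) (use assms in auto)
  ultimately show ?thesis unfolding \<mu>N_def using assms(3)
    by (subst \<nu>.emeasure_pair_measure_Times) auto
qed

lemma AE_good:
  assumes pp: "poisson_process P \<mu>N N" shows "AE w in P. good (N w)"
proof -
  interpret prob_space P using pp by (rule poisson_process_prob_space)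
  have 0: "AE w in P. sets (N w) = sets \<mu>N" using poisson_process_sets[OF pp] by (intro AE_I2)
  have 1: "AE w in P. \<forall>x\<in>\<rat>\<inter>I. \<forall>t\<in>\<rat>. 0 \<le> t \<longrightarrow> count (N w) x t \<in> range of_nat"
  proof (intro AE_ball_countable[THEN iffD2] ballI)
    fix x t :: real assume x: "x \<in> \<rat>\<inter>I" and t: "t \<in> \<rat>"
    show "AE w in P. 0 \<le> t \<longrightarrow> count (N w) x t \<in> range of_nat"
    proof (cases "0 \<le> t")
      case True
      have "AE w in P. emeasure (N w) ({0..t} \<times> einterval (ereal x) xr) \<in> range of_nat"
        using x True by (intro poisson_process_AE_nat[OF pp] times_sets)
          (auto simp: emeasure_\<mu>N emeasure_tail ennreal_mult_less_top)
      then show ?thesis unfolding count_def by eventually_elim simp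
    qed simp
  qed (auto simp: countable_rat)
  have 2: "AE w in P. \<forall>t\<in>\<rat>. 0 < t \<longrightarrow> emeasure (N w) ({0..t} \<times> I) = \<infinity>"
  proof (intro AE_ball_countable[THEN iffD2] ballI)
    fix t :: real assume t: "t \<in> \<rat>"
    show "AE w in P. 0 < t \<longrightarrow> emeasure (N w) ({0..t} \<times> I) = \<infinity>"
    proof (cases "0 < t")
      case True
      have "AE w in P. emeasure (N w) ({0..t} \<times> I) = \<infinity>"
        using True infinite_\<nu> by (intro poisson_process_infinite[OF pp] times_sets I_sets)
          (auto simp: emeasure_\<mu>N I_sets ennreal_mult_eq_top_iff)
      then show ?thesis by eventually_elim simp
    qed simp
  qed (auto simp: countable_rat)
  have 3: "AE w in P. emeasure (N w) ({0} \<times> I) = 0"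
    by (intro poisson_process_AE_0[OF pp] times_sets I_sets) (auto simp: emeasure_\<mu>N I_sets)
  have 4: "AE w in P. \<forall>x\<in>\<rat>\<inter>I. emeasure (N w) ({0..} \<times> einterval (ereal x) xr) = \<infinity>"
  proof (intro AE_ball_countable[THEN iffD2] ballI)
    fix x assume "x \<in> \<rat>\<inter>I"
    then show "AE w in P. emeasure (N w) ({0..} \<times> einterval (ereal x) xr) = \<infinity>"
      using Q_pos[of x] by (intro poisson_process_infinite[OF pp] times_sets)
        (auto simp: emeasure_\<mu>N emeasure_tail ennreal_mult_eq_top_iff emeasure_lborel_Ici)
  qed (auto simp: countable_rat)
  show ?thesis using 0 1 2 3 4 unfolding good_def by eventually_elim blast
qed

end

definition grid_cell :: "nat \<Rightarrow> nat \<Rightarrow> real set" where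
  "grid_cell p i = {real i / 2 ^ p<..real (Suc i) / 2 ^ p}"

lemma grid_cell: "grid_cell p i \<in> sets borel" "grid_cell p i \<subseteq> {0..}" "emeasure lborel (grid_cell p i) = ennreal (1 / 2 ^ p)"
  "disjoint_family (grid_cell p)"
proof -
  show "grid_cell p i \<subseteq> {0..}"
  proof
    fix x assume "x \<in> grid_cell p i"
    moreover have "0 \<le> real i / 2 ^ p" by simp
    ultimately show "x \<in> {0..}" unfolding grid_cell_def by (auto simp del: divide_nonneg_nonneg)
  qed
  show "emeasure lborel (grid_cell p i) = ennreal (1 / 2 ^ p)"
    unfolding grid_cell_def by (subst emeasure_lborel_Ioc) (auto simp: divide_right_mono add_divide_distrib)
  have "False" if "x \<in> grid_cell p i" "x \<in> grid_cell p j" "i < j" for x i j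
  proof -
    have "real (Suc i) / 2 ^ p \<le> real j / 2 ^ p" using that(3) by (intro divide_right_mono) auto
    then show False using that(1,2) by (auto simp: grid_cell_def)
  qed
  then show "disjoint_family (grid_cell p)" unfolding disjoint_family_on_def
    by (metis Int_emptyI linorder_neqE_nat)
qed (simp add: grid_cell_def)

text \<open>A Poisson random measure all of whose realizations are \<open>good\<close>, not just almost all of them. Events of the
  range then lie in the \<open>\<sigma>\<close>-algebras of regions exactly, not only up to null sets.\<close>

locale good_process = tail_measure xl xr \<nu> for xl xr :: ereal and \<nu> :: "real measure" +
  fixes P :: "'w measure" and N :: "'w \<Rightarrow> (real \<times> real) measure"
  assumes pp: "poisson_process P \<mu>N N" and good_N: "w \<in> space P \<Longrightarrow> good (N w)"
begin

sublocale prob_space P using pp by (rule poisson_process_prob_space)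

abbreviation "region A \<equiv> region_algebra P N \<mu>N ({0..} \<times> A)"

abbreviation cN :: "real \<Rightarrow> real \<Rightarrow> 'w \<Rightarrow> nat" where "cN x t w \<equiv> cn (N w) x t"

lemma region_events: "G \<in> sets (region A) \<Longrightarrow> G \<in> events"
  using region_algebra_events[OF pp] by blast

lemma region_mono: "A \<subseteq> B \<Longrightarrow> G \<in> sets (region A) \<Longrightarrow> G \<in> sets (region B)"
  using region_algebra_mono[of "{0..} \<times> A" "{0..} \<times> B"] by blast

lemma cN_region: "x \<in> I \<Longrightarrow> cN x t \<in> measurable (region (einterval (ereal x) xr)) (count_space UNIV)"
proof -
  assume x: "x \<in> I"
  have "(\<lambda>w. emeasure (N w) ({0..t} \<times> einterval (ereal x) xr)) \<in> borel_measurable (region (einterval (ereal x) xr))"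
    using x by (intro measurable_region_algebra times_sets) auto
  then show ?thesis unfolding cn_def[abs_def] count_def by measurable
qed

lemma cN_measurable: "x \<in> I \<Longrightarrow> cN x t \<in> measurable P (count_space UNIV)"
proof (rule measurableI)
  fix A assume x: "x \<in> I" and "A \<in> sets (count_space UNIV :: nat measure)"
  then have "cN x t -` A \<inter> space (region (einterval (ereal x) xr)) \<in> sets (region (einterval (ereal x) xr))"
    by (intro measurable_sets[OF cN_region])
  then show "cN x t -` A \<inter> space P \<in> events" by (intro region_events) simp
qed simp

lemma cN_increment:
  assumes w: "w \<in> space P" and x: "x \<in> I" and st: "0 \<le> s" "s \<le> t"
  shows "emeasure (N w) ({s<..t} \<times> einterval (ereal x) xr) = of_nat (cN x t w - cN x s w)"
proof -
  note g = good_N[OF w]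
  have "{0..t} \<times> einterval (ereal x) xr = ({0..s} \<times> einterval (ereal x) xr) \<union> ({s<..t} \<times> einterval (ereal x) xr)"
    using st by auto
  moreover have "({0..s} \<times> einterval (ereal x) xr) \<inter> ({s<..t} \<times> einterval (ereal x) xr) = {}" by auto
  moreover have A: "{0..s} \<times> einterval (ereal x) xr \<in> sets (N w)" "{s<..t} \<times> einterval (ereal x) xr \<in> sets (N w)"
    using st x by (auto intro!: times_sets_m[OF g])
  ultimately have "count (N w) x t = count (N w) x s + emeasure (N w) ({s<..t} \<times> einterval (ereal x) xr)"
    unfolding count_def using plus_emeasure[OF A] by simp
  then have "of_nat (cN x t w) = of_nat (cN x s w) + emeasure (N w) ({s<..t} \<times> einterval (ereal x) xr)"
    unfolding of_nat_cn[OF g x] .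
  moreover have "cN x s w \<le> cN x t w" using cn_mono[OF g x x order_refl st(2)] .
  then have "(of_nat (cN x t w) :: ennreal) = of_nat (cN x s w) + of_nat (cN x t w - cN x s w)"
    by (simp flip: of_nat_add)
  ultimately show ?thesis by (simp add: ennreal_add_left_cancel)
qed

lemma cN_band_increment:
  assumes w: "w \<in> space P" and ab: "a \<in> I" "b \<in> I" "a \<le> b" and st: "0 \<le> s" "s \<le> t"
  shows "emeasure (N w) ({s<..t} \<times> {a<..b}) = of_nat ((cN a t w - cN b t w) - (cN a s w - cN b s w))"
proof -
  note g = good_N[OF w]
  have "emeasure (N w) ({s<..t} \<times> einterval (ereal a) xr) = emeasure (N w) ({s<..t} \<times> einterval (ereal b) xr) + emeasure (N w) ({s<..t} \<times> {a<..b})"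
    using st by (intro count_split[OF g ab]) auto
  then have 1: "of_nat (cN a t w - cN a s w) = of_nat (cN b t w - cN b s w) + emeasure (N w) ({s<..t} \<times> {a<..b})"
    unfolding cN_increment[OF w ab(1) st] cN_increment[OF w ab(2) st] .
  have m: "cN b s w \<le> cN a s w" "cN b t w \<le> cN a t w" "cN a s w \<le> cN a t w" "cN b s w \<le> cN b t w"
    "cN a s w + cN b t w \<le> cN a t w + cN b s w"
    using cn_mono[OF g] ab st cn_increment_mono(2)[OF g ab st(2)] by auto
  have "cN a t w - cN a s w = (cN b t w - cN b s w) + ((cN a t w - cN b t w) - (cN a s w - cN b s w))"
    using m by linarith
  then have "(of_nat (cN a t w - cN a s w) :: ennreal) = of_nat (cN b t w - cN b s w) + of_nat ((cN a t w - cN b t w) - (cN a s w - cN b s w))"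
    by (simp flip: of_nat_add)
  then show ?thesis using 1 by (simp add: ennreal_add_left_cancel)
qed

lemma prob_cells:
  assumes B: "B \<in> sets \<nu>" and q: "emeasure \<nu> B = ennreal q" "0 \<le> q"
  shows "prob {w\<in>space P. \<forall>i<K. emeasure (N w) (grid_cell p i \<times> B) = of_nat (d i)} = (\<Prod>i<K. poisson_weight (q / 2 ^ p) (d i))"
proof (cases "K = 0")
  case True then show ?thesis by (simp add: prob_space)
next
  case False
  have s: "grid_cell p i \<times> B \<in> sets \<mu>N" for i by (intro times_sets grid_cell B)
  have m: "emeasure \<mu>N (grid_cell p i \<times> B) = ennreal (q / 2 ^ p)" for i
    using q by (simp add: emeasure_\<mu>N grid_cell B flip: ennreal_mult)
  have w: "prob {w\<in>space P. emeasure (N w) (grid_cell p i \<times> B) = of_nat (d i)} = poisson_weight (q / 2 ^ p) (d i)" for i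
    using poisson_process_weight[OF pp s[of i], of "d i"] q by (simp add: m measure_def poisson_weight_def)
  have "indep_vars (\<lambda>_. borel) (\<lambda>i w. emeasure (N w) (grid_cell p i \<times> B)) {..<K}"
    using grid_cell(4)[of p] s by (intro poisson_process_indep_family[OF pp]) (auto simp: disjoint_family_on_def)
  then have "prob (\<Inter>i\<in>{..<K}. (\<lambda>w. emeasure (N w) (grid_cell p i \<times> B)) -` {of_nat (d i)} \<inter> space P)
     = (\<Prod>i<K. prob ((\<lambda>w. emeasure (N w) (grid_cell p i \<times> B)) -` {of_nat (d i)} \<inter> space P))"
    using False by (intro indep_varsD) auto
  moreover have "(\<Inter>i\<in>{..<K}. (\<lambda>w. emeasure (N w) (grid_cell p i \<times> B)) -` {of_nat (d i)} \<inter> space P)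
     = {w\<in>space P. \<forall>i<K. emeasure (N w) (grid_cell p i \<times> B) = of_nat (d i)}"
    using False by auto
  moreover have "(\<lambda>w. emeasure (N w) (grid_cell p i \<times> B)) -` {of_nat (d i)} \<inter> space P = {w\<in>space P. emeasure (N w) (grid_cell p i \<times> B) = of_nat (d i)}" for i
    by auto
  ultimately show ?thesis by (simp add: w)
qed

text \<open>At least two points: \<open>1 - exp (- m) - m * exp (- m) \<le> m\<^sup>2\<close>.\<close>

lemma prob_cell_ge_2:
  assumes B: "B \<in> sets \<nu>" and q: "emeasure \<nu> B = ennreal q" "0 \<le> q"
  shows "prob {w\<in>space P. emeasure (N w) (grid_cell p i \<times> B) \<notin> {of_nat 0, of_nat 1}} \<le> (q / 2 ^ p)\<^sup>2"
proof -
  have s: "grid_cell p i \<times> B \<in> sets \<mu>N" by (intro times_sets grid_cell B)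
  have m: "emeasure \<mu>N (grid_cell p i \<times> B) = ennreal (q / 2 ^ p)"
    using q by (simp add: emeasure_\<mu>N grid_cell B flip: ennreal_mult)
  let ?E = "\<lambda>k. {w\<in>space P. emeasure (N w) (grid_cell p i \<times> B) = of_nat k}"
  have w: "prob (?E k) = poisson_weight (q / 2 ^ p) k" for k
    using poisson_process_weight[OF pp s, of k] q by (simp add: m measure_def poisson_weight_def)
  have ev: "?E k \<in> events" for k using poisson_process_event[OF pp s, of "{of_nat k}"] by simp
  have "{w\<in>space P. emeasure (N w) (grid_cell p i \<times> B) \<notin> {of_nat 0, of_nat 1}} = space P - (?E 0 \<union> ?E 1)" by auto
  moreover have "prob (space P - (?E 0 \<union> ?E 1)) = 1 - prob (?E 0 \<union> ?E 1)"
    by (intro prob_compl sets.Un ev)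
  moreover have "prob (?E 0 \<union> ?E 1) = prob (?E 0) + prob (?E 1)"
    by (intro finite_measure_Union ev) auto
  ultimately have "prob {w\<in>space P. emeasure (N w) (grid_cell p i \<times> B) \<notin> {of_nat 0, of_nat 1}} = 1 - exp (- (q / 2 ^ p)) - (q / 2 ^ p) * exp (- (q / 2 ^ p))"
    using w[of 0] w[of 1] by (simp add: poisson_weight_def)
  then show ?thesis using poisson_defect(2)[of "q / 2 ^ p"] q by simp
qed

end

section \<open>Descending through finitely many levels\<close>

text \<open>Bad realizations are replaced by one good realization; the set where this happens need only be measurable for the
  completion.\<close>

lemma (in tail_measure) ex_good_process:
  assumes pp: "poisson_process P \<mu>N N"
  obtains N' where "good_process xl xr \<nu> (completion P) N'" "AE w in P. N' w = N w"
proof -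
  interpret prob_space P using pp by (rule poisson_process_prob_space)
  obtain w0 where w0: "good (N w0)" using eventually_happens'[OF ae_filter_bot AE_good[OF pp]] by blast
  define N' where "N' w = (if good (N w) then N w else N w0)" for w
  have ae: "AE w in P. N' w = N w" using AE_good[OF pp] by eventually_elim (simp add: N'_def)
  have g: "good (N' w)" for w using w0 by (simp add: N'_def)
  have "poisson_process (completion P) \<mu>N N'"
    by (rule poisson_process_modification[OF pp ae]) (use sets_m[OF g] in auto)
  then have "good_process xl xr \<nu> (completion P) N'"
    by (intro good_process.intro good_process_axioms.intro tail_measure_axioms g)
  then show ?thesis using ae by (rule that)
qed

context good_process
begin

text \<open>By \<open>void_iff\<close> the event that the range of order \<open>r\<close> misses \<open>(a, b]\<close>.\<close>

definition void_ev :: "nat \<Rightarrow> real \<Rightarrow> real \<Rightarrow> 'w set" where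
  "void_ev r a b = {w\<in>space P. \<forall>p k. r \<le> cN a (real k / 2 ^ p) w \<longrightarrow> r \<le> cN b (real k / 2 ^ p) w}"

lemma cN_region_below:
  assumes "a \<in> I" "b \<in> I" "a \<le> b"
  shows "cN b t \<in> measurable (region (einterval (ereal a) xr)) (count_space UNIV)"
proof (rule measurableI)
  fix A assume "A \<in> sets (count_space UNIV :: nat measure)"
  then have "cN b t -` A \<inter> space (region (einterval (ereal b) xr)) \<in> sets (region (einterval (ereal b) xr))"
    by (rule measurable_sets[OF cN_region[OF assms(2)]])
  then have "cN b t -` A \<inter> space P \<in> sets (region (einterval (ereal b) xr))" by simp
  then show "cN b t -` A \<inter> space (region (einterval (ereal a) xr)) \<in> sets (region (einterval (ereal a) xr))"
    unfolding space_region_algebra by (rule region_mono[OF tail_mono[OF assms(3)]])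
qed simp

lemma void_ev_region:
  assumes ab: "a \<in> I" "b \<in> I" "a \<le> b"
  shows "void_ev r a b \<in> sets (region (einterval (ereal a) xr))"
proof -
  note [measurable] = cN_region_below[OF ab] cN_region_below[OF ab(1) ab(1) order_refl]
  have "{w\<in>space (region (einterval (ereal a) xr)). \<forall>p k. r \<le> cN a (real k / 2 ^ p) w \<longrightarrow> r \<le> cN b (real k / 2 ^ p) w}
     \<in> sets (region (einterval (ereal a) xr))"
    by measurable
  then show ?thesis by (simp add: void_ev_def)
qed

text \<open>The event \<open>G\<close> is decided by the points above \<open>b\<close>, but it is independent of their counting process. This is the
  invariant that is carried down from level to level.\<close>

definition level_inv :: "'w set \<Rightarrow> real \<Rightarrow> bool" where
  "level_inv G b \<longleftrightarrow> G \<in> sets (region (einterval (ereal b) xr)) \<and>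
     (\<forall>p K n. prob {w\<in>G. \<forall>i<K. cN b (real (Suc i) / 2 ^ p) w - cN b (real i / 2 ^ p) w = n i}
        = prob G * (\<Prod>i<K. poisson_weight (Q b / 2 ^ p) (n i)))"

lemma cell_bounds: "0 \<le> real i / 2 ^ p" "real i / 2 ^ p \<le> real (Suc i) / 2 ^ p"
  by (auto simp: divide_right_mono)

lemma level_inv_space:
  assumes b: "b \<in> I" shows "level_inv (space P) b"
  unfolding level_inv_def
proof (intro conjI allI)
  show "space P \<in> sets (region (einterval (ereal b) xr))"
    using sets.top[of "region (einterval (ereal b) xr)"] by simp
  fix p K and n :: "nat \<Rightarrow> nat"
  have "{w\<in>space P. \<forall>i<K. cN b (real (Suc i) / 2 ^ p) w - cN b (real i / 2 ^ p) w = n i}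
    = {w\<in>space P. \<forall>i<K. emeasure (N w) (grid_cell p i \<times> einterval (ereal b) xr) = of_nat (n i)}"
  proof -
    have "emeasure (N w) (grid_cell p i \<times> einterval (ereal b) xr) = of_nat (n i) \<longleftrightarrow> cN b (real (Suc i) / 2 ^ p) w - cN b (real i / 2 ^ p) w = n i"
      if "w \<in> space P" for w i
      unfolding grid_cell_def cN_increment[OF that b cell_bounds] by (rule of_nat_eq_iff)
    then show ?thesis by blast
  qed
  then show "prob {w\<in>space P. \<forall>i<K. cN b (real (Suc i) / 2 ^ p) w - cN b (real i / 2 ^ p) w = n i}
        = prob (space P) * (\<Prod>i<K. poisson_weight (Q b / 2 ^ p) (n i))"
    using prob_cells[OF tail_sets[OF b] emeasure_tail[OF b]] Q_pos[OF b] by (simp add: prob_space less_imp_le)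
qed

text \<open>The points above \<open>b\<close> and those in \<open>(a, b]\<close> are two independent streams with rates \<open>Q b\<close> and \<open>Q a - Q b\<close>, and the
  event of missing \<open>(a, b]\<close> is that the first \<open>r\<close> arrivals all belong to the first stream. The
  invariant for \<open>G\<close> is what makes \<open>G\<close> independent of both streams.\<close>

lemma level_inv_step:
  assumes inv: "level_inv G b" and ab: "a \<in> I" "b \<in> I" "a \<le> b"
  shows "level_inv (G \<inter> void_ev r a b) a" "prob (G \<inter> void_ev r a b) = (Q b / Q a) ^ r * prob G"
proof -
  let ?C = "\<lambda>t w. cN b t w" and ?D = "\<lambda>t w. cN a t w - cN b t w"
  have G: "G \<in> sets (region (einterval (ereal b) xr))"
    and Ginv: "\<And>p K n. prob {w\<in>G. \<forall>i<K. cN b (real (Suc i) / 2 ^ p) w - cN b (real i / 2 ^ p) w = n i}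
        = prob G * (\<Prod>i<K. poisson_weight (Q b / 2 ^ p) (n i))"
    using inv by (auto simp: level_inv_def)
  have Gsp: "G \<subseteq> space P" using sets.sets_into_space[OF G] by simp
  have Qab: "Q b \<le> Q a" "0 < Q b" "0 < Q a" using emeasure_Ioc(2)[OF ab] Q_pos ab by auto
  note mC = cN_measurable[OF ab(2)] and mA = cN_measurable[OF ab(1)]
  have le: "cN b t w \<le> cN a t w" if "w \<in> space P" for t w
    using cn_mono[OF good_N[OF that] ab order_refl] .
  interpret thin: thinning P ?C ?D G "Q b" "Q a - Q b" r
  proof unfold_locales
    show "?C t \<in> measurable P (count_space UNIV)" for t by (rule mC)
    show "?D t \<in> measurable P (count_space UNIV)" for t using mC[of t] mA[of t] by measurable
    fix w assume w: "w \<in> space P"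
    show "?C s w \<le> ?C t w" if "s \<le> t" for s t
      using cn_mono[OF good_N[OF w] ab(2) ab(2) order_refl that] .
    show "?D s w \<le> ?D t w" if "s \<le> t" for s t
      using cn_increment_mono(2)[OF good_N[OF w] ab that] le[OF w, of s] le[OF w, of t] by linarith
    show "?C 0 w = 0" "?D 0 w = 0" using cn_0[OF good_N[OF w]] ab by auto
    show "\<exists>n. r \<le> ?C (real n) w" by (rule cn_unbounded[OF good_N[OF w] ab(2)])
  next
    show "G \<in> events" using G by (rule region_events)
    show "0 < Q b" "0 \<le> Q a - Q b" using Qab by auto
  next
    fix K p and c d :: "nat \<Rightarrow> nat"
    let ?G1 = "{w\<in>G. \<forall>i<K. cN b (real (Suc i) / 2 ^ p) w - cN b (real i / 2 ^ p) w = c i}"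
    let ?G2 = "{w\<in>space P. \<forall>i<K. emeasure (N w) (grid_cell p i \<times> {a<..b}) = of_nat (d i)}"
    have "{w\<in>G. \<forall>i<K. ?C (real (Suc i) / 2^p) w - ?C (real i / 2^p) w = c i
        \<and> ?D (real (Suc i) / 2^p) w - ?D (real i / 2^p) w = d i} = ?G1 \<inter> ?G2"
    proof -
      have "emeasure (N w) (grid_cell p i \<times> {a<..b}) = of_nat (d i) \<longleftrightarrow> ?D (real (Suc i) / 2^p) w - ?D (real i / 2^p) w = d i"
        if "w \<in> G" for w i
        unfolding grid_cell_def cN_band_increment[OF subsetD[OF Gsp that] ab cell_bounds] by (rule of_nat_eq_iff)
      then show ?thesis using Gsp by blast
    qed
    moreover have "prob (?G1 \<inter> ?G2) = prob ?G1 * prob ?G2"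
    proof (rule poisson_process_indep_regions[OF pp])
      show "({0..} \<times> einterval (ereal b) xr) \<inter> ({0..} \<times> {a<..b}) = {}" by (auto simp: einterval_def)
      have "?G1 = G \<inter> {w\<in>space (region (einterval (ereal b) xr)). \<forall>i\<in>{..<K}. cN b (real (Suc i) / 2 ^ p) w - cN b (real i / 2 ^ p) w = c i}"
        using Gsp by auto
      also have "\<dots> \<in> sets (region (einterval (ereal b) xr))"
      proof (intro sets.Int G sets_Collect_Ball_finite finite_lessThan)
        fix i
        note [measurable] = cN_region[OF ab(2)]
        show "{w\<in>space (region (einterval (ereal b) xr)). cN b (real (Suc i) / 2 ^ p) w - cN b (real i / 2 ^ p) w = c i}
          \<in> sets (region (einterval (ereal b) xr))" by measurable
      qed
      finally show "?G1 \<in> sets (region (einterval (ereal b) xr))" .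
      have "?G2 = {w\<in>space (region {a<..b}). \<forall>i\<in>{..<K}. emeasure (N w) (grid_cell p i \<times> {a<..b}) = of_nat (d i)}"
        by auto
      also have "\<dots> \<in> sets (region {a<..b})"
      proof (intro sets_Collect_Ball_finite finite_lessThan)
        fix i
        have [measurable]: "(\<lambda>w. emeasure (N w) (grid_cell p i \<times> {a<..b})) \<in> borel_measurable (region {a<..b})"
          using grid_cell(2)[of p i] by (intro measurable_region_algebra times_sets grid_cell Ioc_sets ab) auto
        show "{w\<in>space (region {a<..b}). emeasure (N w) (grid_cell p i \<times> {a<..b}) = of_nat (d i)} \<in> sets (region {a<..b})"
          by measurable
      qed
      finally show "?G2 \<in> sets (region {a<..b})" .
    qed
    moreover have "prob ?G2 = (\<Prod>i<K. poisson_weight ((Q a - Q b) / 2 ^ p) (d i))"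
      using Qab by (intro prob_cells Ioc_sets ab emeasure_Ioc) auto
    ultimately show "prob {w\<in>G. \<forall>i<K. ?C (real (Suc i) / 2^p) w - ?C (real i / 2^p) w = c i
        \<and> ?D (real (Suc i) / 2^p) w - ?D (real i / 2^p) w = d i}
      = prob G * (\<Prod>i<K. poisson_weight (Q b / 2^p) (c i) * poisson_weight ((Q a - Q b) / 2^p) (d i))"
      using Ginv[of K p c] by (simp add: prod.distrib)
  next
    fix i p
    have "{w\<in>space P. 2 \<le> (?C (real (Suc i) / 2^p) w - ?C (real i / 2^p) w)
        + (?D (real (Suc i) / 2^p) w - ?D (real i / 2^p) w)}
      \<subseteq> {w\<in>space P. emeasure (N w) (grid_cell p i \<times> einterval (ereal a) xr) \<notin> {of_nat 0, of_nat 1}}"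
    proof safe
      fix w assume w: "w \<in> space P" and 2: "2 \<le> (?C (real (Suc i) / 2^p) w - ?C (real i / 2^p) w)
        + (?D (real (Suc i) / 2^p) w - ?D (real i / 2^p) w)"
      have "2 \<le> cN a (real (Suc i) / 2^p) w - cN a (real i / 2^p) w"
        using 2 le[OF w, of "real (Suc i) / 2^p"] le[OF w, of "real i / 2^p"]
          cn_mono[OF good_N[OF w] ab(2) ab(2) order_refl cell_bounds(2)[of i p]]
          cn_increment_mono(2)[OF good_N[OF w] ab cell_bounds(2)[of i p]] by linarith
      then have ne: "cN a (real (Suc i) / 2^p) w - cN a (real i / 2^p) w \<noteq> 0" "cN a (real (Suc i) / 2^p) w - cN a (real i / 2^p) w \<noteq> 1" by auto
      show "emeasure (N w) (grid_cell p i \<times> einterval (ereal a) xr) = of_nat 0 \<Longrightarrow> False"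
        using ne(1) unfolding grid_cell_def cN_increment[OF w ab(1) cell_bounds] of_nat_eq_iff by blast
      show "emeasure (N w) (grid_cell p i \<times> einterval (ereal a) xr) = of_nat 1 \<Longrightarrow> False"
        using ne(2) unfolding grid_cell_def cN_increment[OF w ab(1) cell_bounds] of_nat_eq_iff by blast
    qed
    moreover have "{w\<in>space P. emeasure (N w) (grid_cell p i \<times> einterval (ereal a) xr) \<notin> {of_nat 0, of_nat 1}} \<in> events"
      using poisson_process_event[OF pp times_sets[OF grid_cell(1,2) tail_sets[OF ab(1)]], of "- {of_nat 0, of_nat 1}"] by simp
    ultimately have "prob {w\<in>space P. 2 \<le> (?C (real (Suc i) / 2^p) w - ?C (real i / 2^p) w)
        + (?D (real (Suc i) / 2^p) w - ?D (real i / 2^p) w)}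
      \<le> prob {w\<in>space P. emeasure (N w) (grid_cell p i \<times> einterval (ereal a) xr) \<notin> {of_nat 0, of_nat 1}}"
      by (rule finite_measure_mono)
    also have "\<dots> \<le> (Q a / 2 ^ p)\<^sup>2"
      using Qab by (intro prob_cell_ge_2 tail_sets emeasure_tail ab) auto
    finally show "prob {w\<in>space P. 2 \<le> (?C (real (Suc i) / 2^p) w - ?C (real i / 2^p) w)
        + (?D (real (Suc i) / 2^p) w - ?D (real i / 2^p) w)} \<le> ((Q b + (Q a - Q b)) / 2 ^ p)\<^sup>2" by simp
  qed
  have T: "thin.T t w = cN a t w" if "w \<in> space P" for t w
    using le[OF that] by (simp add: thin.T_def)
  have void: "thin.void = void_ev r a b"
    unfolding thin.void_def void_ev_def by (intro Collect_cong conj_cong refl) (simp add: T)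
  have incT: "thin.incT p i w = cN a (real (Suc i) / 2 ^ p) w - cN a (real i / 2 ^ p) w" if w: "w \<in> space P" for p i w
    using T[OF w, of "real (Suc i) / 2 ^ p"] T[OF w, of "real i / 2 ^ p"] thin.T_sum[OF w, of "Suc i" p] thin.T_sum[OF w, of i p]
    by simp
  have main: "prob {w\<in>G \<inter> void_ev r a b. \<forall>i<K. cN a (real (Suc i) / 2 ^ p) w - cN a (real i / 2 ^ p) w = n i}
     = (Q b / Q a) ^ r * (prob G * (\<Prod>i<K. poisson_weight (Q a / 2 ^ p) (n i)))" for K p n
  proof -
    have "{w\<in>G \<inter> void_ev r a b. \<forall>i<K. cN a (real (Suc i) / 2 ^ p) w - cN a (real i / 2 ^ p) w = n i}
      = {w\<in>G \<inter> thin.void. \<forall>i<K. thin.incT p i w = n i}"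
      unfolding void using Gsp incT by auto
    then show ?thesis using thin.thinning[of K p n] by (simp add: thin.\<kappa>_def)
  qed
  from main[of 0] show p: "prob (G \<inter> void_ev r a b) = (Q b / Q a) ^ r * prob G" by (simp add: Int_def)
  have "G \<inter> void_ev r a b \<in> sets (region (einterval (ereal a) xr))"
    using void_ev_region[OF ab] region_mono[OF tail_mono[OF ab(3)] G] by (rule sets.Int[rotated])
  then show "level_inv (G \<inter> void_ev r a b) a"
    unfolding level_inv_def by (intro conjI allI) (simp_all only: main p mult.assoc)
qed

text \<open>The order \<open>r j\<close> may vary with the band; order \<open>0\<close> imposes no condition, so that arbitrary subfamilies
  of the bands are covered.\<close>

lemma prob_void_chain:
  assumes y: "\<And>j. j \<le> n \<Longrightarrow> y j \<in> I" "\<And>j. j < n \<Longrightarrow> y (Suc j) \<le> y j"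
  shows "level_inv (space P \<inter> (\<Inter>j<n. void_ev (r j) (y (Suc j)) (y j))) (y n) \<and>
     prob (space P \<inter> (\<Inter>j<n. void_ev (r j) (y (Suc j)) (y j))) = (\<Prod>j<n. (Q (y j) / Q (y (Suc j))) ^ r j)"
  using assms
proof (induction n)
  case 0
  then show ?case using level_inv_space[of "y 0"] by (simp add: prob_space)
next
  case (Suc n)
  let ?G = "space P \<inter> (\<Inter>j<n. void_ev (r j) (y (Suc j)) (y j))"
  have IH: "level_inv ?G (y n)" "prob ?G = (\<Prod>j<n. (Q (y j) / Q (y (Suc j))) ^ r j)"
    using Suc by auto
  have "space P \<inter> (\<Inter>j<Suc n. void_ev (r j) (y (Suc j)) (y j)) = ?G \<inter> void_ev (r n) (y (Suc n)) (y n)"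
    by (auto simp: lessThan_Suc)
  then show ?case
    using level_inv_step[OF IH(1), of "y (Suc n)" "r n"] Suc.prems IH(2) by (simp add: mult.commute)
qed

end

section \<open>The range is a Poisson process\<close>

inductive_set monotone_class :: "'a set set \<Rightarrow> 'a set set" for \<A> where
  base: "A \<in> \<A> \<Longrightarrow> A \<in> monotone_class \<A>"
| union: "(\<And>n. A n \<in> monotone_class \<A>) \<Longrightarrow> incseq A \<Longrightarrow> (\<Union>n::nat. A n) \<in> monotone_class \<A>"
| inter: "(\<And>n. A n \<in> monotone_class \<A>) \<Longrightarrow> decseq A \<Longrightarrow> (\<Inter>n::nat. A n) \<in> monotone_class \<A>"

text \<open>Halmos' monotone class theorem in the form needed here: the monotone class of an algebra contains the
  generated \<open>\<sigma>\<close>-algebra. A Dynkin argument would not do for void probabilities, since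
  void events of differences of sets are not determined by those of the sets.\<close>

theorem sigma_sets_subset_monotone_class:
  assumes sub: "\<A> \<subseteq> Pow W" and empty: "{} \<in> \<A>"
    and compl: "\<And>A. A \<in> \<A> \<Longrightarrow> W - A \<in> \<A>" and un: "\<And>A B. A \<in> \<A> \<Longrightarrow> B \<in> \<A> \<Longrightarrow> A \<union> B \<in> \<A>"
  shows "sigma_sets W \<A> \<subseteq> monotone_class \<A>"
proof -
  have c: "W - A \<in> monotone_class \<A>" if "A \<in> monotone_class \<A>" for A
    using that
  proof induction
    case (base A) then show ?case using compl monotone_class.base by blast
  next
    case (union A)
    have "W - (\<Union>n. A n) = (\<Inter>n. W - A n)" by blast
    moreover have "decseq (\<lambda>n. W - A n)" using union.hyps(2) unfolding decseq_def incseq_def by blast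
    ultimately show ?case using union.IH by (simp only: monotone_class.inter)
  next
    case (inter A)
    have "W - (\<Inter>n. A n) = (\<Union>n. W - A n)" by blast
    moreover have "incseq (\<lambda>n. W - A n)" using inter.hyps(2) unfolding decseq_def incseq_def by blast
    ultimately show ?case using inter.IH by (simp only: monotone_class.union)
  qed
  have u1: "A \<union> B \<in> monotone_class \<A>" if "A \<in> monotone_class \<A>" "B \<in> \<A>" for A B
    using that(1)
  proof induction
    case (base A) then show ?case using un that(2) monotone_class.base by blast
  next
    case (union A)
    have "(\<Union>n. A n) \<union> B = (\<Union>n. A n \<union> B)" by blast
    moreover have "incseq (\<lambda>n. A n \<union> B)" using union.hyps(2) by (fastforce simp: incseq_def)
    ultimately show ?case using union.IH by (simp only: monotone_class.union)
  next
    case (inter A)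
    have "(\<Inter>n. A n) \<union> B = (\<Inter>n. A n \<union> B)" by blast
    moreover have "decseq (\<lambda>n. A n \<union> B)" using inter.hyps(2) by (fastforce simp: decseq_def)
    ultimately show ?case using inter.IH by (simp only: monotone_class.inter)
  qed
  have u2: "A \<union> B \<in> monotone_class \<A>" if "A \<in> monotone_class \<A>" "B \<in> monotone_class \<A>" for A B
    using that(2)
  proof induction
    case (base B) then show ?case using u1 that(1) by blast
  next
    case (union B)
    have "A \<union> (\<Union>n. B n) = (\<Union>n. A \<union> B n)" by blast
    moreover have "incseq (\<lambda>n. A \<union> B n)" using union.hyps(2) by (fastforce simp: incseq_def)
    ultimately show ?case using union.IH by (simp only: monotone_class.union)
  next
    case (inter B)
    have "A \<union> (\<Inter>n. B n) = (\<Inter>n. A \<union> B n)" by blast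
    moreover have "decseq (\<lambda>n. A \<union> B n)" using inter.hyps(2) by (fastforce simp: decseq_def)
    ultimately show ?case using inter.IH by (simp only: monotone_class.inter)
  qed
  show ?thesis
  proof
    fix A assume "A \<in> sigma_sets W \<A>"
    then show "A \<in> monotone_class \<A>"
    proof induction
      case (Union A)
      define B where "B n = (\<Union>i\<le>n. A i)" for n
      have "B n \<in> monotone_class \<A>" for n
      proof (induction n)
        case 0 then show ?case using Union(2)[of 0] by (simp add: B_def)
      next
        case (Suc n)
        have "B (Suc n) = B n \<union> A (Suc n)" by (auto simp: B_def atMost_Suc)
        then show ?case using u2[OF Suc Union(2)] by simp
      qed
      moreover have "incseq B" unfolding B_def by (intro incseq_SucI UN_mono) auto
      ultimately have "(\<Union>n. B n) \<in> monotone_class \<A>" by (rule monotone_class.union)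
      also have "(\<Union>n. B n) = (\<Union>n. A n)" by (auto simp: B_def)
      finally show ?case .
    qed (use monotone_class.base empty c in auto)
  qed
qed

text \<open>\<open>A\<close> is a union of the half-open cells into which the points of \<open>E\<close> cut the line. In this form Boolean operations on such
  sets are immediate, as two finite sets \<open>E\<close> can be united.\<close>

definition cut_by :: "real set \<Rightarrow> real set \<Rightarrow> bool" where
  "cut_by E A \<longleftrightarrow> (\<forall>x y. (\<forall>e\<in>E. x \<le> e \<longleftrightarrow> y \<le> e) \<longrightarrow> (x \<in> A \<longleftrightarrow> y \<in> A))"

lemma cut_by_mono: "cut_by E A \<Longrightarrow> E \<subseteq> F \<Longrightarrow> cut_by F A"
  unfolding cut_by_def by blast

lemma cut_by_Ioc: "a \<in> E \<Longrightarrow> b \<in> E \<Longrightarrow> cut_by E {a<..b}"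
  unfolding cut_by_def by (auto simp: not_le[symmetric])

text \<open>The cells are listed from right to left because the levels are visited in descending order.\<close>

lemma cut_by_cells:
  assumes "finite E" and cut: "cut_by E A" and ab: "a \<in> E" "b \<in> E" and sub: "A \<subseteq> {a<..b}" "E \<subseteq> {a..b}"
  obtains n and y :: "nat \<Rightarrow> real" and J where "\<And>j. j \<le> n \<Longrightarrow> y j \<in> E" "\<And>j. j < n \<Longrightarrow> y (Suc j) < y j"
    "J \<subseteq> {..<n}" "A = (\<Union>j\<in>J. {y (Suc j)<..y j})"
proof -
  define L where "L = rev (sorted_list_of_set E)"
  have L: "set L = E" "sorted_wrt (>) L"
    using assms(1) strict_sorted_list_of_set[of E] by (simp_all add: L_def sorted_wrt_rev)
  have len: "length L \<noteq> 0" using L(1) ab by auto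
  define n where "n = length L - 1"
  define y where "y j = L ! j" for j
  have yE: "y j \<in> E" if "j \<le> n" for j
  proof -
    have "j < length L" using that len unfolding n_def by linarith
    then show ?thesis using L(1) nth_mem[of j L] by (simp add: y_def)
  qed
  have dec: "y j < y i" if "i < j" "j \<le> n" for i j
    using sorted_wrt_nth_less[OF L(2) that(1)] that len by (simp add: y_def n_def)
  have Ey: "\<exists>i\<le>n. e = y i" if eE: "e \<in> E" for e
  proof -
    obtain i where "i < length L" "L ! i = e" using eE unfolding L(1)[symmetric] in_set_conv_nth by blast
    then show ?thesis unfolding y_def n_def by (intro exI[of _ i]) auto
  qed
  have ex: "\<exists>j<n. y (Suc j) < x \<and> x \<le> y j" if x: "a < x" "x \<le> b" for x
  proof -
    obtain i where i: "i \<le> n" "a = y i" using Ey[OF ab(1)] by blast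
    define k where "k = (LEAST k. y k < x)"
    have k: "y k < x" "k \<le> i"
      unfolding k_def using x i by (auto intro: LeastI Least_le)
    have "k \<noteq> 0"
    proof
      assume "k = 0"
      obtain i' where "i' \<le> n" "b = y i'" using Ey[OF ab(2)] by blast
      then have "b \<le> y 0" using dec[of 0 i'] by (cases "i' = 0") auto
      then show False using k x \<open>k = 0\<close> by simp
    qed
    then obtain j where j: "k = Suc j" using not0_implies_Suc by blast
    then have "\<not> y j < x" unfolding k_def[symmetric] by (intro not_less_Least[of j "\<lambda>k. y k < x", folded k_def]) simp
    then show ?thesis using j k i by (intro exI[of _ j]) auto
  qed
  have same: "z \<in> A \<longleftrightarrow> x \<in> A" if j: "j < n" and x: "y (Suc j) < x" "x \<le> y j" and z: "y (Suc j) < z" "z \<le> y j" for x z j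
  proof -
    have "z \<le> e \<longleftrightarrow> x \<le> e" if e: "e \<in> E" for e
    proof -
      obtain i where i: "i \<le> n" "e = y i" using Ey[OF e] by blast
      show ?thesis
      proof (cases "i \<le> j")
        case True
        then have "y j \<le> y i" using dec[of i j] j by (cases "i = j") auto
        then show ?thesis using x z i by auto
      next
        case False
        then have "y i \<le> y (Suc j)" using dec[of "Suc j" i] i by (cases "i = Suc j") auto
        then show ?thesis using x z i by auto
      qed
    qed
    then show ?thesis using cut unfolding cut_by_def by blast
  qed
  define J where "J = {j. j < n \<and> y j \<in> A}"
  have "A = (\<Union>j\<in>J. {y (Suc j)<..y j})"
  proof (intro equalityI subsetI)
    fix x assume x: "x \<in> A"
    then have "a < x" "x \<le> b" using sub(1) by auto
    then obtain j where j: "j < n" "y (Suc j) < x" "x \<le> y j" using ex by blast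
    then have "y j \<in> A" using same[OF j, of "y j"] dec[of j "Suc j"] x by simp
    then show "x \<in> (\<Union>j\<in>J. {y (Suc j)<..y j})" using j by (auto simp: J_def)
  next
    fix x assume "x \<in> (\<Union>j\<in>J. {y (Suc j)<..y j})"
    then obtain j where j: "j < n" "y j \<in> A" "y (Suc j) < x" "x \<le> y j" by (auto simp: J_def)
    then show "x \<in> A" using same[OF j(1,3,4), of "y j"] dec[of j "Suc j"] by simp
  qed
  moreover have "J \<subseteq> {..<n}" by (auto simp: J_def)
  ultimately show ?thesis
    by (intro that[of n y J] yE dec) auto
qed

lemma void_weight_incseq:
  assumes "range A \<subseteq> sets \<mu>" "incseq A"
  shows "(\<lambda>n. void_weight \<mu> (A n)) \<longlonglongrightarrow> void_weight \<mu> (\<Union>n. A n)"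
proof (cases "emeasure \<mu> (\<Union>n. A n) = \<infinity>")
  case False
  have fin: "emeasure \<mu> (A n) \<noteq> \<infinity>" for n
  proof -
    have "emeasure \<mu> (A n) \<le> emeasure \<mu> (\<Union>n. A n)" using assms(1) by (intro emeasure_mono) auto
    then show ?thesis using False by (auto simp: top_unique)
  qed
  have "(\<lambda>n. measure \<mu> (A n)) \<longlonglongrightarrow> measure \<mu> (\<Union>n. A n)"
    using assms False by (intro Lim_measure_incseq) auto
  then show ?thesis using False fin by (simp add: void_weight_def tendsto_intros)
next
  case True
  have lim: "(\<lambda>n. emeasure \<mu> (A n)) \<longlonglongrightarrow> \<infinity>"
    using Lim_emeasure_incseq[OF assms] True by simp
  have "(\<lambda>n. void_weight \<mu> (A n)) \<longlonglongrightarrow> 0"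
  proof (rule LIMSEQ_I)
    fix e :: real assume e: "0 < e"
    have "\<forall>\<^sub>F n in sequentially. ennreal (\<bar>ln e\<bar> + 1) < emeasure \<mu> (A n)"
      using order_tendstoD(1)[OF lim] by simp
    then obtain n0 where n0: "\<And>n. n0 \<le> n \<Longrightarrow> ennreal (\<bar>ln e\<bar> + 1) < emeasure \<mu> (A n)"
      by (auto simp: eventually_sequentially)
    show "\<exists>n0. \<forall>n\<ge>n0. norm (void_weight \<mu> (A n) - 0) < e"
    proof (intro exI[of _ n0] allI impI)
      fix n assume n: "n0 \<le> n"
      show "norm (void_weight \<mu> (A n) - 0) < e"
      proof (cases "emeasure \<mu> (A n) = \<infinity>")
        case True then show ?thesis using e by (simp add: void_weight_def)
      next
        case False
        then have "emeasure \<mu> (A n) = ennreal (measure \<mu> (A n))" by (intro emeasure_eq_ennreal_measure) simp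
        then have "\<not> ennreal (measure \<mu> (A n)) \<le> ennreal (\<bar>ln e\<bar> + 1)" using n0[OF n] by (simp add: not_le)
        then have "\<bar>ln e\<bar> + 1 < measure \<mu> (A n)" using ennreal_leI[of "measure \<mu> (A n)" "\<bar>ln e\<bar> + 1"] by linarith
        then have "- measure \<mu> (A n) < ln e" by linarith
        then have "exp (- measure \<mu> (A n)) < exp (ln e)" by (simp only: exp_less_cancel_iff)
        then show ?thesis using e False by (simp add: void_weight_def)
      qed
    qed
  qed
  then show ?thesis using True by (simp add: void_weight_def)
qed

context tail_measure
begin

text \<open>The mean measure \<open>r S\<close> of the range, on all of \<open>(x\<^sub>l, x\<^sub>r)\<close>.\<close>

definition record_measure :: "nat \<Rightarrow> real measure" where
  "record_measure r = scale_measure (of_nat r) (S_measure \<nu> xl xr)"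

lemma sets_record_measure: "sets (record_measure r) = sets (restrict_space borel I)"
  by (simp add: record_measure_def sets_S_measure)

lemma sets_record_measure_iff: "A \<in> sets (record_measure r) \<longleftrightarrow> A \<subseteq> I \<and> A \<in> sets borel"
  unfolding sets_record_measure by (simp add: sets_restrict_space_iff)

lemma emeasure_record_Ioc:
  "a \<in> I \<Longrightarrow> b \<in> I \<Longrightarrow> a \<le> b \<Longrightarrow> emeasure (record_measure r) {a<..b} = ennreal (real r * (S b - S a))"
  using S_mono[of a b] by (simp add: record_measure_def emeasure_S_Ioc ennreal_of_nat_eq_real_of_nat flip: ennreal_mult)

lemma void_weight_Ioc:
  assumes ab: "a \<in> I" "b \<in> I" "a \<le> b"
  shows "void_weight (record_measure r) {a<..b} = (Q b / Q a) ^ r"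
proof -
  have "exp (- (real r * (S b - S a))) = exp (- (S b - S a)) ^ r"
    by (simp add: exp_of_nat_mult[symmetric] algebra_simps)
  also have "exp (- (S b - S a)) = Q b / Q a"
    using Q_pos[OF ab(1)] Q_pos[OF ab(2)] by (simp add: S_Q exp_diff)
  finally show ?thesis
    using S_mono[OF ab] unfolding void_weight_def measure_def emeasure_record_Ioc[OF ab]
    by simp
qed

lemma finite_record_Ioc:
  assumes ab: "a \<in> I" "b \<in> I" "A \<subseteq> {a<..b}" shows "emeasure (record_measure r) A \<noteq> \<infinity>"
proof (cases "a \<le> b")
  case True
  have "{a<..b} \<in> sets (record_measure r)" using I_interval[OF ab(1,2)] by (auto simp: sets_record_measure_iff)
  then have "emeasure (record_measure r) A \<le> emeasure (record_measure r) {a<..b}" using ab(3) by (intro emeasure_mono)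
  then show ?thesis using emeasure_record_Ioc[OF ab(1,2) True, of r] by (auto simp: top_unique)
qed (use ab in auto)

end

context good_process
begin

abbreviation "R r w \<equiv> extremal_range xl xr (N w) r"

definition void_formula :: "nat \<Rightarrow> real set \<Rightarrow> bool" where
  "void_formula r A \<longleftrightarrow> {w\<in>space P. R r w \<inter> A = {}} \<in> events \<and>
     prob {w\<in>space P. R r w \<inter> A = {}} = void_weight (record_measure r) A"

lemma void_formula_cells:
  assumes y: "\<And>j. j \<le> n \<Longrightarrow> y j \<in> I" "\<And>j. j < n \<Longrightarrow> y (Suc j) < y j" and J: "J \<subseteq> {..<n}"
  shows "void_formula r (\<Union>j\<in>J. {y (Suc j)<..y j})"
proof -
  \<comment> \<open>Order \<open>0\<close> on the bands that may be hit.\<close>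
  define rr where "rr j = (if j \<in> J then r else 0)" for j
  let ?G = "space P \<inter> (\<Inter>j<n. void_ev (rr j) (y (Suc j)) (y j))"
  have chain: "level_inv ?G (y n)" "prob ?G = (\<Prod>j<n. (Q (y j) / Q (y (Suc j))) ^ rr j)"
    using prob_void_chain[of n y rr] y by (auto simp: less_imp_le)
  have "{w\<in>space P. R r w \<inter> (\<Union>j\<in>J. {y (Suc j)<..y j}) = {}} = ?G"
  proof -
    have v: "R r w \<inter> {y (Suc j)<..y j} = {} \<longleftrightarrow> w \<in> void_ev r (y (Suc j)) (y j)" if "w \<in> space P" "j < n" for w j
      using void_iff[OF good_N[OF that(1)], of "y (Suc j)" "y j" r] y(1)[of j] y(1)[of "Suc j"] that
      by (simp add: void_ev_def)
    have v0: "space P \<subseteq> void_ev 0 a b" for a b by (auto simp: void_ev_def)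
    have "R r w \<inter> (\<Union>j\<in>J. {y (Suc j)<..y j}) = {} \<longleftrightarrow> (\<forall>j<n. w \<in> void_ev (rr j) (y (Suc j)) (y j))"
      if "w \<in> space P" for w
    proof -
      have "R r w \<inter> (\<Union>j\<in>J. {y (Suc j)<..y j}) = {} \<longleftrightarrow> (\<forall>j\<in>J. R r w \<inter> {y (Suc j)<..y j} = {})" by blast
      also have "\<dots> \<longleftrightarrow> (\<forall>j\<in>J. w \<in> void_ev r (y (Suc j)) (y j))" using v[OF that] J by blast
      also have "\<dots> \<longleftrightarrow> (\<forall>j<n. w \<in> void_ev (rr j) (y (Suc j)) (y j))"
        using J v0 that unfolding rr_def by auto
      finally show ?thesis .
    qed
    then show ?thesis by auto
  qed
  moreover have "?G \<in> events"
    by (rule region_events[OF conjunct1[OF chain(1)[unfolded level_inv_def]]])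
  moreover have "void_weight (record_measure r) (\<Union>j\<in>J. {y (Suc j)<..y j}) = prob ?G"
  proof -
    have dec: "y j \<le> y (Suc i)" if "i < j" "j \<le> n" for i j
      using that
    proof (induction j)
      case (Suc j)
      then show ?case using y(2)[of j] by (cases "i = j") auto
    qed simp
    have disj: "disjoint_family_on (\<lambda>j. {y (Suc j)<..y j}) J"
      unfolding disjoint_family_on_def
    proof safe
      fix i j x assume ij: "i \<in> J" "j \<in> J" "i \<noteq> j" and x: "x \<in> {y (Suc i)<..y i}" "x \<in> {y (Suc j)<..y j}"
      have "i < n" "j < n" using ij J by auto
      then have "y j \<le> y (Suc i) \<or> y i \<le> y (Suc j)" using dec[of i j] dec[of j i] ij by linarith
      then show "x \<in> {}" using x by auto
    qed
    have fin: "finite J" using J finite_subset by blast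
    have "void_weight (record_measure r) (\<Union>j\<in>J. {y (Suc j)<..y j}) = (\<Prod>j\<in>J. void_weight (record_measure r) {y (Suc j)<..y j})"
    proof (rule void_weight_UN[OF fin disj])
      fix j assume "j \<in> J"
      then have "y (Suc j) \<in> I" "y j \<in> I" using J y(1) by auto
      then show "{y (Suc j)<..y j} \<in> sets (record_measure r)"
        using I_interval[of "y (Suc j)" "y j"] by (auto simp: sets_record_measure_iff)
    qed
    also have "\<dots> = (\<Prod>j\<in>J. (Q (y j) / Q (y (Suc j))) ^ r)"
      using J y by (intro prod.cong refl void_weight_Ioc) (auto intro: less_imp_le)
    also have "\<dots> = (\<Prod>j<n. (Q (y j) / Q (y (Suc j))) ^ rr j)"
      using J by (intro prod.mono_neutral_cong_left) (auto simp: rr_def)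
    finally show ?thesis using chain(2) by simp
  qed
  ultimately show ?thesis unfolding void_formula_def by simp
qed

text \<open>Finite unions of intervals form an algebra, and the formula is preserved by monotone limits of sets. For decreasing
  limits this needs that the range is finite in a bounded band: if it misses the intersection, it misses one of the
  sets already.\<close>

lemma void_formula_bounded:
  assumes ab: "a \<in> I" "b \<in> I" "a \<le> b" and A: "A \<in> sets borel"
  shows "void_formula r (A \<inter> {a<..b})"
proof -
  let ?W = "{a<..b}"
  let ?E = "\<lambda>E. finite E \<and> a \<in> E \<and> b \<in> E \<and> E \<subseteq> {a..b}"
  define \<A> where "\<A> = {A. A \<subseteq> ?W \<and> (\<exists>E. ?E E \<and> cut_by E A)}"
  have base': "void_formula r A \<and> A \<in> sets borel" if AA: "A \<in> \<A>" for A
  proof -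
    obtain E where E: "?E E" "cut_by E A" and sub: "A \<subseteq> ?W" using AA unfolding \<A>_def by blast
    from E sub obtain n y J where y: "\<And>j. j \<le> n \<Longrightarrow> y j \<in> E" "\<And>j. j < n \<Longrightarrow> y (Suc j) < y j"
      "J \<subseteq> {..<n}" "A = (\<Union>j\<in>J. {y (Suc j)<..y j})"
      using cut_by_cells[of E A a b] by blast
    have "y j \<in> I" if "j \<le> n" for j using y(1)[OF that] E I_interval[OF ab(1,2)] by blast
    then have "void_formula r A" unfolding y(4) using y(2,3) by (rule void_formula_cells)
    moreover have "A \<in> sets borel"
      unfolding y(4) using finite_subset[OF y(3)] by (intro sets.finite_UN) auto
    ultimately show ?thesis ..
  qed
  have mono: "void_formula r A \<and> A \<subseteq> ?W \<and> A \<in> sets borel" if "A \<in> monotone_class \<A>" for A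
    using that
  proof induction
    case (base A)
    then show ?case using base' unfolding \<A>_def by blast
  next
    case (union A)
    have eq: "{w\<in>space P. R r w \<inter> (\<Union>n. A n) = {}} = (\<Inter>n. {w\<in>space P. R r w \<inter> A n = {}})" by auto
    have "(\<lambda>n. prob {w\<in>space P. R r w \<inter> A n = {}}) \<longlonglongrightarrow> prob (\<Inter>n. {w\<in>space P. R r w \<inter> A n = {}})"
    proof (rule finite_Lim_measure_decseq)
      show "decseq (\<lambda>n. {w\<in>space P. R r w \<inter> A n = {}})"
        using union.hyps(2) by (intro decseq_SucI) (auto simp: incseq_Suc_iff)
    qed (use union.IH in \<open>auto simp: void_formula_def\<close>)
    moreover have "(\<lambda>n. void_weight (record_measure r) (A n)) \<longlonglongrightarrow> void_weight (record_measure r) (\<Union>n. A n)"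
      using union.IH union.hyps(2) I_interval[OF ab(1,2)] by (intro void_weight_incseq) (fastforce simp: sets_record_measure_iff)+
    ultimately have "prob (\<Inter>n. {w\<in>space P. R r w \<inter> A n = {}}) = void_weight (record_measure r) (\<Union>n. A n)"
      using union.IH LIMSEQ_unique unfolding void_formula_def by simp
    then show ?case using union.IH unfolding void_formula_def eq by auto
  next
    case (inter A)
    have eq: "{w\<in>space P. R r w \<inter> (\<Inter>n. A n) = {}} = (\<Union>n. {w\<in>space P. R r w \<inter> A n = {}})"
    proof (intro equalityI subsetI)
      fix w assume w: "w \<in> {w\<in>space P. R r w \<inter> (\<Inter>n. A n) = {}}"
      have fin: "finite (R r w \<inter> ?W)" using w finite_extremal_range[OF good_N ab(1,2)] by blast
      have "\<forall>x\<in>R r w \<inter> ?W. \<exists>n. x \<notin> A n" using w by blast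
      then obtain m where m: "\<And>x. x \<in> R r w \<inter> ?W \<Longrightarrow> x \<notin> A (m x)" by metis
      \<comment> \<open>Each of the finitely many points in the band leaves \<open>A n\<close> at some stage \<open>m x\<close>.\<close>
      define k where "k = Max (insert 0 (m ` (R r w \<inter> ?W)))"
      have "m x \<le> k" if "x \<in> R r w \<inter> ?W" for x
        unfolding k_def using fin that by (intro Max_ge) auto
      then have "A k \<subseteq> A (m x)" if "x \<in> R r w \<inter> ?W" for x
        using inter.hyps(2) that unfolding decseq_def by blast
      then have "R r w \<inter> A k = {}" using m inter.IH[of k] by blast
      then show "w \<in> (\<Union>n. {w\<in>space P. R r w \<inter> A n = {}})" using w by blast
    qed auto
    have "(\<lambda>n. prob {w\<in>space P. R r w \<inter> A n = {}}) \<longlonglongrightarrow> prob (\<Union>n. {w\<in>space P. R r w \<inter> A n = {}})"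
    proof (rule finite_Lim_measure_incseq)
      show "incseq (\<lambda>n. {w\<in>space P. R r w \<inter> A n = {}})"
        using inter.hyps(2) by (intro incseq_SucI) (auto simp: decseq_Suc_iff)
    qed (use inter.IH in \<open>auto simp: void_formula_def\<close>)
    moreover have "(\<lambda>n. void_weight (record_measure r) (A n)) \<longlonglongrightarrow> void_weight (record_measure r) (\<Inter>n. A n)"
    proof -
      have fin: "emeasure (record_measure r) B \<noteq> \<infinity>" if "B \<subseteq> ?W" for B
        using finite_record_Ioc[OF ab(1,2) that] .
      have "(\<lambda>n. measure (record_measure r) (A n)) \<longlonglongrightarrow> measure (record_measure r) (\<Inter>n. A n)"
      proof (rule Lim_measure_decseq[OF _ inter.hyps(2)])
        show "range A \<subseteq> sets (record_measure r)"
          using inter.IH I_interval[OF ab(1,2)] by (fastforce simp: sets_record_measure_iff)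
        show "emeasure (record_measure r) (A i) \<noteq> \<infinity>" for i using fin inter.IH by blast
      qed
      moreover have "(\<Inter>n. A n) \<subseteq> ?W" using inter.IH[of 0] by blast
      ultimately show ?thesis using fin inter.IH by (simp add: void_weight_def tendsto_intros)
    qed
    ultimately have "prob (\<Union>n. {w\<in>space P. R r w \<inter> A n = {}}) = void_weight (record_measure r) (\<Inter>n. A n)"
      using inter.IH LIMSEQ_unique unfolding void_formula_def by simp
    moreover have "(\<Inter>n. A n) \<subseteq> ?W" using inter.IH[of 0] by blast
    ultimately show ?case using inter.IH unfolding void_formula_def eq by auto
  qed
  have sig: "sigma_sets ?W \<A> \<subseteq> monotone_class \<A>"
  proof (rule sigma_sets_subset_monotone_class)
    show "\<A> \<subseteq> Pow ?W" by (auto simp: \<A>_def)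
    show "{} \<in> \<A>" using ab(3) by (auto simp: \<A>_def cut_by_def intro!: exI[of _ "{a, b}"])
    show "?W - A \<in> \<A>" if "A \<in> \<A>" for A
    proof -
      obtain E where E: "?E E" "cut_by E A" using \<open>A \<in> \<A>\<close> unfolding \<A>_def by blast
      have "cut_by E ?W" using E by (intro cut_by_Ioc) auto
      then have "cut_by E (?W - A)" using E(2) unfolding cut_by_def by blast
      then show ?thesis using E(1) unfolding \<A>_def by blast
    qed
    show "A \<union> B \<in> \<A>" if AB: "A \<in> \<A>" "B \<in> \<A>" for A B
    proof -
      obtain E F where E: "?E E" "cut_by E A" "?E F" "cut_by F B" using AB unfolding \<A>_def by blast
      have "cut_by (E \<union> F) A" "cut_by (E \<union> F) B" using E by (auto elim: cut_by_mono)
      then have "cut_by (E \<union> F) (A \<union> B)" unfolding cut_by_def by blast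
      moreover have "?E (E \<union> F)" using E by auto
      ultimately show ?thesis using AB unfolding \<A>_def by blast
    qed
  qed
  have "A \<inter> ?W \<in> sigma_sets ?W \<A>"
  proof -
    have "A \<in> sigma_sets UNIV (range (\<lambda>c. {..c}))"
      using A unfolding borel_eq_atMost by simp
    then show ?thesis
    proof induction
      case (Basic B)
      then obtain c where c: "B = {..c}" by auto
      have "B \<inter> ?W \<in> \<A>"
      proof (cases "a \<le> c \<and> c \<le> b")
        case True
        then have "B \<inter> ?W = {a<..c}" unfolding c by auto
        moreover have "{a<..c} \<in> \<A>"
          using True ab unfolding \<A>_def by (auto intro!: exI[of _ "{a, b, c}"] cut_by_Ioc)
        ultimately show ?thesis by simp
      next
        case False
        then have "B \<inter> ?W = (if c < a then {} else ?W)" unfolding c by auto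
        moreover have "{} \<in> \<A>" "?W \<in> \<A>"
          using ab unfolding \<A>_def by (auto simp: cut_by_def[of _ "{}"] intro!: exI[of _ "{a, b}"] cut_by_Ioc)
        ultimately show ?thesis by simp
      qed
      then show ?case by (rule sigma_sets.Basic)
    next
      case (Compl B)
      have "(UNIV - B) \<inter> ?W = ?W - B \<inter> ?W" by blast
      then show ?case using sigma_sets.Compl[OF Compl.IH] by simp
    next
      case (Union B)
      have "(\<Union>i. B i) \<inter> ?W = (\<Union>i. B i \<inter> ?W)" by blast
      then show ?case using sigma_sets.Union[OF Union.IH] by simp
    qed (simp add: sigma_sets.Empty)
  qed
  then show ?thesis using sig mono by blast
qed

lemma void_formula_borel:
  assumes A: "A \<in> sets (record_measure r)" shows "void_formula r A"
proof -
  obtain l u :: "nat \<Rightarrow> real" where lu: "decseq l" "incseq u" "\<And>i. l i \<in> I" "\<And>i. u i \<in> I" "\<And>i. l i < u i"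
      "(\<lambda>i. ereal (l i)) \<longlonglongrightarrow> xl" "(\<lambda>i. ereal (u i)) \<longlonglongrightarrow> xr"
    by (rule I_approx) (rule that; assumption)
  define B where "B i = A \<inter> {l i<..u i}" for i
  have Ab: "A \<in> sets borel" "A \<subseteq> I" using A by (auto simp: sets_record_measure_iff)
  have B: "void_formula r (B i)" for i
    unfolding B_def using lu Ab by (intro void_formula_bounded) (auto intro: less_imp_le)
  have inc: "incseq B"
  proof (rule incseq_SucI)
    fix n
    have "l (Suc n) \<le> l n" "u n \<le> u (Suc n)" using lu(1,2) by (auto simp: incseq_Suc_iff decseq_Suc_iff)
    then show "B n \<subseteq> B (Suc n)" by (auto simp: B_def)
  qed
  have UB: "(\<Union>i. B i) = A"
  proof (intro equalityI subsetI)
    fix x assume x: "x \<in> A"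
    then have "xl < ereal x" "ereal x < xr" using Ab by (auto simp: einterval_def)
    then have "\<forall>\<^sub>F i in sequentially. ereal (l i) < ereal x" "\<forall>\<^sub>F i in sequentially. ereal x < ereal (u i)"
      using order_tendstoD(2)[OF lu(6)] order_tendstoD(1)[OF lu(7)] by blast+
    then have "\<forall>\<^sub>F i in sequentially. x \<in> B i" by eventually_elim (use x in \<open>auto simp: B_def\<close>)
    then show "x \<in> (\<Union>i. B i)" by (auto simp: eventually_sequentially)
  qed (auto simp: B_def)
  have eq: "{w\<in>space P. R r w \<inter> A = {}} = (\<Inter>n. {w\<in>space P. R r w \<inter> B n = {}})" unfolding UB[symmetric] by auto
  have "(\<lambda>n. prob {w\<in>space P. R r w \<inter> B n = {}}) \<longlonglongrightarrow> prob (\<Inter>n. {w\<in>space P. R r w \<inter> B n = {}})"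
  proof (rule finite_Lim_measure_decseq)
    show "decseq (\<lambda>n. {w\<in>space P. R r w \<inter> B n = {}})"
      using inc by (intro decseq_SucI) (auto simp: incseq_Suc_iff)
  qed (use B in \<open>auto simp: void_formula_def\<close>)
  moreover have "(\<lambda>n. void_weight (record_measure r) (B n)) \<longlonglongrightarrow> void_weight (record_measure r) A"
    unfolding UB[symmetric] using Ab by (intro void_weight_incseq inc) (auto simp: B_def sets_record_measure_iff)
  ultimately have "prob (\<Inter>n. {w\<in>space P. R r w \<inter> B n = {}}) = void_weight (record_measure r) A"
    using B LIMSEQ_unique unfolding void_formula_def by simp
  then show ?thesis using B unfolding void_formula_def eq by auto
qed

lemma poisson_range_good:
  "poisson_process P (record_measure r) (\<lambda>w. points_on (record_measure r) (R r w))"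
proof (rule renyi[where I=I])
  show "prob_space P" by (rule prob_space_axioms)
  show "sigma_finite_measure (record_measure r)"
  proof -
    interpret S: sigma_finite_measure "S_measure \<nu> xl xr" by (rule sigma_finite_S)
    obtain F :: "nat \<Rightarrow> real set" where F: "range F \<subseteq> sets (S_measure \<nu> xl xr)" "(\<Union>i. F i) = space (S_measure \<nu> xl xr)"
      "\<And>i. emeasure (S_measure \<nu> xl xr) (F i) \<noteq> \<infinity>" by (rule S.sigma_finite) (rule that; assumption)
    have sp: "space (record_measure r) = space (S_measure \<nu> xl xr)"
      by (rule sets_eq_imp_space_eq) (simp add: record_measure_def)
    show ?thesis
    proof
      show "\<exists>A. countable A \<and> A \<subseteq> sets (record_measure r) \<and> \<Union>A = space (record_measure r) \<and> (\<forall>a\<in>A. emeasure (record_measure r) a \<noteq> \<infinity>)"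
        using F unfolding sp by (intro exI[of _ "range F"]) (auto simp: record_measure_def ennreal_mult_eq_top_iff)
    qed
  qed
  show "emeasure (record_measure r) {x} = 0" if "x \<in> I" for x
    using emeasure_S_singleton[OF that] by (simp add: record_measure_def)
qed (use void_formula_borel in \<open>auto simp: void_formula_def sets_record_measure\<close>)

end

theorem (in tail_measure) poisson_range:
  assumes pp: "poisson_process P \<mu>N N"
  shows "poisson_process (completion P) (record_measure r) (\<lambda>w. points_on (record_measure r) (extremal_range xl xr (N w) r))"
    and "AE w in P. extremal_range xl xr (N w) r \<subseteq> I"
proof -
  obtain N' where N': "good_process xl xr \<nu> (completion P) N'" and ae: "AE w in P. N' w = N w"
    using ex_good_process[OF pp] by blast
  interpret g: good_process xl xr \<nu> "completion P" N' by (rule N')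
  show "poisson_process (completion P) (record_measure r) (\<lambda>w. points_on (record_measure r) (extremal_range xl xr (N w) r))"
  proof (rule poisson_process_modification[OF g.poisson_range_good, unfolded completion_completion])
    show "AE w in completion P. points_on (record_measure r) (extremal_range xl xr (N w) r) = points_on (record_measure r) (g.R r w)"
      using AE_completion[OF ae] by eventually_elim simp
  qed simp
  show "AE w in P. extremal_range xl xr (N w) r \<subseteq> I"
    using AE_good[OF pp] by eventually_elim (rule extremal_range_subset)
qed

section \<open>Vague convergence\<close>

text \<open>The vague topology is initial for the integrals of functions in \<^const>\<open>Cc_pos\<close>, so that sequences converge if
  all these integrals do.\<close>

lemma limitin_vague:
  assumes "\<And>n. X n \<in> radon_measures" "L \<in> radon_measures"
    and lim: "\<And>f. f \<in> Cc_pos \<Longrightarrow> (\<lambda>n. \<integral>x. f x \<partial>X n) \<longlonglongrightarrow> (\<integral>x. f x \<partial>L)"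
  shows "limitin vague_topology X L sequentially"
proof -
  let ?\<phi> = "\<lambda>\<mu> :: real measure. \<lambda>f\<in>Cc_pos. \<integral>x. f x \<partial>\<mu>"
  let ?T = "product_topology (\<lambda>_. euclideanreal) Cc_pos"
  have lp: "limitin ?T (\<lambda>n. ?\<phi> (X n)) (?\<phi> L) sequentially"
    unfolding limitin_componentwise using lim by (auto simp: PiE_iff)
  show ?thesis unfolding limitin_def
  proof (intro conjI allI impI)
    show "L \<in> topspace vague_topology"
      using assms(2) by (auto simp: vague_topology_def topspace_pullback_topology PiE_iff)
    fix U assume U: "openin vague_topology U \<and> L \<in> U"
    then obtain V where V: "openin ?T V" "U = ?\<phi> -` V \<inter> radon_measures"
      unfolding vague_topology_def openin_pullback_topology by blast
    have "?\<phi> L \<in> V" using U V by auto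
    then have "\<forall>\<^sub>F n in sequentially. ?\<phi> (X n) \<in> V" using lp V(1) unfolding limitin_def by blast
    then show "\<forall>\<^sub>F n in sequentially. X n \<in> U" unfolding V(2) by eventually_elim (use assms(1) in auto)
  qed
qed

lemma topspace_vague: "topspace vague_topology = radon_measures"
  by (auto simp: vague_topology_def topspace_pullback_topology PiE_iff)

lemma continuous_map_vague_limit:
  assumes F: "continuous_map (prod_topology vague_topology vague_topology) euclideanreal F"
    and X: "\<And>n. X n \<in> radon_measures" "L \<in> radon_measures" "\<And>f. f \<in> Cc_pos \<Longrightarrow> (\<lambda>n. \<integral>x. f x \<partial>X n) \<longlonglongrightarrow> (\<integral>x. f x \<partial>L)"
    and Y: "\<And>n. Y n \<in> radon_measures" "K \<in> radon_measures" "\<And>f. f \<in> Cc_pos \<Longrightarrow> (\<lambda>n. \<integral>x. f x \<partial>Y n) \<longlonglongrightarrow> (\<integral>x. f x \<partial>K)"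
  shows "(\<lambda>n. F (X n, Y n)) \<longlonglongrightarrow> F (L, K)"
proof -
  have "limitin (prod_topology vague_topology vague_topology) (\<lambda>n. (X n, Y n)) (L, K) sequentially"
    unfolding limitin_pairwise using limitin_vague[OF X] limitin_vague[OF Y] by (simp add: comp_def)
  from continuous_map_limit[OF F this] show ?thesis by (simp add: comp_def)
qed

lemma Cc_posE:
  assumes "f \<in> Cc_pos"
  obtains \<beta> B where "0 < \<beta>" "0 \<le> B" "\<And>x. \<bar>f x\<bar> \<le> B" "\<And>x. f x \<noteq> 0 \<Longrightarrow> 0 < x \<and> x \<le> \<beta>" "continuous_on UNIV f"
proof -
  obtain K where K: "compact K" "K \<subseteq> {0<..}" "\<And>x. x \<notin> K \<Longrightarrow> f x = 0" and f: "continuous_on UNIV f"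
    using assms by (auto simp: Cc_pos_def)
  obtain b where b: "\<And>x. x \<in> K \<Longrightarrow> \<bar>x\<bar> \<le> b"
    using compact_imp_bounded[OF K(1)] unfolding bounded_iff by auto
  have cf: "compact (f ` K)" using f K(1) by (intro compact_continuous_image) (auto intro: continuous_on_subset)
  then obtain B where B: "\<And>x. x \<in> K \<Longrightarrow> \<bar>f x\<bar> \<le> B"
    using compact_imp_bounded[OF cf] unfolding bounded_iff by auto
  show ?thesis
  proof (rule that[of "max b 1" "max B 0"])
    show "\<bar>f x\<bar> \<le> max B 0" for x using B[of x] K(3)[of x] by (cases "x \<in> K") auto
    show "0 < x \<and> x \<le> max b 1" if "f x \<noteq> 0" for x
      using K(2,3) b[of x] that by (cases "x \<in> K") fastforce+
  qed (use f in auto)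
qed

lemma sets_pos_reals_iff: "A \<in> sets pos_reals \<longleftrightarrow> A \<subseteq> {0<..} \<and> A \<in> sets borel"
  by (simp add: sets_restrict_space_iff)

lemma space_pos: "sets \<mu> = sets pos_reals \<Longrightarrow> space \<mu> = {0<..}"
  by (drule sets_eq_imp_space_eq) (simp add: space_restrict_space)

lemma measurable_pos: "sets \<mu> = sets pos_reals \<Longrightarrow> f \<in> borel_measurable borel \<Longrightarrow> f \<in> borel_measurable \<mu>"
  by (auto intro: measurable_restrict_space1 cong: measurable_cong_sets)

section \<open>Discretization\<close>

lemma grid_cell_sets: "grid_cell m i \<in> sets pos_reals"
proof -
  have "0 < x" if "real i / 2 ^ m < x" for x
  proof -
    have "0 \<le> real i / 2 ^ m" by simp
    then show ?thesis using that by linarith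
  qed
  then show ?thesis by (auto simp: sets_pos_reals_iff grid_cell_def)
qed

lemma grid_cell_pos: "grid_cell m i \<subseteq> {0<..}"
  using grid_cell_sets by (simp add: sets_pos_reals_iff)

text \<open>The discretized measure: the \<open>i\<close>-th number of the list is the mass placed at the right end point of the
  \<open>i\<close>-th cell.\<close>

definition grid_measure :: "nat \<Rightarrow> nat list \<Rightarrow> real measure" where
  "grid_measure m ns = distr (point_measure {..<length ns} (\<lambda>i. ennreal (real (ns ! i)))) pos_reals (\<lambda>i. real (Suc i) / 2 ^ m)"

text \<open>The cells up to \<open>m * 2 ^ m\<close> cover \<open>(0, m]\<close>.\<close>

definition grid_counts :: "nat \<Rightarrow> real measure \<Rightarrow> nat list" where
  "grid_counts m \<mu> = map (\<lambda>i. nat \<lfloor>enn2real (emeasure \<mu> (grid_cell m i))\<rfloor>) [0..<m * 2 ^ m]"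

lemma grid_point_measurable: "(\<lambda>i. real (Suc i) / 2 ^ m) \<in> measurable (point_measure {..<n} f) pos_reals"
  unfolding measurable_point_measure_eq1 by (auto simp: space_restrict_space)

lemma grid_measure_radon: "grid_measure m ns \<in> radon_measures"
proof -
  have "emeasure (grid_measure m ns) K < \<infinity>" for K
  proof -
    have "emeasure (grid_measure m ns) K \<le> emeasure (grid_measure m ns) (space (grid_measure m ns))"
      by (rule emeasure_space)
    also have "\<dots> = (\<Sum>i<length ns. ennreal (real (ns ! i)))"
    proof -
      have e: "(\<lambda>i. real (Suc i) / 2 ^ m) -` {0<..} \<inter> space (point_measure {..<length ns} (\<lambda>i. ennreal (real (ns ! i)))) = {..<length ns}"
        by (auto simp: space_point_measure)
      have "space (grid_measure m ns) = {0<..}" by (simp add: grid_measure_def space_restrict_space)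
      moreover have "emeasure (grid_measure m ns) {0<..} = emeasure (point_measure {..<length ns} (\<lambda>i. ennreal (real (ns ! i)))) {..<length ns}"
        using emeasure_distr[OF grid_point_measurable[where m=m and n="length ns" and f="\<lambda>i. ennreal (real (ns ! i))"], of "{0<..}"]
        unfolding grid_measure_def e by (simp add: sets_restrict_space_iff)
      ultimately show ?thesis by (simp add: emeasure_point_measure_finite)
    qed
    also have "\<dots> < \<infinity>" by simp
    finally show ?thesis .
  qed
  then show ?thesis by (simp add: radon_measures_def grid_measure_def)
qed

lemma integral_grid_measure:
  assumes "f \<in> borel_measurable borel"
  shows "(\<integral>x. f x \<partial>grid_measure m ns) = (\<Sum>i<length ns. real (ns ! i) * f (real (Suc i) / 2 ^ m))"
proof -
  have "(\<integral>x. f x \<partial>grid_measure m ns) = (\<integral>i. f (real (Suc i) / 2 ^ m) \<partial>point_measure {..<length ns} (\<lambda>i. ennreal (real (ns ! i))))"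
    unfolding grid_measure_def by (rule integral_distr[OF grid_point_measurable]) (use measurable_restrict_space1[OF assms] in auto)
  also have "\<dots> = (\<Sum>i<length ns. real (ns ! i) * f (real (Suc i) / 2 ^ m))"
    by (subst lebesgue_integral_point_measure_finite) auto
  finally show ?thesis .
qed

text \<open>Stronger than being a Radon measure: the mass near \<open>0\<close> is finite, too. This is what makes the generalized
  inverse of \<open>x \<mapsto> \<mu>(0, x]\<close> meaningful.\<close>

definition finite_initial :: "real measure \<Rightarrow> bool" where
  "finite_initial \<mu> \<longleftrightarrow> sets \<mu> = sets pos_reals \<and> (\<forall>x>0. emeasure \<mu> {0<..x} < \<infinity>)"

definition integral_on_grids :: "real measure \<Rightarrow> bool" where
  "integral_on_grids \<mu> \<longleftrightarrow> (\<forall>m i. emeasure \<mu> (grid_cell m i) \<in> range of_nat)"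

lemma finite_initial_radon: "finite_initial \<mu> \<Longrightarrow> \<mu> \<in> radon_measures"
proof -
  assume n: "finite_initial \<mu>"
  have "emeasure \<mu> K < \<infinity>" if K: "compact K" "K \<subseteq> {0<..}" for K
  proof -
    obtain b where b: "\<And>x. x \<in> K \<Longrightarrow> \<bar>x\<bar> \<le> b" using compact_imp_bounded[OF K(1)] unfolding bounded_iff by auto
    have "K \<subseteq> {0<..max b 1}"
    proof
      fix x assume "x \<in> K"
      then have "0 < x" "\<bar>x\<bar> \<le> b" using K(2) b by auto
      then show "x \<in> {0<..max b 1}" by auto
    qed
    moreover have "{0<..max b 1} \<in> sets \<mu>" using n by (auto simp: finite_initial_def sets_pos_reals_iff)
    ultimately have "emeasure \<mu> K \<le> emeasure \<mu> {0<..max b 1}" by (rule emeasure_mono)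
    also have "\<dots> < \<infinity>" using n by (simp add: finite_initial_def)
    finally show ?thesis .
  qed
  then show ?thesis using n by (auto simp: radon_measures_def finite_initial_def)
qed

lemma grid_cells_union:
  assumes "0 < x" "x \<le> real m" shows "\<exists>i<m * 2 ^ m. x \<in> grid_cell m i"
proof -
  define i where "i = nat (\<lceil>x * 2 ^ m\<rceil> - 1)"
  have pos: "0 < x * 2 ^ m" using assms by simp
  have c: "real_of_int \<lceil>x * 2 ^ m\<rceil> - 1 < x * 2 ^ m" "x * 2 ^ m \<le> real_of_int \<lceil>x * 2 ^ m\<rceil>" by linarith+
  have "1 \<le> \<lceil>x * 2 ^ m\<rceil>" using pos by linarith
  then have i: "real i = real_of_int \<lceil>x * 2 ^ m\<rceil> - 1" by (simp add: i_def)
  have "x * 2 ^ m \<le> real m * 2 ^ m" using assms by (intro mult_right_mono) auto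
  then have "\<lceil>x * 2 ^ m\<rceil> \<le> int (m * 2 ^ m)" by (simp add: ceiling_le_iff)
  then have "i < m * 2 ^ m" using \<open>1 \<le> \<lceil>x * 2 ^ m\<rceil>\<close> by (simp add: i_def nat_less_iff)
  moreover have "x \<in> grid_cell m i"
    unfolding grid_cell_def using c i by (simp add: field_simps)
  ultimately show ?thesis by blast
qed

text \<open>The integral of \<open>f\<close> for the discretized measure is the integral of a step function, constant on the cells, which
  converges to \<open>f\<close> by continuity.\<close>

lemma grid_integral_tendsto:
  assumes n: "finite_initial \<mu>" and z: "integral_on_grids \<mu>" and f: "f \<in> Cc_pos"
  shows "(\<lambda>m. \<integral>x. f x \<partial>grid_measure m (grid_counts m \<mu>)) \<longlonglongrightarrow> (\<integral>x. f x \<partial>\<mu>)"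
proof -
  obtain \<beta> B where B: "0 < \<beta>" "0 \<le> B" "\<And>x. \<bar>f x\<bar> \<le> B" "\<And>x. f x \<noteq> 0 \<Longrightarrow> 0 < x \<and> x \<le> \<beta>" and cont: "continuous_on UNIV f"
    using f by (rule Cc_posE) (rule that; assumption)
  have fm: "f \<in> borel_measurable borel" using cont by (rule borel_measurable_continuous_onI)
  have s: "sets \<mu> = sets pos_reals" using n by (simp add: finite_initial_def)
  have cell: "grid_cell m i \<in> sets \<mu>" for m i
    unfolding s by (rule grid_cell_sets)
  have cell_fin: "emeasure \<mu> (grid_cell m i) < \<infinity>" for m i
  proof -
    obtain k where "emeasure \<mu> (grid_cell m i) = of_nat k" using z unfolding integral_on_grids_def by blast
    then show ?thesis by (simp add: of_nat_less_top)
  qed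
  define h where "h m x = (\<Sum>i<m * 2 ^ m. f (real (Suc i) / 2 ^ m) * indicator (grid_cell m i) x)" for m x
  have "(\<integral>x. f x \<partial>grid_measure m (grid_counts m \<mu>)) = (\<integral>x. h m x \<partial>\<mu>)" for m
  proof -
    have "real (nat \<lfloor>enn2real (emeasure \<mu> (grid_cell m i))\<rfloor>) = measure \<mu> (grid_cell m i)" for i
    proof -
      obtain k where "emeasure \<mu> (grid_cell m i) = of_nat k" using z unfolding integral_on_grids_def by blast
      then show ?thesis by (simp add: measure_def enn2real_of_nat)
    qed
    then have "(\<integral>x. f x \<partial>grid_measure m (grid_counts m \<mu>)) = (\<Sum>i<m * 2 ^ m. measure \<mu> (grid_cell m i) * f (real (Suc i) / 2 ^ m))"
      unfolding integral_grid_measure[OF fm] by (simp add: grid_counts_def)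
    also have "\<dots> = (\<Sum>i<m * 2 ^ m. \<integral>x. f (real (Suc i) / 2 ^ m) * indicator (grid_cell m i) x \<partial>\<mu>)"
    proof (rule sum.cong[OF refl])
      fix i
      have "grid_cell m i \<inter> space \<mu> = grid_cell m i" using sets.sets_into_space[OF cell] by auto
      then show "measure \<mu> (grid_cell m i) * f (real (Suc i) / 2 ^ m) = (\<integral>x. f (real (Suc i) / 2 ^ m) * indicator (grid_cell m i) x \<partial>\<mu>)"
        by simp
    qed
    also have "\<dots> = (\<integral>x. h m x \<partial>\<mu>)"
      unfolding h_def using cell cell_fin
      by (intro Bochner_Integration.integral_sum[symmetric] integrable_mult_right integrable_real_indicator)
    finally show ?thesis .
  qed
  moreover have "(\<lambda>m. \<integral>x. h m x \<partial>\<mu>) \<longlonglongrightarrow> (\<integral>x. f x \<partial>\<mu>)"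
  proof (rule integral_dominated_convergence[where w="\<lambda>x. B * indicator {0<..\<beta>} x"])
    show "f \<in> borel_measurable \<mu>" using s fm by (rule measurable_pos)
    show "h m \<in> borel_measurable \<mu>" for m
      unfolding h_def[abs_def] using cell by (intro borel_measurable_sum borel_measurable_times borel_measurable_indicator) auto
    show "integrable \<mu> (\<lambda>x. B * indicator {0<..\<beta>} x)"
      using n B(1) by (intro integrable_mult_right integrable_real_indicator) (auto simp: finite_initial_def sets_pos_reals_iff)
    have hval: "h m x = f (real (Suc i) / 2 ^ m)" if "x \<in> grid_cell m i" "i < m * 2 ^ m" for m i x
    proof -
      have "x \<notin> grid_cell m j" if "j \<noteq> i" for j
        using grid_cell(4)[of m] that \<open>x \<in> grid_cell m i\<close> unfolding disjoint_family_on_def by blast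
      then have "h m x = (\<Sum>j<m * 2 ^ m. if j = i then f (real (Suc i) / 2 ^ m) else 0)"
        unfolding h_def using that(1) by (intro sum.cong) (auto simp: indicator_def)
      then show ?thesis using that(2) by simp
    qed
    show "AE x in \<mu>. (\<lambda>m. h m x) \<longlonglongrightarrow> f x"
    proof (rule AE_I2)
      fix x assume "x \<in> space \<mu>"
      then have x: "0 < x" using space_pos[OF s] by simp
      obtain M :: nat where M: "x \<le> real M" using real_arch_simple by blast
      have "\<exists>y. \<forall>m\<ge>M. h m x = f (y m) \<and> \<bar>y m - x\<bar> \<le> (1/2)^m"
      proof (rule choice, rule allI)
        fix m show "\<exists>y. M \<le> m \<longrightarrow> h m x = f y \<and> \<bar>y - x\<bar> \<le> (1/2)^m"
        proof (cases "M \<le> m")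
          case True
          then have "x \<le> real m" using M by linarith
          then obtain i where i: "i < m * 2 ^ m" "x \<in> grid_cell m i" using grid_cells_union[OF x] by blast
          have "\<bar>real (Suc i) / 2 ^ m - x\<bar> \<le> (1/2)^m"
            using i(2) by (auto simp: grid_cell_def power_one_over add_divide_distrib abs_le_iff)
          then show ?thesis using hval[OF i(2,1)] by blast
        qed auto
      qed
      then obtain y where y: "\<And>m. M \<le> m \<Longrightarrow> h m x = f (y m)" "\<And>m. M \<le> m \<Longrightarrow> \<bar>y m - x\<bar> \<le> (1/2)^m" by blast
      have "(\<lambda>m. (1/2::real) ^ m) \<longlonglongrightarrow> 0" by (rule LIMSEQ_realpow_zero) auto
      then have "(\<lambda>m. y m - x) \<longlonglongrightarrow> 0"
        by (rule Lim_null_comparison[rotated]) (use y(2) in \<open>auto simp: eventually_sequentially\<close>)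
      then have "y \<longlonglongrightarrow> x" by (rule LIM_zero_cancel)
      then have "(\<lambda>m. f (y m)) \<longlonglongrightarrow> f x"
        using cont by (intro isCont_tendsto_compose[of x f]) (auto simp: continuous_on_eq_continuous_at)
      moreover have "\<forall>\<^sub>F m in sequentially. f (y m) = h m x"
        unfolding eventually_sequentially using y(1) by metis
      ultimately show "(\<lambda>m. h m x) \<longlonglongrightarrow> f x" by (rule Lim_transform_eventually)
    qed
    fix m
    show "AE x in \<mu>. norm (h m x) \<le> B * indicator {0<..\<beta>} x"
    proof (rule AE_I2)
      fix x assume "x \<in> space \<mu>"
      then have x: "0 < x" using space_pos[OF s] by simp
      show "norm (h m x) \<le> B * indicator {0<..\<beta>} x"
      proof (cases "\<exists>i<m * 2 ^ m. x \<in> grid_cell m i")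
        case True
        then obtain i where i: "i < m * 2 ^ m" "x \<in> grid_cell m i" by blast
        have "x \<le> real (Suc i) / 2 ^ m" using i(2) by (simp add: grid_cell_def)
        then show ?thesis using hval[OF i(2,1)] B(3)[of "real (Suc i) / 2 ^ m"] B(4)[of "real (Suc i) / 2 ^ m"] x
          by (cases "f (real (Suc i) / 2 ^ m) = 0") (auto simp: indicator_def B(2))
      next
        case False
        then have "h m x = 0" unfolding h_def by (intro sum.neutral) (auto simp: indicator_def)
        then show ?thesis using B(2) by simp
      qed
    qed
  qed
  ultimately show ?thesis by simp
qed

section \<open>Expectations of vaguely continuous functions of Poisson processes\<close>

lemma grid_counts_eq_sets:
  "{\<mu>\<in>space (measures_algebra pos_reals). grid_counts m \<mu> = ns} \<in> sets (measures_algebra pos_reals)"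
proof -
  let ?M = "measures_algebra pos_reals"
  have cell: "grid_cell m i \<in> sets pos_reals" for i
    by (rule grid_cell_sets)
  have "(\<lambda>\<mu>. nat \<lfloor>enn2real (emeasure \<mu> (grid_cell m i))\<rfloor>) \<in> measurable ?M (count_space UNIV)" for i
    using measurable_emeasure_measures_algebra[OF cell, of i] by measurable
  then have "{\<mu>\<in>space ?M. nat \<lfloor>enn2real (emeasure \<mu> (grid_cell m i))\<rfloor> = k} \<in> sets ?M" for i k
    by measurable
  then have "{\<mu>\<in>space ?M. \<forall>i\<in>{..<m * 2 ^ m}. nat \<lfloor>enn2real (emeasure \<mu> (grid_cell m i))\<rfloor> = ns ! i} \<in> sets ?M"
    by (intro sets_Collect_Ball_finite) auto
  moreover have "grid_counts m \<mu> = ns \<longleftrightarrow> length ns = m * 2 ^ m \<and> (\<forall>i\<in>{..<m * 2 ^ m}. nat \<lfloor>enn2real (emeasure \<mu> (grid_cell m i))\<rfloor> = ns ! i)" for \<mu>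
    by (auto simp: grid_counts_def list_eq_iff_nth_eq)
  ultimately show ?thesis by (cases "length ns = m * 2 ^ m") auto
qed

lemma poisson_process_AE_finite_initial:
  assumes pp: "poisson_process P \<mu> X" and n: "finite_initial \<mu>"
  shows "AE w in P. finite_initial (X w) \<and> integral_on_grids (X w)"
proof -
  have s: "sets \<mu> = sets pos_reals" using n by (simp add: finite_initial_def)
  have fin: "emeasure \<mu> A < \<infinity>" if "A \<subseteq> {0<..real k}" for A k
  proof -
    have "emeasure \<mu> A \<le> emeasure \<mu> {0<..real k + 1}"
      using that by (intro emeasure_mono) (auto simp: s sets_pos_reals_iff)
    also have "\<dots> < \<infinity>" using n by (simp add: finite_initial_def)
    finally show ?thesis .
  qed
  have 1: "AE w in P. \<forall>k. emeasure (X w) {0<..real k} \<in> range of_nat"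
    unfolding AE_all_countable
    using fin by (intro allI poisson_process_AE_nat[OF pp]) (auto simp: s sets_pos_reals_iff)
  have 2: "AE w in P. \<forall>m i. emeasure (X w) (grid_cell m i) \<in> range of_nat"
    unfolding AE_all_countable
  proof (intro allI poisson_process_AE_nat[OF pp])
    fix m i
    note sub = grid_cell_pos[of m i]
    show "grid_cell m i \<in> sets \<mu>" unfolding s by (rule grid_cell_sets)
    obtain k :: nat where "real (Suc i) / 2 ^ m \<le> real k" using real_arch_simple by blast
    then have "grid_cell m i \<subseteq> {0<..real k}" using sub by (auto simp: grid_cell_def)
    then show "emeasure \<mu> (grid_cell m i) < \<infinity>" by (rule fin)
  qed
  have 3: "AE w in P. sets (X w) = sets pos_reals" using poisson_process_sets[OF pp] s by (intro AE_I2) simp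
  show ?thesis using 1 2 3
  proof eventually_elim
    case (elim w)
    have "emeasure (X w) {0<..x} < \<infinity>" if "0 < x" for x
    proof -
      obtain k :: nat where "x \<le> real k" using real_arch_simple by blast
      then have "emeasure (X w) {0<..x} \<le> emeasure (X w) {0<..real k}"
        using elim(3) by (intro emeasure_mono) (auto simp: sets_pos_reals_iff)
      moreover have "emeasure (X w) {0<..real k} \<in> range of_nat" using elim(1) by blast
      ultimately show ?thesis by (auto elim!: le_less_trans simp: of_nat_less_top)
    qed
    then show ?case using elim by (simp add: finite_initial_def integral_on_grids_def)
  qed
qed

lemma prob_grid_counts:
  assumes pp: "poisson_process P \<mu> X" and n: "finite_initial \<mu>"
  shows "measure P {w\<in>space P. grid_counts m (X w) = ns} =
    (if length ns = m * 2 ^ m then \<Prod>i<m * 2 ^ m. poisson_weight (measure \<mu> (grid_cell m i)) (ns ! i) else 0)"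
proof (cases "length ns = m * 2 ^ m")
  case False
  then have e: "{w\<in>space P. grid_counts m (X w) = ns} = {}" by (auto simp: grid_counts_def)
  show ?thesis unfolding e using False by simp
next
  case True
  interpret prob_space P using pp by (rule poisson_process_prob_space)
  have s: "sets \<mu> = sets pos_reals" using n by (simp add: finite_initial_def)
  have cell: "grid_cell m i \<in> sets \<mu>" for i
    unfolding s by (rule grid_cell_sets)
  have fin: "emeasure \<mu> (grid_cell m i) < \<infinity>" for i
  proof -
    have "emeasure \<mu> (grid_cell m i) \<le> emeasure \<mu> {0<..real (Suc i) / 2 ^ m}"
      using sets.sets_into_space[OF cell[of i]] space_pos[OF s]
      by (intro emeasure_mono) (auto simp: s sets_pos_reals_iff grid_cell_def)
    also have "\<dots> < \<infinity>" using n by (simp add: finite_initial_def)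
    finally show ?thesis .
  qed
  let ?E = "\<lambda>i. {w\<in>space P. emeasure (X w) (grid_cell m i) = of_nat (ns ! i)}"
  have ev: "?E i \<in> events" for i using poisson_process_event[OF pp cell, of "{of_nat (ns ! i)}" i] by simp
  have w: "prob (?E i) = poisson_weight (measure \<mu> (grid_cell m i)) (ns ! i)" for i
    using poisson_process_weight[OF pp cell fin] by (simp add: poisson_weight_def)
  have "X \<in> measurable P (measures_algebra pos_reals)"
    using pp unfolding poisson_process_def measures_algebra_cong[OF s] by blast
  from measurable_sets[OF this grid_counts_eq_sets[of m ns]]
  have evG: "{w\<in>space P. grid_counts m (X w) = ns} \<in> events"
  proof -
    have "X -` {\<mu>\<in>space (measures_algebra pos_reals). grid_counts m \<mu> = ns} \<inter> space P = {w\<in>space P. grid_counts m (X w) = ns}"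
      using poisson_process_sets[OF pp] s by (auto simp: space_measures_algebra)
    then show ?thesis using measurable_sets[OF \<open>X \<in> _\<close> grid_counts_eq_sets[of m ns]] by simp
  qed
  have "prob {w\<in>space P. grid_counts m (X w) = ns} = prob {w\<in>space P. \<forall>i\<in>{..<m * 2 ^ m}. emeasure (X w) (grid_cell m i) = of_nat (ns ! i)}"
  proof (rule finite_measure_eq_AE)
    show "AE w in P. (w \<in> {w\<in>space P. grid_counts m (X w) = ns}) = (w \<in> {w\<in>space P. \<forall>i\<in>{..<m * 2 ^ m}. emeasure (X w) (grid_cell m i) = of_nat (ns ! i)})"
      using poisson_process_AE_finite_initial[OF pp n]
    proof eventually_elim
      case (elim w)
      have "nat \<lfloor>enn2real (emeasure (X w) (grid_cell m i))\<rfloor> = k \<longleftrightarrow> emeasure (X w) (grid_cell m i) = of_nat k" for i k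
      proof -
        obtain j where j: "emeasure (X w) (grid_cell m i) = of_nat j" using elim unfolding integral_on_grids_def by blast
        then show ?thesis by (simp add: enn2real_of_nat)
      qed
      then show ?case using True by (auto simp: grid_counts_def list_eq_iff_nth_eq)
    qed
  qed (use evG ev in \<open>auto intro!: sets_Collect_Ball_finite\<close>)
  also have "\<dots> = (\<Prod>i<m * 2 ^ m. poisson_weight (measure \<mu> (grid_cell m i)) (ns ! i))"
  proof (cases "m * 2 ^ m = 0")
    case True then show ?thesis by (simp add: prob_space)
  next
    case False
    have "indep_vars (\<lambda>_. borel) (\<lambda>i w. emeasure (X w) (grid_cell m i)) {..<m * 2 ^ m}"
      using grid_cell(4)[of m] cell
      by (intro poisson_process_indep_family[OF pp]) (auto simp: disjoint_family_on_def)
    then have "prob (\<Inter>i\<in>{..<m * 2 ^ m}. (\<lambda>w. emeasure (X w) (grid_cell m i)) -` {of_nat (ns ! i)} \<inter> space P)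
       = (\<Prod>i<m * 2 ^ m. prob ((\<lambda>w. emeasure (X w) (grid_cell m i)) -` {of_nat (ns ! i)} \<inter> space P))"
      using False by (intro indep_varsD) (auto simp: lessThan_empty_iff)
    moreover have "(\<Inter>i\<in>{..<m * 2 ^ m}. (\<lambda>w. emeasure (X w) (grid_cell m i)) -` {of_nat (ns ! i)} \<inter> space P)
       = {w\<in>space P. \<forall>i\<in>{..<m * 2 ^ m}. emeasure (X w) (grid_cell m i) = of_nat (ns ! i)}"
      using False by (auto simp: lessThan_empty_iff)
    moreover have "(\<lambda>w. emeasure (X w) (grid_cell m i)) -` {of_nat (ns ! i)} \<inter> space P = ?E i" for i by auto
    ultimately show ?thesis by (simp add: w)
  qed
  finally show ?thesis using True by simp
qed

lemma grid_counts_event: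
  assumes pp: "poisson_process P \<mu> X" and n: "finite_initial \<mu>"
  shows "{w\<in>space P. grid_counts m (X w) = ns} \<in> sets P"
proof -
  have s: "sets \<mu> = sets pos_reals" using n by (simp add: finite_initial_def)
  have X: "X \<in> measurable P (measures_algebra pos_reals)"
    using pp unfolding poisson_process_def measures_algebra_cong[OF s] by blast
  have "X -` {\<mu>\<in>space (measures_algebra pos_reals). grid_counts m \<mu> = ns} \<inter> space P = {w\<in>space P. grid_counts m (X w) = ns}"
    using poisson_process_sets[OF pp] s by (auto simp: space_measures_algebra)
  then show ?thesis using measurable_sets[OF X grid_counts_eq_sets[of m ns]] by simp
qed

lemma grid_counts_measurable:
  assumes pp: "poisson_process P \<mu> X" and n: "finite_initial \<mu>"
  shows "(\<lambda>w. grid_counts m (X w)) \<in> measurable P (count_space UNIV)"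
proof (subst measurable_count_space_eq2_countable, safe)
  fix ns
  have "(\<lambda>w. grid_counts m (X w)) -` {ns} \<inter> space P = {w\<in>space P. grid_counts m (X w) = ns}" by auto
  then show "(\<lambda>w. grid_counts m (X w)) -` {ns} \<inter> space P \<in> sets P" using grid_counts_event[OF pp n] by simp
qed auto

lemma grid_pair_measurable:
  assumes "poisson_process P \<mu> X" "finite_initial \<mu>" "poisson_process P \<kappa> Y" "finite_initial \<kappa>"
  shows "(\<lambda>w. (grid_counts m (X w), grid_counts m (Y w))) \<in> measurable P (count_space UNIV)"
proof -
  have "(\<lambda>w. (grid_counts m (X w), grid_counts m (Y w))) \<in> measurable P (count_space UNIV \<Otimes>\<^sub>M count_space UNIV)"
    by (intro measurable_Pair grid_counts_measurable[OF assms(1,2)] grid_counts_measurable[OF assms(3,4)])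
  then show ?thesis by (simp add: pair_measure_countable)
qed

definition grid_value :: "(real measure \<times> real measure \<Rightarrow> real) \<Rightarrow> nat \<Rightarrow> nat list \<times> nat list \<Rightarrow> real" where
  "grid_value F m z = F (grid_measure m (fst z), grid_measure m (snd z))"

text \<open>A function that is continuous for the vague topology need not be measurable for the \<open>\<sigma>\<close>-algebra of evaluations in
  any evident way. Along the discretizations, which take countably many values, it is; and these converge vaguely almost surely.\<close>

theorem vague_expectation:
  fixes F :: "real measure \<times> real measure \<Rightarrow> real"
  assumes X: "poisson_process P \<mu> X" "finite_initial \<mu>" and Y: "poisson_process P \<kappa> Y" "finite_initial \<kappa>"
    and F: "continuous_map (prod_topology vague_topology vague_topology) euclideanreal F"
    and bdd: "bounded (F ` topspace (prod_topology vague_topology vague_topology))"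
  shows "integrable (completion P) (\<lambda>w. F (X w, Y w))" (is ?int)
    and "(\<lambda>m. \<integral>w. grid_value F m (grid_counts m (X w), grid_counts m (Y w)) \<partial>P) \<longlonglongrightarrow> (\<integral>w. F (X w, Y w) \<partial>completion P)" (is ?lim)
proof -
  interpret prob_space P using X(1) by (rule poisson_process_prob_space)
  interpret c: prob_space "completion P" by (rule prob_space_completion_M)
  obtain B where B: "\<And>z. z \<in> topspace (prod_topology vague_topology vague_topology) \<Longrightarrow> \<bar>F z\<bar> \<le> B"
    using bdd unfolding bounded_iff by auto
  define g where "g m w = grid_value F m (grid_counts m (X w), grid_counts m (Y w))" for m w
  have g: "g m \<in> borel_measurable P" for m
    unfolding g_def[abs_def] by (rule measurable_compose[OF grid_pair_measurable[OF X Y]]) simp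
  have gB: "\<bar>g m w\<bar> \<le> B" for m w
    unfolding g_def grid_value_def by (rule B) (simp add: topspace_vague grid_measure_radon)
  have lim: "AE w in P. (\<lambda>m. g m w) \<longlonglongrightarrow> F (X w, Y w)"
    using poisson_process_AE_finite_initial[OF X] poisson_process_AE_finite_initial[OF Y]
  proof eventually_elim
    case (elim w)
    then show ?case unfolding g_def grid_value_def fst_conv snd_conv
      by (intro continuous_map_vague_limit[OF F] grid_measure_radon finite_initial_radon grid_integral_tendsto) auto
  qed
  have meas: "(\<lambda>w. F (X w, Y w)) \<in> borel_measurable (completion P)"
  proof (rule measurable_completion_AE)
    show "(\<lambda>w. lim (\<lambda>m. g m w)) \<in> borel_measurable P" using g by (rule borel_measurable_lim_metric)
    show "AE w in P. F (X w, Y w) = lim (\<lambda>m. g m w)" using lim by eventually_elim (simp add: limI)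
  qed simp
  have dc: "integrable (completion P) (\<lambda>w. F (X w, Y w)) \<and> (\<lambda>m. \<integral>w. g m w \<partial>completion P) \<longlonglongrightarrow> (\<integral>w. F (X w, Y w) \<partial>completion P)"
  proof -
    have w: "integrable (completion P) (\<lambda>_. B)" by (rule c.integrable_const)
    have b: "AE w in completion P. norm (g m w) \<le> B" for m using gB by (intro AE_I2) simp
    note * = meas measurable_completion[OF g] w AE_completion[OF lim] b
    show ?thesis using integrable_dominated_convergence[OF *] integral_dominated_convergence[OF *] by (rule conjI)
  qed
  then show ?int by simp
  show ?lim using dc integral_completion[OF g] unfolding g_def by simp
qed

lemma measure_grid_pair:
  assumes X: "poisson_process P \<mu> X" "finite_initial \<mu>" and Y: "poisson_process P \<kappa> Y" "finite_initial \<kappa>"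
    and ind: "prob_space.indep_var P (measures_algebra pos_reals) X (measures_algebra pos_reals) Y"
  shows "measure P {w\<in>space P. (grid_counts m (X w), grid_counts m (Y w)) = (ns, ks)} =
    measure P {w\<in>space P. grid_counts m (X w) = ns} * measure P {w\<in>space P. grid_counts m (Y w) = ks}"
proof -
  interpret prob_space P using X(1) by (rule poisson_process_prob_space)
  let ?G = "\<lambda>ns. {\<mu>\<in>space (measures_algebra pos_reals). grid_counts m \<mu> = ns}"
  have s: "X w \<in> space (measures_algebra pos_reals)" "Y w \<in> space (measures_algebra pos_reals)" if "w \<in> space P" for w
    using poisson_process_sets[OF X(1) that] poisson_process_sets[OF Y(1) that] X(2) Y(2)
    by (auto simp: space_measures_algebra finite_initial_def)
  have "prob ((\<lambda>w. (X w, Y w)) -` (?G ns \<times> ?G ks) \<inter> space P) = prob (X -` ?G ns \<inter> space P) * prob (Y -` ?G ks \<inter> space P)"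
    by (rule indep_varD[OF ind grid_counts_eq_sets grid_counts_eq_sets])
  moreover have "(\<lambda>w. (X w, Y w)) -` (?G ns \<times> ?G ks) \<inter> space P = {w\<in>space P. (grid_counts m (X w), grid_counts m (Y w)) = (ns, ks)}"
    using s by auto
  moreover have "X -` ?G ns \<inter> space P = {w\<in>space P. grid_counts m (X w) = ns}" "Y -` ?G ks \<inter> space P = {w\<in>space P. grid_counts m (Y w) = ks}"
    using s by auto
  ultimately show ?thesis by simp
qed

text \<open>By \<open>vague_expectation\<close> the expectation is a limit of expectations of functions of finitely many cell counts, and
  the law of these is determined by the means and by independence.\<close>

theorem same_expectation:
  fixes F :: "real measure \<times> real measure \<Rightarrow> real"
  assumes X: "poisson_process P \<mu> X" "finite_initial \<mu>" and Y: "poisson_process P \<kappa> Y" "finite_initial \<kappa>"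
    and ind: "prob_space.indep_var P (measures_algebra pos_reals) X (measures_algebra pos_reals) Y"
    and X': "poisson_process P' \<mu> X'" and Y': "poisson_process P' \<kappa> Y'"
    and ind': "prob_space.indep_var P' (measures_algebra pos_reals) X' (measures_algebra pos_reals) Y'"
    and F: "continuous_map (prod_topology vague_topology vague_topology) euclideanreal F"
    and bdd: "bounded (F ` topspace (prod_topology vague_topology vague_topology))"
  shows "(\<integral>w. F (X w, Y w) \<partial>completion P) = (\<integral>w. F (X' w, Y' w) \<partial>completion P')"
proof -
  have "(\<integral>w. grid_value F m (grid_counts m (X w), grid_counts m (Y w)) \<partial>P)
      = (\<integral>w. grid_value F m (grid_counts m (X' w), grid_counts m (Y' w)) \<partial>P')" for m
  proof -
    let ?V = "\<lambda>w. (grid_counts m (X w), grid_counts m (Y w))"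
    let ?V' = "\<lambda>w. (grid_counts m (X' w), grid_counts m (Y' w))"
    note V = grid_pair_measurable[OF X Y, of m] and V' = grid_pair_measurable[OF X' X(2) Y' Y(2), of m]
    interpret p: prob_space P using X(1) by (rule poisson_process_prob_space)
    interpret p': prob_space P' using X' by (rule poisson_process_prob_space)
    have "distr P (count_space UNIV) ?V = distr P' (count_space UNIV) ?V'"
    proof (rule measure_eqI_countable[where A=UNIV])
      fix z :: "nat list \<times> nat list"
      obtain ns ks where z: "z = (ns, ks)" by (cases z)
      have pre: "?V -` {z} \<inter> space P = {w\<in>space P. ?V w = (ns, ks)}" "?V' -` {z} \<inter> space P' = {w\<in>space P'. ?V' w = (ns, ks)}"
        unfolding z by auto
      have "measure P {w\<in>space P. ?V w = (ns, ks)} = measure P' {w\<in>space P'. ?V' w = (ns, ks)}"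
        unfolding measure_grid_pair[OF X Y ind] measure_grid_pair[OF X' X(2) Y' Y(2) ind']
          prob_grid_counts[OF X] prob_grid_counts[OF Y] prob_grid_counts[OF X' X(2)] prob_grid_counts[OF Y' Y(2)] ..
      then show "emeasure (distr P (count_space UNIV) ?V) {z} = emeasure (distr P' (count_space UNIV) ?V') {z}"
        unfolding emeasure_distr[OF V, of "{z}", simplified pre, simplified] emeasure_distr[OF V', of "{z}", simplified pre, simplified]
        by (simp add: emeasure_distr[OF V] emeasure_distr[OF V'] pre p.emeasure_eq_measure p'.emeasure_eq_measure)
    qed auto
    then have "(\<integral>z. grid_value F m z \<partial>distr P (count_space UNIV) ?V) = (\<integral>z. grid_value F m z \<partial>distr P' (count_space UNIV) ?V')" by simp
    then show ?thesis by (simp add: integral_distr[OF V] integral_distr[OF V'])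
  qed
  then show ?thesis
    using vague_expectation(2)[OF X Y F bdd] vague_expectation(2)[OF X' X(2) Y' Y(2) F bdd]
    by (simp add: LIMSEQ_unique)
qed

section \<open>Coupling\<close>

text \<open>The intervals \<open>(0, x]\<close> are a generator, stable under intersection, of finite measure.\<close>

lemma finite_initial_eqI:
  assumes n: "finite_initial \<mu>" and s: "sets \<nu> = sets pos_reals" and eq: "\<And>x. 0 < x \<Longrightarrow> emeasure \<nu> {0<..x} = emeasure \<mu> {0<..x}"
  shows "\<nu> = \<mu>"
proof -
  have s': "sets \<mu> = sets pos_reals" using n by (simp add: finite_initial_def)
  have m: "(\<lambda>x. x) \<in> measurable \<nu> borel" "(\<lambda>x. x) \<in> measurable \<mu> borel"
    by (rule measurable_pos[OF s], simp, rule measurable_pos[OF s'], simp)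
  have e: "emeasure (distr \<nu> borel (\<lambda>x. x)) {..x} = emeasure (distr \<mu> borel (\<lambda>x. x)) {..x}"
    "emeasure (distr \<nu> borel (\<lambda>x. x)) {..x} \<noteq> \<infinity>" for x :: real
  proof -
    have "{..x} \<inter> {0<..} = {0<..x}" by auto
    then have *: "emeasure (distr \<nu> borel (\<lambda>x. x)) {..x} = emeasure \<nu> {0<..x}" "emeasure (distr \<mu> borel (\<lambda>x. x)) {..x} = emeasure \<mu> {0<..x}"
      using space_pos[OF s] space_pos[OF s'] by (simp_all add: emeasure_distr[OF m(1)] emeasure_distr[OF m(2)])
    have "emeasure \<nu> {0<..x} = emeasure \<mu> {0<..x} \<and> emeasure \<mu> {0<..x} \<noteq> \<infinity>"
      using eq[of x] n by (cases "0 < x") (auto simp: finite_initial_def)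
    then show "emeasure (distr \<nu> borel (\<lambda>x. x)) {..x} = emeasure (distr \<mu> borel (\<lambda>x. x)) {..x}"
      "emeasure (distr \<nu> borel (\<lambda>x. x)) {..x} \<noteq> \<infinity>" unfolding * by auto
  qed
  have d: "distr \<nu> borel (\<lambda>x. x) = distr \<mu> borel (\<lambda>x. x)"
  proof (rule measure_eqI_generator_eq[where E="range atMost" and \<Omega>=UNIV and A="\<lambda>i. {..real i}"])
    show "Int_stable (range (atMost :: real \<Rightarrow> real set))"
    proof (rule Int_stableI, elim rangeE)
      fix a b x y assume "a = {..x::real}" "b = {..y::real}"
      then have "a \<inter> b = {..min x y}" by auto
      then show "a \<inter> b \<in> range atMost" by blast
    qed
    have "\<exists>i. x \<le> real i" for x by (rule real_arch_simple)
    then show "(\<Union>i. {..real i}) = UNIV" by auto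
    show "sets (distr \<nu> borel (\<lambda>x. x)) = sigma_sets UNIV (range atMost)"
      "sets (distr \<mu> borel (\<lambda>x. x)) = sigma_sets UNIV (range atMost)"
      unfolding sets_distr by (subst borel_eq_atMost, rule sets_measure_of, simp)+
  qed (use e in auto)
  show ?thesis
  proof (rule measure_eqI)
    show "sets \<nu> = sets \<mu>" by (simp only: s s')
    fix A assume "A \<in> sets \<nu>"
    then have A: "A \<in> sets borel" "A \<subseteq> {0<..}" by (simp_all add: s sets_pos_reals_iff)
    have "emeasure (distr \<nu> borel (\<lambda>x. x)) A = emeasure (distr \<mu> borel (\<lambda>x. x)) A" unfolding d ..
    then show "emeasure \<nu> A = emeasure \<mu> A"
      using A space_pos[OF s] space_pos[OF s'] by (simp add: emeasure_distr[OF m(1)] emeasure_distr[OF m(2)] Int_absorb2)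
  qed
qed

text \<open>The levels \<open>v\<close> that are reached by \<open>x \<mapsto> \<mu>(0, x]\<close>, that is, the domain of its generalized inverse.\<close>

definition mass_dom :: "real measure \<Rightarrow> real set" where
  "mass_dom \<mu> = {v. 0 < v \<and> (\<exists>x>0. ennreal v \<le> emeasure \<mu> {0<..x})}"

definition mass_quantile :: "real measure \<Rightarrow> real \<Rightarrow> real" where
  "mass_quantile \<mu> v = Inf {x. 0 < x \<and> ennreal v \<le> emeasure \<mu> {0<..x}}"

lemma finite_initial_mono: "finite_initial \<mu> \<Longrightarrow> x \<le> y \<Longrightarrow> emeasure \<mu> {0<..x} \<le> emeasure \<mu> {0<..y}"
  by (intro emeasure_mono) (auto simp: finite_initial_def sets_pos_reals_iff)

lemma finite_initial_right_limit:
  assumes n: "finite_initial \<mu>" and a: "0 \<le> a"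
  shows "(\<lambda>k. emeasure \<mu> {0<..a + inverse (real (Suc k))}) \<longlonglongrightarrow> emeasure \<mu> {0<..a}"
proof -
  have "(\<lambda>k. emeasure \<mu> {0<..a + inverse (real (Suc k))}) \<longlonglongrightarrow> emeasure \<mu> (\<Inter>k. {0<..a + inverse (real (Suc k))})"
  proof (rule Lim_emeasure_decseq)
    show "decseq (\<lambda>k. {0<..a + inverse (real (Suc k))})"
      by (intro decseq_SucI) (auto elim!: order_trans simp: le_imp_inverse_le)
    show "range (\<lambda>k. {0<..a + inverse (real (Suc k))}) \<subseteq> sets \<mu>"
      using n by (auto simp: finite_initial_def sets_pos_reals_iff)
    fix k
    have "0 < a + inverse (real (Suc k))" using a by (intro add_nonneg_pos) auto
    then show "emeasure \<mu> {0<..a + inverse (real (Suc k))} \<noteq> \<infinity>" using n by (auto simp: finite_initial_def)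
  qed
  moreover have "(\<Inter>k. {0<..a + inverse (real (Suc k))}) = {0<..a}"
  proof (intro equalityI subsetI)
    fix x assume x: "x \<in> (\<Inter>k. {0<..a + inverse (real (Suc k))})"
    have "(\<lambda>k. a + inverse (real (Suc k))) \<longlonglongrightarrow> a + 0" by (intro tendsto_add tendsto_const LIMSEQ_inverse_real_of_nat)
    then have "x \<le> a" using x by (intro LIMSEQ_le_const) auto
    then show "x \<in> {0<..a}" using x by auto
  qed (auto intro: add_increasing2)
  ultimately show ?thesis by simp
qed

text \<open>The infimum is attained by right continuity of \<open>x \<mapsto> \<mu>(0, x]\<close>.\<close>

lemma mass_quantile:
  assumes n: "finite_initial \<mu>" and v: "v \<in> mass_dom \<mu>"
  shows "0 < mass_quantile \<mu> v" "0 < x \<Longrightarrow> mass_quantile \<mu> v \<le> x \<longleftrightarrow> ennreal v \<le> emeasure \<mu> {0<..x}"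
proof -
  let ?S = "{x. 0 < x \<and> ennreal v \<le> emeasure \<mu> {0<..x}}"
  have v0: "0 < v" and ne: "?S \<noteq> {}" using v by (auto simp: mass_dom_def)
  have "(\<lambda>k. emeasure \<mu> {0<..0 + inverse (real (Suc k))}) \<longlonglongrightarrow> emeasure \<mu> {0<..0::real}"
    by (rule finite_initial_right_limit[OF n]) simp
  then have "\<forall>\<^sub>F k in sequentially. emeasure \<mu> {0<..0 + inverse (real (Suc k))} < ennreal v"
    using v0 by (intro order_tendstoD(2)) auto
  then obtain k where k: "emeasure \<mu> {0<..inverse (real (Suc k))} < ennreal v"
    by (auto simp: eventually_sequentially)
  have lb: "inverse (real (Suc k)) \<le> x" if "x \<in> ?S" for x
  proof (rule ccontr)
    assume "\<not> inverse (real (Suc k)) \<le> x"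
    then have "emeasure \<mu> {0<..x} \<le> emeasure \<mu> {0<..inverse (real (Suc k))}" by (intro finite_initial_mono[OF n]) simp
    then show False using that k by (auto dest: order_trans simp: not_le[symmetric])
  qed
  have bdd: "bdd_below ?S" using lb by (intro bdd_belowI)
  have "inverse (real (Suc k)) \<le> mass_quantile \<mu> v" unfolding mass_quantile_def using ne lb by (rule cInf_greatest)
  then show pos: "0 < mass_quantile \<mu> v" by (rule less_le_trans[rotated]) simp
  have att: "ennreal v \<le> emeasure \<mu> {0<..mass_quantile \<mu> v}"
  proof (rule LIMSEQ_le_const[OF finite_initial_right_limit[OF n less_imp_le[OF pos]]], intro exI allI impI)
    fix j :: nat
    have "mass_quantile \<mu> v < mass_quantile \<mu> v + inverse (real (Suc j))" by simp
    then obtain x where x: "x \<in> ?S" "x < mass_quantile \<mu> v + inverse (real (Suc j))"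
      unfolding mass_quantile_def by (rule cInf_lessD[OF ne, THEN bexE])
    then have "ennreal v \<le> emeasure \<mu> {0<..x}" by simp
    also have "\<dots> \<le> emeasure \<mu> {0<..mass_quantile \<mu> v + inverse (real (Suc j))}" using x by (intro finite_initial_mono[OF n]) simp
    finally show "ennreal v \<le> emeasure \<mu> {0<..mass_quantile \<mu> v + inverse (real (Suc j))}" .
  qed
  show "mass_quantile \<mu> v \<le> x \<longleftrightarrow> ennreal v \<le> emeasure \<mu> {0<..x}" if "0 < x"
  proof
    assume "mass_quantile \<mu> v \<le> x"
    from finite_initial_mono[OF n this] show "ennreal v \<le> emeasure \<mu> {0<..x}" by (rule order_trans[OF att])
  next
    assume "ennreal v \<le> emeasure \<mu> {0<..x}"
    then show "mass_quantile \<mu> v \<le> x" unfolding mass_quantile_def using that bdd by (intro cInf_lower) auto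
  qed
qed

lemma mass_dom_borel: "finite_initial \<mu> \<Longrightarrow> mass_dom \<mu> \<in> sets borel"
proof -
  assume n: "finite_initial \<mu>"
  have fin: "emeasure \<mu> {0<..real (Suc k)} = ennreal (measure \<mu> {0<..real (Suc k)})" for k
    using n by (intro emeasure_eq_ennreal_measure) (auto simp: finite_initial_def less_top)
  have "mass_dom \<mu> = (\<Union>k. {0<..measure \<mu> {0<..real (Suc k)}})"
  proof (intro equalityI subsetI)
    fix v assume "v \<in> mass_dom \<mu>"
    then obtain x where v: "0 < v" "ennreal v \<le> emeasure \<mu> {0<..x}" by (auto simp: mass_dom_def)
    obtain k :: nat where "x \<le> real k" using real_arch_simple by blast
    then have "ennreal v \<le> ennreal (measure \<mu> {0<..real (Suc k)})"
      unfolding fin[symmetric] using v(2) finite_initial_mono[OF n, of x "real (Suc k)"] by (intro order_trans[OF v(2)]) simp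
    then have "v \<le> measure \<mu> {0<..real (Suc k)}" by (simp add: ennreal_le_iff)
    then show "v \<in> (\<Union>k. {0<..measure \<mu> {0<..real (Suc k)}})" using v by auto
  next
    fix v assume "v \<in> (\<Union>k. {0<..measure \<mu> {0<..real (Suc k)}})"
    then obtain k where v: "0 < v" "v \<le> measure \<mu> {0<..real (Suc k)}" by auto
    then have "ennreal v \<le> emeasure \<mu> {0<..real (Suc k)}" unfolding fin by (intro ennreal_leI)
    then show "v \<in> mass_dom \<mu>" using v by (auto simp: mass_dom_def intro!: exI[of _ "real (Suc k)"])
  qed
  then show ?thesis by simp
qed

text \<open>For \<open>s = 1\<close> the positive and for \<open>s = -1\<close> the negative half-line is used, so that the two sides of a pair are built
  from disjoint parts of one process and are independent.\<close>

definition signed_dom :: "real \<Rightarrow> real measure \<Rightarrow> real set" where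
  "signed_dom s \<mu> = {u. s * u \<in> mass_dom \<mu>}"

text \<open>The points of \<open>U\<close> mapped by the generalized inverse of \<open>x \<mapsto> \<mu>(0, x]\<close>: a function of \<open>U\<close> that turns Lebesgue mean into
  mean \<open>\<mu>\<close>, simultaneously for all \<open>\<mu>\<close>.\<close>

definition coupled :: "real \<Rightarrow> real measure \<Rightarrow> real measure \<Rightarrow> real measure" where
  "coupled s \<mu> U = distr (restrict_space U (signed_dom s \<mu>)) pos_reals (\<lambda>u. mass_quantile \<mu> (s * u))"

lemma signed_dom_borel: "finite_initial \<mu> \<Longrightarrow> signed_dom s \<mu> \<in> sets borel"
proof -
  assume n: "finite_initial \<mu>"
  have "(\<lambda>u. s * u) -` mass_dom \<mu> \<inter> space borel \<in> sets borel"
    by (rule measurable_sets[OF _ mass_dom_borel[OF n]]) simp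
  then show ?thesis by (simp add: signed_dom_def vimage_def)
qed

lemma coupled_map_measurable:
  assumes n: "finite_initial \<mu>"
  shows "(\<lambda>u. mass_quantile \<mu> (s * u)) \<in> measurable (restrict_space borel (signed_dom s \<mu>)) pos_reals"
proof (rule measurable_restrict_space2)
  show "(\<lambda>u. mass_quantile \<mu> (s * u)) \<in> space (restrict_space borel (signed_dom s \<mu>)) \<rightarrow> {0<..}"
    using mass_quantile(1)[OF n] by (auto simp: space_restrict_space signed_dom_def)
  have "mono_on (mass_dom \<mu>) (mass_quantile \<mu>)"
  proof (rule mono_onI)
    fix v w assume vw: "v \<in> mass_dom \<mu>" "w \<in> mass_dom \<mu>" "v \<le> w"
    have pos: "0 < mass_quantile \<mu> w" by (rule mass_quantile(1)[OF n vw(2)])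
    have "ennreal w \<le> emeasure \<mu> {0<..mass_quantile \<mu> w}" using mass_quantile(2)[OF n vw(2) pos] by simp
    then have "ennreal v \<le> emeasure \<mu> {0<..mass_quantile \<mu> w}" using ennreal_leI[OF vw(3)] by (rule order_trans[rotated])
    then show "mass_quantile \<mu> v \<le> mass_quantile \<mu> w" using mass_quantile(2)[OF n vw(1) pos] by simp
  qed
  then have q: "mass_quantile \<mu> \<in> borel_measurable (restrict_space borel (mass_dom \<mu>))"
    by (rule borel_measurable_mono_on_fnc)
  have "(\<lambda>u. s * u) \<in> measurable (restrict_space borel (signed_dom s \<mu>)) (restrict_space borel (mass_dom \<mu>))"
    by (intro measurable_restrict_space2 measurable_restrict_space1) (auto simp: space_restrict_space signed_dom_def)
  from measurable_compose[OF this q]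
  show "(\<lambda>u. mass_quantile \<mu> (s * u)) \<in> borel_measurable (restrict_space borel (signed_dom s \<mu>))" .
qed

lemma coupled_map_measurable_lborel:
  "finite_initial \<mu> \<Longrightarrow> (\<lambda>u. mass_quantile \<mu> (s * u)) \<in> measurable (restrict_space lborel (signed_dom s \<mu>)) pos_reals"
  using coupled_map_measurable[of \<mu> s]
    measurable_cong_sets[OF sets_restrict_space_cong[OF sets_lborel] refl, of "signed_dom s \<mu>" pos_reals] by blast

lemma coupled_mean:
  assumes n: "finite_initial \<mu>" and s: "s = 1 \<or> s = -1"
  shows "distr (restrict_space lborel (signed_dom s \<mu>)) pos_reals (\<lambda>u. mass_quantile \<mu> (s * u)) = \<mu>"
proof (rule finite_initial_eqI[OF n])
  fix x :: real assume x: "0 < x"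
  have q: "(\<lambda>u. mass_quantile \<mu> (s * u)) \<in> measurable (restrict_space lborel (signed_dom s \<mu>)) pos_reals"
    by (rule coupled_map_measurable_lborel[OF n])
  have fin: "emeasure \<mu> {0<..x} = ennreal (measure \<mu> {0<..x})"
    using n x by (intro emeasure_eq_ennreal_measure) (auto simp: finite_initial_def less_top)
  have "emeasure (distr (restrict_space lborel (signed_dom s \<mu>)) pos_reals (\<lambda>u. mass_quantile \<mu> (s * u))) {0<..x}
     = emeasure lborel ((\<lambda>u. mass_quantile \<mu> (s * u)) -` {0<..x} \<inter> signed_dom s \<mu>)"
    using signed_dom_borel[OF n] q by (intro emeasure_distr_restrict(2)) (auto simp: sets_pos_reals_iff)
  also have "(\<lambda>u. mass_quantile \<mu> (s * u)) -` {0<..x} \<inter> signed_dom s \<mu> = {u. 0 < s * u \<and> s * u \<le> measure \<mu> {0<..x}}"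
  proof (intro equalityI subsetI)
    fix u assume u: "u \<in> (\<lambda>u. mass_quantile \<mu> (s * u)) -` {0<..x} \<inter> signed_dom s \<mu>"
    then have d: "s * u \<in> mass_dom \<mu>" by (simp add: signed_dom_def)
    then have "ennreal (s * u) \<le> emeasure \<mu> {0<..x}" using u mass_quantile(2)[OF n d x] by simp
    then show "u \<in> {u. 0 < s * u \<and> s * u \<le> measure \<mu> {0<..x}}"
      using d unfolding fin by (simp add: ennreal_le_iff mass_dom_def)
  next
    fix u assume u: "u \<in> {u. 0 < s * u \<and> s * u \<le> measure \<mu> {0<..x}}"
    then have le: "ennreal (s * u) \<le> emeasure \<mu> {0<..x}" unfolding fin by (simp add: ennreal_leI)
    then have d: "s * u \<in> mass_dom \<mu>" using u x by (auto simp: mass_dom_def)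
    then show "u \<in> (\<lambda>u. mass_quantile \<mu> (s * u)) -` {0<..x} \<inter> signed_dom s \<mu>"
      using le mass_quantile(1)[OF n d] mass_quantile(2)[OF n d x] by (simp add: signed_dom_def)
  qed
  also have "emeasure lborel {u. 0 < s * u \<and> s * u \<le> measure \<mu> {0<..x}} = ennreal (measure \<mu> {0<..x})"
  proof (cases "s = 1")
    case True
    then have "{u. 0 < s * u \<and> s * u \<le> measure \<mu> {0<..x}} = {0<..measure \<mu> {0<..x}}" by auto
    then show ?thesis by simp
  next
    case False
    then have "{u. 0 < s * u \<and> s * u \<le> measure \<mu> {0<..x}} = {- measure \<mu> {0<..x}..<0}" using s by auto
    then show ?thesis by simp
  qed
  finally show "emeasure (distr (restrict_space lborel (signed_dom s \<mu>)) pos_reals (\<lambda>u. mass_quantile \<mu> (s * u))) {0<..x} = emeasure \<mu> {0<..x}"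
    by (simp add: fin)
qed simp

lemma coupled_poisson:
  assumes U: "poisson_process P lborel U" and n: "finite_initial \<mu>" and s: "s = 1 \<or> s = -1"
  shows "poisson_process P \<mu> (\<lambda>w. coupled s \<mu> (U w))"
proof -
  have "(\<lambda>u. mass_quantile \<mu> (s * u)) \<in> measurable (restrict_space lborel (signed_dom s \<mu>)) pos_reals"
    by (rule coupled_map_measurable_lborel[OF n])
  from poisson_process_pushforward[OF U _ this] show ?thesis
    unfolding coupled_mean[OF n s] coupled_def using signed_dom_borel[OF n] by simp
qed

lemma coupled_indep:
  assumes U: "poisson_process P lborel U" and n: "finite_initial \<mu>" "finite_initial \<kappa>"
  shows "prob_space.indep_var P (measures_algebra pos_reals) (\<lambda>w. coupled 1 \<mu> (U w)) (measures_algebra pos_reals) (\<lambda>w. coupled (-1) \<kappa> (U w))"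
  unfolding coupled_def
proof (rule poisson_process_indep_pushforward[OF U])
  show "signed_dom 1 \<mu> \<inter> signed_dom (-1) \<kappa> = {}" by (auto simp: signed_dom_def mass_dom_def)
  show "signed_dom 1 \<mu> \<in> sets lborel" "signed_dom (-1) \<kappa> \<in> sets lborel" using signed_dom_borel n by auto
  show "(\<lambda>u. mass_quantile \<mu> (1 * u)) \<in> measurable (restrict_space lborel (signed_dom 1 \<mu>)) pos_reals"
    "(\<lambda>u. mass_quantile \<kappa> (-1 * u)) \<in> measurable (restrict_space lborel (signed_dom (-1) \<kappa>)) pos_reals"
    by (rule coupled_map_measurable_lborel, rule n)+
qed

section \<open>Convergence of coupled processes\<close>

lemma coupled_integral:
  fixes f :: "real \<Rightarrow> real"
  assumes n: "finite_initial \<mu>" and U: "sets U = sets borel" and f: "f \<in> borel_measurable borel"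
  shows "(\<lambda>u. indicator (signed_dom s \<mu>) u *\<^sub>R f (mass_quantile \<mu> (s * u))) \<in> borel_measurable U"
    and "(\<integral>x. f x \<partial>coupled s \<mu> U) = (\<integral>u. indicator (signed_dom s \<mu>) u *\<^sub>R f (mass_quantile \<mu> (s * u)) \<partial>U)"
proof -
  have D: "signed_dom s \<mu> \<inter> space U \<in> sets U"
    using signed_dom_borel[OF n, of s] sets_eq_imp_space_eq[OF U] by (simp add: U)
  have q: "(\<lambda>u. mass_quantile \<mu> (s * u)) \<in> measurable (restrict_space U (signed_dom s \<mu>)) pos_reals"
    using coupled_map_measurable[OF n, of s]
      measurable_cong_sets[OF sets_restrict_space_cong[OF U] refl, of "signed_dom s \<mu>" pos_reals] by blast
  have fp: "f \<in> borel_measurable pos_reals" by (rule measurable_restrict_space1[OF f])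
  show "(\<lambda>u. indicator (signed_dom s \<mu>) u *\<^sub>R f (mass_quantile \<mu> (s * u))) \<in> borel_measurable U"
    using measurable_compose[OF q fp] unfolding borel_measurable_restrict_space_iff[OF D] .
  show "(\<integral>x. f x \<partial>coupled s \<mu> U) = (\<integral>u. indicator (signed_dom s \<mu>) u *\<^sub>R f (mass_quantile \<mu> (s * u)) \<partial>U)"
    unfolding coupled_def integral_distr[OF q fp] by (rule integral_restrict_space[OF D])
qed

text \<open>Convergence of the inverse functions at \<open>v\<close> can fail only if \<open>x \<mapsto> \<mu>(0, x]\<close> has the constant value \<open>v\<close> on an interval;
  such values are attained at rational \<open>x\<close>, and \<open>null\<close> says that \<open>U\<close> has no points there. Only points of
  \<open>U\<close> in a bounded set contribute to the integrals, which gives the integrable bound.\<close>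

theorem coupled_tendsto:
  assumes n: "\<And>n. finite_initial (\<mu>n n)" "finite_initial \<mu>"
    and conv: "\<And>x. 0 < x \<Longrightarrow> (\<lambda>n. emeasure (\<mu>n n) {0<..x}) \<longlonglongrightarrow> emeasure \<mu> {0<..x}"
    and U: "sets U = sets borel" and s: "s = 1 \<or> s = -1"
    and fin: "\<And>C::nat. emeasure U {u. 0 < s * u \<and> s * u \<le> real C} < \<infinity>"
    and null: "emeasure U ((\<lambda>q. s * measure \<mu> {0<..q}) ` \<rat>) = 0"
    and f: "f \<in> Cc_pos"
  shows "(\<lambda>n. \<integral>x. f x \<partial>coupled s (\<mu>n n) U) \<longlonglongrightarrow> (\<integral>x. f x \<partial>coupled s \<mu> U)"
proof -
  obtain \<beta> B where B: "0 < \<beta>" "0 \<le> B" "\<And>x. \<bar>f x\<bar> \<le> B" "\<And>x. f x \<noteq> 0 \<Longrightarrow> 0 < x \<and> x \<le> \<beta>" and cont: "continuous_on UNIV f"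
    using f by (rule Cc_posE) (rule that; assumption)
  have fm: "f \<in> borel_measurable borel" using cont by (rule borel_measurable_continuous_onI)
  define H where "H \<kappa> u = indicator (signed_dom s \<kappa>) u *\<^sub>R f (mass_quantile \<kappa> (s * u))" for \<kappa> u
  have H0: "H \<kappa> u = 0" if "s * u \<notin> mass_dom \<kappa>" for \<kappa> u
    using that by (simp add: H_def signed_dom_def)
  have H1: "H \<kappa> u = f (mass_quantile \<kappa> (s * u))" if "s * u \<in> mass_dom \<kappa>" for \<kappa> u
    using that by (simp add: H_def signed_dom_def)
  have "emeasure \<mu> {0<..\<beta>} < \<infinity>" using n(2) B(1) by (simp add: finite_initial_def)
  then obtain C :: nat where C: "emeasure \<mu> {0<..\<beta>} < of_nat C" by (auto dest: ennreal_Ex_less_of_nat)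
  have "\<forall>\<^sub>F n in sequentially. emeasure (\<mu>n n) {0<..\<beta>} < of_nat C"
    using conv[OF B(1)] C by (rule order_tendstoD(2))
  then obtain n0 where n0: "\<And>n. n0 \<le> n \<Longrightarrow> emeasure (\<mu>n n) {0<..\<beta>} < of_nat C"
    by (auto simp: eventually_sequentially)
  have bound: "norm (H \<kappa> u) \<le> B * indicator {u. 0 < s * u \<and> s * u \<le> real C} u"
    if k: "finite_initial \<kappa>" "emeasure \<kappa> {0<..\<beta>} < of_nat C" for \<kappa> u
  proof (cases "H \<kappa> u = 0")
    case True then show ?thesis using B(2) by simp
  next
    case False
    then have d: "s * u \<in> mass_dom \<kappa>" using H0 by blast
    then have "mass_quantile \<kappa> (s * u) \<le> \<beta>" using False H1 B(4) by auto
    then have "ennreal (s * u) \<le> emeasure \<kappa> {0<..\<beta>}" using mass_quantile(2)[OF k(1) d B(1)] by simp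
    then have "ennreal (s * u) < ennreal (real C)" using k(2) by (simp add: ennreal_of_nat_eq_real_of_nat)
    then have "s * u < real C" by (simp add: ennreal_less_iff d[unfolded mass_dom_def, simplified] less_imp_le)
    then show ?thesis using d B(3) H1[OF d] by (simp add: mass_dom_def)
  qed
  have lim: "(\<lambda>n. H (\<mu>n n) u) \<longlonglongrightarrow> H \<mu> u" if u: "u \<notin> (\<lambda>q. s * measure \<mu> {0<..q}) ` \<rat>" for u
  proof (cases "0 < s * u")
    case False
    then show ?thesis using H0 by (simp add: mass_dom_def)
  next
    case True
    have above: "\<forall>\<^sub>F n in sequentially. s * u \<in> mass_dom (\<mu>n n) \<and> mass_quantile (\<mu>n n) (s * u) \<le> x"
      if x: "0 < x" "ennreal (s * u) < emeasure \<mu> {0<..x}" for x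
      using order_tendstoD(1)[OF conv[OF x(1)] x(2)]
    proof eventually_elim
      case (elim n)
      then have d: "s * u \<in> mass_dom (\<mu>n n)" using True x by (auto simp: mass_dom_def intro!: exI[of _ x] less_imp_le)
      then show ?case using mass_quantile(2)[OF n(1) d x(1)] elim by (simp add: less_imp_le)
    qed
    have below: "\<forall>\<^sub>F n in sequentially. s * u \<in> mass_dom (\<mu>n n) \<longrightarrow> x < mass_quantile (\<mu>n n) (s * u)"
      if x: "0 < x" "emeasure \<mu> {0<..x} < ennreal (s * u)" for x
      using order_tendstoD(2)[OF conv[OF x(1)] x(2)]
    proof eventually_elim
      case (elim n)
      show ?case
      proof
        assume d: "s * u \<in> mass_dom (\<mu>n n)"
        show "x < mass_quantile (\<mu>n n) (s * u)" using mass_quantile(2)[OF n(1) d x(1)] elim by (simp add: not_le[symmetric])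
      qed
    qed
    show ?thesis
    proof (cases "s * u \<in> mass_dom \<mu>")
      case False
      then have "emeasure \<mu> {0<..\<beta>} < ennreal (s * u)" using True B(1) by (auto simp: mass_dom_def not_le)
      from below[OF B(1) this] have "\<forall>\<^sub>F n in sequentially. H (\<mu>n n) u = 0"
      proof eventually_elim
        case (elim n)
        then show ?case using H0[of u "\<mu>n n"] H1[of u "\<mu>n n"] B(4)[of "mass_quantile (\<mu>n n) (s * u)"]
          by (cases "s * u \<in> mass_dom (\<mu>n n)") auto
      qed
      then show ?thesis unfolding H0[OF False] by (rule tendsto_eventually)
    next
      case d: True
      define q where "q = mass_quantile \<mu> (s * u)"
      have q: "0 < q" unfolding q_def by (rule mass_quantile(1)[OF n(2) d])
      have up: "ennreal (s * u) < emeasure \<mu> {0<..x}" if x: "q < x" for x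
      proof -
        obtain r where r: "r \<in> \<rat>" "q < r" "r < x" using Rats_dense_in_real[OF x] by blast
        have r0: "0 < r" using q r by simp
        have e: "emeasure \<mu> {0<..r} = ennreal (measure \<mu> {0<..r})"
          using n(2) r0 by (intro emeasure_eq_ennreal_measure) (auto simp: finite_initial_def less_top)
        have "ennreal (s * u) \<le> emeasure \<mu> {0<..r}"
          using mass_quantile(2)[OF n(2) d r0] r(2) unfolding q_def by simp
        then have "s * u \<le> measure \<mu> {0<..r}" unfolding e by (simp add: ennreal_le_iff)
        moreover have "s * u \<noteq> measure \<mu> {0<..r}"
        proof
          assume eq: "s * u = measure \<mu> {0<..r}"
          \<comment> \<open>\<open>s\<^sup>2 = 1\<close>\<close>
          have "u = s * (s * u)" using s by auto
          then have "u = s * measure \<mu> {0<..r}" unfolding eq .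
          then show False using u r(1) by blast
        qed
        ultimately have "ennreal (s * u) < emeasure \<mu> {0<..r}" unfolding e using True by (simp add: ennreal_less_iff less_imp_le)
        also have "\<dots> \<le> emeasure \<mu> {0<..x}" using r by (intro finite_initial_mono[OF n(2)]) simp
        finally show ?thesis .
      qed
      have dom: "\<forall>\<^sub>F n in sequentially. s * u \<in> mass_dom (\<mu>n n)"
        using above[OF _ up, of "q + 1"] q by (auto elim: eventually_mono)
      have "(\<lambda>n. mass_quantile (\<mu>n n) (s * u)) \<longlonglongrightarrow> q"
      proof (rule order_tendstoI)
        fix a assume "a < q"
        then obtain x where x: "max a 0 < x" "x < q" using dense[of "max a 0" q] q by auto
        then have x0: "0 < x" "a < x" by auto
        have "emeasure \<mu> {0<..x} < ennreal (s * u)" using mass_quantile(2)[OF n(2) d x0(1)] x(2) unfolding q_def by (simp add: not_le[symmetric])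
        from below[OF x0(1) this] dom show "\<forall>\<^sub>F n in sequentially. a < mass_quantile (\<mu>n n) (s * u)"
          by eventually_elim (use x0 in auto)
      next
        fix a assume "q < a"
        then obtain x where x: "q < x" "x < a" using dense by blast
        from above[OF _ up[OF x(1)]] x q show "\<forall>\<^sub>F n in sequentially. mass_quantile (\<mu>n n) (s * u) < a"
          by (auto elim: eventually_mono)
      qed
      then have "(\<lambda>n. f (mass_quantile (\<mu>n n) (s * u))) \<longlonglongrightarrow> f q"
        using cont by (intro isCont_tendsto_compose[of q f]) (auto simp: continuous_on_eq_continuous_at)
      moreover have "\<forall>\<^sub>F n in sequentially. f (mass_quantile (\<mu>n n) (s * u)) = H (\<mu>n n) u"
        using dom by eventually_elim (simp add: H1)
      ultimately show ?thesis unfolding H1[OF d] q_def[symmetric] by (rule Lim_transform_eventually)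
    qed
  qed
  have Ic: "{u. 0 < s * u \<and> s * u \<le> real C} \<in> sets U" unfolding U by measurable
  have "(\<lambda>n. \<integral>u. H (\<mu>n (n + n0)) u \<partial>U) \<longlonglongrightarrow> (\<integral>u. H \<mu> u \<partial>U)"
  proof (rule integral_dominated_convergence[where w="\<lambda>u. B * indicator {u. 0 < s * u \<and> s * u \<le> real C} u"])
    show "H \<mu> \<in> borel_measurable U" "\<And>n. H (\<mu>n (n + n0)) \<in> borel_measurable U"
      unfolding H_def[abs_def] using coupled_integral(1)[OF n(2) U fm] coupled_integral(1)[OF n(1) U fm] by auto
    show "integrable U (\<lambda>u. B * indicator {u. 0 < s * u \<and> s * u \<le> real C} u)"
      using Ic fin by (intro integrable_mult_right integrable_real_indicator)
    have "countable ((\<lambda>q. s * measure \<mu> {0<..q}) ` \<rat>)" by (intro countable_image countable_rat)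
    then have "(\<lambda>q. s * measure \<mu> {0<..q}) ` \<rat> \<in> sets U" unfolding U by (rule sets.countable[rotated]) auto
    then have "(\<lambda>q. s * measure \<mu> {0<..q}) ` \<rat> \<in> null_sets U" using null by (rule null_setsI[rotated])
    from AE_not_in[OF this] show "AE u in U. (\<lambda>n. H (\<mu>n (n + n0)) u) \<longlonglongrightarrow> H \<mu> u"
      by eventually_elim (rule LIMSEQ_ignore_initial_segment[OF lim])
    show "AE u in U. norm (H (\<mu>n (n + n0)) u) \<le> B * indicator {u. 0 < s * u \<and> s * u \<le> real C} u" for n
      using bound[OF n(1) n0] by simp
  qed
  then have "(\<lambda>n. \<integral>u. H (\<mu>n n) u \<partial>U) \<longlonglongrightarrow> (\<integral>u. H \<mu> u \<partial>U)" by (rule LIMSEQ_offset)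
  then show ?thesis
    unfolding coupled_integral(2)[OF n(1) U fm] coupled_integral(2)[OF n(2) U fm] H_def .
qed

lemma coupled_AE_tendsto:
  assumes pp: "poisson_process P lborel U"
    and n: "\<And>n. finite_initial (\<mu>n n)" "finite_initial \<mu>"
    and conv: "\<And>x. 0 < x \<Longrightarrow> (\<lambda>n. emeasure (\<mu>n n) {0<..x}) \<longlonglongrightarrow> emeasure \<mu> {0<..x}"
    and s: "s = 1 \<or> s = -1"
  shows "AE w in P. (\<forall>n. coupled s (\<mu>n n) (U w) \<in> radon_measures) \<and> coupled s \<mu> (U w) \<in> radon_measures \<and>
    (\<forall>f\<in>Cc_pos. (\<lambda>n. \<integral>x. f x \<partial>coupled s (\<mu>n n) (U w)) \<longlonglongrightarrow> (\<integral>x. f x \<partial>coupled s \<mu> (U w)))"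
proof -
  have 1: "AE w in P. \<forall>n. finite_initial (coupled s (\<mu>n n) (U w))"
    unfolding AE_all_countable using poisson_process_AE_finite_initial[OF coupled_poisson[OF pp n(1) s] n(1)] by (auto elim: eventually_mono)
  have 2: "AE w in P. finite_initial (coupled s \<mu> (U w))"
    using poisson_process_AE_finite_initial[OF coupled_poisson[OF pp n(2) s] n(2)] by (auto elim: eventually_mono)
  have fin: "emeasure lborel {u. 0 < s * u \<and> s * u \<le> real C} < \<infinity>" for C
  proof -
    have "emeasure lborel {u. 0 < s * u \<and> s * u \<le> real C} \<le> emeasure lborel {- real C..real C}"
      using s by (intro emeasure_mono) auto
    then show ?thesis by (rule le_less_trans) simp
  qed
  have 3: "AE w in P. \<forall>C::nat. emeasure (U w) {u. 0 < s * u \<and> s * u \<le> real C} \<in> range of_nat"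
    unfolding AE_all_countable
  proof (intro allI poisson_process_AE_nat[OF pp _ fin])
    show "{u. 0 < s * u \<and> s * u \<le> real C} \<in> sets lborel" for C by measurable
  qed
  have c: "countable ((\<lambda>q. s * measure \<mu> {0<..q}) ` \<rat>)" by (intro countable_image countable_rat)
  have 4: "AE w in P. emeasure (U w) ((\<lambda>q. s * measure \<mu> {0<..q}) ` \<rat>) = 0"
    using countable_imp_null_set_lborel[OF c] by (intro poisson_process_AE_0[OF pp]) auto
  have 5: "AE w in P. sets (U w) = sets borel"
    using poisson_process_sets[OF pp] by (intro AE_I2) simp
  show ?thesis using 1 2 3 4 5
  proof eventually_elim
    case (elim w)
    have "emeasure (U w) {u. 0 < s * u \<and> s * u \<le> real C} < \<infinity>" for C :: nat
    proof -
      obtain k :: nat where "emeasure (U w) {u. 0 < s * u \<and> s * u \<le> real C} = of_nat k" using elim(3) by blast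
      then show ?thesis by (simp add: of_nat_less_top)
    qed
    from coupled_tendsto[OF n conv elim(5) s this elim(4)] show ?case
      using elim(1,2) finite_initial_radon by blast
  qed
qed

lemma weakly_converges_completion:
  "weakly_converges T (completion P) X P' X' \<Longrightarrow> weakly_converges T P X P' X'"
  unfolding weakly_converges_def completion_completion AE_completion_iff .

text \<open>Replace the given pairs by coupled ones, which does not change any expectation, and use that the latter converge almost
  surely.\<close>

theorem coupling_convergence:
  fixes U :: "'w \<Rightarrow> real measure"
  assumes X: "\<And>n. poisson_process P (\<mu>n n) (X n)" and Y: "\<And>n. poisson_process P (\<kappa>n n) (Y n)"
    and n: "\<And>n. finite_initial (\<mu>n n)" "finite_initial \<mu>" and k: "\<And>n. finite_initial (\<kappa>n n)" "finite_initial \<kappa>"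
    and ind: "\<And>n. prob_space.indep_var P (measures_algebra pos_reals) (X n) (measures_algebra pos_reals) (Y n)"
    and U: "poisson_process P lborel U"
    and conv: "\<forall>x>0. (\<lambda>n. emeasure (\<mu>n n) {0<..x}) \<longlonglongrightarrow> emeasure \<mu> {0<..x}"
      "\<forall>x>0. (\<lambda>n. emeasure (\<kappa>n n) {0<..x}) \<longlonglongrightarrow> emeasure \<kappa> {0<..x}"
    and \<xi>: "poisson_process P' \<mu> \<xi>" and \<eta>: "poisson_process P' \<kappa> \<eta>"
    and ind': "prob_space.indep_var P' (measures_algebra pos_reals) \<xi> (measures_algebra pos_reals) \<eta>"
  shows "weakly_converges (prod_topology vague_topology vague_topology) P (\<lambda>n w. (X n w, Y n w)) P' (\<lambda>w. (\<xi> w, \<eta> w))"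
  unfolding weakly_converges_def
proof (intro conjI allI impI)
  let ?T = "prod_topology vague_topology vague_topology"
  have radon: "AE w in M. (Z w, W w) \<in> topspace ?T"
    if "poisson_process M \<zeta> Z" "finite_initial \<zeta>" "poisson_process M \<theta> W" "finite_initial \<theta>" for M :: "'z measure" and \<zeta> Z \<theta> W
    using poisson_process_AE_finite_initial[OF that(1,2)] poisson_process_AE_finite_initial[OF that(3,4)]
    by eventually_elim (simp add: topspace_vague finite_initial_radon)
  show "AE w in P. (X m w, Y m w) \<in> topspace ?T" for m by (rule radon[OF X n(1) Y k(1)])
  show "AE w in P'. (\<xi> w, \<eta> w) \<in> topspace ?T" by (rule radon[OF \<xi> n(2) \<eta> k(2)])
  fix F assume F: "continuous_map ?T euclideanreal F" and bdd: "bounded (F ` topspace ?T)"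
  show "integrable (completion P) (\<lambda>w. F (X m w, Y m w))" for m
    by (rule vague_expectation(1)[OF X n(1) Y k(1) F bdd])
  show "integrable (completion P') (\<lambda>w. F (\<xi> w, \<eta> w))"
    by (rule vague_expectation(1)[OF \<xi> n(2) \<eta> k(2) F bdd])
  interpret prob_space P using U by (rule poisson_process_prob_space)
  interpret c: prob_space "completion P" by (rule prob_space_completion_M)
  have p: "(1::real) = 1 \<or> (1::real) = -1" and m: "(-1::real) = 1 \<or> (-1::real) = -1" by auto
  let ?V = "\<lambda>m w. F (coupled 1 (\<mu>n m) (U w), coupled (-1) (\<kappa>n m) (U w))"
  let ?L = "\<lambda>w. F (coupled 1 \<mu> (U w), coupled (-1) \<kappa> (U w))"
  have e: "(\<integral>w. F (X m w, Y m w) \<partial>completion P) = (\<integral>w. ?V m w \<partial>completion P)" for m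
    by (rule same_expectation[OF X n(1) Y k(1) ind coupled_poisson[OF U n(1) p] coupled_poisson[OF U k(1) m] coupled_indep[OF U n(1) k(1)] F bdd])
  have e': "(\<integral>w. F (\<xi> w, \<eta> w) \<partial>completion P') = (\<integral>w. ?L w \<partial>completion P)"
    by (rule same_expectation[OF \<xi> n(2) \<eta> k(2) ind' coupled_poisson[OF U n(2) p] coupled_poisson[OF U k(2) m] coupled_indep[OF U n(2) k(2)] F bdd])
  obtain B where B: "\<And>z. z \<in> topspace ?T \<Longrightarrow> \<bar>F z\<bar> \<le> B"
    using bdd unfolding bounded_iff by auto
  have cp: "AE w in completion P. (\<forall>j. coupled 1 (\<mu>n j) (U w) \<in> radon_measures) \<and> coupled 1 \<mu> (U w) \<in> radon_measures \<and>
    (\<forall>f\<in>Cc_pos. (\<lambda>j. \<integral>x. f x \<partial>coupled 1 (\<mu>n j) (U w)) \<longlonglongrightarrow> (\<integral>x. f x \<partial>coupled 1 \<mu> (U w)))"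
    by (rule AE_completion, rule coupled_AE_tendsto[OF U n _ p], use conv(1) in blast)
  have cm: "AE w in completion P. (\<forall>j. coupled (-1) (\<kappa>n j) (U w) \<in> radon_measures) \<and> coupled (-1) \<kappa> (U w) \<in> radon_measures \<and>
    (\<forall>f\<in>Cc_pos. (\<lambda>j. \<integral>x. f x \<partial>coupled (-1) (\<kappa>n j) (U w)) \<longlonglongrightarrow> (\<integral>x. f x \<partial>coupled (-1) \<kappa> (U w)))"
    by (rule AE_completion, rule coupled_AE_tendsto[OF U k _ m], use conv(2) in blast)
  have "(\<lambda>m. \<integral>w. ?V m w \<partial>completion P) \<longlonglongrightarrow> (\<integral>w. ?L w \<partial>completion P)"
  proof (rule integral_dominated_convergence[where w="\<lambda>_. B"])
    show "?L \<in> borel_measurable (completion P)"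
      by (rule borel_measurable_integrable[OF vague_expectation(1)[OF coupled_poisson[OF U n(2) p] n(2) coupled_poisson[OF U k(2) m] k(2) F bdd]])
    show "?V m \<in> borel_measurable (completion P)" for m
      by (rule borel_measurable_integrable[OF vague_expectation(1)[OF coupled_poisson[OF U n(1) p] n(1) coupled_poisson[OF U k(1) m] k(1) F bdd]])
    show "AE w in completion P. norm (?V m w) \<le> B" for m
      using AE_completion[OF radon[OF coupled_poisson[OF U n(1) p] n(1) coupled_poisson[OF U k(1) m] k(1)]]
      by eventually_elim (use B in auto)
    show "AE w in completion P. (\<lambda>m. ?V m w) \<longlonglongrightarrow> ?L w"
      using cp cm
      by eventually_elim (intro continuous_map_vague_limit[OF F], auto)
  qed simp
  then show "(\<lambda>m. \<integral>w. F (X m w, Y m w) \<partial>completion P) \<longlonglongrightarrow> (\<integral>w. F (\<xi> w, \<eta> w) \<partial>completion P')"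
    unfolding e e' .
qed

section \<open>Scaling and cutting Poisson processes on the half-line\<close>

text \<open>The points that remain in \<open>(0, k)\<close> after scaling.\<close>

definition cut_region :: "real \<Rightarrow> real \<Rightarrow> ereal \<Rightarrow> real set" where
  "cut_region a b k = {y. 0 < y \<and> 0 < (y + b) / a \<and> ereal ((y + b) / a) < k}"

lemma cut_region_sets: "cut_region a b k \<in> sets pos_reals"
proof -
  have "cut_region a b k \<in> sets borel" unfolding cut_region_def by measurable
  then show ?thesis by (auto simp: sets_pos_reals_iff cut_region_def)
qed

lemma affine_measurable:
  assumes "sets M = sets pos_reals"
  shows "(\<lambda>y. (y + b) / a) \<in> measurable (restrict_space M (cut_region a b k)) pos_reals"
proof (rule measurable_restrict_space2)
  show "(\<lambda>y. (y + b) / a) \<in> borel_measurable (restrict_space M (cut_region a b k))"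
    by (rule measurable_restrict_space1, rule measurable_pos[OF assms]) measurable
qed (auto simp: space_restrict_space cut_region_def)

text \<open>Scaling and cutting a set of points is restricting and mapping its point measure.\<close>

lemma cut_scaled_points:
  assumes a: "0 < a" and A: "A \<subseteq> {0<..}"
  shows "cut k (point_measure_of ((\<lambda>y. (y + b) / a) ` A)) =
    distr (restrict_space (point_measure_of A) (cut_region a b k)) pos_reals (\<lambda>y. (y + b) / a)"
proof (rule measure_eqI)
  let ?g = "\<lambda>y. (y + b) / a"
  have sp: "sets (point_measure_of B) = sets pos_reals" for B by (simp add: point_measure_of_eq)
  have inj: "inj ?g" using a by (auto simp: inj_def)
  show "sets (cut k (point_measure_of (?g ` A))) = sets (distr (restrict_space (point_measure_of A) (cut_region a b k)) pos_reals ?g)"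
    by (simp add: cut_def sp)
  fix E assume "E \<in> sets (cut k (point_measure_of (?g ` A)))"
  then have E: "E \<in> sets pos_reals" by (simp add: cut_def sp)
  have k: "{x. ereal x < k} \<in> sets borel" by measurable
  then have Ek: "{x. ereal x < k} \<inter> E \<in> sets pos_reals" using E by (auto simp: sets_pos_reals_iff)
  have "emeasure (cut k (point_measure_of (?g ` A))) E = (\<integral>\<^sup>+x. indicator {x. ereal x < k} x * indicator E x \<partial>point_measure_of (?g ` A))"
    unfolding cut_def
  proof (rule emeasure_density)
    show "(indicator {x. ereal x < k} :: real \<Rightarrow> ennreal) \<in> borel_measurable (point_measure_of (?g ` A))"
      by (rule measurable_pos[OF sp]) (use k in measurable)
  qed (use E sp in simp)
  also have "\<dots> = (\<integral>\<^sup>+x. indicator ({x. ereal x < k} \<inter> E) x \<partial>point_measure_of (?g ` A))"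
    by (intro nn_integral_cong) (simp add: indicator_def)
  also have "\<dots> = emeasure (point_measure_of (?g ` A)) ({x. ereal x < k} \<inter> E)"
    using Ek sp by (intro nn_integral_indicator) simp
  finally have L: "emeasure (cut k (point_measure_of (?g ` A))) E = emeasure (point_measure_of (?g ` A)) ({x. ereal x < k} \<inter> E)" .
  have R1: "?g -` E \<inter> cut_region a b k \<in> sets pos_reals"
    by (rule emeasure_distr_restrict(1)[OF refl cut_region_sets affine_measurable[OF refl] E])
  have R2: "emeasure (distr (restrict_space (point_measure_of A) (cut_region a b k)) pos_reals ?g) E
     = emeasure (point_measure_of A) (?g -` E \<inter> cut_region a b k)"
    by (rule emeasure_distr_restrict(2)[OF sp cut_region_sets affine_measurable[OF refl] E])
  have im: "?g ` A \<inter> ({x. ereal x < k} \<inter> E) = ?g ` (A \<inter> (?g -` E \<inter> cut_region a b k))"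
    using A E unfolding sets_pos_reals_iff cut_region_def by auto
  have "emeasure (point_measure_of (?g ` A)) ({x. ereal x < k} \<inter> E) = emeasure (point_measure_of A) (?g -` E \<inter> cut_region a b k)"
    unfolding point_measure_of_eq emeasure_points_on[OF Ek] emeasure_points_on[OF R1] im
    by (simp add: finite_image_iff[OF inj_on_subset[OF inj subset_UNIV]] card_image[OF inj_on_subset[OF inj subset_UNIV]])
  then show "emeasure (cut k (point_measure_of (?g ` A))) E = emeasure (distr (restrict_space (point_measure_of A) (cut_region a b k)) pos_reals ?g) E"
    unfolding L R2 .
qed

text \<open>What \<open>S\<^sup>+\<close> and \<open>S\<^sup>-\<close> have in common as functions and as measures: the function is the distribution function of the
  measure as long as it is finite, and its value \<open>\<infinity>\<close> marks the part of the half-line beyond the support.\<close>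

locale half_line_mean =
  fixes \<Lambda> :: "real measure" and \<Sigma> :: "real \<Rightarrow> ennreal"
  assumes sets_\<Lambda>: "sets \<Lambda> = sets pos_reals"
    and mono: "x \<le> y \<Longrightarrow> \<Sigma> x \<le> \<Sigma> y"
    and nonpos: "y \<le> 0 \<Longrightarrow> \<Sigma> y = 0"
    and mass: "0 < y \<Longrightarrow> \<Sigma> y < \<infinity> \<Longrightarrow> emeasure \<Lambda> {0<..y} = \<Sigma> y"
    and right_finite: "\<Sigma> c < \<infinity> \<Longrightarrow> \<exists>d>c. \<Sigma> d < \<infinity>"
    and beyond: "\<Sigma> c = \<infinity> \<Longrightarrow> emeasure \<Lambda> {c<..} = 0"
begin

definition scaled_mean :: "nat \<Rightarrow> real \<Rightarrow> real \<Rightarrow> ereal \<Rightarrow> real measure" where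
  "scaled_mean r a b k = distr (restrict_space (scale_measure (of_nat r) \<Lambda>) (cut_region a b k)) pos_reals (\<lambda>y. (y + b) / a)"

lemma sets_scaled_mean [simp]: "sets (scaled_mean r a b k) = sets pos_reals"
  by (simp add: scaled_mean_def)

lemma emeasure_scaled_mean:
  assumes "A \<in> sets pos_reals"
  shows "emeasure (scaled_mean r a b k) A = of_nat r * emeasure \<Lambda> ((\<lambda>y. (y + b) / a) -` A \<inter> cut_region a b k)"
proof -
  have "emeasure (scaled_mean r a b k) A = emeasure (scale_measure (of_nat r) \<Lambda>) ((\<lambda>y. (y + b) / a) -` A \<inter> cut_region a b k)"
    unfolding scaled_mean_def
    by (rule emeasure_distr_restrict(2)) (use assms affine_measurable cut_region_sets sets_\<Lambda> in auto)
  then show ?thesis by simp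
qed

text \<open>The minimum covers the case that the lower bound \<open>c\<close> lies above \<open>d\<close>, and \<open>\<Sigma> c = 0\<close> the one that it is
  negative.\<close>

lemma between:
  assumes d: "\<Sigma> d < \<infinity>"
  shows "emeasure \<Lambda> {y. 0 < y \<and> c < y \<and> y \<le> d} + \<Sigma> (min c d) = \<Sigma> d"
proof -
  have pos: "{0<..x} \<in> sets \<Lambda>" "{y. 0 < y \<and> c < y \<and> y \<le> x} \<in> sets \<Lambda>" for x
  proof -
    have "{y. 0 < y \<and> c < y \<and> y \<le> x} \<in> sets borel" by measurable
    then show "{0<..x} \<in> sets \<Lambda>" "{y. 0 < y \<and> c < y \<and> y \<le> x} \<in> sets \<Lambda>" by (auto simp: sets_\<Lambda> sets_pos_reals_iff)
  qed
  have empty: "emeasure \<Lambda> {y. 0 < y \<and> c < y \<and> y \<le> d} = 0" if "d \<le> 0 \<or> d \<le> c"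
  proof -
    have e: "{y. 0 < y \<and> c < y \<and> y \<le> d} = {}" using that by (intro equals0I) auto
    show ?thesis unfolding e by simp
  qed
  consider "d \<le> 0" | "0 < d" "d \<le> c" | "0 < d" "c < d" "c \<le> 0" | "0 < c" "c < d" by linarith
  then show ?thesis
  proof cases
    case 1
    then show ?thesis using empty 1 nonpos[of "min c d"] nonpos[of d] by simp
  next
    case 2
    then show ?thesis using empty by (simp add: min_absorb2)
  next
    case 3
    then have "{y. 0 < y \<and> c < y \<and> y \<le> d} = {0<..d}" by auto
    then show ?thesis using 3 mass[OF 3(1) d] nonpos[of "min c d"] by simp
  next
    case 4
    then have c: "\<Sigma> c < \<infinity>" using mono[of c d] d by (auto intro: le_less_trans)
    have u: "{0<..d} = {y. 0 < y \<and> c < y \<and> y \<le> d} \<union> {0<..c}" using 4 by auto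
    have "emeasure \<Lambda> {0<..d} = emeasure \<Lambda> {y. 0 < y \<and> c < y \<and> y \<le> d} + emeasure \<Lambda> {0<..c}"
      unfolding u by (rule plus_emeasure[symmetric]) (use pos in auto)
    then show ?thesis using 4 mass[OF 4(1) c] mass[OF _ d] by simp
  qed
qed

lemma scaled_mean_Ioc:
  assumes a: "0 < a" and x: "0 < x" "ereal x < k" and fin: "\<Sigma> (a * x - b) < \<infinity>"
  shows "emeasure (scaled_mean r a b k) {0<..x} = of_nat r * \<Sigma> (a * x - b) - of_nat r * \<Sigma> (- b)"
proof -
  have le: "- b \<le> a * x - b" using a x by simp
  have iff: "0 < (y + b) / a \<longleftrightarrow> - b < y" "(y + b) / a \<le> x \<longleftrightarrow> y \<le> a * x - b" for y
    using a by (auto simp: field_simps)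
  have "ereal ((y + b) / a) < k" if "(y + b) / a \<le> x" for y
    using that x(2) by (meson ereal_less_eq(3) le_less_trans)
  then have pre: "(\<lambda>y. (y + b) / a) -` {0<..x} \<inter> cut_region a b k = {y. 0 < y \<and> - b < y \<and> y \<le> a * x - b}"
    unfolding cut_region_def using iff by auto
  have Ioc: "{0<..x} \<in> sets pos_reals" by (auto simp: sets_pos_reals_iff)
  have sum: "emeasure \<Lambda> {y. 0 < y \<and> - b < y \<and> y \<le> a * x - b} + \<Sigma> (- b) = \<Sigma> (a * x - b)"
    using between[OF fin, of "- b"] le by (simp add: min_absorb1)
  have nt: "of_nat r * \<Sigma> (- b) \<noteq> top"
    using fin mono[OF le] by (auto simp: ennreal_mult_eq_top_iff top_unique)
  show ?thesis
    unfolding emeasure_scaled_mean[OF Ioc] pre sum[symmetric] distrib_left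
    using nt by (rule ennreal_add_diff_cancel_right[symmetric])
qed

lemma eventually_finite:
  assumes "(\<lambda>n. of_nat n * \<Sigma> (y n)) \<longlonglongrightarrow> l" "l < \<infinity>"
  shows "\<forall>\<^sub>F n in sequentially. \<Sigma> (y n) < \<infinity>"
  using order_tendstoD(2)[OF assms] eventually_gt_at_top[of 0]
proof eventually_elim
  case (elim n)
  have "\<Sigma> (y n) \<noteq> \<infinity>"
  proof
    assume i: "\<Sigma> (y n) = \<infinity>"
    show False using elim unfolding i by (simp add: ennreal_mult_top)
  qed
  then show ?case by (simp add: less_top)
qed

text \<open>The mass of \<open>(0, x]\<close> after scaling is \<open>n * \<Sigma> (a x - b) - n * \<Sigma> (- b)\<close>, where the second term is the mass that is
  scaled out of the half-line. It vanishes in the limit, since it is bounded by \<open>n * \<Sigma> (a y - b)\<close> for every \<open>y > 0\<close> and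
  \<open>M (0, y]\<close> tends to \<open>0\<close> as \<open>y\<close> does.\<close>

theorem scaled_mean_tendsto:
  assumes a: "\<And>n. 0 < a n" and M: "finite_initial M"
    and conv: "\<And>x. 0 < x \<Longrightarrow> (\<lambda>n. of_nat n * \<Sigma> (a n * x - b n)) \<longlonglongrightarrow> emeasure M {0<..x}"
    and k: "k \<longlonglongrightarrow> \<infinity>" and x: "0 < x"
  shows "(\<lambda>n. emeasure (scaled_mean n (a n) (b n) (k n)) {0<..x}) \<longlonglongrightarrow> emeasure M {0<..x}"
proof -
  have finM: "emeasure M {0<..y} < \<infinity>" if "0 < y" for y using M that by (simp add: finite_initial_def)
  have z: "(\<lambda>n. of_nat n * \<Sigma> (- b n)) \<longlonglongrightarrow> 0"
  proof (rule order_tendstoI)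
    fix e :: ennreal assume e: "0 < e"
    have "(\<lambda>j. emeasure M {0<..0 + inverse (real (Suc j))}) \<longlonglongrightarrow> emeasure M {0<..0::real}"
      by (rule finite_initial_right_limit[OF M]) simp
    then have "\<forall>\<^sub>F j in sequentially. emeasure M {0<..inverse (real (Suc j))} < e"
      using e by (auto dest!: order_tendstoD(2)[where a=e])
    then obtain j where j: "emeasure M {0<..inverse (real (Suc j))} < e" by (auto simp: eventually_sequentially)
    have p: "0 < inverse (real (Suc j))" by simp
    show "\<forall>\<^sub>F n in sequentially. of_nat n * \<Sigma> (- b n) < e"
      using order_tendstoD(2)[OF conv[OF p] j]
    proof eventually_elim
      case (elim n)
      have "of_nat n * \<Sigma> (- b n) \<le> of_nat n * \<Sigma> (a n * inverse (real (Suc j)) - b n)"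
      proof (intro mult_left_mono mono)
        have "0 \<le> a n * inverse (real (Suc j))" using a[of n] p by (intro mult_nonneg_nonneg) auto
        then show "- b n \<le> a n * inverse (real (Suc j)) - b n" by linarith
      qed simp
      then show ?case using elim by (rule le_less_trans)
    qed
  qed simp
  have "(\<lambda>n. of_nat n * \<Sigma> (a n * x - b n) - of_nat n * \<Sigma> (- b n)) \<longlonglongrightarrow> emeasure M {0<..x} - 0"
    using finM[OF x] by (intro tendsto_diff_ennreal conv[OF x] z) auto
  then have l: "(\<lambda>n. of_nat n * \<Sigma> (a n * x - b n) - of_nat n * \<Sigma> (- b n)) \<longlonglongrightarrow> emeasure M {0<..x}" by simp
  have kx: "\<forall>\<^sub>F n in sequentially. ereal x < k n" using k by (simp add: tendsto_PInfty)
  have "\<forall>\<^sub>F n in sequentially. of_nat n * \<Sigma> (a n * x - b n) - of_nat n * \<Sigma> (- b n) = emeasure (scaled_mean n (a n) (b n) (k n)) {0<..x}"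
    using kx eventually_finite[OF conv[OF x] finM[OF x]]
  proof eventually_elim
    case (elim n)
    from scaled_mean_Ioc[OF a x elim] show ?case by simp
  qed
  with l show ?thesis by (rule Lim_transform_eventually)
qed

text \<open>Near \<open>0\<close> the mass is finite in any case: either \<open>\<Sigma>\<close> is still finite slightly beyond \<open>- b\<close>, or \<open>- b\<close> is beyond the support
  of \<open>\<Lambda>\<close>.\<close>

lemma scaled_mean_finite_initial:
  assumes a: "0 < a" and radon: "scaled_mean r a b k \<in> radon_measures"
  shows "finite_initial (scaled_mean r a b k)"
  unfolding finite_initial_def
proof (intro conjI allI impI)
  fix x :: real assume x: "0 < x"
  have Ioc: "{0<..y} \<in> sets pos_reals" for y by (auto simp: sets_pos_reals_iff)
  have "\<exists>y>0. emeasure (scaled_mean r a b k) {0<..y} < \<infinity>"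
  proof (cases "\<Sigma> (- b) = \<infinity>")
    case True
    have "emeasure \<Lambda> ((\<lambda>y. (y + b) / a) -` {0<..1} \<inter> cut_region a b k) \<le> emeasure \<Lambda> {- b<..}"
    proof (rule emeasure_mono)
      have "0 < - b" using True nonpos[of "- b"] by (cases "0 < - b") auto
      then show "{- b<..} \<in> sets \<Lambda>" by (auto simp: sets_\<Lambda> sets_pos_reals_iff)
      show "(\<lambda>y. (y + b) / a) -` {0<..1} \<inter> cut_region a b k \<subseteq> {- b<..}"
        using a by (auto simp: zero_less_divide_iff)
    qed
    then have "emeasure (scaled_mean r a b k) {0<..1} = 0"
      unfolding emeasure_scaled_mean[OF Ioc] using beyond[OF True] by simp
    then show ?thesis by (intro exI[of _ 1]) simp
  next
    case False
    then obtain d where d: "- b < d" "\<Sigma> d < \<infinity>" using right_finite[of "- b"] by (auto simp: less_top)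
    define y where "y = (d + b) / a"
    have y: "0 < y" "a * y - b = d" using a d(1) by (simp_all add: y_def)
    have sub: "(\<lambda>y. (y + b) / a) -` {0<..y} \<inter> cut_region a b k \<subseteq> {z. 0 < z \<and> - b < z \<and> z \<le> d}"
      unfolding cut_region_def using a by (auto simp: y_def divide_le_cancel zero_less_divide_iff)
    have s: "{z. 0 < z \<and> - b < z \<and> z \<le> d} \<in> sets \<Lambda>"
    proof -
      have "{z. 0 < z \<and> - b < z \<and> z \<le> d} \<in> sets borel" by measurable
      then show ?thesis by (auto simp: sets_\<Lambda> sets_pos_reals_iff)
    qed
    have "emeasure \<Lambda> {z. 0 < z \<and> - b < z \<and> z \<le> d} \<le> \<Sigma> d"
      unfolding between[OF d(2), of "- b", symmetric] by simp
    then have "emeasure \<Lambda> ((\<lambda>y. (y + b) / a) -` {0<..y} \<inter> cut_region a b k) < \<infinity>"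
      using emeasure_mono[OF sub s] d(2) by (auto intro: le_less_trans order_trans)
    then have "emeasure (scaled_mean r a b k) {0<..y} < \<infinity>"
      unfolding emeasure_scaled_mean[OF Ioc] by (simp add: ennreal_mult_less_top of_nat_less_top)
    then show ?thesis using y(1) by blast
  qed
  then obtain y where y: "0 < y" "emeasure (scaled_mean r a b k) {0<..y} < \<infinity>" by blast
  have "compact {y..x}" "{y..x} \<subseteq> {0<..}" using y by auto
  then have "emeasure (scaled_mean r a b k) {y..x} < \<infinity>" using radon unfolding radon_measures_def by blast
  moreover have "emeasure (scaled_mean r a b k) {0<..x} \<le> emeasure (scaled_mean r a b k) ({0<..y} \<union> {y..x})"
    using y by (intro emeasure_mono) (auto simp: sets_pos_reals_iff)
  moreover have "emeasure (scaled_mean r a b k) ({0<..y} \<union> {y..x}) \<le> emeasure (scaled_mean r a b k) {0<..y} + emeasure (scaled_mean r a b k) {y..x}"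
    using y by (intro emeasure_subadditive) (auto simp: sets_pos_reals_iff)
  ultimately show "emeasure (scaled_mean r a b k) {0<..x} < \<infinity>"
    using y(2) by (auto intro: le_less_trans order_trans)
qed simp

text \<open>Take for \<open>k n\<close> the largest integer \<open>m \<le> n\<close> up to which the scaled mean is finite.\<close>

lemma ex_cut_levels:
  assumes a: "\<And>n. 0 < a n"
    and conv: "\<And>x. 0 < x \<Longrightarrow> \<forall>\<^sub>F n in sequentially. \<Sigma> (a n * x - b n) < \<infinity>"
  shows "\<exists>k. k \<longlonglongrightarrow> \<infinity> \<and> (\<forall>n. scaled_mean n (a n) (b n) (k n) \<in> radon_measures)"
proof -
  define G where "G n = insert 0 {m. m \<le> n \<and> \<Sigma> (a n * real m - b n) < \<infinity>}" for n
  define k where "k n = ereal (real (Max (G n)))" for n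
  have fin: "finite (G n)" "G n \<noteq> {}" for n by (auto simp: G_def)
  have "k \<longlonglongrightarrow> \<infinity>" unfolding tendsto_PInfty
  proof
    fix B
    obtain m :: nat where "\<bar>B\<bar> < real m" using reals_Archimedean2 by blast
    then have m: "B < real m" "0 < real m" by auto
    show "\<forall>\<^sub>F n in sequentially. ereal B < k n"
      using conv[OF m(2)] eventually_ge_at_top[of m]
    proof eventually_elim
      case (elim n)
      then have "m \<le> Max (G n)" using fin by (intro Max_ge) (auto simp: G_def)
      then show ?case using m unfolding k_def by simp
    qed
  qed
  moreover have "scaled_mean n (a n) (b n) (k n) \<in> radon_measures" for n
  proof -
    define m where "m = Max (G n)"
    have m: "m \<in> G n" unfolding m_def using fin by (rule Max_in)
    have sp: "space (scaled_mean n (a n) (b n) (k n)) = {0<..}" by (rule space_pos) simp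
    have "emeasure \<Lambda> ((\<lambda>y. (y + b n) / a n) -` {0<..} \<inter> cut_region (a n) (b n) (k n)) < \<infinity>"
    proof (cases "m = 0")
      case True
      then have "k n = 0" by (simp add: k_def m_def[symmetric] zero_ereal_def)
      then have "cut_region (a n) (b n) (k n) = {}" by (auto simp: cut_region_def zero_ereal_def)
      then show ?thesis by simp
    next
      case False
      then have f: "\<Sigma> (a n * real m - b n) < \<infinity>" using m by (auto simp: G_def)
      have s: "{0<..y} \<in> sets \<Lambda>" for y by (auto simp: sets_\<Lambda> sets_pos_reals_iff)
      have e: "k n = ereal (real m)" by (simp add: k_def m_def)
      have "emeasure \<Lambda> ((\<lambda>y. (y + b n) / a n) -` {0<..} \<inter> cut_region (a n) (b n) (k n)) \<le> emeasure \<Lambda> {0<..a n * real m - b n}"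
        using a[of n] by (intro emeasure_mono s) (auto simp: cut_region_def e field_simps)
      also have "\<dots> < \<infinity>"
        using mass[of "a n * real m - b n"] f by (cases "0 < a n * real m - b n") auto
      finally show ?thesis .
    qed
    then have "emeasure (scaled_mean n (a n) (b n) (k n)) {0<..} < \<infinity>"
      by (subst emeasure_scaled_mean) (auto simp: sets_pos_reals_iff ennreal_mult_less_top of_nat_less_top)
    then have "emeasure (scaled_mean n (a n) (b n) (k n)) K < \<infinity>" for K
      using emeasure_space[of "scaled_mean n (a n) (b n) (k n)" K] unfolding sp by (rule le_less_trans[rotated])
    then show ?thesis by (simp add: radon_measures_def)
  qed
  ultimately show ?thesis by blast
qed

lemma scaled_poisson:
  assumes pp: "poisson_process P (scale_measure (of_nat r) \<Lambda>) \<zeta>"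
  shows "poisson_process P (scaled_mean r a b k) (\<lambda>w. distr (restrict_space (\<zeta> w) (cut_region a b k)) pos_reals (\<lambda>y. (y + b) / a))"
  unfolding scaled_mean_def using pp
  by (rule poisson_process_pushforward) (use cut_region_sets sets_\<Lambda> affine_measurable in auto)

end

lemma measurable_pushforward:
  assumes "D \<in> sets K" "q \<in> measurable (restrict_space K D) L"
  shows "(\<lambda>\<mu>. distr (restrict_space \<mu> D) L q) \<in> measurable (measures_algebra K) (measures_algebra L)"
proof (rule measurable_into_measures_algebra)
  fix A assume A: "A \<in> sets L"
  have e: "emeasure (distr (restrict_space \<mu> D) L q) A = emeasure \<mu> (q -` A \<inter> D)" if "\<mu> \<in> space (measures_algebra K)" for \<mu>
    using that by (intro emeasure_distr_restrict(2)[OF _ assms A]) (simp add: space_measures_algebra)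
  show "(\<lambda>\<mu>. emeasure (distr (restrict_space \<mu> D) L q) A) \<in> borel_measurable (measures_algebra K)"
    by (subst measurable_cong[OF e], assumption) (rule measurable_emeasure_measures_algebra[OF emeasure_distr_restrict(1)[OF refl assms A]])
qed simp

text \<open>A Poisson process has infinitely many points almost surely in a set of infinite mean.\<close>

lemma poisson_process_radon_mean:
  assumes pp: "poisson_process P \<mu> X" and s: "sets \<mu> = sets pos_reals" and ae: "AE w in P. X w \<in> radon_measures"
  shows "\<mu> \<in> radon_measures"
proof -
  interpret prob_space P using pp by (rule poisson_process_prob_space)
  have "emeasure \<mu> K < \<infinity>" if K: "compact K" "K \<subseteq> {0<..}" for K
  proof -
  have sK: "K \<in> sets \<mu>" using K by (simp add: s sets_pos_reals_iff borel_compact)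
  show "emeasure \<mu> K < \<infinity>"
  proof (rule ccontr)
    assume "\<not> emeasure \<mu> K < \<infinity>"
    then have "emeasure \<mu> K = \<infinity>" by (simp add: not_less top_unique)
    from poisson_process_infinite[OF pp sK this] ae have "AE w in P. False"
      by eventually_elim (use K in \<open>auto simp: radon_measures_def\<close>)
    then show False by simp
  qed
  qed
  then show ?thesis using s by (simp add: radon_measures_def)
qed

section \<open>The two sides of the range\<close>

lemma (in half_line_mean) scaled_points_processes:
  assumes pp: "\<And>n. poisson_process (completion P) (scale_measure (of_nat n) \<Lambda>) (\<lambda>w. point_measure_of (A n w))"
    and A: "\<And>n w. A n w \<subseteq> {0<..}" and a: "\<And>n. 0 < a n" and M: "finite_initial M"
    and conv: "\<forall>x>0. (\<lambda>n. of_nat n * \<Sigma> (a n * x - b n)) \<longlonglongrightarrow> emeasure M {0<..x}"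
  defines "X \<equiv> \<lambda>n w. point_measure_of ((\<lambda>y. (y + b n) / a n) ` A n w)"
  shows "\<exists>k. admissible_cut P X k"
    and "admissible_cut P X k \<Longrightarrow> poisson_process (completion P) (scaled_mean n (a n) (b n) (k n)) (\<lambda>w. cut (k n) (X n w))"
    and "admissible_cut P X k \<Longrightarrow> finite_initial (scaled_mean n (a n) (b n) (k n))"
    and "admissible_cut P X k \<Longrightarrow> \<forall>x>0. (\<lambda>n. emeasure (scaled_mean n (a n) (b n) (k n)) {0<..x}) \<longlonglongrightarrow> emeasure M {0<..x}"
proof -
  have pc: "poisson_process (completion P) (scaled_mean n (a n) (b n) k) (\<lambda>w. cut k (X n w))" for n k
    unfolding X_def cut_scaled_points[OF a A] by (rule scaled_poisson[OF pp])
  show "\<exists>k. admissible_cut P X k"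
  proof -
    have "\<exists>k. k \<longlonglongrightarrow> \<infinity> \<and> (\<forall>n. scaled_mean n (a n) (b n) (k n) \<in> radon_measures)"
      using M by (intro ex_cut_levels a eventually_finite[OF conv[rule_format]]) (auto simp: finite_initial_def)
    then obtain k where k: "k \<longlonglongrightarrow> \<infinity>" "\<And>n. scaled_mean n (a n) (b n) (k n) \<in> radon_measures" by blast
    have "AE w in completion P. cut (k n) (X n w) \<in> radon_measures" for n
      using poisson_process_AE_finite_initial[OF pc[of n "k n"] scaled_mean_finite_initial[OF a k(2)]] by eventually_elim (simp add: finite_initial_radon)
    then have "AE w in P. cut (k n) (X n w) \<in> radon_measures" for n
      unfolding AE_completion_iff .
    then show ?thesis using k(1) unfolding admissible_cut_def by blast
  qed
  show "poisson_process (completion P) (scaled_mean n (a n) (b n) (k n)) (\<lambda>w. cut (k n) (X n w))" by (rule pc)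
  assume k: "admissible_cut P X k"
  have "AE w in completion P. cut (k n) (X n w) \<in> radon_measures"
    by (rule AE_completion) (use k in \<open>simp add: admissible_cut_def\<close>)
  then show "finite_initial (scaled_mean n (a n) (b n) (k n))"
    by (intro scaled_mean_finite_initial a poisson_process_radon_mean[OF pc]) auto
  show "\<forall>x>0. (\<lambda>n. emeasure (scaled_mean n (a n) (b n) (k n)) {0<..x}) \<longlonglongrightarrow> emeasure M {0<..x}"
    using k by (intro allI impI scaled_mean_tendsto a M conv[rule_format]) (simp_all add: admissible_cut_def)
qed

lemma cut_points_compose:
  assumes "\<And>w. A w \<subseteq> {0<..}" "0 < a"
  shows "(\<lambda>w. cut k (point_measure_of ((\<lambda>y. (y + b) / a) ` A w))) =
    (\<lambda>\<mu>. distr (restrict_space \<mu> (cut_region a b k)) pos_reals (\<lambda>y. (y + b) / a)) \<circ> (\<lambda>w. point_measure_of (A w))"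
  by (simp add: comp_def cut_scaled_points[OF assms(2,1)])

lemma distr_restrict_points:
  assumes D: "D \<in> sets K" and q: "q \<in> measurable (restrict_space K D) L" and inj: "inj_on q D"
  shows "distr (restrict_space (points_on K R) D) L q = points_on L (q ` (R \<inter> D))"
proof (rule measure_eqI)
  fix E assume "E \<in> sets (distr (restrict_space (points_on K R) D) L q)"
  then have E: "E \<in> sets L" by simp
  have s: "q -` E \<inter> D \<in> sets K" by (rule emeasure_distr_restrict(1)[OF refl D q E])
  have im: "q ` (R \<inter> D) \<inter> E = q ` (R \<inter> (q -` E \<inter> D))" by auto
  have inj': "inj_on q (R \<inter> (q -` E \<inter> D))" using inj by (rule inj_on_subset) auto
  show "emeasure (distr (restrict_space (points_on K R) D) L q) E = emeasure (points_on L (q ` (R \<inter> D))) E"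
    unfolding emeasure_distr_restrict(2)[OF sets_points_on D q E] emeasure_points_on[OF E] emeasure_points_on[OF s] im
    by (simp add: finite_image_iff[OF inj'] card_image[OF inj'])
qed simp

lemma restrict_space_Int_space: "restrict_space M D = restrict_space M (D \<inter> space M)"
proof -
  have "(\<inter>) D ` sets M = (\<inter>) (D \<inter> space M) ` sets M"
    by (intro image_cong refl) (use sets.sets_into_space in blast)
  then show ?thesis by (simp add: restrict_space_def)
qed

lemma distr_restrict_scale:
  assumes D: "D \<in> sets M" and q: "q \<in> measurable (restrict_space M D) L"
  shows "distr (restrict_space (scale_measure c M) D) L q = scale_measure c (distr (restrict_space M D) L q)"
proof (rule measure_eqI)
  fix E assume "E \<in> sets (distr (restrict_space (scale_measure c M) D) L q)"
  then have E: "E \<in> sets L" by simp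
  show "emeasure (distr (restrict_space (scale_measure c M) D) L q) E = emeasure (scale_measure c (distr (restrict_space M D) L q)) E"
    unfolding emeasure_scale_measure emeasure_distr_restrict(2)[OF refl D q E]
      emeasure_distr_restrict(2)[OF sets_scale_measure D q E] ..
qed simp

lemma tendsto_along_nat:
  fixes G :: "real \<Rightarrow> ennreal" and u v :: "real \<Rightarrow> real"
  assumes "((\<lambda>t. ennreal t * G (u t * x - v t)) \<longlongrightarrow> l) at_top" and "\<And>n. 0 < n \<Longrightarrow> w n = u (real n)"
  shows "(\<lambda>n. of_nat n * G (w n * x - v (real n))) \<longlonglongrightarrow> l"
proof (rule Lim_transform_eventually)
  show "(\<lambda>n. ennreal (real n) * G (u (real n) * x - v (real n))) \<longlonglongrightarrow> l"
    by (rule filterlim_compose[OF assms(1) filterlim_real_sequentially])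
  show "\<forall>\<^sub>F n in sequentially. ennreal (real n) * G (u (real n) * x - v (real n)) = of_nat n * G (w n * x - v (real n))"
    using eventually_gt_at_top[of 0] by eventually_elim (simp add: assms(2) ennreal_of_nat_eq_real_of_nat)
qed

context tail_measure
begin

text \<open>The two sides of the interval are kept inside \<open>(x\<^sub>l, x\<^sub>r)\<close>, where the mean measure of the range lives.\<close>

definition "pos_part = I \<inter> {0<..}"
definition "neg_part = I \<inter> {..<0}"

lemma parts_sets: "pos_part \<in> sets (record_measure r)" "neg_part \<in> sets (record_measure r)"
  "pos_part \<in> sets (S_measure \<nu> xl xr)" "neg_part \<in> sets (S_measure \<nu> xl xr)"
  unfolding sets_record_measure sets_S_measure
  by (auto simp: pos_part_def neg_part_def sets_restrict_space_iff)

lemma parts_measurable: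
  assumes "sets M = sets (restrict_space borel I)"
  shows "(\<lambda>x. x) \<in> measurable (restrict_space M pos_part) pos_reals"
    "(\<lambda>x. - x) \<in> measurable (restrict_space M neg_part) pos_reals"
proof -
  have m: "f \<in> borel_measurable M" if "f \<in> borel_measurable borel" for f :: "real \<Rightarrow> real"
    using measurable_restrict_space1[OF that, of I] measurable_cong_sets[OF assms refl, of borel] by blast
  have "(\<lambda>x. x) \<in> borel_measurable M" "(\<lambda>x. - x) \<in> borel_measurable M" by (rule m, simp)+
  then show "(\<lambda>x. x) \<in> measurable (restrict_space M pos_part) pos_reals"
    "(\<lambda>x. - x) \<in> measurable (restrict_space M neg_part) pos_reals"
    by - (rule measurable_restrict_space2, force simp: space_restrict_space pos_part_def neg_part_def,
      erule measurable_restrict_space1)+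
qed

lemma space_S: "space (S_measure \<nu> xl xr) = I"
  using sets_eq_imp_space_eq[OF sets_S_measure] by (simp add: space_restrict_space)

lemma S_side_measures:
  "S_plus_measure \<nu> xl xr = distr (restrict_space (S_measure \<nu> xl xr) pos_part) pos_reals (\<lambda>x. x)"
  "S_minus_measure \<nu> xl xr = distr (restrict_space (S_measure \<nu> xl xr) neg_part) pos_reals (\<lambda>x. - x)"
  unfolding S_plus_measure_def S_minus_measure_def pos_part_def neg_part_def
    restrict_space_Int_space[of "S_measure \<nu> xl xr" "{0<..}"] restrict_space_Int_space[of "S_measure \<nu> xl xr" "{..<0}"] space_S
  by (simp_all only: Int_commute)

lemma record_sides:
  "distr (restrict_space (record_measure r) pos_part) pos_reals (\<lambda>x. x) = scale_measure (of_nat r) (S_plus_measure \<nu> xl xr)"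
  "distr (restrict_space (record_measure r) neg_part) pos_reals (\<lambda>x. - x) = scale_measure (of_nat r) (S_minus_measure \<nu> xl xr)"
  unfolding record_measure_def S_side_measures
  by (rule distr_restrict_scale[OF parts_sets(3) parts_measurable(1)[OF sets_S_measure]],
      rule distr_restrict_scale[OF parts_sets(4) parts_measurable(2)[OF sets_S_measure]])

text \<open>Disjoint parts of the Poisson process of \<open>poisson_range\<close>; the point \<open>0\<close> carries no mass.\<close>

theorem range_sides:
  assumes pp: "poisson_process P \<mu>N N"
  shows "AE w in P. extremal_range xl xr (N w) r = extremal_range_pos xl xr (N w) r \<union> extremal_range_neg xl xr (N w) r"
    and "poisson_process (completion P) (scale_measure (of_nat r) (S_plus_measure \<nu> xl xr))
          (\<lambda>w. point_measure_of (extremal_range_pos xl xr (N w) r))" (is "poisson_process _ _ ?Z1")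
    and "poisson_process (completion P) (scale_measure (of_nat r) (S_minus_measure \<nu> xl xr))
          (\<lambda>w. point_measure_of (uminus ` extremal_range_neg xl xr (N w) r))" (is "poisson_process _ _ ?Z2")
    and "prob_space.indep_var (completion P) (measures_algebra pos_reals)
          (\<lambda>w. point_measure_of (extremal_range_pos xl xr (N w) r)) (measures_algebra pos_reals)
          (\<lambda>w. point_measure_of (uminus ` extremal_range_neg xl xr (N w) r))"
proof -
  interpret prob_space P using pp by (rule poisson_process_prob_space)
  interpret c: prob_space "completion P" by (rule prob_space_completion_M)
  let ?R = "\<lambda>w. extremal_range xl xr (N w) r"
  let ?K = "record_measure r"
  note pr = poisson_range(1)[OF pp, of r]
  note sub = AE_completion[OF poisson_range(2)[OF pp, of r]]
  note m = parts_measurable[OF sets_record_measure[of r]]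
  have "AE w in completion P. emeasure (points_on ?K (?R w)) {0} = 0"
  proof (rule poisson_process_AE_0[OF pr])
    show "{0} \<in> sets ?K" using zero_in_I by (simp add: sets_record_measure_iff)
    show "emeasure ?K {0} = 0" using emeasure_S_singleton[OF zero_in_I] by (simp add: record_measure_def)
  qed
  then have "AE w in P. emeasure (points_on ?K (?R w)) {0} = 0" unfolding AE_completion_iff .
  then show "AE w in P. extremal_range xl xr (N w) r = extremal_range_pos xl xr (N w) r \<union> extremal_range_neg xl xr (N w) r"
  proof eventually_elim
    case (elim w)
    have s: "{0} \<in> sets ?K" using zero_in_I by (simp add: sets_record_measure_iff)
    have "0 \<notin> ?R w"
    proof
      assume "0 \<in> ?R w"
      then have "?R w \<inter> {0} = {0}" by auto
      then show False using elim unfolding emeasure_points_on[OF s] by simp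
    qed
    then have "x \<noteq> 0" if "x \<in> ?R w" for x using that by auto
    then show ?case unfolding extremal_range_pos_def extremal_range_neg_def by (auto simp: neq_iff)
  qed
  have e1: "AE w in completion P. ?Z1 w = distr (restrict_space (points_on ?K (?R w)) pos_part) pos_reals (\<lambda>x. x)"
    using sub
  proof eventually_elim
    case (elim w)
    then have "(\<lambda>x. x) ` (?R w \<inter> pos_part) = extremal_range_pos xl xr (N w) r"
      unfolding extremal_range_pos_def pos_part_def by auto
    then show ?case unfolding distr_restrict_points[OF parts_sets(1) m(1) inj_on_id2] point_measure_of_eq by simp
  qed
  have e2: "AE w in completion P. ?Z2 w = distr (restrict_space (points_on ?K (?R w)) neg_part) pos_reals (\<lambda>x. - x)"
    using sub
  proof eventually_elim
    case (elim w)
    then have "?R w \<inter> neg_part = extremal_range_neg xl xr (N w) r"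
      unfolding extremal_range_neg_def neg_part_def by auto
    then show ?case by (subst distr_restrict_points[OF parts_sets(2) m(2)]) (auto simp: point_measure_of_eq)
  qed
  have s: "sets (point_measure_of B) = sets pos_reals" for B by (simp add: point_measure_of_eq)
  show "poisson_process (completion P) (scale_measure (of_nat r) (S_plus_measure \<nu> xl xr)) ?Z1"
    using poisson_process_modification[OF poisson_process_pushforward[OF pr parts_sets(1) m(1)] e1]
    unfolding completion_completion record_sides by (simp add: s S_plus_measure_def)
  show "poisson_process (completion P) (scale_measure (of_nat r) (S_minus_measure \<nu> xl xr)) ?Z2"
    using poisson_process_modification[OF poisson_process_pushforward[OF pr parts_sets(2) m(2)] e2]
    unfolding completion_completion record_sides by (simp add: s S_minus_measure_def)
  have "pos_part \<inter> neg_part = {}" by (auto simp: pos_part_def neg_part_def)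
  from c.indep_var_completion_modification[OF poisson_process_indep_pushforward[OF pr this parts_sets(1) m(1) parts_sets(2) m(2)] e1 e2]
  show "prob_space.indep_var (completion P) (measures_algebra pos_reals) ?Z1 (measures_algebra pos_reals) ?Z2"
    unfolding completion_completion by (simp add: space_measures_algebra s)
qed

lemma half_line_plus: "half_line_mean (S_plus_measure \<nu> xl xr) (S_plus \<nu> xr)"
proof
  have em: "emeasure (S_plus_measure \<nu> xl xr) A = emeasure (S_measure \<nu> xl xr) (A \<inter> pos_part)" if "A \<in> sets pos_reals" for A
    unfolding S_side_measures using emeasure_distr_restrict(2)[OF refl parts_sets(3) parts_measurable(1)[OF sets_S_measure] that] by simp
  have inI: "x \<in> I" if "0 < x" "ereal x < xr" for x
    using that endpoints by (auto simp: einterval_def intro: less_trans[of xl 0])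
  show "sets (S_plus_measure \<nu> xl xr) = sets pos_reals" by (simp add: S_plus_measure_def)
  show "S_plus \<nu> xr x \<le> S_plus \<nu> xr y" if "x \<le> y" for x y
  proof -
    have "S x - S 0 \<le> S y - S 0" if "0 < x" "ereal y < xr"
      using that \<open>x \<le> y\<close> by (intro diff_right_mono S_mono inI) (auto intro: le_less_trans[of _ "ereal y"])
    moreover have "ereal x < xr" if "ereal y < xr" using that \<open>x \<le> y\<close> by (auto intro: le_less_trans[of _ "ereal y"])
    ultimately show ?thesis using that by (auto simp: S_plus_def ennreal_leI)
  qed
  show "S_plus \<nu> xr y = 0" if "y \<le> 0" for y using that by (simp add: S_plus_def)
  show "emeasure (S_plus_measure \<nu> xl xr) {0<..y} = S_plus \<nu> xr y" if y: "0 < y" "S_plus \<nu> xr y < \<infinity>" for y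
  proof -
    have "ereal y < xr" using y by (auto simp: S_plus_def split: if_splits)
    then have yI: "y \<in> I" using y by (intro inI)
    have "{0<..y} \<inter> pos_part = {0<..y}" using I_interval[OF zero_in_I yI] by (auto simp: pos_part_def)
    then show ?thesis using emeasure_S_Ioc[OF zero_in_I yI] y \<open>ereal y < xr\<close>
      by (subst em) (auto simp: S_plus_def sets_pos_reals_iff)
  qed
  show "\<exists>d>c. S_plus \<nu> xr d < \<infinity>" if "S_plus \<nu> xr c < \<infinity>" for c
  proof -
    have "ereal c < xr"
    proof (cases "c \<le> 0")
      case True then show ?thesis using endpoints(2) by (cases xr) auto
    qed (use that in \<open>auto simp: S_plus_def split: if_splits\<close>)
    then obtain d where "ereal c < ereal d" "ereal d < xr" using ereal_dense2 by blast
    then show ?thesis by (intro exI[of _ d]) (simp add: S_plus_def)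
  qed
  show "emeasure (S_plus_measure \<nu> xl xr) {c<..} = 0" if "S_plus \<nu> xr c = \<infinity>" for c
  proof -
    have c: "0 < c" "xr \<le> ereal c" using that by (auto simp: S_plus_def split: if_splits)
    have "{c<..} \<inter> pos_part = {}"
    proof (intro equals0I)
      fix x assume "x \<in> {c<..} \<inter> pos_part"
      then have "ereal c < ereal x" "ereal x < xr" by (auto simp: pos_part_def einterval_def)
      then have "ereal c < xr" by (rule less_trans)
      then show False using c(2) by simp
    qed
    then show ?thesis using c by (subst em) (auto simp: sets_pos_reals_iff)
  qed
qed

lemma half_line_minus: "half_line_mean (S_minus_measure \<nu> xl xr) (S_minus \<nu> xl xr)"
proof
  have em: "emeasure (S_minus_measure \<nu> xl xr) A = emeasure (S_measure \<nu> xl xr) (uminus -` A \<inter> neg_part)" if "A \<in> sets pos_reals" for A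
    unfolding S_side_measures using emeasure_distr_restrict(2)[OF refl parts_sets(4) parts_measurable(2)[OF sets_S_measure] that] by simp
  have inI: "- x \<in> I" if "0 < x" "ereal x < - xl" for x
  proof -
    have "xl < ereal (- x)" using that(2) by (cases xl) auto
    moreover have "ereal (- x) < xr" using that(1) endpoints(2) by (cases xr) auto
    ultimately show ?thesis by (simp add: einterval_def)
  qed
  show "sets (S_minus_measure \<nu> xl xr) = sets pos_reals" by (simp add: S_minus_measure_def)
  show "S_minus \<nu> xl xr x \<le> S_minus \<nu> xl xr y" if "x \<le> y" for x y
  proof -
    have "S 0 - S (- x) \<le> S 0 - S (- y)" if "0 < x" "ereal y < - xl"
    proof (intro diff_left_mono S_mono inI)
      show "0 < x" "ereal y < - xl" "- y \<le> - x" using that \<open>x \<le> y\<close> by auto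
      then show "0 < y" using \<open>x \<le> y\<close> by simp
      show "ereal x < - xl" using le_less_trans[of "ereal x" "ereal y"] that(2) \<open>x \<le> y\<close> by simp
    qed
    moreover have "ereal x < - xl" if "ereal y < - xl"
      using le_less_trans[of "ereal x" "ereal y"] that \<open>x \<le> y\<close> by simp
    ultimately show ?thesis using that by (auto simp: S_minus_def ennreal_leI)
  qed
  show "S_minus \<nu> xl xr y = 0" if "y \<le> 0" for y using that by (simp add: S_minus_def)
  show "emeasure (S_minus_measure \<nu> xl xr) {0<..y} = S_minus \<nu> xl xr y" if y: "0 < y" "S_minus \<nu> xl xr y < \<infinity>" for y
  proof -
    have yx: "ereal y < - xl" using y by (auto simp: S_minus_def split: if_splits)
    then have yI: "- y \<in> I" using y by (intro inI)
    note J = I_interval[OF yI zero_in_I]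
    have st: "B \<in> sets (S_measure \<nu> xl xr)" if "B \<subseteq> {- y..0}" "B \<in> sets borel" for B
      using that J by (auto simp: sets_S_measure sets_restrict_space_iff)
    have null: "{z} \<in> null_sets (S_measure \<nu> xl xr)" if "z \<in> {- y..0}" for z
    proof -
      have "z \<in> I" using that J by auto
      then show ?thesis by (intro null_setsI emeasure_S_singleton st) (use that in auto)
    qed
    have "uminus -` {0<..y} \<inter> neg_part = {- y..<0}" using J by (auto simp: neg_part_def)
    then have "emeasure (S_minus_measure \<nu> xl xr) {0<..y} = emeasure (S_measure \<nu> xl xr) {- y..<0}"
      by (subst em) (auto simp: sets_pos_reals_iff)
    also have "\<dots> = emeasure (S_measure \<nu> xl xr) ({- y..<0} \<union> {0})"
      using y(1) by (intro emeasure_Un_null_set[symmetric] st null) auto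
    also have "{- y..<0} \<union> {0} = {- y<..0} \<union> {- y}" using y(1) by auto
    also have "emeasure (S_measure \<nu> xl xr) \<dots> = emeasure (S_measure \<nu> xl xr) {- y<..0}"
      using y(1) by (intro emeasure_Un_null_set st null) auto
    finally show ?thesis using emeasure_S_Ioc[OF yI zero_in_I] y(1) yx by (simp add: S_minus_def)
  qed
  show "\<exists>d>c. S_minus \<nu> xl xr d < \<infinity>" if "S_minus \<nu> xl xr c < \<infinity>" for c
  proof -
    have "ereal c < - xl"
    proof (cases "c \<le> 0")
      case True
      have "0 < - xl" using endpoints(1) by (cases xl) auto
      then show ?thesis using True by (cases xl) auto
    qed (use that in \<open>auto simp: S_minus_def split: if_splits\<close>)
    then obtain d where "ereal c < ereal d" "ereal d < - xl" using ereal_dense2 by blast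
    then show ?thesis by (intro exI[of _ d]) (simp add: S_minus_def)
  qed
  show "emeasure (S_minus_measure \<nu> xl xr) {c<..} = 0" if "S_minus \<nu> xl xr c = \<infinity>" for c
  proof -
    have c: "0 < c" "- xl \<le> ereal c" using that by (auto simp: S_minus_def split: if_splits)
    have "uminus -` {c<..} \<inter> neg_part = {}"
    proof (intro equals0I)
      fix x assume "x \<in> uminus -` {c<..} \<inter> neg_part"
      then have "c < - x" "xl < ereal x" by (auto simp: neg_part_def einterval_def)
      then show False using c(2) by (cases xl) auto
    qed
    then show ?thesis using c by (subst em) (auto simp: sets_pos_reals_iff)
  qed
qed

text \<open>The source of randomness for the coupling is found in \<open>N\<close> itself, so that the probability space need not be
  enlarged.\<close>

lemma ex_poisson_lborel:
  assumes pp: "poisson_process P \<mu>N N"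
  shows "\<exists>U :: _ \<Rightarrow> real measure. poisson_process (completion P) lborel U"
proof -
  have r1: "record_measure 1 = S_measure \<nu> xl xr"
    unfolding record_measure_def by (rule measure_eqI) simp_all
  have full: "restrict_space (S_measure \<nu> xl xr) I = S_measure \<nu> xl xr"
  proof (rule measure_eqI)
    show "sets (restrict_space (S_measure \<nu> xl xr) I) = sets (S_measure \<nu> xl xr)"
      using sets.sets_into_space[of _ "S_measure \<nu> xl xr"] unfolding sets_restrict_space space_S by (auto simp: Int_absorb1)
    fix A assume "A \<in> sets (restrict_space (S_measure \<nu> xl xr) I)"
    then show "emeasure (restrict_space (S_measure \<nu> xl xr) I) A = emeasure (S_measure \<nu> xl xr) A"
      using sets.top[of "S_measure \<nu> xl xr"] unfolding space_S
      by (subst emeasure_restrict_space) (auto simp: space_S sets_restrict_space)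
  qed
  have "I \<in> sets (S_measure \<nu> xl xr)" using sets.top[of "S_measure \<nu> xl xr"] unfolding space_S .
  moreover have "S \<in> measurable (restrict_space (S_measure \<nu> xl xr) I) borel"
    unfolding full using S_measurable measurable_cong_sets[OF sets_S_measure refl, of borel] by blast
  ultimately have "poisson_process (completion P) (distr (restrict_space (record_measure 1) I) borel S)
    (\<lambda>w. distr (restrict_space (points_on (record_measure 1) (extremal_range xl xr (N w) 1)) I) borel S)"
    unfolding r1[symmetric] by (rule poisson_process_pushforward[OF poisson_range(1)[OF pp]])
  then show ?thesis unfolding r1 full distr_S by (intro exI)
qed

lemma extremal_range_0: "extremal_range xl xr M 0 = {}"
  by (auto simp: extremal_range_def extremal_process_def top_ereal_def)

text \<open>Both sides satisfy \<open>half_line_mean\<close>, so that the cut processes are independent Poisson processes whose means converge,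
  and \<open>coupling_convergence\<close> applies.\<close>

theorem scaled_sides_converge:
  assumes pp: "poisson_process P \<mu>N N"
    and pos: "\<And>t. 0 < t \<Longrightarrow> 0 < ap t" "\<And>t. 0 < t \<Longrightarrow> 0 < am t"
    and initial: "finite_initial Sp" "finite_initial Sm"
    and conv: "\<And>x. 0 < x \<Longrightarrow> ((\<lambda>t. ennreal t * S_plus \<nu> xr (ap t * x - bp t)) \<longlongrightarrow> emeasure Sp {0<..x}) at_top"
      "\<And>x. 0 < x \<Longrightarrow> ((\<lambda>t. ennreal t * S_minus \<nu> xl xr (am t * x - bm t)) \<longlongrightarrow> emeasure Sm {0<..x}) at_top"
    and lim: "poisson_process P' Sp \<xi>" "poisson_process P' Sm \<eta>"
      "prob_space.indep_var P' (measures_algebra pos_reals) \<xi> (measures_algebra pos_reals) \<eta>"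
  shows "pp_converges_jointly P
    (\<lambda>r w. point_measure_of ((\<lambda>x. (x + bp (real r)) / ap (real r)) ` extremal_range_pos xl xr (N w) r))
    (\<lambda>r w. point_measure_of ((\<lambda>x. (- x + bm (real r)) / am (real r)) ` extremal_range_neg xl xr (N w) r)) P' \<xi> \<eta>"
proof -
  interpret prob_space P using pp by (rule poisson_process_prob_space)
  interpret c: prob_space "completion P" by (rule prob_space_completion_M)
  interpret pl: half_line_mean "S_plus_measure \<nu> xl xr" "S_plus \<nu> xr" by (rule half_line_plus)
  interpret mi: half_line_mean "S_minus_measure \<nu> xl xr" "S_minus \<nu> xl xr" by (rule half_line_minus)
  \<comment> \<open>The scaling constants for \<open>n = 0\<close> need not be positive, but the range of order \<open>0\<close> is empty.\<close>
  define a1 where "a1 n = (if n = 0 then 1 else ap (real n))" for n :: nat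
  define a2 where "a2 n = (if n = 0 then 1 else am (real n))" for n :: nat
  have a: "0 < a1 n" "0 < a2 n" for n using pos by (auto simp: a1_def a2_def)
  let ?A = "\<lambda>n w. extremal_range_pos xl xr (N w) n"
  let ?B = "\<lambda>n w. uminus ` extremal_range_neg xl xr (N w) n"
  have AB: "?A n w \<subseteq> {0<..}" "?B n w \<subseteq> {0<..}" for n w
    by (auto simp: extremal_range_pos_def extremal_range_neg_def)
  let ?X = "\<lambda>n w. point_measure_of ((\<lambda>y. (y + bp (real n)) / a1 n) ` ?A n w)"
  let ?Y = "\<lambda>n w. point_measure_of ((\<lambda>y. (y + bm (real n)) / a2 n) ` ?B n w)"
  have X: "(\<lambda>r w. point_measure_of ((\<lambda>x. (x + bp (real r)) / ap (real r)) ` ?A r w)) = ?X"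
    by (intro ext) (auto simp: a1_def extremal_range_pos_def extremal_range_0)
  have Y: "(\<lambda>r w. point_measure_of ((\<lambda>x. (- x + bm (real r)) / am (real r)) ` extremal_range_neg xl xr (N w) r)) = ?Y"
    by (intro ext) (auto simp: a2_def extremal_range_neg_def extremal_range_0 image_image)
  have c1: "\<forall>x>0. (\<lambda>n. of_nat n * S_plus \<nu> xr (a1 n * x - bp (real n))) \<longlonglongrightarrow> emeasure Sp {0<..x}"
    by (intro allI impI) (rule tendsto_along_nat[where u=ap and v=bp and w=a1 and G="S_plus \<nu> xr"], rule conv(1), auto simp: a1_def)
  have c2: "\<forall>x>0. (\<lambda>n. of_nat n * S_minus \<nu> xl xr (a2 n * x - bm (real n))) \<longlonglongrightarrow> emeasure Sm {0<..x}"
    by (intro allI impI) (rule tendsto_along_nat[where u=am and v=bm and w=a2 and G="S_minus \<nu> xl xr"], rule conv(2), auto simp: a2_def)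
  note P1 = pl.scaled_points_processes[where A="?A" and a=a1 and b="\<lambda>n. bp (real n)", OF range_sides(2)[OF pp] AB(1) a(1) initial(1) c1]
  note P2 = mi.scaled_points_processes[where A="?B" and a=a2 and b="\<lambda>n. bm (real n)", OF range_sides(3)[OF pp] AB(2) a(2) initial(2) c2]
  obtain U :: "_ \<Rightarrow> real measure" where U: "poisson_process (completion P) lborel U" using ex_poisson_lborel[OF pp] by blast
  show ?thesis unfolding X Y pp_converges_jointly_def
  proof (intro conjI allI impI)
    show "\<exists>k. admissible_cut P ?X k" by (rule P1(1))
    show "\<exists>k. admissible_cut P ?Y k" by (rule P2(1))
    fix k l assume k: "admissible_cut P ?X k" and l: "admissible_cut P ?Y l"
    have ind: "c.indep_var (measures_algebra pos_reals) (\<lambda>w. cut (k n) (?X n w)) (measures_algebra pos_reals) (\<lambda>w. cut (l n) (?Y n w))" for n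
      unfolding cut_points_compose[where A="?A n", OF AB(1) a(1)] cut_points_compose[where A="?B n", OF AB(2) a(2)]
      by (intro c.indep_var_compose[OF range_sides(4)[OF pp]] measurable_pushforward cut_region_sets affine_measurable refl)
    show "weakly_converges (prod_topology vague_topology vague_topology) P
      (\<lambda>n w. (cut (k n) (?X n w), cut (l n) (?Y n w))) P' (\<lambda>w. (\<xi> w, \<eta> w))"
      by (rule weakly_converges_completion, rule coupling_convergence[OF P1(2)[OF k] P2(2)[OF l] P1(3)[OF k] initial(1) P2(3)[OF l] initial(2) ind U P1(4)[OF k] P2(4)[OF l] lim])
  qed
qed

end

theorem theorem4p1:
  fixes xl xr :: ereal
    and \<nu> :: "real measure"
    and P :: "'w measure"
    and N :: "'w \<Rightarrow> (real \<times> real) measure"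
  assumes endpoints: "xl < 0" "0 < xr"
    and sets_\<nu>: "sets \<nu> = sets (restrict_space borel (einterval xl xr))"
    and atomless: "\<forall>x\<in>einterval xl xr. emeasure \<nu> {x} = 0"
    and infinite_\<nu>: "emeasure \<nu> (einterval xl xr) = \<infinity>"
    and Q: "\<forall>x\<in>einterval xl xr.
              0 < emeasure \<nu> (einterval (ereal x) xr) \<and> emeasure \<nu> (einterval (ereal x) xr) < \<infinity>"
    and N: "poisson_process P (restrict_space lborel {0..} \<Otimes>\<^sub>M \<nu>) N"
  shows
    "(\<forall>r\<ge>1.
        (AE \<omega> in P. extremal_range xl xr (N \<omega>) r =
           extremal_range_pos xl xr (N \<omega>) r \<union> extremal_range_neg xl xr (N \<omega>) r) \<and>
        poisson_process (completion P) (scale_measure (of_nat r) (S_plus_measure \<nu> xl xr))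
          (\<lambda>\<omega>. point_measure_of (extremal_range_pos xl xr (N \<omega>) r)) \<and>
        poisson_process (completion P) (scale_measure (of_nat r) (S_minus_measure \<nu> xl xr))
          (\<lambda>\<omega>. point_measure_of (uminus ` extremal_range_neg xl xr (N \<omega>) r)) \<and>
        prob_space.indep_var (completion P)
          (measures_algebra pos_reals)
          (\<lambda>\<omega>. point_measure_of (extremal_range_pos xl xr (N \<omega>) r))
          (measures_algebra pos_reals)
          (\<lambda>\<omega>. point_measure_of (uminus ` extremal_range_neg xl xr (N \<omega>) r)))
     \<and>
     (\<forall>(ap :: real \<Rightarrow> real) (bp :: real \<Rightarrow> real) (am :: real \<Rightarrow> real) (bm :: real \<Rightarrow> real)
        (Sp :: real measure) (Sm :: real measure)
        (P' :: 'v measure) (\<xi> :: 'v \<Rightarrow> real measure) (\<eta> :: 'v \<Rightarrow> real measure).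
        (\<forall>t>0. ap t > 0 \<and> am t > 0) \<longrightarrow>
        Sp \<in> radon_measures \<longrightarrow> Sm \<in> radon_measures \<longrightarrow>
        (\<forall>x>0. emeasure Sp {0<..x} < \<infinity> \<and> emeasure Sm {0<..x} < \<infinity>) \<longrightarrow>
        emeasure Sp {0<..} = \<infinity> \<longrightarrow> emeasure Sm {0<..} = \<infinity> \<longrightarrow>
        (\<forall>x>0. ((\<lambda>t. ennreal t * S_plus \<nu> xr (ap t * x - bp t))
                  \<longlongrightarrow> emeasure Sp {0<..x}) at_top) \<longrightarrow>
        (\<forall>x>0. ((\<lambda>t. ennreal t * S_minus \<nu> xl xr (am t * x - bm t))
                  \<longlongrightarrow> emeasure Sm {0<..x}) at_top) \<longrightarrow>
        poisson_process P' Sp \<xi> \<longrightarrow> poisson_process P' Sm \<eta> \<longrightarrow>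
        prob_space.indep_var P' (measures_algebra pos_reals) \<xi> (measures_algebra pos_reals) \<eta> \<longrightarrow>
        pp_converges_jointly
          P (\<lambda>r \<omega>. point_measure_of
                 ((\<lambda>x. (x + bp (real r)) / ap (real r)) ` extremal_range_pos xl xr (N \<omega>) r))
            (\<lambda>r \<omega>. point_measure_of
                 ((\<lambda>x. (- x + bm (real r)) / am (real r)) ` extremal_range_neg xl xr (N \<omega>) r))
          P' \<xi> \<eta>)"
proof -
  interpret tail_measure xl xr \<nu> by (rule tail_measure.intro) (use assms in auto)
  note pp = N[folded \<mu>N_def]
  show ?thesis
  proof (intro conjI allI impI)
    show "AE \<omega> in P. extremal_range xl xr (N \<omega>) r = extremal_range_pos xl xr (N \<omega>) r \<union> extremal_range_neg xl xr (N \<omega>) r" for r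
      by (rule range_sides(1)[OF pp])
    show "poisson_process (completion P) (scale_measure (of_nat r) (S_plus_measure \<nu> xl xr))
          (\<lambda>\<omega>. point_measure_of (extremal_range_pos xl xr (N \<omega>) r))" for r
      by (rule range_sides(2)[OF pp])
    show "poisson_process (completion P) (scale_measure (of_nat r) (S_minus_measure \<nu> xl xr))
          (\<lambda>\<omega>. point_measure_of (uminus ` extremal_range_neg xl xr (N \<omega>) r))" for r
      by (rule range_sides(3)[OF pp])
    show "prob_space.indep_var (completion P) (measures_algebra pos_reals)
          (\<lambda>\<omega>. point_measure_of (extremal_range_pos xl xr (N \<omega>) r)) (measures_algebra pos_reals)
          (\<lambda>\<omega>. point_measure_of (uminus ` extremal_range_neg xl xr (N \<omega>) r))" for r
      by (rule range_sides(4)[OF pp])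
  qed (rule scaled_sides_converge[OF pp], auto simp: finite_initial_def radon_measures_def)
qed

end
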